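(* Let $\Sigma$ be an alphabet and $\delta:\Sigma^2\to\mathbb{R}^+$ an arbitrary function. Given two strings $S$ and $T$ over $\Sigma$ in run-length encoded form, with $n$ and $m$ runs respectively, the Dynamic Time Warping distance $\mathsf{DTW}(S,T)$ can be computed in $\tilde O(nm)$ time.
   Context: A run-length encoding $S=s_1^{\ell_1}s_2^{\ell_2}\cdots s_n^{\ell_n}$ represents the string consisting of letter $s_1$ repeated $\ell_1$ times, followed by $s_2$ repeated $\ell_2$ times, etc.; $n$ is the number of runs. A string $S'=s_1^{\ell'_1}\cdots s_n^{\ell'_n}$ is a time-warp of $S=s_1^{\ell_1}\cdots s_n^{\ell_n}$ if $\ell'_i\ge \ell_i$ for every $i$. The Dynamic Time Warping distance is $\mathsf{DTW}(S,T)=\min_{|S'|=|T'|}\sum_{i=1}^{|S'|}\delta(S'[i],T'[i])$, where $S'$ and $T'$ range over all time-warps of $S$ and $T$ respectively. $\delta$ need not satisfy the triangle inequality; it is assumed that $\delta$ can be evaluated in constant time and arithmetic on values takes constant time. $\tilde O(\cdot)$ hides polylogarithmic factors. *)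

theory Defs
  imports Complex_Main
begin

section \<open>Run-length encoded strings and dynamic time warping\<close>

text \<open>
  A run-length encoding is a list of pairs (letter, run length).  Neighbouring runs are not
  required to carry different letters; encodings into maximal runs are a special case.
\<close>

type_synonym 'a rle = "('a \<times> nat) list"

definition is_rle :: "'a rle \<Rightarrow> bool" where
  "is_rle R \<longleftrightarrow> R \<noteq> [] \<and> (\<forall>(s, l) \<in> set R. 1 \<le> l)"

definition expand :: "'a rle \<Rightarrow> 'a list" where
  "expand R = concat (map (\<lambda>(s, l). replicate l s) R)"

definition time_warps :: "'a rle \<Rightarrow> 'a list set" where
  "time_warps R =
     {expand R' | R'. map fst R' = map fst R \<and> list_all2 (\<le>) (map snd R) (map snd R')}"

definition warp_cost :: "('a \<Rightarrow> 'a \<Rightarrow> real) \<Rightarrow> 'a list \<Rightarrow> 'a list \<Rightarrow> real" where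
  "warp_cost \<delta> u v = (\<Sum>i<length u. \<delta> (u ! i) (v ! i))"

text \<open>
  The minimum is a genuine one (attained), so it is taken with the least-element
  operator rather than as an infimum.
\<close>

definition DTW :: "('a \<Rightarrow> 'a \<Rightarrow> real) \<Rightarrow> 'a rle \<Rightarrow> 'a rle \<Rightarrow> real" where
  "DTW \<delta> S T =
     (LEAST c. \<exists>u \<in> time_warps S. \<exists>v \<in> time_warps T.
        length u = length v \<and> c = warp_cost \<delta> u v)"

section \<open>The machine model\<close>

text \<open>
  A random access machine with two sorts of data, programmed in a while language.

  \<^item> Words are natural numbers used for indexing and control.  Every word that a program
    computes must stay below the word bound \<open>W\<close>; otherwise the program is stuck.

  \<^item> Values (run lengths, costs) are real numbers with exact unit-cost arithmetic and
    comparison.  There is no conversion from values to words (no rounding), and programs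
    contain no real constants.

  \<^item> Letters are not data of the machine.  A program refers to a letter by its position in
    the list of input letters and can use letters only through unit-cost evaluations
    of \<open>\<delta>\<close>.

  Words and values are kept in registers and in arrays.  Registers and arrays have fixed names
  in the program text, so each program uses finitely many of them.
\<close>

record store =
  wreg :: "nat \<Rightarrow> nat"
  warr :: "nat \<Rightarrow> nat \<Rightarrow> nat"
  vreg :: "nat \<Rightarrow> real"
  varr :: "nat \<Rightarrow> nat \<Rightarrow> real"

datatype wexp =
    WConst nat
  | WReg nat
  | WArr nat wexp
  | WAdd wexp wexp
  | WSub wexp wexp
  | WMul wexp wexp
  | WDiv wexp wexp

datatype vexp =
    VReg nat
  | VArr nat wexp
  | VWord wexp
  | VDelta wexp wexp
  | VAdd vexp vexp
  | VSub vexp vexp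
  | VMul vexp vexp
  | VDiv vexp vexp

datatype cond =
    WEq wexp wexp
  | WLess wexp wexp
  | VEq vexp vexp
  | VLess vexp vexp
  | CNot cond
  | CAnd cond cond

datatype com =
    Skip
  | SetW nat wexp
  | PutW nat wexp wexp
  | SetV nat vexp
  | PutV nat wexp vexp
  | Seq com com
  | Branch cond com com
  | Loop cond com

subsection \<open>Evaluation\<close>

fun wval :: "store \<Rightarrow> wexp \<Rightarrow> nat" where
  "wval st (WConst c) = c"
| "wval st (WReg x) = wreg st x"
| "wval st (WArr a i) = warr st a (wval st i)"
| "wval st (WAdd e f) = wval st e + wval st f"
| "wval st (WSub e f) = wval st e - wval st f"
| "wval st (WMul e f) = wval st e * wval st f"
| "wval st (WDiv e f) = wval st e div wval st f"

text \<open>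
  In the following, \<open>us\<close> is the list of input letters.
\<close>

fun vval :: "('a \<Rightarrow> 'a \<Rightarrow> real) \<Rightarrow> 'a list \<Rightarrow> store \<Rightarrow> vexp \<Rightarrow> real" where
  "vval \<delta> us st (VReg x) = vreg st x"
| "vval \<delta> us st (VArr a i) = varr st a (wval st i)"
| "vval \<delta> us st (VWord e) = real (wval st e)"
| "vval \<delta> us st (VDelta i j) = \<delta> (us ! wval st i) (us ! wval st j)"
| "vval \<delta> us st (VAdd e f) = vval \<delta> us st e + vval \<delta> us st f"
| "vval \<delta> us st (VSub e f) = vval \<delta> us st e - vval \<delta> us st f"
| "vval \<delta> us st (VMul e f) = vval \<delta> us st e * vval \<delta> us st f"
| "vval \<delta> us st (VDiv e f) = vval \<delta> us st e / vval \<delta> us st f"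

fun holds :: "('a \<Rightarrow> 'a \<Rightarrow> real) \<Rightarrow> 'a list \<Rightarrow> store \<Rightarrow> cond \<Rightarrow> bool" where
  "holds \<delta> us st (WEq e f) \<longleftrightarrow> wval st e = wval st f"
| "holds \<delta> us st (WLess e f) \<longleftrightarrow> wval st e < wval st f"
| "holds \<delta> us st (VEq e f) \<longleftrightarrow> vval \<delta> us st e = vval \<delta> us st f"
| "holds \<delta> us st (VLess e f) \<longleftrightarrow> vval \<delta> us st e < vval \<delta> us st f"
| "holds \<delta> us st (CNot b) \<longleftrightarrow> \<not> holds \<delta> us st b"
| "holds \<delta> us st (CAnd b c) \<longleftrightarrow> holds \<delta> us st b \<and> holds \<delta> us st c"

subsection \<open>Defined evaluations\<close>

text \<open>
  An evaluation is defined if no word reaches the bound \<open>W\<close>, no division by zero takes place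
  and \<open>\<delta>\<close> is applied to input letters only.
\<close>

fun wdef :: "nat \<Rightarrow> store \<Rightarrow> wexp \<Rightarrow> bool" where
  "wdef W st (WConst c) \<longleftrightarrow> c < W"
| "wdef W st (WReg x) \<longleftrightarrow> wreg st x < W"
| "wdef W st (WArr a i) \<longleftrightarrow> wdef W st i \<and> warr st a (wval st i) < W"
| "wdef W st (WAdd e f) \<longleftrightarrow> wdef W st e \<and> wdef W st f \<and> wval st e + wval st f < W"
| "wdef W st (WSub e f) \<longleftrightarrow> wdef W st e \<and> wdef W st f"
| "wdef W st (WMul e f) \<longleftrightarrow> wdef W st e \<and> wdef W st f \<and> wval st e * wval st f < W"
| "wdef W st (WDiv e f) \<longleftrightarrow> wdef W st e \<and> wdef W st f \<and> wval st f \<noteq> 0"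

fun vdef :: "('a \<Rightarrow> 'a \<Rightarrow> real) \<Rightarrow> 'a list \<Rightarrow> nat \<Rightarrow> store \<Rightarrow> vexp \<Rightarrow> bool" where
  "vdef \<delta> us W st (VReg x) \<longleftrightarrow> True"
| "vdef \<delta> us W st (VArr a i) \<longleftrightarrow> wdef W st i"
| "vdef \<delta> us W st (VWord e) \<longleftrightarrow> wdef W st e"
| "vdef \<delta> us W st (VDelta i j) \<longleftrightarrow>
     wdef W st i \<and> wdef W st j \<and> wval st i < length us \<and> wval st j < length us"
| "vdef \<delta> us W st (VAdd e f) \<longleftrightarrow> vdef \<delta> us W st e \<and> vdef \<delta> us W st f"
| "vdef \<delta> us W st (VSub e f) \<longleftrightarrow> vdef \<delta> us W st e \<and> vdef \<delta> us W st f"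
| "vdef \<delta> us W st (VMul e f) \<longleftrightarrow> vdef \<delta> us W st e \<and> vdef \<delta> us W st f"
| "vdef \<delta> us W st (VDiv e f) \<longleftrightarrow>
     vdef \<delta> us W st e \<and> vdef \<delta> us W st f \<and> vval \<delta> us st f \<noteq> 0"

fun cdef :: "('a \<Rightarrow> 'a \<Rightarrow> real) \<Rightarrow> 'a list \<Rightarrow> nat \<Rightarrow> store \<Rightarrow> cond \<Rightarrow> bool" where
  "cdef \<delta> us W st (WEq e f) \<longleftrightarrow> wdef W st e \<and> wdef W st f"
| "cdef \<delta> us W st (WLess e f) \<longleftrightarrow> wdef W st e \<and> wdef W st f"
| "cdef \<delta> us W st (VEq e f) \<longleftrightarrow> vdef \<delta> us W st e \<and> vdef \<delta> us W st f"
| "cdef \<delta> us W st (VLess e f) \<longleftrightarrow> vdef \<delta> us W st e \<and> vdef \<delta> us W st f"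
| "cdef \<delta> us W st (CNot b) \<longleftrightarrow> cdef \<delta> us W st b"
| "cdef \<delta> us W st (CAnd b c) \<longleftrightarrow> cdef \<delta> us W st b \<and> cdef \<delta> us W st c"

subsection \<open>Running time and execution\<close>

text \<open>
  Each operation, memory access and evaluation of \<open>\<delta>\<close> takes one time unit.
\<close>

fun wtime :: "wexp \<Rightarrow> nat" where
  "wtime (WConst c) = 1"
| "wtime (WReg x) = 1"
| "wtime (WArr a i) = wtime i + 1"
| "wtime (WAdd e f) = wtime e + wtime f + 1"
| "wtime (WSub e f) = wtime e + wtime f + 1"
| "wtime (WMul e f) = wtime e + wtime f + 1"
| "wtime (WDiv e f) = wtime e + wtime f + 1"

fun vtime :: "vexp \<Rightarrow> nat" where
  "vtime (VReg x) = 1"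
| "vtime (VArr a i) = wtime i + 1"
| "vtime (VWord e) = wtime e + 1"
| "vtime (VDelta i j) = wtime i + wtime j + 1"
| "vtime (VAdd e f) = vtime e + vtime f + 1"
| "vtime (VSub e f) = vtime e + vtime f + 1"
| "vtime (VMul e f) = vtime e + vtime f + 1"
| "vtime (VDiv e f) = vtime e + vtime f + 1"

fun ctime :: "cond \<Rightarrow> nat" where
  "ctime (WEq e f) = wtime e + wtime f + 1"
| "ctime (WLess e f) = wtime e + wtime f + 1"
| "ctime (VEq e f) = vtime e + vtime f + 1"
| "ctime (VLess e f) = vtime e + vtime f + 1"
| "ctime (CNot b) = ctime b + 1"
| "ctime (CAnd b c) = ctime b + ctime c + 1"

text \<open>
  \<open>exec \<delta> us W P st t st'\<close>: program \<open>P\<close> started in \<open>st\<close> halts in \<open>st'\<close> after \<open>t\<close> time units.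
\<close>

inductive exec ::
  "('a \<Rightarrow> 'a \<Rightarrow> real) \<Rightarrow> 'a list \<Rightarrow> nat \<Rightarrow> com \<Rightarrow> store \<Rightarrow> nat \<Rightarrow> store \<Rightarrow> bool"
  for \<delta> :: "'a \<Rightarrow> 'a \<Rightarrow> real" and us :: "'a list" and W :: nat
where
  Skip: "exec \<delta> us W Skip st 1 st"
| SetW: "wdef W st e \<Longrightarrow>
    exec \<delta> us W (SetW x e) st (wtime e + 1) (st\<lparr>wreg := (wreg st)(x := wval st e)\<rparr>)"
| PutW: "wdef W st i \<Longrightarrow> wdef W st e \<Longrightarrow>
    exec \<delta> us W (PutW a i e) st (wtime i + wtime e + 1)
      (st\<lparr>warr := (warr st)(a := (warr st a)(wval st i := wval st e))\<rparr>)"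
| SetV: "vdef \<delta> us W st e \<Longrightarrow>
    exec \<delta> us W (SetV x e) st (vtime e + 1) (st\<lparr>vreg := (vreg st)(x := vval \<delta> us st e)\<rparr>)"
| PutV: "wdef W st i \<Longrightarrow> vdef \<delta> us W st e \<Longrightarrow>
    exec \<delta> us W (PutV a i e) st (wtime i + vtime e + 1)
      (st\<lparr>varr := (varr st)(a := (varr st a)(wval st i := vval \<delta> us st e))\<rparr>)"
| Seq: "exec \<delta> us W P st t st' \<Longrightarrow> exec \<delta> us W Q st' t' st'' \<Longrightarrow>
    exec \<delta> us W (Seq P Q) st (t + t') st''"
| BranchTrue: "cdef \<delta> us W st b \<Longrightarrow> holds \<delta> us st b \<Longrightarrow> exec \<delta> us W P st t st' \<Longrightarrow>
    exec \<delta> us W (Branch b P Q) st (ctime b + t + 1) st'"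
| BranchFalse: "cdef \<delta> us W st b \<Longrightarrow> \<not> holds \<delta> us st b \<Longrightarrow> exec \<delta> us W Q st t st' \<Longrightarrow>
    exec \<delta> us W (Branch b P Q) st (ctime b + t + 1) st'"
| LoopFalse: "cdef \<delta> us W st b \<Longrightarrow> \<not> holds \<delta> us st b \<Longrightarrow>
    exec \<delta> us W (Loop b P) st (ctime b + 1) st"
| LoopTrue: "cdef \<delta> us W st b \<Longrightarrow> holds \<delta> us st b \<Longrightarrow> exec \<delta> us W P st t st' \<Longrightarrow>
    exec \<delta> us W (Loop b P) st' t' st'' \<Longrightarrow>
    exec \<delta> us W (Loop b P) st (ctime b + t + t' + 1) st''"

inductive_cases exec_cases:
  "exec \<delta> us W Skip st t st'"
  "exec \<delta> us W (SetW x e) st t st'"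
  "exec \<delta> us W (PutW a i e) st t st'"
  "exec \<delta> us W (SetV x v) st t st'"
  "exec \<delta> us W (PutV a i v) st t st'"
  "exec \<delta> us W (Seq P Q) st t st'"
  "exec \<delta> us W (Branch b P Q) st t st'"
  "exec \<delta> us W (Loop b P) st t st'"

lemma exec_deterministic:
  assumes "exec \<delta> us W P st t st'" "exec \<delta> us W P st u st''"
  shows "t = u \<and> st' = st''"
  using assms
proof (induction arbitrary: u st'' rule: exec.induct)
  case (Skip st)
  from Skip.prems show ?case by (rule exec_cases(1)) simp
next
  case (SetW st e x)
  from SetW.prems show ?case by (rule exec_cases(2)) simp
next
  case (PutW st i e a)
  from PutW.prems show ?case by (rule exec_cases(3)) simp
next
  case (SetV st e x)
  from SetV.prems show ?case by (rule exec_cases(4)) simp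
next
  case (PutV st i e a)
  from PutV.prems show ?case by (rule exec_cases(5)) simp
next
  case (Seq P st t st' Q t' st2)
  from Seq.prems show ?case by (rule exec_cases(6)) (metis Seq.IH)+
next
  case (BranchTrue st b P t st' Q)
  from BranchTrue.prems show ?case
    by (rule exec_cases(7)) (use BranchTrue.hyps in \<open>auto dest: BranchTrue.IH\<close>)
next
  case (BranchFalse st b Q t st' P)
  from BranchFalse.prems show ?case
    by (rule exec_cases(7)) (use BranchFalse.hyps in \<open>auto dest: BranchFalse.IH\<close>)
next
  case (LoopFalse st b P)
  from LoopFalse.prems show ?case
    by (rule exec_cases(8)) (simp_all add: LoopFalse.hyps)
next
  case (LoopTrue st b P t st' t' st2)
  from LoopTrue.prems show ?case
    by (rule exec_cases(8)) (use LoopTrue.hyps in \<open>auto dest!: LoopTrue.IH\<close>)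
qed

subsection \<open>Input and output for two run-length encoded strings\<close>

text \<open>
  Word registers 0 and 1 hold the numbers of runs, value arrays 0 and 1 the run lengths, and all
  other memory is zero.  The input letters are the letters of the first string followed by
  those of the second.  The output is read from value register 0.
\<close>

definition input_letters :: "'a rle \<Rightarrow> 'a rle \<Rightarrow> 'a list" where
  "input_letters S T = map fst S @ map fst T"

definition input_store :: "'a rle \<Rightarrow> 'a rle \<Rightarrow> store" where
  "input_store S T =
     \<lparr>wreg = (\<lambda>_. 0)(0 := length S, 1 := length T),
      warr = (\<lambda>_ _. 0),
      vreg = (\<lambda>_. 0),
      varr = (\<lambda>_ _. 0)
        (0 := (\<lambda>i. if i < length S then real (snd (S ! i)) else 0),
         1 := (\<lambda>i. if i < length T then real (snd (T ! i)) else 0))\<rparr>"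

definition result :: "store \<Rightarrow> real" where
  "result st = vreg st 0"

text \<open>
  Words consist of \<open>O(log (n + m))\<close> bits: for \<open>n\<close> and \<open>m\<close> runs the word bound is \<open>(n + m) ^ w\<close>
  with a constant \<open>w\<close>.
\<close>

definition computes_within ::
  "('a \<Rightarrow> 'a \<Rightarrow> real) \<Rightarrow> nat \<Rightarrow> com \<Rightarrow> 'a rle \<Rightarrow> 'a rle \<Rightarrow> real \<Rightarrow> real \<Rightarrow> bool" where
  "computes_within \<delta> w P S T r B \<longleftrightarrow>
     (\<exists>t st. exec \<delta> (input_letters S T) ((length S + length T) ^ w) P (input_store S T) t st
        \<and> result st = r \<and> real t \<le> B)"

end

theory Submission
  imports Defs
begin

text \<open>The obstacle is that a push draws on values that it also changes, on many diagonals at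
  once. Two families of values resolve this. \<open>R\<close> changes only by touches, so thresholds
  have to be repaired on one root path only, while a whole push is one cone stored at the root.
  \<open>R\<close> may lag behind \<open>H\<close>, but only from above, so an outdated source never
  makes a minimum too small. And where a push strictly lowers the value, the new values follow a
  straight line from their source, so the result is concave there and the outdated source is not
  missed. Hence eight touches and two cones per block suffice.

  A touch costs a cube of the height: one factor for the root path, one for the search of a tangent
  at each of its nodes, one for the hull query behind each comparison of that search.

  There is no infinity among the values. \<open>total\<close> bounds the cost of one explicit path,
  so it can stand for unreached diagonals; no value ever exceeds \<open>2 * total\<close>, which is
  the slope \<open>M\<close>. Distinct diagonals differ by at least 1, so an unwanted source is
  always at least \<open>M\<close> more expensive.\<close>

text \<open>
  Inside the block of runs \<open>i\<close> of \<open>S\<close> and \<open>j\<close> of \<open>T\<close> each matched pair costs the same amount \<open>D\<close>.  The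
  blocks are processed row by row.  The staircase between the processed blocks and the others meets every
  diagonal once, so the optimal costs on it form a function \<open>h\<close> of the diagonal \<open>z\<close>.  Passing a block
  replaces \<open>h z\<close>, on the diagonals of this block, by the minimum of \<open>h l + D * \<bar>l - z\<bar>\<close> over the \<open>l\<close> between
  \<open>z\<close> and the diagonal of the upper left corner, and then adds \<open>D\<close> times a trapezoid.

  Away from the \<open>O(n m)\<close> diagonals through corners of blocks, \<open>h\<close> is concave wherever a minimum is about
  to be taken, so that only corner diagonals are useful sources and \<open>h\<close> need be known only there.  Adding
  the right piecewise linear function turns the minimum above into one with the cone
  \<open>M * \<bar>l - z\<bar>\<close> over all diagonals, where \<open>M\<close> exceeds all costs.  What remains to be supported are range
  additions of linear functions, reading single values, and the operation \<open>H := min H (R * cone)\<close>, the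
  infimal convolution of source values \<open>R\<close> with a cone.  A segment tree over the sorted corner diagonals does this
  in \<open>O((log (n m))^3)\<close>: every node stores a linear function that is added to its leaves, a line and a
  cone that are still to be taken into account below it, and a threshold slope that tells in which of
  its children \<open>R + s * z\<close> is minimal.
\<close>

subsection \<open>Weakest preconditions\<close>

notation Seq (infixr ";;" 55)

fun mod_wreg :: "com \<Rightarrow> nat set" where
  "mod_wreg (SetW x e) = {x}"
| "mod_wreg (P ;; Q) = mod_wreg P \<union> mod_wreg Q"
| "mod_wreg (Branch b P Q) = mod_wreg P \<union> mod_wreg Q"
| "mod_wreg (Loop b P) = mod_wreg P"
| "mod_wreg _ = {}"

fun mod_warr :: "com \<Rightarrow> nat set" where
  "mod_warr (PutW a i e) = {a}"
| "mod_warr (P ;; Q) = mod_warr P \<union> mod_warr Q"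
| "mod_warr (Branch b P Q) = mod_warr P \<union> mod_warr Q"
| "mod_warr (Loop b P) = mod_warr P"
| "mod_warr _ = {}"

fun mod_vreg :: "com \<Rightarrow> nat set" where
  "mod_vreg (SetV x e) = {x}"
| "mod_vreg (P ;; Q) = mod_vreg P \<union> mod_vreg Q"
| "mod_vreg (Branch b P Q) = mod_vreg P \<union> mod_vreg Q"
| "mod_vreg (Loop b P) = mod_vreg P"
| "mod_vreg _ = {}"

fun mod_varr :: "com \<Rightarrow> nat set" where
  "mod_varr (PutV a i e) = {a}"
| "mod_varr (P ;; Q) = mod_varr P \<union> mod_varr Q"
| "mod_varr (Branch b P Q) = mod_varr P \<union> mod_varr Q"
| "mod_varr (Loop b P) = mod_varr P"
| "mod_varr _ = {}"

definition frame :: "com \<Rightarrow> store \<Rightarrow> store \<Rightarrow> bool" where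
  "frame P st st' \<longleftrightarrow>
     (\<forall>x. x \<notin> mod_wreg P \<longrightarrow> wreg st' x = wreg st x) \<and>
     (\<forall>x. x \<notin> mod_warr P \<longrightarrow> warr st' x = warr st x) \<and>
     (\<forall>x. x \<notin> mod_vreg P \<longrightarrow> vreg st' x = vreg st x) \<and>
     (\<forall>x. x \<notin> mod_varr P \<longrightarrow> varr st' x = varr st x)"

lemma frame_wreg: "frame P st st' \<Longrightarrow> x \<notin> mod_wreg P \<Longrightarrow> wreg st' x = wreg st x"
  and frame_warr: "frame P st st' \<Longrightarrow> x \<notin> mod_warr P \<Longrightarrow> warr st' x = warr st x"
  and frame_vreg: "frame P st st' \<Longrightarrow> x \<notin> mod_vreg P \<Longrightarrow> vreg st' x = vreg st x"
  and frame_varr: "frame P st st' \<Longrightarrow> x \<notin> mod_varr P \<Longrightarrow> varr st' x = varr st x"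
  by (auto simp: frame_def)

lemma exec_frame: "exec \<delta> us W P st t st' \<Longrightarrow> frame P st st'"
  by (induction rule: exec.induct) (auto simp: frame_def)

lemma frame_warr_all: "frame P st st' \<Longrightarrow> mod_warr P = {} \<Longrightarrow> warr st' = warr st"
  and frame_varr_all: "frame P st st' \<Longrightarrow> mod_varr P = {} \<Longrightarrow> varr st' = varr st"
  by (auto simp: frame_def)

text \<open>An addition that the simplifier leaves alone, so that elapsed times stay small terms.\<close>

definition tick :: "nat \<Rightarrow> nat \<Rightarrow> nat" where
  "tick k n = k + n"

locale machine =
  fixes \<delta> :: "'a \<Rightarrow> 'a \<Rightarrow> real" and us :: "'a list" and W :: nat
begin

text \<open>Total correctness with a clock: \<open>k\<close> is the time spent before
  \<open>P\<close> starts, and \<open>Q\<close> sees the final store together with the time shown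
  then.\<close>

definition wp :: "com \<Rightarrow> store \<Rightarrow> nat \<Rightarrow> (store \<Rightarrow> nat \<Rightarrow> bool) \<Rightarrow> bool" where
  "wp P st k Q \<longleftrightarrow> (\<exists>t st'. exec \<delta> us W P st t st' \<and> Q st' (k + t))"

text \<open>The second premise also receives \<open>frame P st st'\<close>. Specifications can
  therefore confine themselves to what a program changes, and all preservation facts come from its
  syntax.\<close>

lemma wp_conseq:
  assumes "wp P st k Q"
    and "\<And>st' t. Q st' t \<Longrightarrow> frame P st st' \<Longrightarrow> Q' st' t"
  shows "wp P st k Q'"
  using assms exec_frame by (fastforce simp: wp_def)

lemma exec_iff:
  "exec \<delta> us W Skip st t st' \<longleftrightarrow> t = 1 \<and> st' = st"
  "exec \<delta> us W (SetW x e) st t st' \<longleftrightarrow> wdef W st e \<and> t = wtime e + 1 \<and>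
     st' = st\<lparr>wreg := (wreg st)(x := wval st e)\<rparr>"
  "exec \<delta> us W (PutW a i e) st t st' \<longleftrightarrow> wdef W st i \<and> wdef W st e \<and> t = wtime i + wtime e + 1 \<and>
     st' = st\<lparr>warr := (warr st)(a := (warr st a)(wval st i := wval st e))\<rparr>"
  "exec \<delta> us W (SetV x f) st t st' \<longleftrightarrow> vdef \<delta> us W st f \<and> t = vtime f + 1 \<and>
     st' = st\<lparr>vreg := (vreg st)(x := vval \<delta> us st f)\<rparr>"
  "exec \<delta> us W (PutV a i f) st t st' \<longleftrightarrow> wdef W st i \<and> vdef \<delta> us W st f \<and> t = wtime i + vtime f + 1 \<and>
     st' = st\<lparr>varr := (varr st)(a := (varr st a)(wval st i := vval \<delta> us st f))\<rparr>"
  by (subst exec.simps; auto)+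

lemma exec_Branch_iff:
  "exec \<delta> us W (Branch b P R) st t st' \<longleftrightarrow> cdef \<delta> us W st b \<and>
     (\<exists>u. t = ctime b + u + 1 \<and>
       (if holds \<delta> us st b then exec \<delta> us W P st u st' else exec \<delta> us W R st u st'))"
  by (subst exec.simps; auto)

lemma exec_Loop_iff:
  "exec \<delta> us W (Loop b P) st t st' \<longleftrightarrow> cdef \<delta> us W st b \<and>
     (if holds \<delta> us st b
      then \<exists>u v st1. t = ctime b + u + v + 1 \<and> exec \<delta> us W P st u st1 \<and> exec \<delta> us W (Loop b P) st1 v st'
      else t = ctime b + 1 \<and> st' = st)"
  by (subst exec.simps; auto)

lemma wp_Skip [simp]: "wp Skip st k Q \<longleftrightarrow> Q st (tick k 1)"
  and wp_SetW [simp]: "wp (SetW x e) st k Q \<longleftrightarrow>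
    wdef W st e \<and> Q (st\<lparr>wreg := (wreg st)(x := wval st e)\<rparr>) (tick k (wtime e + 1))"
  and wp_PutW [simp]: "wp (PutW a i e) st k Q \<longleftrightarrow>
    wdef W st i \<and> wdef W st e \<and>
    Q (st\<lparr>warr := (warr st)(a := (warr st a)(wval st i := wval st e))\<rparr>) (tick k (wtime i + wtime e + 1))"
  and wp_SetV [simp]: "wp (SetV x f) st k Q \<longleftrightarrow>
    vdef \<delta> us W st f \<and> Q (st\<lparr>vreg := (vreg st)(x := vval \<delta> us st f)\<rparr>) (tick k (vtime f + 1))"
  and wp_PutV [simp]: "wp (PutV a i f) st k Q \<longleftrightarrow>
    wdef W st i \<and> vdef \<delta> us W st f \<and>
    Q (st\<lparr>varr := (varr st)(a := (varr st a)(wval st i := vval \<delta> us st f))\<rparr>) (tick k (wtime i + vtime f + 1))"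
  unfolding wp_def exec_iff tick_def by blast+

lemma wp_Seq [simp]: "wp (P ;; R) st k Q \<longleftrightarrow> wp P st k (\<lambda>st' k'. wp R st' k' Q)"
proof
  assume "wp (P ;; R) st k Q"
  then obtain t t' st' st'' where "exec \<delta> us W P st t st'" "exec \<delta> us W R st' t' st''"
    "Q st'' (k + (t + t'))"
    unfolding wp_def by (blast elim: exec_cases)
  then show "wp P st k (\<lambda>st' k'. wp R st' k' Q)"
    unfolding wp_def by (metis add.assoc)
next
  assume "wp P st k (\<lambda>st' k'. wp R st' k' Q)"
  then obtain t t' st' st'' where "exec \<delta> us W P st t st'" "exec \<delta> us W R st' t' st''"
    "Q st'' (k + t + t')"
    unfolding wp_def by blast
  then show "wp (P ;; R) st k Q"
    unfolding wp_def by (metis add.assoc exec.Seq)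
qed

lemma wp_Branch [simp]: "wp (Branch b P R) st k Q \<longleftrightarrow>
    cdef \<delta> us W st b \<and>
    (if holds \<delta> us st b then wp P st (tick k (ctime b + 1)) Q else wp R st (tick k (ctime b + 1)) Q)"
proof -
  have eq: "k + (ctime b + t + 1) = k + (ctime b + 1) + t" for t by simp
  show ?thesis
    unfolding wp_def exec_Branch_iff tick_def by (cases "holds \<delta> us st b") (simp_all only: if_True if_False, (metis eq)+)
qed

lemma wp_Loop: "wp (Loop b P) st k Q \<longleftrightarrow>
    cdef \<delta> us W st b \<and>
    (if holds \<delta> us st b then wp P st (tick k (ctime b + 1)) (\<lambda>st' k'. wp (Loop b P) st' k' Q)
     else Q st (tick k (ctime b + 1)))"
proof -
  have eq: "k + (ctime b + t + t' + 1) = k + (ctime b + 1) + t + t'" for t t' by simp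
  show ?thesis
  proof (cases "holds \<delta> us st b")
    case True
    have "wp (Loop b P) st k Q \<longleftrightarrow> cdef \<delta> us W st b \<and>
      (\<exists>u v st1 st'. exec \<delta> us W P st u st1 \<and> exec \<delta> us W (Loop b P) st1 v st' \<and>
        Q st' (k + (ctime b + u + v + 1)))"
      by (subst wp_def, subst exec_Loop_iff, simp only: True if_True) blast
    also have "\<dots> \<longleftrightarrow> cdef \<delta> us W st b \<and>
      wp P st (tick k (ctime b + 1)) (\<lambda>st' k'. wp (Loop b P) st' k' Q)"
      unfolding wp_def eq tick_def by blast
    finally show ?thesis using True by simp
  next
    case False
    show ?thesis
      by (subst wp_def, subst exec_Loop_iff) (use False in \<open>auto simp: tick_def\<close>)
  qed
qed

text \<open>The invariant is indexed by the number of rounds still to come. The index decides the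
  loop condition and replaces a variant, and the time bound is a plain product.\<close>

lemma wp_Loop_count:
  fixes I :: "nat \<Rightarrow> store \<Rightarrow> bool" and c :: nat
  assumes "I N st"
    and defd: "\<And>i s. I i s \<Longrightarrow> i \<le> N \<Longrightarrow> cdef \<delta> us W s b \<and> (holds \<delta> us s b \<longleftrightarrow> 0 < i)"
    and body: "\<And>i s k. I (Suc i) s \<Longrightarrow> i < N \<Longrightarrow> wp P s k (\<lambda>s' k'. k' \<le> k + c \<and> I i s')"
    and post: "\<And>s' k'. I 0 s' \<Longrightarrow> k' \<le> k + N * (c + ctime b + 1) + (ctime b + 1) \<Longrightarrow> Q s' k'"
  shows "wp (Loop b P) st k Q"
proof -
  have "i \<le> N \<Longrightarrow> I i s \<Longrightarrow>
    wp (Loop b P) s k (\<lambda>s' k'. I 0 s' \<and> k' \<le> k + i * (c + ctime b + 1) + (ctime b + 1))" for i s k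
  proof (induction i arbitrary: s k)
    case 0
    then show ?case by (subst wp_Loop) (use defd in \<open>auto simp: tick_def\<close>)
  next
    case (Suc i)
    have "wp P s (tick k (ctime b + 1)) (\<lambda>st' k'. wp (Loop b P) st' k'
        (\<lambda>s' k'. I 0 s' \<and> k' \<le> k + Suc i * (c + ctime b + 1) + (ctime b + 1)))"
    proof (rule wp_conseq[OF body[OF Suc.prems(2)]])
      show "i < N" using Suc.prems by simp
      fix s' k' assume a: "k' \<le> tick k (ctime b + 1) + c \<and> I i s'"
      show "wp (Loop b P) s' k'
        (\<lambda>s' k'. I 0 s' \<and> k' \<le> k + Suc i * (c + ctime b + 1) + (ctime b + 1))"
        by (rule wp_conseq[OF Suc.IH]) (use a Suc.prems in \<open>auto simp: tick_def\<close>)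
    qed
    then show ?case by (subst wp_Loop) (use defd[OF Suc.prems(2,1)] in simp)
  qed
  from this[OF order_refl assms(1)] show ?thesis
    by (rule wp_conseq) (use post in blast)
qed

end

section \<open>Memory layout and heap numbering of a complete binary tree\<close>

abbreviation (input) addC :: nat where "addC \<equiv> 10"
abbreviation (input) addS :: nat where "addS \<equiv> 11"
abbreviation (input) leafR :: nat where "leafR \<equiv> 12"
abbreviation (input) linC :: nat where "linC \<equiv> 13"
abbreviation (input) linS :: nat where "linS \<equiv> 14"
abbreviation (input) tagL :: nat where "tagL \<equiv> 15"
abbreviation (input) tagR :: nat where "tagR \<equiv> 16"
abbreviation (input) thr :: nat where "thr \<equiv> 17"
abbreviation (input) keyM :: nat where "keyM \<equiv> 18"
abbreviation (input) keyL :: nat where "keyL \<equiv> 19"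
abbreviation (input) hasL :: nat where "hasL \<equiv> 2"
abbreviation (input) hasT :: nat where "hasT \<equiv> 3"

type_synonym varrays = "nat \<Rightarrow> nat \<Rightarrow> real"
type_synonym warrays = "nat \<Rightarrow> nat \<Rightarrow> nat"

definition lv :: "nat \<Rightarrow> nat \<Rightarrow> nat set" where
  "lv e c = {x. x div 2 ^ e = c}"

lemma lv_0 [simp]: "lv 0 c = {c}"
  by (auto simp: lv_def)

lemma div_pow_Suc: "x div 2 ^ Suc e = (x div 2 ^ e) div (2::nat)"
  by (simp only: power_Suc2 div_mult2_eq)

lemma lv_Suc: "lv (Suc e) c = lv e (2 * c) \<union> lv e (2 * c + 1)"
  by (auto simp: lv_def div_pow_Suc simp del: power_Suc)

lemma lv_interval: "lv e c = {c * 2 ^ e ..< (c + 1) * 2 ^ e}"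
  unfolding lv_def
proof (intro set_eqI)
  fix x :: nat
  have "x div 2 ^ e = c \<longleftrightarrow> c \<le> x div 2 ^ e \<and> x div 2 ^ e < c + 1" by auto
  also have "\<dots> \<longleftrightarrow> c * 2 ^ e \<le> x \<and> x < (c + 1) * 2 ^ e"
    by (simp add: less_eq_div_iff_mult_less_eq div_less_iff_less_mult)
  finally show "x \<in> {x. x div 2 ^ e = c} \<longleftrightarrow> x \<in> {c * 2 ^ e ..< (c + 1) * 2 ^ e}" by simp
qed

lemma finite_lv [simp]: "finite (lv e c)"
  by (simp add: lv_interval)

lemma first_mem_lv: "c * 2 ^ e \<in> lv e c"
  by (simp add: lv_def)

lemma lv_nonempty [simp]: "lv e c \<noteq> {}"
  using first_mem_lv by blast

text \<open>Node \<open>c\<close> has height \<open>e\<close> in the complete tree of height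
  \<open>h\<close>: it lies at depth \<open>g\<close>, whose nodes carry the numbers from
  \<open>2 ^ g\<close> to \<open>2 * 2 ^ g - 1\<close>.\<close>

definition nd :: "nat \<Rightarrow> nat \<Rightarrow> nat \<Rightarrow> bool" where
  "nd h e c \<longleftrightarrow> (\<exists>g. h = g + e \<and> 2 ^ g \<le> c \<and> c < 2 * 2 ^ g)"

lemma nd_Suc: "nd h (Suc e) c \<Longrightarrow> nd h e (2 * c) \<and> nd h e (2 * c + 1) \<and> c < 2 ^ h"
proof -
  assume "nd h (Suc e) c"
  then obtain g where g: "h = g + Suc e" "2 ^ g \<le> c" "c < 2 * 2 ^ g" by (auto simp: nd_def)
  have "c < 2 ^ Suc g" using g by simp
  also have "(2::nat) ^ Suc g \<le> 2 ^ h" using g by (intro power_increasing) auto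
  finally have "c < 2 ^ h" .
  moreover have "nd h e (2 * c)" "nd h e (2 * c + 1)"
    unfolding nd_def using g by (auto intro!: exI[of _ "Suc g"])
  ultimately show ?thesis by simp
qed

lemma nd_0: "nd h 0 c \<longleftrightarrow> 2 ^ h \<le> c \<and> c < 2 * 2 ^ h"
  by (auto simp: nd_def)

lemma nd_pos: "nd h e c \<Longrightarrow> 0 < c"
  by (auto simp: nd_def intro: Nat.gr0I)

lemma nd_root: "nd h h 1"
  by (auto simp: nd_def)

lemma nd_less: "nd h e c \<Longrightarrow> c < 2 * 2 ^ h"
proof -
  assume "nd h e c"
  then obtain g where g: "h = g + e" "c < 2 * 2 ^ g" by (auto simp: nd_def)
  have "(2::nat) ^ g \<le> 2 ^ h" using g by (intro power_increasing) auto
  then show ?thesis using g by linarith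
qed

lemma nd_leaf: "nd h e c \<Longrightarrow> x \<in> lv e c \<Longrightarrow> nd h 0 x"
  by (induction e arbitrary: c) (use nd_Suc in \<open>auto simp: lv_Suc\<close>)

lemma nd_parent: "nd h e c \<Longrightarrow> e < h \<Longrightarrow> nd h (Suc e) (c div 2)"
proof -
  assume "nd h e c" "e < h"
  then obtain g where g: "h = g + e" "2 ^ g \<le> c" "c < 2 * 2 ^ g" by (auto simp: nd_def)
  with \<open>e < h\<close> obtain g' where "g = Suc g'" by (cases g) auto
  with g show ?thesis unfolding nd_def by (intro exI[of _ g']) auto
qed

lemma nd_top: "nd h h c \<longleftrightarrow> c = 1"
  by (auto simp: nd_def)

text \<open>Membership in the subtree of \<open>c\<close>, with \<open>c\<close> itself and the
  inner nodes included.\<close>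

definition sub :: "nat \<Rightarrow> nat \<Rightarrow> bool" where
  "sub c \<nu> \<longleftrightarrow> (\<exists>i. \<nu> div 2 ^ i = c)"

lemma sub_refl [simp]: "sub c c"
  unfolding sub_def by (rule exI[of _ 0]) simp

lemma sub_child: "sub (2 * c) \<nu> \<Longrightarrow> sub c \<nu>" "sub (2 * c + 1) \<nu> \<Longrightarrow> sub c \<nu>"
proof -
  have "sub c \<nu>" if s: "sub d \<nu>" and d: "d div 2 = c" for d
  proof -
    obtain i where "\<nu> div 2 ^ i = d" using s by (auto simp: sub_def)
    then have "\<nu> div 2 ^ Suc i = c" using d by (simp add: div_pow_Suc del: power_Suc)
    then show ?thesis unfolding sub_def by blast
  qed
  then show "sub (2 * c) \<nu> \<Longrightarrow> sub c \<nu>" "sub (2 * c + 1) \<nu> \<Longrightarrow> sub c \<nu>"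
    by simp_all
qed

lemma sub_lv: "x \<in> lv e c \<Longrightarrow> sub c x"
  by (auto simp: lv_def sub_def)

lemma lv_Suc_cases:
  assumes "x \<in> lv (Suc e) c"
  obtains d where "d = 2 * c \<or> d = 2 * c + 1" "x \<in> lv e d" "\<And>\<nu>. sub d \<nu> \<Longrightarrow> sub c \<nu>"
  using assms sub_child that by (metis Un_iff lv_Suc)

text \<open>A common descendant would make one sibling equal to or an ancestor of the other, but
  halving \<open>2 * c + 1\<close> at least once leaves at most \<open>c\<close>. Node 0 is its own
  left child, hence the positivity.\<close>

lemma sub_child_disj: "0 < c \<Longrightarrow> sub (2 * c) \<nu> \<Longrightarrow> \<not> sub (2 * c + 1) \<nu>"
proof
  assume c: "0 < c" and "sub (2 * c) \<nu>" "sub (2 * c + 1) \<nu>"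
  then obtain i j where i: "\<nu> div 2 ^ i = 2 * c" and j: "\<nu> div 2 ^ j = 2 * c + 1"
    by (auto simp: sub_def)
  consider "i = j" | k where "j = Suc (i + k)" | k where "i = Suc (j + k)"
    by (metis less_imp_Suc_add linorder_neqE_nat)
  then show False
  proof cases
    case 1 with i j show False by simp
  next
    case 2
    have "\<nu> div 2 ^ j = (2 * c) div 2 ^ Suc k"
      unfolding i[symmetric] 2 by (simp only: div_mult2_eq[symmetric] power_add[symmetric]) simp
    also have "\<dots> \<le> 2 * c" by (rule div_le_dividend)
    finally show False using j by simp
  next
    case 3
    have "\<nu> div 2 ^ i = (2 * c + 1) div 2 ^ Suc k"
      unfolding j[symmetric] 3 by (simp only: div_mult2_eq[symmetric] power_add[symmetric]) simp
    also have "\<dots> = ((2 * c + 1) div 2) div 2 ^ k"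
      by (simp only: power_Suc div_mult2_eq)
    also have "\<dots> \<le> c" using div_le_dividend[of c "2 ^ k"] by simp
    finally show False using i c by simp
  qed
qed

lemma not_sub_child: "0 < c \<Longrightarrow> \<not> sub (2 * c) c" "0 < c \<Longrightarrow> \<not> sub (2 * c + 1) c"
proof -
  have "c div 2 ^ i \<le> c" for i by simp
  then have "c div 2 ^ i \<noteq> d" if "c < d" for i d using that by (metis linorder_not_le)
  then show "0 < c \<Longrightarrow> \<not> sub (2 * c) c" "0 < c \<Longrightarrow> \<not> sub (2 * c + 1) c"
    unfolding sub_def by simp_all
qed

text \<open>All arrays are compared at once, so that locality statements need not list the arrays
  that matter.\<close>

definition same_at :: "varrays \<Rightarrow> warrays \<Rightarrow> varrays \<Rightarrow> warrays \<Rightarrow> nat \<Rightarrow> bool" where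
  "same_at A B A' B' \<nu> \<longleftrightarrow> (\<forall>a. A' a \<nu> = A a \<nu>) \<and> (\<forall>a. B' a \<nu> = B a \<nu>)"

lemma same_at_refl [simp]: "same_at A B A B \<nu>"
  by (simp add: same_at_def)

lemma same_at_trans: "same_at A B A' B' \<nu> \<Longrightarrow> same_at A' B' A'' B'' \<nu> \<Longrightarrow> same_at A B A'' B'' \<nu>"
  by (simp add: same_at_def)

subsection \<open>Semantics of the tree\<close>

text \<open>
  Node \<open>c\<close> has the children \<open>2 * c\<close> and \<open>2 * c + 1\<close>, and \<open>lv e c\<close> are the leaves at depth \<open>e\<close> below it.
  \<open>R A e x\<close> is the source value and \<open>H A B e x\<close> the value of leaf \<open>x\<close>, as far as the arrays of its
  ancestors up to height \<open>e\<close> determine it: \<open>addC + addS * z\<close> is added to both,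
  the line \<open>linC + linS * z\<close> (present if \<open>hasL\<close> is set) bounds \<open>H\<close> from above, and so do
  the cones with slopes \<open>tagL\<close> and \<open>tagR\<close> at all sources below the node (if \<open>hasT\<close> is set).
  \<open>keyM\<close> holds the diagonals at the leaves and separates the keys of the two children elsewhere.
\<close>

definition pen :: "real \<Rightarrow> real \<Rightarrow> real \<Rightarrow> real \<Rightarrow> real" where
  "pen cl cr y x = (if x \<le> y then cl * (y - x) else cr * (x - y))"

fun R :: "varrays \<Rightarrow> nat \<Rightarrow> nat \<Rightarrow> real" where
  "R A 0 x = A leafR x + A addC x + A addS x * A keyM x"
| "R A (Suc e) x = R A e x + A addC (x div 2 ^ Suc e) + A addS (x div 2 ^ Suc e) * A keyM x"

definition with_line :: "varrays \<Rightarrow> warrays \<Rightarrow> nat \<Rightarrow> nat \<Rightarrow> real \<Rightarrow> real" where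
  "with_line A B c x y = (if B hasL c = 0 then y else min y (A linC c + A linS c * A keyM x))"

definition tag_min :: "varrays \<Rightarrow> nat \<Rightarrow> nat \<Rightarrow> real \<Rightarrow> real \<Rightarrow> nat \<Rightarrow> real" where
  "tag_min A e c cl cr x =
     Min ((\<lambda>l. R A e l + pen cl cr (A keyM l) (A keyM x)) ` lv e c)"

text \<open>Here \<open>c\<close> has height \<open>Suc e\<close> but the source values are taken at
  height \<open>e\<close>, before the linear function of \<open>c\<close> itself is added. These are
  the coordinates in which the entries of a node are stored.\<close>

definition tag_min' :: "varrays \<Rightarrow> nat \<Rightarrow> nat \<Rightarrow> real \<Rightarrow> real \<Rightarrow> nat \<Rightarrow> real" where
  "tag_min' A e c cl cr x =
     Min ((\<lambda>l. R A e l + pen cl cr (A keyM l) (A keyM x)) ` lv (Suc e) c)"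

definition with_tag :: "varrays \<Rightarrow> warrays \<Rightarrow> nat \<Rightarrow> nat \<Rightarrow> nat \<Rightarrow> real \<Rightarrow> real" where
  "with_tag A B e c x y =
     (if B hasT c = 0 then y else min y (tag_min' A e c (A tagL c) (A tagR c) x))"

fun H :: "varrays \<Rightarrow> warrays \<Rightarrow> nat \<Rightarrow> nat \<Rightarrow> real" where
  "H A B 0 x = with_line A B x x (A leafR x) + A addC x + A addS x * A keyM x"
| "H A B (Suc e) x =
     with_tag A B e (x div 2 ^ Suc e) x (with_line A B (x div 2 ^ Suc e) x (H A B e x))
     + A addC (x div 2 ^ Suc e) + A addS (x div 2 ^ Suc e) * A keyM x"

declare R.simps(2) [simp del] H.simps(2) [simp del]

lemma H_Suc: "x \<in> lv (Suc e) c \<Longrightarrow>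
    H A B (Suc e) x = with_tag A B e c x (with_line A B c x (H A B e x)) + A addC c + A addS c * A keyM x"
  by (simp add: H.simps lv_def del: power_Suc)

lemma R_Suc: "x \<in> lv (Suc e) c \<Longrightarrow> R A (Suc e) x = R A e x + A addC c + A addS c * A keyM x"
  by (simp add: R.simps lv_def del: power_Suc)

text \<open>Every leaf is bounded by its own source. A cone that arrives at a single leaf therefore
  has no effect.\<close>

lemma H_le_R: "H A B e x \<le> R A e x"
proof (induction e)
  case 0
  then show ?case by (simp add: with_line_def)
next
  case (Suc e)
  then show ?case
    by (simp add: H.simps R.simps with_line_def with_tag_def min_def)
qed

lemma pen_self [simp]: "pen cl cr x x = 0"
  by (simp add: pen_def)

lemma tag_min_le: "l \<in> lv e c \<Longrightarrow> tag_min A e c cl cr x \<le> R A e l + pen cl cr (A keyM l) (A keyM x)"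
  unfolding tag_min_def by (intro Min_le) auto

lemma tag_min_attained:
  obtains l where "l \<in> lv e c" "tag_min A e c cl cr x = R A e l + pen cl cr (A keyM l) (A keyM x)"
proof -
  have "tag_min A e c cl cr x \<in> (\<lambda>l. R A e l + pen cl cr (A keyM l) (A keyM x)) ` lv e c"
    unfolding tag_min_def by (intro Min_in) auto
  then show thesis using that by blast
qed

lemma tag_min'_le: "l \<in> lv (Suc e) c \<Longrightarrow> tag_min' A e c cl cr x \<le> R A e l + pen cl cr (A keyM l) (A keyM x)"
  unfolding tag_min'_def by (intro Min_le) auto

lemma tag_min'_attained:
  obtains l where "l \<in> lv (Suc e) c" "tag_min' A e c cl cr x = R A e l + pen cl cr (A keyM l) (A keyM x)"
proof -
  have "tag_min' A e c cl cr x \<in> (\<lambda>l. R A e l + pen cl cr (A keyM l) (A keyM x)) ` lv (Suc e) c"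
    unfolding tag_min'_def by (intro Min_in) auto
  then show thesis using that by blast
qed

text \<open>As a function of \<open>s\<close> this is the support function of the points
  (\<open>keyM x\<close>, \<open>R A e x\<close>). Only points of their lower convex hull attain it,
  and the side of a cone that faces a whole subtree is such a value.\<close>

definition Qm :: "varrays \<Rightarrow> nat \<Rightarrow> nat \<Rightarrow> real \<Rightarrow> real" where
  "Qm A e c s = Min ((\<lambda>x. R A e x + s * A keyM x) ` lv e c)"

lemma Qm_le: "x \<in> lv e c \<Longrightarrow> Qm A e c s \<le> R A e x + s * A keyM x"
  unfolding Qm_def by (intro Min_le) auto

lemma Qm_attained:
  obtains x where "x \<in> lv e c" "Qm A e c s = R A e x + s * A keyM x"
proof -
  have "Qm A e c s \<in> (\<lambda>x. R A e x + s * A keyM x) ` lv e c"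
    unfolding Qm_def by (intro Min_in) auto
  then show thesis using that by blast
qed

lemma Qm_0: "Qm A 0 c s = A leafR c + A addC c + (s + A addS c) * A keyM c"
  by (simp add: Qm_def algebra_simps)

text \<open>A linear function added to all points merely shifts the slope at which the children are
  asked. This is what makes lazy addition compatible with the hull structure.\<close>

lemma Qm_Suc: "Qm A (Suc e) c s = A addC c + min (Qm A e (2 * c) (s + A addS c)) (Qm A e (2 * c + 1) (s + A addS c))"
proof (rule antisym)
  show "Qm A (Suc e) c s \<le> A addC c + min (Qm A e (2 * c) (s + A addS c)) (Qm A e (2 * c + 1) (s + A addS c))"
  proof -
    have "Qm A (Suc e) c s \<le> A addC c + Qm A e d (s + A addS c)" if d: "d = 2 * c \<or> d = 2 * c + 1" for d
    proof -
      obtain x where x: "x \<in> lv e d" "Qm A e d (s + A addS c) = R A e x + (s + A addS c) * A keyM x"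
        by (rule Qm_attained)
      then have "x \<in> lv (Suc e) c" using d by (auto simp: lv_Suc)
      then show ?thesis using Qm_le[of x "Suc e" c A s] x by (simp add: R_Suc algebra_simps)
    qed
    then show ?thesis by (simp add: min_def)
  qed
  obtain x where x: "x \<in> lv (Suc e) c" "Qm A (Suc e) c s = R A (Suc e) x + s * A keyM x"
    by (rule Qm_attained)
  then consider "x \<in> lv e (2 * c)" | "x \<in> lv e (2 * c + 1)" by (auto simp: lv_Suc)
  then show "A addC c + min (Qm A e (2 * c) (s + A addS c)) (Qm A e (2 * c + 1) (s + A addS c)) \<le> Qm A (Suc e) c s"
    by cases (use x Qm_le[of x e _ A "s + A addS c"] in \<open>fastforce simp: R_Suc algebra_simps\<close>)+
qed

text \<open>The children are compared before the linear function of \<open>c\<close> acts, so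
  changing \<open>addC c\<close> or \<open>addS c\<close> keeps \<open>thr c\<close> valid. The two
  implications overlap at the threshold itself, where the children tie.\<close>

fun hull_ok :: "varrays \<Rightarrow> nat \<Rightarrow> nat \<Rightarrow> bool" where
  "hull_ok A 0 c = True"
| "hull_ok A (Suc e) c \<longleftrightarrow> hull_ok A e (2 * c) \<and> hull_ok A e (2 * c + 1) \<and>
     (\<forall>s. (s \<le> A thr c \<longrightarrow> Qm A e (2 * c + 1) s \<le> Qm A e (2 * c) s) \<and>
          (A thr c \<le> s \<longrightarrow> Qm A e (2 * c) s \<le> Qm A e (2 * c + 1) s))"

subsection \<open>Locality\<close>

lemma R_eqI:
  assumes "A' addC = A addC" "A' addS = A addS" "A' leafR = A leafR" "A' keyM = A keyM"
  shows "R A' e x = R A e x"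
  by (induction e) (simp_all add: R.simps assms)

lemma Qm_eqI:
  assumes "A' addC = A addC" "A' addS = A addS" "A' leafR = A leafR" "A' keyM = A keyM"
  shows "Qm A' e c s = Qm A e c s"
  unfolding Qm_def using assms by (simp add: R_eqI[OF assms])

lemma hull_eqI:
  assumes "A' addC = A addC" "A' addS = A addS" "A' leafR = A leafR" "A' keyM = A keyM" "A' thr = A thr"
  shows "hull_ok A' e c = hull_ok A e c"
  by (induction e arbitrary: c) (simp_all add: assms Qm_eqI[OF assms(1-4)])

lemma R_cong:
  assumes "\<And>\<nu>. sub c \<nu> \<Longrightarrow> same_at A B A' B' \<nu>" "x \<in> lv e c"
  shows "R A' e x = R A e x"
  using assms
proof (induction e arbitrary: c)
  case 0
  then show ?case by (simp add: same_at_def)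
next
  case (Suc e)
  have "same_at A B A' B' x" using Suc.prems sub_lv by blast
  moreover have "same_at A B A' B' c" using Suc.prems by simp
  moreover have "R A' e x = R A e x"
    using Suc.prems(2) by (rule lv_Suc_cases) (use Suc.prems(1) Suc.IH in blast)
  ultimately show ?case using Suc.prems(2) by (simp add: R_Suc same_at_def)
qed

lemma H_cong:
  assumes "\<And>\<nu>. sub c \<nu> \<Longrightarrow> same_at A B A' B' \<nu>" "x \<in> lv e c"
  shows "H A' B' e x = H A B e x"
  using assms
proof (induction e arbitrary: c)
  case 0
  then show ?case by (simp add: same_at_def with_line_def)
next
  case (Suc e)
  have s: "same_at A B A' B' l" if "l \<in> lv (Suc e) c" for l
    using Suc.prems that sub_lv by blast
  have c: "same_at A B A' B' c" using Suc.prems by simp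
  have "H A' B' e x = H A B e x"
    using Suc.prems(2) by (rule lv_Suc_cases) (use Suc.prems(1) Suc.IH in blast)
  moreover have "R A' e l = R A e l" if "l \<in> lv (Suc e) c" for l
    using that by (rule lv_Suc_cases) (use Suc.prems(1) R_cong[of _ A B A' B'] in blast)
  then have "tag_min' A' e c cl cr x = tag_min' A e c cl cr x" for cl cr
    unfolding tag_min'_def
    by (intro arg_cong[where f = Min] image_cong) (use s Suc.prems(2) in \<open>auto simp: same_at_def\<close>)
  ultimately show ?case using Suc.prems(2) c s[OF Suc.prems(2)]
    by (simp add: H_Suc same_at_def with_line_def with_tag_def)
qed

lemma Qm_cong:
  assumes "\<And>\<nu>. sub c \<nu> \<Longrightarrow> same_at A B A' B' \<nu>"
  shows "Qm A' e c s = Qm A e c s"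
proof -
  have "same_at A B A' B' l" if "l \<in> lv e c" for l
    using assms that sub_lv by blast
  then show ?thesis
    unfolding Qm_def using R_cong[of c A B A' B', OF assms]
    by (intro arg_cong[where f = Min] image_cong) (auto simp: same_at_def)
qed

lemma hull_cong:
  assumes "\<And>\<nu>. sub c \<nu> \<Longrightarrow> same_at A B A' B' \<nu>"
  shows "hull_ok A' e c = hull_ok A e c"
  using assms
proof (induction e arbitrary: c)
  case 0
  then show ?case by simp
next
  case (Suc e)
  have "A' thr c = A thr c" using Suc.prems[of c] by (simp add: same_at_def)
  moreover have "hull_ok A' e d = hull_ok A e d" "Qm A' e d = Qm A e d" if "d = 2 * c \<or> d = 2 * c + 1" for d
    using that Suc.IH[of d] Qm_cong[of d A B A' B' e] Suc.prems sub_child by blast+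
  ultimately show ?case by simp
qed

lemma H_Suc_cong:
  assumes "x \<in> lv (Suc e) c" "same_at A B A' B' c"
    and "\<And>l. R A' e l = R A e l" "A' keyM = A keyM" "H A' B' e x = H A B e x"
  shows "H A' B' (Suc e) x = H A B (Suc e) x"
  using assms by (simp add: H_Suc with_line_def with_tag_def tag_min'_def same_at_def)

subsection \<open>Crossing point of two envelopes\<close>

text \<open>For each \<open>x\<close> in \<open>X\<close> the slopes at which it is no worse than
  all of \<open>Y\<close> form a half line that begins at \<open>t x\<close>. At the least of these
  beginnings the two minima meet.\<close>

lemma envelope_crossing:
  fixes f z :: "nat \<Rightarrow> real"
  assumes "finite X" "X \<noteq> {}" "finite Y" "Y \<noteq> {}" and lt: "\<And>x y. x \<in> X \<Longrightarrow> y \<in> Y \<Longrightarrow> z x < z y"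
  shows "\<exists>s. Min ((\<lambda>x. f x + s * z x) ` X) = Min ((\<lambda>x. f x + s * z x) ` Y)"
proof -
  define g where "g x y = (f x - f y) / (z y - z x)" for x y
  define t where "t x = Max (g x ` Y)" for x
  define s where "s = Min (t ` X)"
  have le: "f x + s' * z x \<le> f y + s' * z y \<longleftrightarrow> g x y \<le> s'" if "x \<in> X" "y \<in> Y" for x y s'
    using lt[OF that] by (simp add: g_def field_simps)
  have ge: "f y + s' * z y \<le> f x + s' * z x \<longleftrightarrow> s' \<le> g x y" if "x \<in> X" "y \<in> Y" for x y s'
    using lt[OF that] by (simp add: g_def field_simps)
  have "s \<in> t ` X" unfolding s_def using assms by (intro Min_in) auto
  then obtain x0 where x0: "x0 \<in> X" "s = t x0" by auto
  have "t x0 \<in> g x0 ` Y" unfolding t_def using assms by (intro Max_in) auto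
  then obtain y0 where y0: "y0 \<in> Y" "s = g x0 y0" using x0 by auto
  have gy: "g x0 y \<le> s" if "y \<in> Y" for y
    unfolding x0(2) t_def using assms that by (intro Max_ge) auto
  let ?v = "f x0 + s * z x0"
  have v: "?v = f y0 + s * z y0"
    using le[OF x0(1) y0(1), of s] ge[OF x0(1) y0(1), of s] y0(2) by simp
  have Y: "Min ((\<lambda>x. f x + s * z x) ` Y) = ?v"
  proof (rule Min_eqI)
    show "finite ((\<lambda>x. f x + s * z x) ` Y)" using assms by simp
    show "?v \<le> w" if "w \<in> (\<lambda>x. f x + s * z x) ` Y" for w
      using that gy le[OF x0(1)] by auto
    show "?v \<in> (\<lambda>x. f x + s * z x) ` Y" using v y0(1) by (rule image_eqI)
  qed
  have "?v \<le> f x + s * z x" if "x \<in> X" for x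
  proof -
    have "s \<le> t x" unfolding s_def using assms that by (intro Min_le) auto
    moreover have "t x \<in> g x ` Y" unfolding t_def using assms by (intro Max_in) auto
    ultimately obtain y where y: "y \<in> Y" "s \<le> g x y" by auto
    then have "f y + s * z y \<le> f x + s * z x" using ge[OF that y(1)] by simp
    moreover have "?v \<le> f y + s * z y" using le[OF x0(1) y(1)] gy[OF y(1)] by simp
    ultimately show ?thesis by simp
  qed
  then have "Min ((\<lambda>x. f x + s * z x) ` X) = ?v"
    using assms x0(1) by (intro Min_eqI) auto
  with Y show ?thesis by metis
qed

text \<open>The keys on the left are smaller, so a growing slope favours the left child and the
  comparison of the two envelopes flips only once. Comparing them at \<open>t\<close> thus tells on
  which side of the crossing \<open>t\<close> lies, even while the crossing is unknown.\<close>

lemma Qm_compare: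
  assumes lt: "\<And>x y. x \<in> lv e c \<Longrightarrow> y \<in> lv e d \<Longrightarrow> A keyM x < A keyM y"
    and eq: "Qm A e c s = Qm A e d s"
  shows "Qm A e c t \<le> Qm A e d t \<longleftrightarrow> s \<le> t" "t \<le> s \<Longrightarrow> Qm A e d t \<le> Qm A e c t"
proof -
  obtain x where x: "x \<in> lv e c" "Qm A e c s = R A e x + s * A keyM x" by (rule Qm_attained)
  obtain y where y: "y \<in> lv e d" "Qm A e d s = R A e y + s * A keyM y" by (rule Qm_attained)
  obtain x' where x': "x' \<in> lv e c" "Qm A e c t = R A e x' + t * A keyM x'" by (rule Qm_attained)
  obtain y' where y': "y' \<in> lv e d" "Qm A e d t = R A e y' + t * A keyM y'" by (rule Qm_attained)
  note b = Qm_le[OF x(1), of A t] Qm_le[OF y(1), of A t] Qm_le[OF x'(1), of A s] Qm_le[OF y'(1), of A s]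
  have up: "Qm A e c t - Qm A e d t \<le> (t - s) * (A keyM x - A keyM y')"
    using b x y' eq by (simp add: algebra_simps)
  have lo: "Qm A e c t - Qm A e d t \<ge> (t - s) * (A keyM x' - A keyM y)"
    using b x' y eq by (simp add: algebra_simps)
  have k: "A keyM x - A keyM y' < 0" "A keyM x' - A keyM y < 0"
    using lt x(1) y(1) x'(1) y'(1) by auto
  have 1: "s \<le> t \<Longrightarrow> Qm A e c t \<le> Qm A e d t"
    using up mult_nonneg_nonpos[of "t - s" "A keyM x - A keyM y'"] k(1) by simp
  have 2: "t < s \<Longrightarrow> Qm A e d t < Qm A e c t"
    using lo mult_neg_neg[of "t - s" "A keyM x' - A keyM y"] k(2) by simp
  show "Qm A e c t \<le> Qm A e d t \<longleftrightarrow> s \<le> t" using 1 2 by fastforce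
  show "t \<le> s \<Longrightarrow> Qm A e d t \<le> Qm A e c t" using 2 eq by (cases "t = s") auto
qed

abbreviation (input) rNN :: nat where "rNN \<equiv> 2"
abbreviation (input) rC :: nat where "rC \<equiv> 5"
abbreviation (input) rC2 :: nat where "rC2 \<equiv> 6"
abbreviation (input) rV :: nat where "rV \<equiv> 7"
abbreviation (input) rPW :: nat where "rPW \<equiv> 8"
abbreviation (input) rX0 :: nat where "rX0 \<equiv> 9"
abbreviation (input) rLC :: nat where "rLC \<equiv> 10"
abbreviation (input) rPC :: nat where "rPC \<equiv> 11"
abbreviation (input) rTC :: nat where "rTC \<equiv> 12"

abbreviation (input) fACC :: nat where "fACC \<equiv> 20"
abbreviation (input) fS :: nat where "fS \<equiv> 2"
abbreviation (input) fQ :: nat where "fQ \<equiv> 3"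
abbreviation (input) fU :: nat where "fU \<equiv> 4"
abbreviation (input) fV :: nat where "fV \<equiv> 5"
abbreviation (input) fT1 :: nat where "fT1 \<equiv> 6"
abbreviation (input) fT2 :: nat where "fT2 \<equiv> 7"
abbreviation (input) fTL :: nat where "fTL \<equiv> 8"
abbreviation (input) fTR :: nat where "fTR \<equiv> 9"
abbreviation (input) fA1 :: nat where "fA1 \<equiv> 10"
abbreviation (input) fA2 :: nat where "fA2 \<equiv> 11"
abbreviation (input) fAL :: nat where "fAL \<equiv> 12"
abbreviation (input) fBB :: nat where "fBB \<equiv> 13"
abbreviation (input) fTT :: nat where "fTT \<equiv> 14"
abbreviation (input) fXX :: nat where "fXX \<equiv> 15"
abbreviation (input) fR1 :: nat where "fR1 \<equiv> 16"
abbreviation (input) fZ1 :: nat where "fZ1 \<equiv> 17"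
abbreviation (input) fBE :: nat where "fBE \<equiv> 18"

abbreviation (input) vzero :: vexp where "vzero \<equiv> VWord (WConst 0)"
abbreviation (input) varr_at :: "nat \<Rightarrow> nat \<Rightarrow> vexp" where "varr_at a r \<equiv> VArr a (WReg r)"
abbreviation (input) child0 :: "nat \<Rightarrow> wexp" where "child0 r \<equiv> WMul (WConst 2) (WReg r)"
abbreviation (input) child1 :: "nat \<Rightarrow> wexp" where "child1 r \<equiv> WAdd (WMul (WConst 2) (WReg r)) (WConst 1)"

subsection \<open>Operations on the tree\<close>

definition query_loop :: com where
  "query_loop = Loop (WLess (WReg rC) (WReg rNN))
     (SetV fACC (VAdd (VReg fACC) (varr_at addC rC)) ;;
      SetV fS (VAdd (VReg fS) (varr_at addS rC)) ;;
      Branch (VLess (VReg fS) (varr_at thr rC)) (SetW rC (child1 rC)) (SetW rC (child0 rC)))"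

definition query :: com where
  "query = SetV fACC vzero ;; query_loop ;;
     SetV fQ (VAdd (VReg fACC) (VAdd (VAdd (varr_at leafR rC) (varr_at addC rC))
       (VMul (VAdd (VReg fS) (varr_at addS rC)) (varr_at keyM rC))))"

text \<open>One step in a Li Chao tree: the node keeps the line that is lower at its separating key
  and hands the other one to the side where it can still win, on the left if it is the steeper one.
  After filling an empty node the register is set to \<open>2 * 2 ^ h\<close>, beyond all nodes,
  which ends the loop.\<close>

definition insert_body :: com where
  "insert_body =
     (SetV fU (VSub (VReg fU) (varr_at addC rC2)) ;;
      SetV fV (VSub (VReg fV) (varr_at addS rC2)) ;;
      Branch (WEq (WArr hasL (WReg rC2)) (WConst 0))
        (PutV linC (WReg rC2) (VReg fU) ;;
         PutV linS (WReg rC2) (VReg fV) ;;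
         PutW hasL (WReg rC2) (WConst 1) ;;
         SetW rC2 (child0 rNN))
        (Branch (VLess (VAdd (VReg fU) (VMul (VReg fV) (varr_at keyM rC2)))
                       (VAdd (varr_at linC rC2) (VMul (varr_at linS rC2) (varr_at keyM rC2))))
           (SetV fT1 (varr_at linC rC2) ;;
            SetV fT2 (varr_at linS rC2) ;;
            PutV linC (WReg rC2) (VReg fU) ;;
            PutV linS (WReg rC2) (VReg fV) ;;
            SetV fU (VReg fT1) ;;
            SetV fV (VReg fT2))
           Skip ;;
         Branch (VLess (varr_at linS rC2) (VReg fV)) (SetW rC2 (child0 rC2)) (SetW rC2 (child1 rC2))))"

definition insert_loop :: com where
  "insert_loop = Loop (WLess (WReg rC2) (child0 rNN)) insert_body"

text \<open>Two cones over the same sources merge into the one with the smaller slopes, so one tag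
  per node is enough. The sources below a tag do not change while it waits, because a touch first
  empties the nodes above its leaf.\<close>

definition apply_tag :: com where
  "apply_tag =
     SetV fA1 (VAdd (VReg fTL) (varr_at addS rTC)) ;;
     SetV fA2 (VSub (VReg fTR) (varr_at addS rTC)) ;;
     Branch (WEq (WArr hasT (WReg rTC)) (WConst 0))
       (PutW hasT (WReg rTC) (WConst 1) ;;
        PutV tagL (WReg rTC) (VReg fA1) ;;
        PutV tagR (WReg rTC) (VReg fA2))
       (Branch (VLess (VReg fA1) (varr_at tagL rTC)) (PutV tagL (WReg rTC) (VReg fA1)) Skip ;;
        Branch (VLess (VReg fA2) (varr_at tagR rTC)) (PutV tagR (WReg rTC) (VReg fA2)) Skip)"

lemmas mods = mod_wreg.simps mod_warr.simps mod_vreg.simps mod_varr.simps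

lemma mod_query [simp]:
  "mod_wreg query = {rC}" "mod_warr query = {}" "mod_vreg query = {fACC, fS, fQ}" "mod_varr query = {}"
  "mod_varr query_loop = {}" "mod_warr query_loop = {}"
  by (auto simp: query_def query_loop_def)

lemma mod_insert [simp]:
  "mod_wreg insert_loop = {rC2}" "mod_warr insert_loop = {hasL}"
  "mod_vreg insert_loop = {fU, fV, fT1, fT2}" "mod_varr insert_loop = {linC, linS}"
  by (auto simp: insert_loop_def insert_body_def)

lemma mod_apply_tag [simp]:
  "mod_wreg apply_tag = {}" "mod_warr apply_tag = {hasT}"
  "mod_vreg apply_tag = {fA1, fA2}" "mod_varr apply_tag = {tagL, tagR}"
  by (auto simp: apply_tag_def)

context machine
begin

text \<open>The sum of the accumulated constant and the envelope of the current node at the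
  accumulated slope does not change on the way down.\<close>

lemma wp_query_loop:
  assumes "nd h e (wreg st rC)" "wreg st rNN = 2 ^ h" "hull_ok (varr st) e (wreg st rC)" "8 * 2 ^ h \<le> W"
  shows "wp query_loop st k (\<lambda>st' t. t \<le> k + 30 * e + 10 \<and> nd h 0 (wreg st' rC) \<and>
     vreg st' fACC + Qm (varr st) 0 (wreg st' rC) (vreg st' fS)
       = vreg st fACC + Qm (varr st) e (wreg st rC) (vreg st fS))"
  using assms(1-3)
proof (induction e arbitrary: st k)
  case 0
  then show ?case
    using assms(4) by (auto simp: query_loop_def nd_0 wp_Loop tick_def)
next
  case (Suc e)
  let ?c = "wreg st rC" and ?A = "varr st"
  let ?s = "vreg st fS + ?A addS ?c"
  have c: "nd h e (2 * ?c)" "nd h e (Suc (2 * ?c))" "?c < 2 ^ h" using nd_Suc Suc.prems by fastforce+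
  have hs: "if ?s < ?A thr ?c then Qm ?A e (2 * ?c + 1) ?s \<le> Qm ?A e (2 * ?c) ?s
          else Qm ?A e (2 * ?c) ?s \<le> Qm ?A e (2 * ?c + 1) ?s"
    using Suc.prems(3) by simp
  show ?case
    apply (subst query_loop_def, subst wp_Loop, fold query_loop_def)
    using c assms(4) Suc.prems(2) hs
    apply (auto simp: Qm_Suc min_def split: if_splits intro!: wp_conseq[OF Suc.IH])
    using Suc.prems(3) apply (auto simp: tick_def)
    done
qed

lemma wp_query:
  assumes "nd h e (wreg st rC)" "wreg st rNN = 2 ^ h" "hull_ok (varr st) e (wreg st rC)" "8 * 2 ^ h \<le> W"
  shows "wp query st k (\<lambda>st' t. t \<le> k + 30 * e + 50 \<and>
     vreg st' fQ = Qm (varr st) e (wreg st rC) (vreg st fS))"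
proof -
  have W: "0 < W" using assms(4) by (metis less_le_trans nat_0_less_mult_iff zero_less_numeral zero_less_power)
  have nd0: "nd h 0 c \<Longrightarrow> c < W" for c using assms(4) nd_less[of h 0 c] by simp
  show ?thesis
    apply (simp add: query_def W)
    apply (rule wp_conseq[OF wp_query_loop[of h e]])
        apply (use assms in simp_all)
    subgoal for st' t
      using nd0[of "wreg st' rC"] frame_varr_all[of query_loop _ st'] by (simp add: Qm_0 tick_def)
    done
qed

end

section \<open>Insertion of a line\<close>

fun key_ok :: "varrays \<Rightarrow> nat \<Rightarrow> nat \<Rightarrow> bool" where
  "key_ok A 0 c = True"
| "key_ok A (Suc e) c \<longleftrightarrow> key_ok A e (2 * c) \<and> key_ok A e (2 * c + 1) \<and>
     (\<forall>x \<in> lv e (2 * c). A keyM x < A keyM c) \<and> (\<forall>x \<in> lv e (2 * c + 1). A keyM c \<le> A keyM x)"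

lemma key_ok_eqI: "A' keyM = A keyM \<Longrightarrow> key_ok A' e c = key_ok A e c"
  by (induction e arbitrary: c) simp_all

definition flags_ok :: "warrays \<Rightarrow> bool" where
  "flags_ok B \<longleftrightarrow> (\<forall>\<nu>. B hasL \<nu> \<le> 1 \<and> B hasT \<nu> \<le> 1)"

definition set_line :: "varrays \<Rightarrow> nat \<Rightarrow> real \<Rightarrow> real \<Rightarrow> varrays" where
  "set_line A c u v = A(linC := (A linC)(c := u), linS := (A linS)(c := v))"

lemma set_line_simps [simp]:
  "set_line A c u v linC = (A linC)(c := u)" "set_line A c u v linS = (A linS)(c := v)"
  "a \<noteq> linC \<Longrightarrow> a \<noteq> linS \<Longrightarrow> set_line A c u v a = A a"
  by (simp_all add: set_line_def)

lemma same_at_set_line: "\<nu> \<noteq> c \<Longrightarrow> same_at A B (set_line A c u v) B \<nu>"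
  by (simp add: same_at_def set_line_def)

lemma with_tag_min:
  "with_tag A B e c x (min y w) = min (with_tag A B e c x y) w"
  by (simp add: with_tag_def min.assoc min.commute min.left_commute)

lemma min_add_shift: "min (a::real) b + c + d = min (a + c + d) (b + c + d)"
  by simp

context machine
begin

text \<open>For an occupied node only the common features of both outcomes are stated: the kept and
  the passed line have the same minimum as before everywhere, and the kept one is lower at the
  key.\<close>

lemma wp_insert_body:
  fixes st :: store
  defines "c \<equiv> wreg st rC2" and "A \<equiv> varr st" and "B \<equiv> warr st"
  assumes "c < 2 * 2 ^ h" "wreg st rNN = 2 ^ h" "8 * 2 ^ h \<le> W" "flags_ok B"
  shows "wp insert_body st k
    (\<lambda>s t. t \<le> k + 60 \<and> wreg s rNN = 2 ^ h \<and>
      (if B hasL c = 0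
       then wreg s rC2 = 2 * 2 ^ h \<and> varr s = set_line A c (vreg st fU - A addC c) (vreg st fV - A addS c) \<and>
         warr s = B(hasL := (B hasL)(c := 1))
       else varr s = set_line A c (varr s linC c) (varr s linS c) \<and> warr s = B \<and>
         varr s linC c + varr s linS c * A keyM c \<le> vreg s fU + vreg s fV * A keyM c \<and>
         (\<forall>z. min (varr s linC c + varr s linS c * z) (vreg s fU + vreg s fV * z) =
           min (A linC c + A linS c * z) ((vreg st fU - A addC c) + (vreg st fV - A addS c) * z)) \<and>
         wreg s rC2 = (if varr s linS c < vreg s fV then 2 * c else 2 * c + 1)))"
proof -
  have W: "c < W" "c * 2 < W" "1 + c * 2 < W" "2 * c < W" "Suc (2 * c) < W" "2 < W" "1 < W" "0 < W" "2 ^ h < W" "2 * 2 ^ h < W" "B hasL c < W"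
  proof -
    have h: "(1::nat) \<le> 2 ^ h" by simp
    show "c < W" "c * 2 < W" "1 + c * 2 < W" "2 * c < W" "Suc (2 * c) < W" "2 < W" "1 < W" "0 < W" "2 ^ h < W" "2 * 2 ^ h < W"
      using assms(4-6) h by linarith+
    have "B hasL c \<le> 1" using assms(7) by (simp add: flags_ok_def)
    then show "B hasL c < W" using \<open>1 < W\<close> by linarith
  qed
  show ?thesis
    using W assms(4-6) unfolding c_def A_def B_def insert_body_def
    by (simp add: set_line_def tick_def min.commute)
qed

end

text \<open>What the line of a node is compared with: the source at a leaf, \<open>H\<close> one
  level lower elsewhere. It lets leaves and inner nodes share one argument about changed
  lines.\<close>

definition below :: "varrays \<Rightarrow> warrays \<Rightarrow> nat \<Rightarrow> nat \<Rightarrow> real" where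
  "below A B e x = (case e of 0 \<Rightarrow> A leafR x | Suc e' \<Rightarrow> H A B e' x)"

lemma below_simps [simp]: "below A B 0 x = A leafR x" "below A B (Suc e) x = H A B e x"
  by (simp_all add: below_def)

lemma H_line_change:
  assumes x: "x \<in> lv e c"
    and A: "\<And>a. a \<noteq> linC \<Longrightarrow> a \<noteq> linS \<Longrightarrow> A' a = A a" and B: "\<And>a. a \<noteq> hasL \<Longrightarrow> B' a = B a"
    and eq: "with_line A' B' c x (below A' B' e x) = min (with_line A B c x (below A B e x)) w"
  shows "H A' B' e x = min (H A B e x) (w + A addC c + A addS c * A keyM x)"
proof (cases e)
  case 0
  then show ?thesis using assms by (simp add: min_add_shift)
next
  case (Suc e')
  have R: "R A' e l = R A e l" for e l by (rule R_eqI) (simp_all add: A)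
  have "with_tag A' B' e' c x y = with_tag A B e' c x y" for y
    by (simp add: with_tag_def tag_min'_def A B R)
  then show ?thesis using x eq unfolding Suc
    by (simp add: H_Suc with_tag_min A min_add_shift)
qed

lemma H_child_outside:
  assumes "0 < c" "\<And>\<nu>. \<nu> \<noteq> c \<Longrightarrow> \<not> sub d \<nu> \<Longrightarrow> same_at A B A' B' \<nu>" "d = 2 * c \<or> d = 2 * c + 1"
    "x \<in> lv (Suc e) c" "x \<notin> lv e d"
  shows "H A' B' e x = H A B e x"
  using assms(4)
proof (rule lv_Suc_cases)
  fix d' assume d': "d' = 2 * c \<or> d' = 2 * c + 1" "x \<in> lv e d'"
  with assms(3,5) have "d' \<noteq> d" by auto
  then have "\<not> sub d \<nu>" if "sub d' \<nu>" for \<nu>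
    using d'(1) assms(1,3) that sub_child_disj by blast
  moreover have "\<nu> \<noteq> c" if "sub d' \<nu>" for \<nu>
    using d'(1) assms(1) that not_sub_child by blast
  ultimately show ?thesis using d'(2) assms(2) by (intro H_cong[of d']) auto
qed

lemma H_only_root_changed:
  assumes "0 < c" "\<And>\<nu>. \<nu> \<noteq> c \<Longrightarrow> same_at A B A' B' \<nu>" "x \<in> lv (Suc e) c"
  shows "H A' B' e x = H A B e x"
  using assms(3)
proof (rule lv_Suc_cases)
  fix d' assume d': "d' = 2 * c \<or> d' = 2 * c + 1" "x \<in> lv e d'"
  have "\<nu> \<noteq> c" if "sub d' \<nu>" for \<nu>
    using d'(1) assms(1) that not_sub_child by blast
  then show ?thesis using d'(2) assms(2) by (intro H_cong[of d']) auto
qed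

context machine
begin

lemma wp_insert_loop:
  assumes "nd h e (wreg st rC2)" "wreg st rNN = 2 ^ h" "8 * 2 ^ h \<le> W"
    "flags_ok (warr st)" "key_ok (varr st) e (wreg st rC2)"
  shows "wp insert_loop st k (\<lambda>s t. t \<le> k + 70 * e + 80 \<and> flags_ok (warr s) \<and>
    (\<forall>x \<in> lv e (wreg st rC2). H (varr s) (warr s) e x
       = min (H (varr st) (warr st) e x) (vreg st fU + vreg st fV * varr st keyM x)) \<and>
    (\<forall>\<nu>. \<not> sub (wreg st rC2) \<nu> \<longrightarrow> same_at (varr st) (warr st) (varr s) (warr s) \<nu>))"
  using assms(1,2,4,5)
proof (induction e arbitrary: st k)
  case 0
  let ?c = "wreg st rC2" and ?A = "varr st" and ?B = "warr st"
  have c: "?c < 2 * 2 ^ h" "2 ^ h \<le> ?c" using 0 by (simp_all add: nd_0)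
  have p: "(1::nat) \<le> 2 ^ h" by simp
  have W: "2 < W" "2 ^ h < W" "2 * 2 ^ h < W" "?c < W" "2 * ?c < W" "Suc (2 * ?c) < W"
    using assms(3) c p by linarith+
  have exit: "wp insert_loop s t' Q" if "2 * 2 ^ h \<le> wreg s rC2" "wreg s rC2 < W" "wreg s rNN = 2 ^ h"
    "Q s (tick t' 6)" for s t' Q
    by (subst insert_loop_def, subst wp_Loop) (use that W in \<open>simp add: eval_nat_numeral\<close>)
  have "wp insert_body st k' (\<lambda>s t. wp insert_loop s t (\<lambda>s t. t \<le> k' + 70 \<and> flags_ok (warr s) \<and>
    (\<forall>x \<in> lv 0 ?c. H (varr s) (warr s) 0 x = min (H ?A ?B 0 x) (vreg st fU + vreg st fV * ?A keyM x)) \<and>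
    (\<forall>\<nu>. \<not> sub ?c \<nu> \<longrightarrow> same_at ?A ?B (varr s) (warr s) \<nu>)))" (is "wp _ _ _ (\<lambda>s t. wp _ s t (?Q k'))") for k'
  proof (rule wp_conseq[OF wp_insert_body[OF c(1) 0(2) assms(3) 0(3)]], goal_cases)
    case (1 s t)
    note s = 1(1)[THEN conjunct2, THEN conjunct2] and t = 1(1)[THEN conjunct1]
    note NN = 1(1)[THEN conjunct2, THEN conjunct1]
    have Q: "?Q k' s (tick t 6)"
    proof (cases "?B hasL ?c = 0")
      case True
      with s have s: "varr s = set_line ?A ?c (vreg st fU - ?A addC ?c) (vreg st fV - ?A addS ?c)"
        "warr s = ?B(hasL := (?B hasL)(?c := 1))" by auto
      have "flags_ok (warr s)" using 0(3) by (simp add: s flags_ok_def)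
      moreover have "same_at ?A ?B (varr s) (warr s) \<nu>" if "\<nu> \<noteq> ?c" for \<nu>
        using that by (simp add: s same_at_def set_line_def)
      moreover have "H (varr s) (warr s) 0 ?c = min (H ?A ?B 0 ?c) (vreg st fU + vreg st fV * ?A keyM ?c)"
        using True by (simp add: s with_line_def min_add_shift algebra_simps)
      ultimately show ?thesis using t by (simp add: tick_def) (metis sub_refl)
    next
      case False
      with s have s: "varr s = set_line ?A ?c (varr s linC ?c) (varr s linS ?c)" "warr s = ?B" and
        le: "varr s linC ?c + varr s linS ?c * ?A keyM ?c \<le> vreg s fU + vreg s fV * ?A keyM ?c" and
        mn: "\<And>z. min (varr s linC ?c + varr s linS ?c * z) (vreg s fU + vreg s fV * z) =
           min (?A linC ?c + ?A linS ?c * z) ((vreg st fU - ?A addC ?c) + (vreg st fV - ?A addS ?c) * z)"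
        by auto
      have oth: "a \<noteq> linC \<Longrightarrow> a \<noteq> linS \<Longrightarrow> varr s a = ?A a" for a
        by (subst s(1)) simp
      have "same_at ?A ?B (varr s) (warr s) \<nu>" if "\<nu> \<noteq> ?c" for \<nu>
        by (subst s(1), subst s(2)) (rule same_at_set_line[OF that])
      moreover have "H (varr s) (warr s) 0 ?c = min (H ?A ?B 0 ?c) (vreg st fU + vreg st fV * ?A keyM ?c)"
        using False mn[of "?A keyM ?c"] le by (simp add: s(2) oth with_line_def min_add_shift algebra_simps min.absorb1)
      ultimately show ?thesis using t 0(3) by (simp add: tick_def s(2)) (metis sub_refl)
    qed
    show ?case
      by (rule exit) (use s c W NN Q in \<open>auto split: if_splits\<close>)
  qed
  then have "wp insert_body st (tick k 6) (\<lambda>s t. wp insert_loop s t (\<lambda>s t. t \<le> k + 70 * 0 + 80 \<and> flags_ok (warr s) \<and>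
    (\<forall>x \<in> lv 0 ?c. H (varr s) (warr s) 0 x = min (H ?A ?B 0 x) (vreg st fU + vreg st fV * ?A keyM x)) \<and>
    (\<forall>\<nu>. \<not> sub ?c \<nu> \<longrightarrow> same_at ?A ?B (varr s) (warr s) \<nu>)))"
    by (rule wp_conseq) (erule wp_conseq, simp add: tick_def)
  then show ?case
    by (subst insert_loop_def, subst wp_Loop, fold insert_loop_def) (use W 0 c in \<open>simp add: eval_nat_numeral\<close>)
next
  case (Suc e)
  let ?c = "wreg st rC2" and ?A = "varr st" and ?B = "warr st"
  have c: "nd h e (2 * ?c)" "nd h e (2 * ?c + 1)" "?c < 2 ^ h" "0 < ?c"
    using nd_Suc nd_pos Suc.prems(1) by blast+
  then have c2: "?c < 2 * 2 ^ h" by simp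
  have p: "(1::nat) \<le> 2 ^ h" by simp
  have W: "2 < W" "2 ^ h < W" "2 * 2 ^ h < W" "?c < W" "2 * ?c < W" "Suc (2 * ?c) < W"
    using assms(3) c p by linarith+
  have exit: "wp insert_loop s t' Q" if "2 * 2 ^ h \<le> wreg s rC2" "wreg s rC2 < W" "wreg s rNN = 2 ^ h"
    "Q s (tick t' 6)" for s t' Q
    by (subst insert_loop_def, subst wp_Loop) (use that W in \<open>simp add: eval_nat_numeral\<close>)
  \<comment> \<open>\<open>?w\<close> is the new line in the inner coordinates of \<open>?c\<close>,
    before \<open>addC\<close> and \<open>addS\<close> of that node act.\<close>
  let ?w = "\<lambda>x. (vreg st fU - ?A addC ?c) + (vreg st fV - ?A addS ?c) * ?A keyM x"
  have w: "?w x + ?A addC ?c + ?A addS ?c * ?A keyM x = vreg st fU + vreg st fV * ?A keyM x" for x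
    by (simp add: algebra_simps)
  let ?Q = "\<lambda>k s t. t \<le> k + 70 * e + 144 \<and> flags_ok (warr s) \<and>
    (\<forall>x \<in> lv (Suc e) ?c. H (varr s) (warr s) (Suc e) x
       = min (H ?A ?B (Suc e) x) (vreg st fU + vreg st fV * ?A keyM x)) \<and>
    (\<forall>\<nu>. \<not> sub ?c \<nu> \<longrightarrow> same_at ?A ?B (varr s) (warr s) \<nu>)"
  have "wp insert_body st k' (\<lambda>s t. wp insert_loop s t (?Q k'))" for k'
  proof (rule wp_conseq[OF wp_insert_body[OF c2 Suc.prems(2) assms(3) Suc.prems(3)]], goal_cases)
    case (1 s t)
    note s = 1(1)[THEN conjunct2, THEN conjunct2] and t = 1(1)[THEN conjunct1]
    note NN = 1(1)[THEN conjunct2, THEN conjunct1]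
    show ?case
    proof (cases "?B hasL ?c = 0")
      case True
      with s have s: "varr s = set_line ?A ?c (vreg st fU - ?A addC ?c) (vreg st fV - ?A addS ?c)"
        "warr s = ?B(hasL := (?B hasL)(?c := 1))" "wreg s rC2 = 2 * 2 ^ h" by auto
      have "flags_ok (warr s)" using Suc.prems(3) by (simp add: s flags_ok_def)
      moreover have sm: "same_at ?A ?B (varr s) (warr s) \<nu>" if "\<nu> \<noteq> ?c" for \<nu>
        using that by (simp add: s same_at_def set_line_def)
      moreover have "H (varr s) (warr s) (Suc e) x = min (H ?A ?B (Suc e) x) (vreg st fU + vreg st fV * ?A keyM x)"
        if x: "x \<in> lv (Suc e) ?c" for x
      proof -
        have "H (varr s) (warr s) e x = H ?A ?B e x"
          by (rule H_only_root_changed[OF c(4) sm x])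
        then have "with_line (varr s) (warr s) ?c x (below (varr s) (warr s) (Suc e) x)
            = min (with_line ?A ?B ?c x (below ?A ?B (Suc e) x)) (?w x)"
          using True by (simp add: with_line_def s)
        then show ?thesis unfolding w[symmetric]
          by (intro H_line_change[OF x, unfolded add.assoc, folded add.assoc]) (simp_all add: s)
      qed
      ultimately have "?Q k' s (tick t 6)" using t by (simp add: tick_def) (metis sub_refl)
      then show ?thesis by (intro exit) (use s W NN in auto)
    next
      case False
      with s have s: "varr s = set_line ?A ?c (varr s linC ?c) (varr s linS ?c)" "warr s = ?B" and
        le: "varr s linC ?c + varr s linS ?c * ?A keyM ?c \<le> vreg s fU + vreg s fV * ?A keyM ?c" and
        mn: "\<And>z. min (varr s linC ?c + varr s linS ?c * z) (vreg s fU + vreg s fV * z) =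
           min (?A linC ?c + ?A linS ?c * z) ((vreg st fU - ?A addC ?c) + (vreg st fV - ?A addS ?c) * z)" and
        d: "wreg s rC2 = (if varr s linS ?c < vreg s fV then 2 * ?c else 2 * ?c + 1)"
        by auto
      let ?d = "wreg s rC2"
      have oth: "a \<noteq> linC \<Longrightarrow> a \<noteq> linS \<Longrightarrow> varr s a = ?A a" for a
        by (subst s(1)) simp
      have d2: "?d = 2 * ?c \<or> ?d = 2 * ?c + 1" using d by (simp split: if_splits)
      have sm: "same_at ?A ?B (varr s) (warr s) \<nu>" if "\<nu> \<noteq> ?c" for \<nu>
        by (subst s(1), subst s(2)) (rule same_at_set_line[OF that])
      have nd: "nd h e ?d" using c(1,2) d2 by metis
      have ko: "key_ok (varr s) e ?d" using Suc.prems(4) d2 key_ok_eqI[of "varr s" ?A] oth by auto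
      show ?thesis
      proof (rule wp_conseq[OF Suc.IH[OF nd NN _ ko]], goal_cases)
        case 1
        show ?case using Suc.prems(3) by (simp add: s(2))
      next
        case (2 s' t')
        let ?A' = "varr s'" and ?B' = "warr s'"
        have oth': "a \<noteq> linC \<Longrightarrow> a \<noteq> linS \<Longrightarrow> ?A' a = ?A a" "b \<noteq> hasL \<Longrightarrow> ?B' b = ?B b" for a b
          using frame_varr[OF 2(2)] frame_warr[OF 2(2)] oth s(2) by simp_all
        have Hd: "H ?A' ?B' e x = min (H (varr s) (warr s) e x) (vreg s fU + vreg s fV * ?A keyM x)"
          if "x \<in> lv e ?d" for x using 2(1) that oth[of keyM] by simp
        have sm': "same_at (varr s) (warr s) ?A' ?B' \<nu>" if "\<not> sub ?d \<nu>" for \<nu>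
          using 2(1) that by blast
        have sm'': "same_at ?A ?B ?A' ?B' \<nu>" if "\<nu> \<noteq> ?c" "\<not> sub ?d \<nu>" for \<nu>
          using sm sm' same_at_trans that by blast
        have nd: "\<not> sub ?d ?c" using d2 not_sub_child c(4) by metis
        have at_c: "?A' linC ?c = varr s linC ?c" "?A' linS ?c = varr s linS ?c" "?B' hasL ?c = ?B hasL ?c"
          using sm'[OF nd] s(2) by (auto simp: same_at_def)
        have "H ?A' ?B' (Suc e) x = min (H ?A ?B (Suc e) x) (vreg st fU + vreg st fV * ?A keyM x)"
          if x: "x \<in> lv (Suc e) ?c" for x
        proof -
          let ?L = "vreg s fU + vreg s fV * ?A keyM x" and ?W = "varr s linC ?c + varr s linS ?c * ?A keyM x"
          have "min (H ?A' ?B' e x) ?W = min (H ?A ?B e x) (min ?W ?L)"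
          proof (cases "x \<in> lv e ?d")
            case True
            then show ?thesis using Hd[OF True] H_only_root_changed[OF c(4) sm x]
              by (simp add: min.assoc min.commute)
          next
            case F: False
            have "H ?A' ?B' e x = H ?A ?B e x"
              by (rule H_child_outside[OF c(4) sm'' d2 x F])
            \<comment> \<open>On the side that is not entered the kept line wins: it is no higher at
              the key of \<open>?c\<close>, and by the order of the slopes the gap cannot shrink
              away from it.\<close>
            moreover have "?W \<le> ?L"
            proof (cases "varr s linS ?c < vreg s fV")
              case True
              then have "x \<in> lv e (2 * ?c + 1)" using F x d by (auto simp: lv_Suc)
              then have "?A keyM ?c \<le> ?A keyM x" using Suc.prems(4) by simp
              then have "varr s linS ?c * (?A keyM x - ?A keyM ?c) \<le> vreg s fV * (?A keyM x - ?A keyM ?c)"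
                using True by (intro mult_right_mono) auto
              then show ?thesis using le by (simp add: algebra_simps)
            next
              case Fa: False
              then have "x \<in> lv e (2 * ?c)" using F x d by (auto simp: lv_Suc)
              then have "?A keyM x < ?A keyM ?c" using Suc.prems(4) by simp
              then have "vreg s fV * (?A keyM ?c - ?A keyM x) \<le> varr s linS ?c * (?A keyM ?c - ?A keyM x)"
                using Fa by (intro mult_right_mono) auto
              then show ?thesis using le by (simp add: algebra_simps)
            qed
            ultimately show ?thesis by (simp add: min.absorb1)
          qed
          then have "with_line ?A' ?B' ?c x (below ?A' ?B' (Suc e) x)
              = min (with_line ?A ?B ?c x (below ?A ?B (Suc e) x)) (?w x)"
            using False mn[of "?A keyM x"] by (simp add: with_line_def at_c oth' min.assoc)
          then show ?thesis unfolding w[symmetric]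
            by (intro H_line_change[OF x, unfolded add.assoc, folded add.assoc]) (simp_all add: oth')
        qed
        moreover have "same_at ?A ?B ?A' ?B' \<nu>" if "\<not> sub ?c \<nu>" for \<nu>
          using sm''[of \<nu>] that d2 sub_child sub_refl by metis
        ultimately show ?case using 2(1) t by simp
      qed
    qed
  qed
  then have "wp insert_body st (tick k 6) (\<lambda>s t. wp insert_loop s t (\<lambda>s t. t \<le> k + 70 * Suc e + 80 \<and> flags_ok (warr s) \<and>
    (\<forall>x \<in> lv (Suc e) ?c. H (varr s) (warr s) (Suc e) x = min (H ?A ?B (Suc e) x) (vreg st fU + vreg st fV * ?A keyM x)) \<and>
    (\<forall>\<nu>. \<not> sub ?c \<nu> \<longrightarrow> same_at ?A ?B (varr s) (warr s) \<nu>)))"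
    by (rule wp_conseq) (erule wp_conseq, simp add: tick_def)
  then show ?case
    by (subst insert_loop_def, subst wp_Loop, fold insert_loop_def) (use W Suc.prems(2) c in \<open>simp add: eval_nat_numeral\<close>)
qed

end

section \<open>Merging cones and splitting them between the children\<close>

lemma pen_min: "pen (min a a') (min b b') y x = min (pen a b y x) (pen a' b' y x)"
proof -
  have "min a a' * c = min (a * c) (a' * c)" if "0 \<le> c" for a a' c :: real
    using that by (cases "a \<le> a'") (simp_all add: min_def mult_right_mono antisym)
  then show ?thesis by (simp add: pen_def)
qed

text \<open>Distances are nonnegative, so the pointwise minimum of two cones with the same apex is
  the cone with the smaller slope on either side.\<close>

lemma tag_min'_min:
  "tag_min' A e c (min a a') (min b b') x = min (tag_min' A e c a b x) (tag_min' A e c a' b' x)"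
proof (rule antisym)
  obtain l where "l \<in> lv (Suc e) c" "tag_min' A e c a b x = R A e l + pen a b (A keyM l) (A keyM x)"
    by (rule tag_min'_attained)
  then have 1: "tag_min' A e c (min a a') (min b b') x \<le> tag_min' A e c a b x"
    using tag_min'_le[of l e c A "min a a'" "min b b'" x] by (simp add: pen_min)
  obtain l where "l \<in> lv (Suc e) c" "tag_min' A e c a' b' x = R A e l + pen a' b' (A keyM l) (A keyM x)"
    by (rule tag_min'_attained)
  then have 2: "tag_min' A e c (min a a') (min b b') x \<le> tag_min' A e c a' b' x"
    using tag_min'_le[of l e c A "min a a'" "min b b'" x] by (simp add: pen_min)
  show "tag_min' A e c (min a a') (min b b') x \<le> min (tag_min' A e c a b x) (tag_min' A e c a' b' x)"
    using 1 2 by simp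
  obtain l where l: "l \<in> lv (Suc e) c"
    "tag_min' A e c (min a a') (min b b') x = R A e l + pen (min a a') (min b b') (A keyM l) (A keyM x)"
    by (rule tag_min'_attained)
  show "min (tag_min' A e c a b x) (tag_min' A e c a' b' x) \<le> tag_min' A e c (min a a') (min b b') x"
    using tag_min'_le[OF l(1), of A a b x] tag_min'_le[OF l(1), of A a' b' x] unfolding l(2) pen_min by linarith
qed

text \<open>Moving the term \<open>addS c * z\<close> from the source to the target tilts the cone:
  one slope grows by \<open>addS c\<close>, the other shrinks by it. This is why the two slopes are
  stored separately although every push begins with \<open>M\<close> on both sides.\<close>

lemma tag_min_shift:
  assumes "x \<in> lv (Suc e) c"
  shows "tag_min A (Suc e) c cl cr x = tag_min' A e c (cl + A addS c) (cr - A addS c) x + (A addC c + A addS c * A keyM x)"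
proof -
  have eq: "R A (Suc e) l + pen cl cr (A keyM l) (A keyM x) =
      R A e l + pen (cl + A addS c) (cr - A addS c) (A keyM l) (A keyM x) + (A addC c + A addS c * A keyM x)"
    if "l \<in> lv (Suc e) c" for l
    using that by (simp add: R_Suc pen_def algebra_simps)
  have "tag_min A (Suc e) c cl cr x = Min ((\<lambda>l. R A e l + pen (cl + A addS c) (cr - A addS c) (A keyM l) (A keyM x)
      + (A addC c + A addS c * A keyM x)) ` lv (Suc e) c)"
    unfolding tag_min_def by (intro arg_cong[where f = Min] image_cong refl eq)
  also have "\<dots> = tag_min' A e c (cl + A addS c) (cr - A addS c) x + (A addC c + A addS c * A keyM x)"
    unfolding tag_min'_def by (rule Min_add_commute) auto
  finally show ?thesis .
qed

lemma H_tag: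
  assumes x: "x \<in> lv e c" and "0 < c"
    and oth: "\<And>\<nu>. \<nu> \<noteq> c \<Longrightarrow> same_at A B A' B' \<nu>"
    and A: "\<And>a. a \<noteq> tagL \<Longrightarrow> a \<noteq> tagR \<Longrightarrow> A' a = A a" and B: "\<And>a. a \<noteq> hasT \<Longrightarrow> B' a = B a"
    and "B' hasT c = 1"
    and "A' tagL c = (if B hasT c = 0 then cl + A addS c else min (A tagL c) (cl + A addS c))"
    and "A' tagR c = (if B hasT c = 0 then cr - A addS c else min (A tagR c) (cr - A addS c))"
  shows "H A' B' e x = min (H A B e x) (tag_min A e c cl cr x)"
proof (cases e)
  \<comment> \<open>A leaf is its own only source, at distance 0, and \<open>H_le_R\<close> already
    bounds its value.\<close>
  case 0
  have "H A' B' 0 x = H A B 0 x" by (simp add: A B with_line_def)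
  moreover have "tag_min A 0 c cl cr x = R A 0 x" using x 0 by (simp add: tag_min_def)
  ultimately show ?thesis using H_le_R[of A B 0 x] unfolding 0 by (simp add: min.absorb1)
next
  case (Suc e')
  note x' = x[unfolded Suc]
  have R: "R A' e l = R A e l" for e l by (rule R_eqI) (simp_all add: A)
  have tg: "tag_min' A' e' c a b x = tag_min' A e' c a b x" for a b
    by (simp add: tag_min'_def R A)
  have H: "H A' B' e' x = H A B e' x"
    by (rule H_only_root_changed[OF assms(2) oth x'])
  have "with_tag A' B' e' c x y = min (with_tag A B e' c x y) (tag_min' A e' c (cl + A addS c) (cr - A addS c) x)" for y
    using assms(6-8) by (simp add: with_tag_def tg tag_min'_min min.assoc)
  then show ?thesis
    unfolding Suc H_Suc[OF x'] tag_min_shift[OF x']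
    by (simp add: with_line_def H A B add.assoc min_add_distrib_left)
qed

text \<open>Seen from the left child, all sources of the right child lie on one side, so the kinks
  of their cones are invisible. Their minimum is a single line with slope \<open>- cl\<close> whose
  constant is one hull query. Only the sources of the own child still need a cone.\<close>

lemma tag_split_left:
  assumes "key_ok A (Suc e) c" "x \<in> lv e (2 * c)"
  shows "tag_min' A e c cl cr x = min (Qm A e (2 * c + 1) cl + (0 - cl) * A keyM x) (tag_min A e (2 * c) cl cr x)"
proof (rule antisym)
  have pr: "pen cl cr (A keyM l) (A keyM x) = cl * A keyM l - cl * A keyM x" if "l \<in> lv e (2 * c + 1)" for l
    using assms that by (force simp: pen_def algebra_simps)
  obtain l where l: "l \<in> lv e (2 * c + 1)" "Qm A e (2 * c + 1) cl = R A e l + cl * A keyM l" by (rule Qm_attained)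
  then have 1: "tag_min' A e c cl cr x \<le> Qm A e (2 * c + 1) cl + (0 - cl) * A keyM x"
    using tag_min'_le[of l e c A cl cr x] pr[OF l(1)] by (simp add: lv_Suc)
  obtain l where l: "l \<in> lv e (2 * c)" "tag_min A e (2 * c) cl cr x = R A e l + pen cl cr (A keyM l) (A keyM x)"
    by (rule tag_min_attained)
  then have 2: "tag_min' A e c cl cr x \<le> tag_min A e (2 * c) cl cr x"
    using tag_min'_le[of l e c A cl cr x] by (simp add: lv_Suc)
  show "tag_min' A e c cl cr x \<le> min (Qm A e (2 * c + 1) cl + (0 - cl) * A keyM x) (tag_min A e (2 * c) cl cr x)"
    using 1 2 by simp
  obtain l where l: "l \<in> lv (Suc e) c" "tag_min' A e c cl cr x = R A e l + pen cl cr (A keyM l) (A keyM x)"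
    by (rule tag_min'_attained)
  from l(1) consider "l \<in> lv e (2 * c)" | "l \<in> lv e (2 * c + 1)" by (auto simp: lv_Suc)
  then show "min (Qm A e (2 * c + 1) cl + (0 - cl) * A keyM x) (tag_min A e (2 * c) cl cr x) \<le> tag_min' A e c cl cr x"
  proof cases
    case 1
    show ?thesis using tag_min_le[OF 1, of A cl cr x] unfolding l(2) by simp
  next
    case 2
    show ?thesis using Qm_le[OF 2, of A cl] unfolding l(2) pr[OF 2] by simp
  qed
qed

lemma tag_split_right:
  assumes "key_ok A (Suc e) c" "x \<in> lv e (2 * c + 1)"
  shows "tag_min' A e c cl cr x = min (Qm A e (2 * c) (0 - cr) + cr * A keyM x) (tag_min A e (2 * c + 1) cl cr x)"
proof (rule antisym)
  have pr: "pen cl cr (A keyM l) (A keyM x) = cr * A keyM x - cr * A keyM l" if "l \<in> lv e (2 * c)" for l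
    using assms that by (force simp: pen_def algebra_simps)
  obtain l where l: "l \<in> lv e (2 * c)" "Qm A e (2 * c) (0 - cr) = R A e l + (0 - cr) * A keyM l" by (rule Qm_attained)
  then have 1: "tag_min' A e c cl cr x \<le> Qm A e (2 * c) (0 - cr) + cr * A keyM x"
    using tag_min'_le[of l e c A cl cr x] pr[OF l(1)] by (simp add: lv_Suc)
  obtain l where l: "l \<in> lv e (2 * c + 1)" "tag_min A e (2 * c + 1) cl cr x = R A e l + pen cl cr (A keyM l) (A keyM x)"
    by (rule tag_min_attained)
  then have 2: "tag_min' A e c cl cr x \<le> tag_min A e (2 * c + 1) cl cr x"
    using tag_min'_le[of l e c A cl cr x] by (simp add: lv_Suc)
  show "tag_min' A e c cl cr x \<le> min (Qm A e (2 * c) (0 - cr) + cr * A keyM x) (tag_min A e (2 * c + 1) cl cr x)"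
    using 1 2 by simp
  obtain l where l: "l \<in> lv (Suc e) c" "tag_min' A e c cl cr x = R A e l + pen cl cr (A keyM l) (A keyM x)"
    by (rule tag_min'_attained)
  from l(1) consider "l \<in> lv e (2 * c)" | "l \<in> lv e (2 * c + 1)" by (auto simp: lv_Suc)
  then show "min (Qm A e (2 * c) (0 - cr) + cr * A keyM x) (tag_min A e (2 * c + 1) cl cr x) \<le> tag_min' A e c cl cr x"
  proof cases
    case 1
    show ?thesis using Qm_le[OF 1, of A "0 - cr"] unfolding l(2) pr[OF 1] by simp
  next
    case 2
    show ?thesis using tag_min_le[OF 2, of A cl cr x] unfolding l(2) by simp
  qed
qed

section \<open>Emptying a node into its children\<close>

definition push_down :: com where
  "push_down =
     Branch (WEq (WArr hasL (WReg rV)) (WConst 1))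
       (SetW rC2 (child0 rV) ;; SetV fU (varr_at linC rV) ;; SetV fV (varr_at linS rV) ;; insert_loop ;;
        SetW rC2 (child1 rV) ;; SetV fU (varr_at linC rV) ;; SetV fV (varr_at linS rV) ;; insert_loop ;;
        PutW hasL (WReg rV) (WConst 0))
       Skip ;;
     Branch (WEq (WArr hasT (WReg rV)) (WConst 1))
       (SetW rC (child1 rV) ;; SetV fS (varr_at tagL rV) ;; query ;;
        SetW rC2 (child0 rV) ;; SetV fU (VReg fQ) ;; SetV fV (VSub vzero (varr_at tagL rV)) ;; insert_loop ;;
        SetW rC (child0 rV) ;; SetV fS (VSub vzero (varr_at tagR rV)) ;; query ;;
        SetW rC2 (child1 rV) ;; SetV fU (VReg fQ) ;; SetV fV (varr_at tagR rV) ;; insert_loop ;;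
        SetV fTL (varr_at tagL rV) ;; SetV fTR (varr_at tagR rV) ;;
        SetW rTC (child0 rV) ;; apply_tag ;;
        SetW rTC (child1 rV) ;; apply_tag ;;
        PutW hasT (WReg rV) (WConst 0))
       Skip"

lemma mod_push_down [simp]:
  "mod_wreg push_down = {rC, rC2, rTC}" "mod_warr push_down = {hasL, hasT}"
  "mod_vreg push_down = {fACC, fS, fQ, fU, fV, fT1, fT2, fTL, fTR, fA1, fA2}"
  "mod_varr push_down = {linC, linS, tagL, tagR}"
  by (auto simp: push_down_def)

text \<open>These arrays determine \<open>R\<close>, the hull and the keys. Handing entries down
  leaves them alone, so queries made in between still refer to the original arrays.\<close>

definition core_eq :: "varrays \<Rightarrow> varrays \<Rightarrow> bool" where
  "core_eq A A' \<longleftrightarrow> (\<forall>a \<in> {addC, addS, leafR, thr, keyM, keyL}. A' a = A a)"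

lemma core_eqD:
  assumes "core_eq A A'"
  shows "A' keyM = A keyM" "R A' = R A" "Qm A' = Qm A" "hull_ok A' = hull_ok A" "key_ok A' = key_ok A"
    "tag_min A' = tag_min A" "A' addC = A addC" "A' addS = A addS"
proof -
  have A: "A' addC = A addC" "A' addS = A addS" "A' leafR = A leafR" "A' keyM = A keyM" "A' thr = A thr"
    using assms by (simp_all add: core_eq_def)
  show "A' keyM = A keyM" "A' addC = A addC" "A' addS = A addS" using A by simp_all
  show R: "R A' = R A" by (intro ext R_eqI A)
  show "Qm A' = Qm A" by (intro ext Qm_eqI A)
  show "hull_ok A' = hull_ok A" by (intro ext hull_eqI A)
  show "key_ok A' = key_ok A" by (intro ext key_ok_eqI A)
  show "tag_min A' = tag_min A" by (intro ext) (simp add: tag_min_def R A)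
qed

text \<open>The state while the line and the tag of node \<open>\<nu>\<close> are handed to its children; \<open>ga\<close> and \<open>gb\<close>
  are the values stored below the two children, \<open>fl\<close> and \<open>ft\<close> the flags of \<open>\<nu>\<close>.\<close>

definition PD :: "varrays \<Rightarrow> warrays \<Rightarrow> nat \<Rightarrow> nat \<Rightarrow> nat \<Rightarrow> (nat \<Rightarrow> real) \<Rightarrow> (nat \<Rightarrow> real) \<Rightarrow> nat \<Rightarrow> nat \<Rightarrow> store \<Rightarrow> bool" where
  "PD A B h e \<nu> ga gb fl ft s \<longleftrightarrow>
     wreg s rNN = 2 ^ h \<and> wreg s rV = \<nu> \<and> flags_ok (warr s) \<and> core_eq A (varr s) \<and>
     (\<forall>\<mu>. \<not> sub \<nu> \<mu> \<longrightarrow> same_at A B (varr s) (warr s) \<mu>) \<and>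
     (\<forall>a. varr s a \<nu> = A a \<nu>) \<and> warr s hasL \<nu> = fl \<and> warr s hasT \<nu> = ft \<and>
     (\<forall>x \<in> lv e (2 * \<nu>). H (varr s) (warr s) e x = ga x) \<and>
     (\<forall>x \<in> lv e (2 * \<nu> + 1). H (varr s) (warr s) e x = gb x)"

lemma PD_reg [simp]:
  "PD A B h e \<nu> ga gb fl ft (s\<lparr>vreg := f\<rparr>) = PD A B h e \<nu> ga gb fl ft s"
  "r rNN = wreg s rNN \<Longrightarrow> r rV = wreg s rV \<Longrightarrow>
    PD A B h e \<nu> ga gb fl ft (s\<lparr>wreg := r\<rparr>) = PD A B h e \<nu> ga gb fl ft s"
  by (simp_all add: PD_def)

lemma PD_D:
  assumes "PD A B h e \<nu> ga gb fl ft s"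
  shows "wreg s rNN = 2 ^ h" "wreg s rV = \<nu>" "warr s hasL \<nu> = fl" "warr s hasT \<nu> = ft" "varr s a \<nu> = A a \<nu>"
  using assms by (simp_all add: PD_def)

context machine
begin

lemma wp_apply_tag:
  assumes "c = wreg st rTC" "c < W" "8 \<le> W" "flags_ok (warr st)"
  shows "wp apply_tag st k (\<lambda>s t. t \<le> k + 60 \<and> flags_ok (warr s) \<and> warr s hasT c = 1 \<and>
    varr s tagL c = (if warr st hasT c = 0 then vreg st fTL + varr st addS c
      else min (varr st tagL c) (vreg st fTL + varr st addS c)) \<and>
    varr s tagR c = (if warr st hasT c = 0 then vreg st fTR - varr st addS c
      else min (varr st tagR c) (vreg st fTR - varr st addS c)) \<and>
    (\<forall>\<nu>. \<nu> \<noteq> c \<longrightarrow> same_at (varr st) (warr st) (varr s) (warr s) \<nu>))"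
proof -
  have B: "warr st hasT c \<le> 1" using assms(4) by (simp add: flags_ok_def)
  have W: "warr st hasT c < W" "0 < W" "Suc 0 < W" using B assms(3) by linarith+
  have one: "warr st hasT c \<noteq> 0 \<Longrightarrow> warr st hasT c = Suc 0" using B by linarith
  show ?thesis
    using W assms one unfolding apply_tag_def
    by (auto simp: tick_def flags_ok_def same_at_def min_def)
qed

lemma wp_PD_insert:
  assumes PD: "PD A B h e \<nu> ga gb fl ft st" and nd: "nd h (Suc e) \<nu>" and "8 * 2 ^ h \<le> W" and ko: "key_ok A (Suc e) \<nu>"
    and d: "wreg st rC2 = 2 * \<nu> \<or> wreg st rC2 = 2 * \<nu> + 1"
    and Q: "\<And>s t. t \<le> k + 70 * e + 80 \<Longrightarrow> PD A B h e \<nu>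
      (if wreg st rC2 = 2 * \<nu> then (\<lambda>x. min (ga x) (vreg st fU + vreg st fV * A keyM x)) else ga)
      (if wreg st rC2 = 2 * \<nu> then gb else (\<lambda>x. min (gb x) (vreg st fU + vreg st fV * A keyM x))) fl ft s \<Longrightarrow>
      frame insert_loop st s \<Longrightarrow> Q s t"
  shows "wp insert_loop st k Q"
proof -
  let ?d = "wreg st rC2"
  have \<nu>: "0 < \<nu>" using nd nd_pos by blast
  have core: "core_eq A (varr st)" using PD by (simp add: PD_def)
  note cD = core_eqD[OF core]
  have ndd: "nd h e ?d" using nd_Suc[OF nd] d by metis
  have "key_ok (varr st) e ?d" using ko d by (auto simp: cD(5))
  moreover have "flags_ok (warr st)" "wreg st rNN = 2 ^ h" using PD by (simp_all add: PD_def)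
  ultimately show ?thesis
  proof (rule_tac wp_conseq[OF wp_insert_loop[OF ndd]])
    fix s t
    assume s: "t \<le> k + 70 * e + 80 \<and> flags_ok (warr s) \<and>
       (\<forall>x\<in>lv e ?d. H (varr s) (warr s) e x = min (H (varr st) (warr st) e x) (vreg st fU + vreg st fV * varr st keyM x)) \<and>
       (\<forall>\<nu>. \<not> sub ?d \<nu> \<longrightarrow> same_at (varr st) (warr st) (varr s) (warr s) \<nu>)"
      and f: "frame insert_loop st s"
    have oth: "a \<noteq> linC \<Longrightarrow> a \<noteq> linS \<Longrightarrow> varr s a = varr st a" for a
      using frame_varr[OF f] by simp
    have nsub: "\<not> sub ?d \<nu>" using d \<nu> not_sub_child by metis
    have sm: "\<not> sub ?d \<mu> \<Longrightarrow> same_at (varr st) (warr st) (varr s) (warr s) \<mu>" for \<mu> using s by blast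
    have out: "H (varr s) (warr s) e x = H (varr st) (warr st) e x" if "x \<in> lv (Suc e) \<nu>" "x \<notin> lv e ?d" for x
      by (rule H_child_outside[OF \<nu> sm d that])
    have disj: "x \<in> lv e (2 * \<nu>) \<Longrightarrow> x \<notin> lv e (2 * \<nu> + 1)"
      "x \<in> lv e (2 * \<nu> + 1) \<Longrightarrow> x \<notin> lv e (2 * \<nu>)" for x by (auto simp: lv_def)
    have "PD A B h e \<nu>
      (if ?d = 2 * \<nu> then (\<lambda>x. min (ga x) (vreg st fU + vreg st fV * A keyM x)) else ga)
      (if ?d = 2 * \<nu> then gb else (\<lambda>x. min (gb x) (vreg st fU + vreg st fV * A keyM x))) fl ft s"
      unfolding PD_def
    proof (intro conjI allI impI)
      show "wreg s rNN = 2 ^ h" "wreg s rV = \<nu>" using PD frame_wreg[OF f] by (simp_all add: PD_def)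
      show "flags_ok (warr s)" using s by blast
      show "core_eq A (varr s)" using core oth by (simp add: core_eq_def)
      show "same_at A B (varr s) (warr s) \<mu>" if "\<not> sub \<nu> \<mu>" for \<mu>
      proof -
        have "\<not> sub ?d \<mu>" using that d sub_child by metis
        then show ?thesis using sm PD that same_at_trans unfolding PD_def by blast
      qed
      show "varr s a \<nu> = A a \<nu>" for a using sm[OF nsub] PD by (simp add: PD_def same_at_def)
      show "warr s hasL \<nu> = fl" "warr s hasT \<nu> = ft" using sm[OF nsub] PD by (simp_all add: PD_def same_at_def)
      show "\<forall>x\<in>lv e (2 * \<nu>). H (varr s) (warr s) e x =
          (if ?d = 2 * \<nu> then (\<lambda>x. min (ga x) (vreg st fU + vreg st fV * A keyM x)) else ga) x"
        using s PD out d disj by (auto simp: PD_def cD(1) lv_Suc)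
      show "\<forall>x\<in>lv e (2 * \<nu> + 1). H (varr s) (warr s) e x =
          (if ?d = 2 * \<nu> then gb else (\<lambda>x. min (gb x) (vreg st fU + vreg st fV * A keyM x))) x"
        using s PD out d disj by (auto simp: PD_def cD(1) lv_Suc)
    qed
    then show "Q s t" using Q s f by blast
  qed (use assms in auto)
qed

lemma wp_PD_tag:
  assumes PD: "PD A B h e \<nu> ga gb fl ft st" and nd: "nd h (Suc e) \<nu>" and W: "8 * 2 ^ h \<le> W"
    and d: "wreg st rTC = 2 * \<nu> \<or> wreg st rTC = 2 * \<nu> + 1"
    and Q: "\<And>s t. t \<le> k + 60 \<Longrightarrow> PD A B h e \<nu>
      (if wreg st rTC = 2 * \<nu> then (\<lambda>x. min (ga x) (tag_min A e (2 * \<nu>) (vreg st fTL) (vreg st fTR) x)) else ga)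
      (if wreg st rTC = 2 * \<nu> then gb else (\<lambda>x. min (gb x) (tag_min A e (2 * \<nu> + 1) (vreg st fTL) (vreg st fTR) x))) fl ft s \<Longrightarrow>
      frame apply_tag st s \<Longrightarrow> Q s t"
  shows "wp apply_tag st k Q"
proof -
  let ?d = "wreg st rTC"
  have \<nu>: "0 < \<nu>" using nd nd_pos by blast
  then have d0: "0 < ?d" using d by auto
  have core: "core_eq A (varr st)" using PD by (simp add: PD_def)
  note cD = core_eqD[OF core]
  have ndd: "nd h e ?d" using nd_Suc[OF nd] d by metis
  have "(1::nat) \<le> 2 ^ h" by simp
  then have "?d < W" "8 \<le> W" using nd_less[OF ndd] W by linarith+
  moreover have "flags_ok (warr st)" using PD by (simp add: PD_def)
  ultimately show ?thesis
  proof (rule_tac wp_conseq[OF wp_apply_tag[OF refl]], goal_cases)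
    case (4 s t)
    note s = 4(4) and f = 4(5)
    have oth: "a \<noteq> tagL \<Longrightarrow> a \<noteq> tagR \<Longrightarrow> varr s a = varr st a" "b \<noteq> hasT \<Longrightarrow> warr s b = warr st b" for a b
      using frame_varr[OF f] frame_warr[OF f] by simp_all
    have sm: "\<mu> \<noteq> ?d \<Longrightarrow> same_at (varr st) (warr st) (varr s) (warr s) \<mu>" for \<mu> using s by blast
    have nd: "?d \<noteq> \<nu>" using d \<nu> by auto
    have Hd: "H (varr s) (warr s) e x = min (H (varr st) (warr st) e x) (tag_min A e ?d (vreg st fTL) (vreg st fTR) x)"
      if "x \<in> lv e ?d" for x
      using H_tag[OF that d0 sm oth] s by (simp add: cD)
    have sm2: "\<not> sub ?d \<mu> \<Longrightarrow> same_at (varr st) (warr st) (varr s) (warr s) \<mu>" for \<mu> using sm sub_refl by metis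
    have out: "H (varr s) (warr s) e x = H (varr st) (warr st) e x" if "x \<in> lv (Suc e) \<nu>" "x \<notin> lv e ?d" for x
      by (rule H_child_outside[OF \<nu> sm2 d that])
    have disj: "x \<in> lv e (2 * \<nu>) \<Longrightarrow> x \<notin> lv e (2 * \<nu> + 1)"
      "x \<in> lv e (2 * \<nu> + 1) \<Longrightarrow> x \<notin> lv e (2 * \<nu>)" for x by (auto simp: lv_def)
    have "PD A B h e \<nu>
      (if ?d = 2 * \<nu> then (\<lambda>x. min (ga x) (tag_min A e (2 * \<nu>) (vreg st fTL) (vreg st fTR) x)) else ga)
      (if ?d = 2 * \<nu> then gb else (\<lambda>x. min (gb x) (tag_min A e (2 * \<nu> + 1) (vreg st fTL) (vreg st fTR) x))) fl ft s"
      unfolding PD_def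
    proof (intro conjI allI impI)
      show "wreg s rNN = 2 ^ h" "wreg s rV = \<nu>" using PD frame_wreg[OF f] by (simp_all add: PD_def)
      show "flags_ok (warr s)" using s by blast
      show "core_eq A (varr s)" using core oth by (simp add: core_eq_def)
      show "same_at A B (varr s) (warr s) \<mu>" if "\<not> sub \<nu> \<mu>" for \<mu>
      proof -
        have "\<not> sub ?d \<mu>" using that d sub_child by metis
        then show ?thesis using sm2 PD that same_at_trans unfolding PD_def by blast
      qed
      show "varr s a \<nu> = A a \<nu>" for a using sm[OF nd[symmetric]] PD by (simp add: PD_def same_at_def)
      show "warr s hasL \<nu> = fl" "warr s hasT \<nu> = ft" using sm[OF nd[symmetric]] PD by (simp_all add: PD_def same_at_def)
      show "\<forall>x\<in>lv e (2 * \<nu>). H (varr s) (warr s) e x =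
          (if ?d = 2 * \<nu> then (\<lambda>x. min (ga x) (tag_min A e (2 * \<nu>) (vreg st fTL) (vreg st fTR) x)) else ga) x"
        using Hd PD out d disj by (auto simp: PD_def lv_Suc)
      show "\<forall>x\<in>lv e (2 * \<nu> + 1). H (varr s) (warr s) e x =
          (if ?d = 2 * \<nu> then gb else (\<lambda>x. min (gb x) (tag_min A e (2 * \<nu> + 1) (vreg st fTL) (vreg st fTR) x))) x"
        using Hd PD out d disj by (auto simp: PD_def lv_Suc)
    qed
    then show "Q s t" using Q s f by blast
  qed auto
qed

lemma wp_PD_query:
  assumes PD: "PD A B h e \<nu> ga gb fl ft st" and nd: "nd h (Suc e) \<nu>" and "8 * 2 ^ h \<le> W" and ho: "hull_ok A (Suc e) \<nu>"
    and d: "wreg st rC = 2 * \<nu> \<or> wreg st rC = 2 * \<nu> + 1"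
    and Q: "\<And>s t. t \<le> k + 30 * e + 50 \<Longrightarrow> PD A B h e \<nu> ga gb fl ft s \<Longrightarrow>
      vreg s fQ = Qm A e (wreg st rC) (vreg st fS) \<Longrightarrow> frame query st s \<Longrightarrow> Q s t"
  shows "wp query st k Q"
proof -
  have core: "core_eq A (varr st)" using PD by (simp add: PD_def)
  note cD = core_eqD[OF core]
  have ndd: "nd h e (wreg st rC)" using nd_Suc[OF nd] d by metis
  have "hull_ok (varr st) e (wreg st rC)" using ho d by (auto simp: cD)
  moreover have "wreg st rNN = 2 ^ h" using PD by (simp add: PD_def)
  ultimately show ?thesis
  proof (rule_tac wp_conseq[OF wp_query[OF ndd]], goal_cases)
    case (4 s t)
    have "varr s = varr st" "warr s = warr st" "wreg s rNN = wreg st rNN" "wreg s rV = wreg st rV"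
      using frame_varr_all[OF 4(4)] frame_warr_all[OF 4(4)] frame_wreg[OF 4(4)] by simp_all
    then have "PD A B h e \<nu> ga gb fl ft s" using PD by (simp add: PD_def)
    then show ?case using Q 4 by (simp add: cD)
  qed (use assms in auto)
qed

text \<open>The order in which lines and cones are handed down does not matter for \<open>H\<close>,
  since all of them enter as minima, and the queries see only \<open>R\<close>, which no insertion
  alters.\<close>

lemma wp_push_down:
  assumes nd: "nd h (Suc e) \<nu>" and st: "wreg st rV = \<nu>" "wreg st rNN = 2 ^ h" "8 * 2 ^ h \<le> W"
    and fl: "flags_ok (warr st)" and ko: "key_ok (varr st) (Suc e) \<nu>" and ho: "hull_ok (varr st) (Suc e) \<nu>"
  shows "wp push_down st k (\<lambda>s t. t \<le> k + 400 * e + 1000 \<and> flags_ok (warr s) \<and>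
    (\<forall>x \<in> lv (Suc e) \<nu>. H (varr s) (warr s) (Suc e) x = H (varr st) (warr st) (Suc e) x) \<and>
    (\<forall>\<mu>. \<not> sub \<nu> \<mu> \<longrightarrow> same_at (varr st) (warr st) (varr s) (warr s) \<mu>) \<and>
    warr s hasL \<nu> = 0 \<and> warr s hasT \<nu> = 0)"
proof -
  define A B where "A = varr st" and "B = warr st"
  let ?fl = "B hasL \<nu>" and ?ft = "B hasT \<nu>"
  have \<nu>: "\<nu> < 2 ^ h" "0 < \<nu>" using nd_Suc[OF nd] nd_pos[OF nd] by auto
  have p: "(1::nat) \<le> 2 ^ h" by simp
  have W: "0 < W" "Suc 0 < W" "2 < W" "\<nu> < W" "2 * \<nu> < W" "Suc (2 * \<nu>) < W" using st(3) p \<nu> by linarith+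
  have f01: "?fl = 0 \<or> ?fl = Suc 0" "?ft = 0 \<or> ?ft = Suc 0"
    using fl unfolding B_def flags_ok_def by (metis One_nat_def le_0_eq le_Suc_eq)+
  have PD0: "PD A B h e \<nu> (H A B e) (H A B e) ?fl ?ft st"
    using st fl by (simp add: PD_def A_def B_def core_eq_def)
  note ko' = ko[folded A_def] and ho' = ho[folded A_def]
  let ?l = "\<lambda>x. if ?fl = 0 then H A B e x else min (H A B e x) (A linC \<nu> + A linS \<nu> * A keyM x)"
  have PD_flag: "PD A B h e \<nu> ga gb 0 ft (s\<lparr>warr := (warr s)(hasL := (warr s hasL)(\<nu> := 0))\<rparr>)"
    if "PD A B h e \<nu> ga gb fl ft s" for ga gb fl ft s
  proof -
    have same: "H (varr s) ((warr s)(hasL := (warr s hasL)(\<nu> := 0))) e x = H (varr s) (warr s) e x"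
      if "x \<in> lv (Suc e) \<nu>" for x
      by (rule H_only_root_changed[OF \<nu>(2) _ that]) (simp add: same_at_def)
    show ?thesis using that same by (auto simp: PD_def flags_ok_def same_at_def lv_Suc)
  qed
  have PD_flagT: "PD A B h e \<nu> ga gb fl 0 (s\<lparr>warr := (warr s)(hasT := (warr s hasT)(\<nu> := 0))\<rparr>)"
    if "PD A B h e \<nu> ga gb fl ft s" for ga gb fl ft s
  proof -
    have same: "H (varr s) ((warr s)(hasT := (warr s hasT)(\<nu> := 0))) e x = H (varr s) (warr s) e x"
      if "x \<in> lv (Suc e) \<nu>" for x
      by (rule H_only_root_changed[OF \<nu>(2) _ that]) (simp add: same_at_def)
    show ?thesis using that same by (auto simp: PD_def flags_ok_def same_at_def lv_Suc)
  qed
  note ins = wp_PD_insert[where A = A and B = B and \<nu> = \<nu>, OF _ nd st(3) ko']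
    and qry = wp_PD_query[where A = A and B = B and \<nu> = \<nu>, OF _ nd st(3) ho']
    and tag = wp_PD_tag[where A = A and B = B and \<nu> = \<nu>, OF _ nd st(3)]
  have L0: "wp (SetW rC2 (child0 rV) ;; SetV fU (varr_at linC rV) ;; SetV fV (varr_at linS rV) ;; insert_loop ;; P) s k Q"
    if PD: "PD A B h e \<nu> ga gb fl ft s" and cont: "\<And>s' t. t \<le> k + 70 * e + 100 \<Longrightarrow>
      PD A B h e \<nu> (\<lambda>x. min (ga x) (A linC \<nu> + A linS \<nu> * A keyM x)) gb fl ft s' \<Longrightarrow> wp P s' t Q"
    for ga gb fl ft s k P Q
    using PD_D[OF PD] W apply simp
    apply (rule ins[where ga = ga and gb = gb and fl = fl and ft = ft])
    using PD cont by (auto simp: tick_def)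
  have L1: "wp (SetW rC2 (child1 rV) ;; SetV fU (varr_at linC rV) ;; SetV fV (varr_at linS rV) ;; insert_loop ;; P) s k Q"
    if PD: "PD A B h e \<nu> ga gb fl ft s" and cont: "\<And>s' t. t \<le> k + 70 * e + 100 \<Longrightarrow>
      PD A B h e \<nu> ga (\<lambda>x. min (gb x) (A linC \<nu> + A linS \<nu> * A keyM x)) fl ft s' \<Longrightarrow> wp P s' t Q"
    for ga gb fl ft s k P Q
    using PD_D[OF PD] W apply simp
    apply (rule ins[where ga = ga and gb = gb and fl = fl and ft = ft])
    using PD cont by (auto simp: tick_def)
  have T0: "wp (SetW rC (child1 rV) ;; SetV fS (varr_at tagL rV) ;; query ;;
      SetW rC2 (child0 rV) ;; SetV fU (VReg fQ) ;; SetV fV (VSub vzero (varr_at tagL rV)) ;; insert_loop ;; P) s k Q"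
    if PD: "PD A B h e \<nu> ga gb fl ft s" and cont: "\<And>s' t. t \<le> k + 100 * e + 200 \<Longrightarrow>
      PD A B h e \<nu> (\<lambda>x. min (ga x) (Qm A e (2 * \<nu> + 1) (A tagL \<nu>) + (0 - A tagL \<nu>) * A keyM x)) gb fl ft s' \<Longrightarrow> wp P s' t Q"
    for ga gb fl ft s k P Q
    using PD_D[OF PD] W apply simp
    apply (rule qry[where ga = ga and gb = gb and fl = fl and ft = ft])
    using PD apply simp
     apply simp
    subgoal for s' t
      using PD_D[of A B h e \<nu> ga gb fl ft s'] apply simp
      apply (rule ins[where ga = ga and gb = gb and fl = fl and ft = ft])
      using cont by (auto simp: tick_def)
    done
  have T1: "wp (SetW rC (child0 rV) ;; SetV fS (VSub vzero (varr_at tagR rV)) ;; query ;;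
      SetW rC2 (child1 rV) ;; SetV fU (VReg fQ) ;; SetV fV (varr_at tagR rV) ;; insert_loop ;; P) s k Q"
    if PD: "PD A B h e \<nu> ga gb fl ft s" and cont: "\<And>s' t. t \<le> k + 100 * e + 200 \<Longrightarrow>
      PD A B h e \<nu> ga (\<lambda>x. min (gb x) (Qm A e (2 * \<nu>) (0 - A tagR \<nu>) + A tagR \<nu> * A keyM x)) fl ft s' \<Longrightarrow> wp P s' t Q"
    for ga gb fl ft s k P Q
    using PD_D[OF PD] W apply simp
    apply (rule qry[where ga = ga and gb = gb and fl = fl and ft = ft])
    using PD apply simp
     apply simp
    subgoal for s' t
      using PD_D[of A B h e \<nu> ga gb fl ft s'] apply simp
      apply (rule ins[where ga = ga and gb = gb and fl = fl and ft = ft])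
      using cont by (auto simp: tick_def)
    done
  have TT: "wp (SetV fTL (varr_at tagL rV) ;; SetV fTR (varr_at tagR rV) ;;
        SetW rTC (child0 rV) ;; apply_tag ;; SetW rTC (child1 rV) ;; apply_tag ;; P) s k Q"
    if PD: "PD A B h e \<nu> ga gb fl ft s" and cont: "\<And>s' t. t \<le> k + 200 \<Longrightarrow>
      PD A B h e \<nu> (\<lambda>x. min (ga x) (tag_min A e (2 * \<nu>) (A tagL \<nu>) (A tagR \<nu>) x))
        (\<lambda>x. min (gb x) (tag_min A e (2 * \<nu> + 1) (A tagL \<nu>) (A tagR \<nu>) x)) fl ft s' \<Longrightarrow> wp P s' t Q"
    for ga gb fl ft s k P Q
    using PD_D[OF PD] W apply simp
    apply (rule tag[where ga = ga and gb = gb and fl = fl and ft = ft])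
    using PD apply simp
     apply simp
    subgoal for s' t
      using PD_D[of A B h e \<nu> "\<lambda>x. min (ga x) (tag_min A e (2 * \<nu>) (A tagL \<nu>) (A tagR \<nu>) x)" gb fl ft s']
        frame_vreg[of apply_tag _ s' fTL] frame_vreg[of apply_tag _ s' fTR] apply simp
      apply (rule tag[where ga = "\<lambda>x. min (ga x) (tag_min A e (2 * \<nu>) (A tagL \<nu>) (A tagR \<nu>) x)"
            and gb = gb and fl = fl and ft = ft])
      using cont by (auto simp: tick_def)
    done
  let ?l = "\<lambda>x. with_line A B \<nu> x (H A B e x)"
  let ?t = "\<lambda>x. with_tag A B e \<nu> x (?l x)"
  let ?P2 = "Branch (WEq (WArr hasT (WReg rV)) (WConst 1))
       (SetW rC (child1 rV) ;; SetV fS (varr_at tagL rV) ;; query ;;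
        SetW rC2 (child0 rV) ;; SetV fU (VReg fQ) ;; SetV fV (VSub vzero (varr_at tagL rV)) ;; insert_loop ;;
        SetW rC (child0 rV) ;; SetV fS (VSub vzero (varr_at tagR rV)) ;; query ;;
        SetW rC2 (child1 rV) ;; SetV fU (VReg fQ) ;; SetV fV (varr_at tagR rV) ;; insert_loop ;;
        SetV fTL (varr_at tagL rV) ;; SetV fTR (varr_at tagR rV) ;;
        SetW rTC (child0 rV) ;; apply_tag ;;
        SetW rTC (child1 rV) ;; apply_tag ;;
        PutW hasT (WReg rV) (WConst 0))
       Skip"
  have 2: "wp ?P2 s k (\<lambda>s t. t \<le> k + 200 * e + 650 \<and> PD A B h e \<nu> ?t ?t 0 0 s)"
    if PD: "PD A B h e \<nu> ?l ?l 0 ?ft s" for s k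
  proof (cases "?ft = 0")
    case True
    then show ?thesis using PD_D[OF PD] W PD by (simp add: tick_def with_tag_def)
  next
    case False
    with f01 have ft: "?ft = Suc 0" by simp
    let ?g0 = "\<lambda>x. min (min (?l x) (Qm A e (2 * \<nu> + 1) (A tagL \<nu>) + (0 - A tagL \<nu>) * A keyM x))
      (tag_min A e (2 * \<nu>) (A tagL \<nu>) (A tagR \<nu>) x)"
    let ?g1 = "\<lambda>x. min (min (?l x) (Qm A e (2 * \<nu>) (0 - A tagR \<nu>) + A tagR \<nu> * A keyM x))
      (tag_min A e (2 * \<nu> + 1) (A tagL \<nu>) (A tagR \<nu>) x)"
    \<comment> \<open>The line made from the sibling's sources and the cone over the own sources
      together make up the old tag.\<close>
    have fin: "PD A B h e \<nu> ?t ?t 0 0 s'" if "PD A B h e \<nu> ?g0 ?g1 0 0 s'" for s'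
      using that False unfolding PD_def
      by (simp add: tag_split_left[OF ko'] tag_split_right[OF ko'] with_tag_def min.assoc)
    show ?thesis
      unfolding wp_Branch
    proof (intro conjI, goal_cases)
      case 1
      show ?case using PD_D[OF PD] W ft by simp
    next
      case 2
      have h: "holds \<delta> us s (WEq (WArr hasT (WReg rV)) (WConst 1))" using PD_D[OF PD] ft by simp
      show ?case unfolding if_P[OF h]
        apply (rule T0[OF PD])
        apply (rule T1, assumption)
        apply (rule TT, assumption)
        subgoal for s1 t1 s2 t2 s3 t3
          using PD_D[of A B h e \<nu> ?g0 ?g1 0 ?ft s3] W PD_flagT[of ?g0 ?g1 0 ?ft s3] fin
          by (simp add: tick_def)
        done
    qed
  qed
  have 1: "wp (Branch (WEq (WArr hasL (WReg rV)) (WConst 1))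
       (SetW rC2 (child0 rV) ;; SetV fU (varr_at linC rV) ;; SetV fV (varr_at linS rV) ;; insert_loop ;;
        SetW rC2 (child1 rV) ;; SetV fU (varr_at linC rV) ;; SetV fV (varr_at linS rV) ;; insert_loop ;;
        PutW hasL (WReg rV) (WConst 0)) Skip) st k (\<lambda>s t. t \<le> k + 140 * e + 300 \<and> PD A B h e \<nu> ?l ?l 0 ?ft s)"
  proof (cases "?fl = 0")
    case True
    then show ?thesis using st W PD0 PD_D[OF PD0] by (simp add: tick_def with_line_def)
  next
    case False
    then have fl: "?fl = Suc 0" using f01 by simp
    let ?g = "\<lambda>x. min (H A B e x) (A linC \<nu> + A linS \<nu> * A keyM x)"
    show ?thesis
      unfolding wp_Branch
    proof (intro conjI, goal_cases)
      case 1
      show ?case using PD_D[OF PD0] W fl by simp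
    next
      case 2
      have h: "holds \<delta> us st (WEq (WArr hasL (WReg rV)) (WConst 1))" using PD_D[OF PD0] fl by simp
      show ?case unfolding if_P[OF h]
        apply (rule L0[OF PD0])
        apply (rule L1, assumption)
        subgoal for s1 t1 s2 t2
          using PD_D[of A B h e \<nu> ?g ?g ?fl ?ft s2] W PD_flag[of ?g ?g ?fl ?ft s2] fl
          by (simp add: tick_def with_line_def)
        done
    qed
  qed
  show ?thesis
    unfolding push_down_def wp_Seq
  proof (rule wp_conseq[OF wp_conseq[OF 1, where Q' = "\<lambda>s t. wp ?P2 s t (\<lambda>s' t'. t' \<le> k + 340 * e + 950 \<and> PD A B h e \<nu> ?t ?t 0 0 s')"]], goal_cases)
    case (1 s t)
    then show ?case by (intro wp_conseq[OF 2]) auto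
  next
    case (2 s t)
    from 2(1) show ?case
    proof (rule wp_conseq, goal_cases)
      case (1 s' t')
      then have PD: "PD A B h e \<nu> ?t ?t 0 0 s'" and t: "t' \<le> k + 340 * e + 950" by auto
      have core: "varr s' addC \<nu> = A addC \<nu>" "varr s' addS \<nu> = A addS \<nu>" "varr s' keyM = A keyM"
        using PD by (simp_all add: PD_def core_eq_def)
      have "H (varr s') (warr s') (Suc e) x = H A B (Suc e) x" if x: "x \<in> lv (Suc e) \<nu>" for x
      proof -
        have "H (varr s') (warr s') e x = ?t x" using PD x by (auto simp: PD_def lv_Suc)
        then show ?thesis using PD_D[OF PD] core
          by (simp add: H_Suc[OF x] with_line_def[of "varr s'"] with_tag_def[of "varr s'"])
      qed
      then show ?case using PD t by (simp add: PD_def A_def B_def)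
    qed
  qed
qed

end

section \<open>Recomputing the threshold of a node\<close>

definition tan_loop :: com where
  "tan_loop = Loop (WLess (WReg rPC) (WReg rNN))
     (SetV fAL (VAdd (VReg fAL) (varr_at addC rPC)) ;;
      SetV fBB (VAdd (VReg fBB) (varr_at addS rPC)) ;;
      SetV fTT (VSub (varr_at thr rPC) (VReg fBB)) ;;
      SetW rC (child0 rLC) ;; SetV fS (VReg fTT) ;; query ;; SetV fXX (VReg fQ) ;;
      SetW rC (child1 rLC) ;; SetV fS (VReg fTT) ;; query ;;
      Branch (VLess (VReg fQ) (VReg fXX)) (SetW rPC (child0 rPC)) (SetW rPC (child1 rPC)))"

definition tangent :: "wexp \<Rightarrow> com" where
  "tangent w = SetW rPC w ;; SetV fAL vzero ;; SetV fBB vzero ;; tan_loop ;;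
     SetV fAL (VAdd (VReg fAL) (VAdd (VAdd (varr_at leafR rPC) (varr_at addC rPC))
       (VMul (VAdd (VReg fBB) (varr_at addS rPC)) (varr_at keyM rPC))))"

definition pull :: com where
  "pull = tangent (child0 rLC) ;; SetV fR1 (VReg fAL) ;; SetV fZ1 (varr_at keyM rPC) ;;
     tangent (child1 rLC) ;;
     PutV thr (WReg rLC) (VDiv (VSub (VReg fAL) (VReg fR1)) (VSub (VReg fZ1) (varr_at keyM rPC)))"

lemma mod_tan_loop [simp]:
  "mod_wreg tan_loop = {rPC, rC}" "mod_warr tan_loop = {}"
  "mod_vreg tan_loop = {fACC, fS, fQ, fAL, fBB, fTT, fXX}" "mod_varr tan_loop = {}"
  by (auto simp: tan_loop_def)

lemma mod_tangent [simp]: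
  "mod_wreg (tangent w) = {rPC, rC}" "mod_warr (tangent w) = {}"
  "mod_vreg (tangent w) = {fACC, fS, fQ, fAL, fBB, fTT, fXX}" "mod_varr (tangent w) = {}"
  by (auto simp: tangent_def)

lemma mod_pull [simp]:
  "mod_wreg pull = {rPC, rC}" "mod_warr pull = {}"
  "mod_vreg pull = {fACC, fS, fQ, fAL, fBB, fTT, fXX, fR1, fZ1}" "mod_varr pull = {thr}"
  by (auto simp: pull_def)

lemma key_ok_across:
  "key_ok A (Suc e) c \<Longrightarrow> x \<in> lv e (2 * c) \<Longrightarrow> y \<in> lv e (2 * c + 1) \<Longrightarrow> A keyM x < A keyM y"
  by fastforce

context machine
begin

text \<open>A parametric search. It descends in one child of \<open>\<nu>\<close> to a leaf that is
  optimal at the crossing slope \<open>s\<close> of both children, without knowing \<open>s\<close>.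
  At each node it must know whether \<open>s\<close> is at most the local threshold, translated to
  an outer slope by subtracting the collected \<open>addS\<close>; by \<open>Qm_compare\<close>, two
  queries at that slope give the answer.\<close>

lemma wp_tan_loop:
  assumes nd: "nd h (Suc E) \<nu>" and W: "8 * 2 ^ h \<le> W"
    and hull: "hull_ok A E (2 * \<nu>)" "hull_ok A E (2 * \<nu> + 1)" and ko: "key_ok A (Suc E) \<nu>"
    and eq: "Qm A E (2 * \<nu>) s = Qm A E (2 * \<nu> + 1) s"
    and "varr st = A" "wreg st rLC = \<nu>" "wreg st rNN = 2 ^ h" "nd h e (wreg st rPC)" "hull_ok A e (wreg st rPC)"
    and "e \<le> E"
  shows "wp tan_loop st k (\<lambda>s' t. t \<le> k + e * (60 * E + 200) + 10 \<and> nd h 0 (wreg s' rPC) \<and>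
     wreg s' rPC \<in> lv e (wreg st rPC) \<and>
     vreg s' fAL + Qm A 0 (wreg s' rPC) (s + vreg s' fBB) = vreg st fAL + Qm A e (wreg st rPC) (s + vreg st fBB))"
  using assms(7-)
proof (induction e arbitrary: st k)
  case 0
  then show ?case
    using W by (auto simp: tan_loop_def nd_0 wp_Loop tick_def)
next
  case (Suc e)
  let ?c = "wreg st rPC"
  let ?b = "vreg st fBB + A addS ?c"
  let ?t = "A thr ?c - ?b"
  have c: "nd h e (2 * ?c)" "nd h e (2 * ?c + 1)" "?c < 2 ^ h" using nd_Suc Suc.prems(4) by blast+
  have n: "nd h E (2 * \<nu>)" "nd h E (2 * \<nu> + 1)" "\<nu> < 2 ^ h" using nd_Suc nd by blast+
  have p: "(1::nat) \<le> 2 ^ h" by simp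
  have Ws: "0 < W" "Suc 0 < W" "2 < W" "\<nu> < W" "2 * \<nu> < W" "Suc (2 * \<nu>) < W" "?c < W" "2 * ?c < W" "Suc (2 * ?c) < W" "2 ^ h < W"
    using W p n(3) c(3) by linarith+
  have hc: "hull_ok A e (2 * ?c)" "hull_ok A e (2 * ?c + 1)" using Suc.prems(5) by simp_all
  have cmp: "Qm A E (2 * \<nu>) ?t \<le> Qm A E (2 * \<nu> + 1) ?t \<longleftrightarrow> s \<le> ?t"
    by (rule Qm_compare(1)[OF key_ok_across[OF ko] eq])
  have right: "Qm A (Suc e) ?c (s + vreg st fBB) = A addC ?c + Qm A e (2 * ?c + 1) (s + ?b)" if "s \<le> ?t"
    using Suc.prems(5) that by (simp add: Qm_Suc min_def add.assoc algebra_simps antisym)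
  have left: "Qm A (Suc e) ?c (s + vreg st fBB) = A addC ?c + Qm A e (2 * ?c) (s + ?b)" if "\<not> s \<le> ?t"
    using Suc.prems(5) that by (simp add: Qm_Suc min_def add.assoc algebra_simps)
  let ?Q = "\<lambda>s' t. t \<le> k + Suc e * (60 * E + 200) + 10 \<and> nd h 0 (wreg s' rPC) \<and>
     wreg s' rPC \<in> lv (Suc e) ?c \<and>
     vreg s' fAL + Qm A 0 (wreg s' rPC) (s + vreg s' fBB) = vreg st fAL + Qm A (Suc e) ?c (s + vreg st fBB)"
  have rec: "wp tan_loop s1 t1 ?Q"
    if s1: "varr s1 = A" "wreg s1 rLC = \<nu>" "wreg s1 rNN = 2 ^ h" "vreg s1 fAL = vreg st fAL + A addC ?c"
      "vreg s1 fBB = ?b" "wreg s1 rPC = (if s \<le> ?t then 2 * ?c + 1 else 2 * ?c)" "t1 \<le> k + (60 * E + 200)" for s1 t1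
  proof -
    have "nd h e (wreg s1 rPC)" "hull_ok A e (wreg s1 rPC)" using s1(6) c hc by (simp_all split: if_splits)
    then show ?thesis
    proof (rule wp_conseq[OF Suc.IH[OF s1(1,2,3)]], goal_cases)
      case (2 s' t)
      have "wreg s1 rPC = 2 * ?c + 1 \<or> wreg s1 rPC = 2 * ?c" using s1(6) by simp
      then have "wreg s' rPC \<in> lv (Suc e) ?c" using 2(1) by (auto simp: lv_Suc)
      moreover have "vreg st fAL + Qm A (Suc e) ?c (s + vreg st fBB)
          = vreg s1 fAL + Qm A e (wreg s1 rPC) (s + vreg s1 fBB)"
        using left right s1(4-6) by simp
      ultimately show ?case using 2 s1(7) by simp
    qed (use Suc.prems in simp)
  qed
  have q: "wp query s1 k1 Q"
    if "varr s1 = A" "wreg s1 rNN = 2 ^ h" "wreg s1 rC = 2 * \<nu> \<or> wreg s1 rC = 2 * \<nu> + 1"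
      "\<And>s' t. t \<le> k1 + 30 * E + 50 \<Longrightarrow> vreg s' fQ = Qm A E (wreg s1 rC) (vreg s1 fS) \<Longrightarrow> frame query s1 s' \<Longrightarrow> Q s' t"
    for s1 k1 Q
    by (rule wp_conseq[OF wp_query[of h E]]) (use that n hull W in auto)
  show ?case
    apply (subst tan_loop_def, subst wp_Loop, fold tan_loop_def)
    using Ws c(3) Suc.prems(1,2,3) apply simp
    apply (rule q)
       apply simp
      apply simp
     apply simp
    subgoal for s1 t1
      using frame_wreg[of query _ s1] frame_vreg[of query _ s1] frame_varr_all[of query _ s1] apply simp
      apply (rule q)
         apply simp
        apply simp
       apply simp
      subgoal for s2 t2
        using frame_wreg[of query _ s2] frame_vreg[of query _ s2] frame_varr_all[of query _ s2] cmp apply simp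
        apply (intro conjI impI; rule wp_conseq[OF rec])
        by (auto simp: tick_def)
      done
    done
qed

lemma wp_tangent:
  assumes nd: "nd h (Suc E) \<nu>" and W: "8 * 2 ^ h \<le> W"
    and hull: "hull_ok A E (2 * \<nu>)" "hull_ok A E (2 * \<nu> + 1)" and ko: "key_ok A (Suc E) \<nu>"
    and eq: "Qm A E (2 * \<nu>) s = Qm A E (2 * \<nu> + 1) s"
    and st: "varr st = A" "wreg st rLC = \<nu>" "wreg st rNN = 2 ^ h"
    and w: "wdef W st w" "wval st w = d" "wtime w \<le> 6" "d = 2 * \<nu> \<or> d = 2 * \<nu> + 1"
  shows "wp (tangent w) st k (\<lambda>s' t. t \<le> k + E * (60 * E + 200) + 60 \<and>
     wreg s' rPC \<in> lv E d \<and> nd h 0 (wreg s' rPC) \<and> vreg s' fAL + s * A keyM (wreg s' rPC) = Qm A E d s)"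
proof -
  have p: "(1::nat) \<le> 2 ^ h" by simp
  then have W0: "0 < W" using W by linarith
  have ndd: "nd h E d" using nd_Suc[OF nd] w(4) by blast
  have hd: "hull_ok A E d" using hull w(4) by blast
  have lt: "c < W" if "nd h 0 c" for c using nd_less[OF that] W p by linarith
  show ?thesis
    apply (simp add: tangent_def w W0)
    apply (rule wp_conseq[OF wp_tan_loop[OF nd W hull ko eq, where e = E]])
          apply (use st ndd hd in simp_all)
    subgoal for s1 t1
      using w(3) lt[of "wreg s1 rPC"] frame_varr_all[of tan_loop _ s1]
      by (simp add: tick_def Qm_0 algebra_simps)
    done
qed

text \<open>The two leaves found are optimal at \<open>s\<close>, one in each child, and the
  children tie at \<open>s\<close>. So both leaves lie on the common tangent of the two hulls and
  \<open>s\<close> is a quotient of differences; the denominator is nonzero because the keys of the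
  two children are separated.\<close>

lemma wp_pull:
  assumes nd: "nd h (Suc E) \<nu>" and W: "8 * 2 ^ h \<le> W"
    and hull: "hull_ok (varr st) E (2 * \<nu>)" "hull_ok (varr st) E (2 * \<nu> + 1)" and ko: "key_ok (varr st) (Suc E) \<nu>"
    and st: "wreg st rLC = \<nu>" "wreg st rNN = 2 ^ h"
  shows "wp pull st k (\<lambda>s t. t \<le> k + 2 * E * (60 * E + 200) + 200 \<and> hull_ok (varr s) (Suc E) \<nu> \<and>
     (\<forall>a. a \<noteq> thr \<longrightarrow> varr s a = varr st a) \<and> (\<forall>\<mu>. \<mu> \<noteq> \<nu> \<longrightarrow> varr s thr \<mu> = varr st thr \<mu>))"
proof -
  define A where "A = varr st"
  have p: "(1::nat) \<le> 2 ^ h" by simp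
  have \<nu>: "\<nu> < 2 ^ h" "0 < \<nu>" using nd_Suc[OF nd] nd_pos[OF nd] by auto
  have Ws: "2 < W" "\<nu> < W" "2 * \<nu> < W" "Suc (2 * \<nu>) < W" "Suc 0 < W" using W p \<nu> by linarith+
  note across = key_ok_across[OF ko[folded A_def]]
  obtain s where eq: "Qm A E (2 * \<nu>) s = Qm A E (2 * \<nu> + 1) s"
    unfolding Qm_def using envelope_crossing[of "lv E (2 * \<nu>)" "lv E (2 * \<nu> + 1)" "A keyM" "R A E"] across by auto
  note tan = wp_tangent[OF nd W hull[folded A_def] ko[folded A_def] eq]
  have hull': "hull_ok A' (Suc E) \<nu>"
    if A': "\<And>a. a \<noteq> thr \<Longrightarrow> A' a = A a" "\<And>\<mu>. \<mu> \<noteq> \<nu> \<Longrightarrow> A' thr \<mu> = A thr \<mu>" "A' thr \<nu> = s" for A'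
  proof -
    have sm: "same_at A B A' B \<mu>" if "\<mu> \<noteq> \<nu>" for \<mu> and B :: warrays
      unfolding same_at_def using A' that by (metis)
    have "hull_ok A' E d = hull_ok A E d" if d: "d = 2 * \<nu> \<or> d = 2 * \<nu> + 1" for d
    proof (rule hull_cong)
      fix \<mu> assume "sub d \<mu>"
      then have "\<mu> \<noteq> \<nu>" using d not_sub_child[OF \<nu>(2)] by metis
      then show "same_at A (\<lambda>_ _. 0) A' (\<lambda>_ _. 0) \<mu>" by (rule sm)
    qed
    moreover have "Qm A' E = Qm A E" using A' by (intro ext Qm_eqI) auto
    moreover have "Qm A E (2 * \<nu>) t \<le> Qm A E (2 * \<nu> + 1) t \<longleftrightarrow> s \<le> t" for t
      by (rule Qm_compare(1)[OF across eq])
    moreover have "t \<le> s \<Longrightarrow> Qm A E (2 * \<nu> + 1) t \<le> Qm A E (2 * \<nu>) t" for t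
      by (rule Qm_compare(2)[OF across eq])
    ultimately show ?thesis
      using hull A'(3) unfolding A_def[symmetric] by simp
  qed
  show ?thesis
    supply hull_ok.simps(2) [simp del]
    apply (simp add: pull_def)
    apply (rule wp_conseq[OF tan[where d = "2 * \<nu>"]])
           apply (use st Ws in \<open>simp_all add: A_def\<close>)
    subgoal for s1 t1
      using frame_wreg[of "tangent (child0 rLC)" _ s1] frame_varr_all[of "tangent (child0 rLC)" _ s1]
        frame_warr_all[of "tangent (child0 rLC)" _ s1] nd_less[of h 0 "wreg s1 rPC"] W p Ws apply simp
      apply (rule wp_conseq[OF tan[where d = "2 * \<nu> + 1"]])
             apply (use st Ws in \<open>simp_all add: A_def\<close>)
      subgoal for s2 t2
        using frame_wreg[of "tangent (child1 rLC)" _ s2] frame_varr_all[of "tangent (child1 rLC)" _ s2]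
          frame_vreg[of "tangent (child1 rLC)" _ s2]
          frame_warr_all[of "tangent (child1 rLC)" _ s2] nd_less[of h 0 "wreg s2 rPC"]
          across[of "wreg s1 rPC" "wreg s2 rPC"] eq apply (simp add: A_def del: hull_ok.simps)
        apply (intro conjI hull')
            apply (simp add: tick_def)
           apply (simp add: A_def)
          apply (simp add: A_def)
         apply (simp add: A_def field_simps)
        done
      done
    done
qed

end

section \<open>Touching a leaf\<close>

definition touch_down :: com where
  "touch_down = Loop (WLess (WConst 1) (WReg rPW))
     (SetW rV (WDiv (WReg rX0) (WReg rPW)) ;; push_down ;; SetW rPW (WDiv (WReg rPW) (WConst 2)))"

definition activate :: com where
  "activate = Branch (WEq (WArr hasL (WReg rX0)) (WConst 1))
     (Branch (VLess (VAdd (varr_at linC rX0) (VMul (varr_at linS rX0) (varr_at keyM rX0))) (varr_at leafR rX0))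
       (PutV leafR (WReg rX0) (VAdd (varr_at linC rX0) (VMul (varr_at linS rX0) (varr_at keyM rX0)))) Skip)
     Skip"

text \<open>Adds \<open>fBE * max 0 (z - z0)\<close>, where \<open>z0\<close> is the key of the
  touched leaf: subtrees that hang off the path on the right lie entirely beyond \<open>z0\<close>
  and receive the linear function as a whole, those on the left receive nothing, and at the leaf
  itself the term is 0.\<close>

definition touch_up :: com where
  "touch_up = Loop (WLess (WConst 1) (WReg rLC))
     (Branch (WEq (WMul (WConst 2) (WDiv (WReg rLC) (WConst 2))) (WReg rLC))
        (PutV addC (WAdd (WReg rLC) (WConst 1))
           (VSub (VArr addC (WAdd (WReg rLC) (WConst 1))) (VMul (VReg fBE) (varr_at keyM rX0))) ;;
         PutV addS (WAdd (WReg rLC) (WConst 1))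
           (VAdd (VArr addS (WAdd (WReg rLC) (WConst 1))) (VReg fBE)))
        Skip ;;
      SetW rLC (WDiv (WReg rLC) (WConst 2)) ;; pull)"

definition touch :: com where
  "touch = SetW rPW (WReg rNN) ;; touch_down ;; activate ;; SetW rLC (WReg rX0) ;; touch_up"

lemma mod_touch_down [simp]:
  "mod_wreg touch_down = {rV, rC, rC2, rTC, rPW}" "mod_warr touch_down = {hasL, hasT}"
  "mod_vreg touch_down = {fACC, fS, fQ, fU, fV, fT1, fT2, fTL, fTR, fA1, fA2}"
  "mod_varr touch_down = {linC, linS, tagL, tagR}"
  by (auto simp: touch_down_def)

lemma mod_touch_up [simp]:
  "mod_wreg touch_up = {rLC, rC, rPC}" "mod_warr touch_up = {}"
  "mod_vreg touch_up = {fACC, fS, fQ, fAL, fBB, fTT, fXX, fR1, fZ1}"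
  "mod_varr touch_up = {addC, addS, thr}"
  by (auto simp: touch_up_def)

lemma mod_activate [simp]:
  "mod_wreg activate = {}" "mod_warr activate = {}" "mod_vreg activate = {}" "mod_varr activate = {leafR}"
  by (auto simp: activate_def)

lemma mod_touch [simp]:
  "mod_wreg touch = {rV, rC, rC2, rTC, rPW, rLC, rPC}" "mod_warr touch = {hasL, hasT}"
  "mod_vreg touch = {fACC, fS, fQ, fU, fV, fT1, fT2, fTL, fTR, fA1, fA2, fAL, fBB, fTT, fXX, fR1, fZ1}"
  "mod_varr touch = {linC, linS, tagL, tagR, leafR, addC, addS, thr}"
  by (auto simp: touch_def)

context machine
begin

lemma wp_touch_down:
  assumes W: "8 * 2 ^ h \<le> W"
    and "nd h e (x0 div 2 ^ e)" "wreg st rX0 = x0" "wreg st rPW = 2 ^ e" "wreg st rNN = 2 ^ h" "x0 < 2 * 2 ^ h"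
    and "flags_ok (warr st)" "key_ok (varr st) e (x0 div 2 ^ e)" "hull_ok (varr st) e (x0 div 2 ^ e)"
  shows "wp touch_down st k (\<lambda>s t. t \<le> k + e * (400 * e + 1100) + 10 \<and> flags_ok (warr s) \<and>
    (\<forall>x \<in> lv e (x0 div 2 ^ e). H (varr s) (warr s) e x = H (varr st) (warr st) e x) \<and>
    (\<forall>\<mu>. \<not> sub (x0 div 2 ^ e) \<mu> \<longrightarrow> same_at (varr st) (warr st) (varr s) (warr s) \<mu>) \<and>
    (\<forall>i. 1 \<le> i \<longrightarrow> i \<le> e \<longrightarrow> warr s hasL (x0 div 2 ^ i) = 0 \<and> warr s hasT (x0 div 2 ^ i) = 0))"
  using assms(2-)
proof (induction e arbitrary: st k)
  case 0
  have "(1::nat) \<le> 2 ^ h" by simp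
  then have "Suc 0 < W" using W by linarith
  with 0 show ?case by (simp add: touch_down_def wp_Loop tick_def)
next
  case (Suc e)
  let ?c = "x0 div 2 ^ Suc e" and ?d = "x0 div 2 ^ e"
  have p: "(1::nat) \<le> 2 ^ h" by simp
  have e: "Suc e \<le> h" using Suc.prems(1) by (auto simp: nd_def)
  have pe: "(2::nat) ^ Suc e \<le> 2 ^ h" using e by (intro power_increasing) auto
  have Ws: "Suc 0 < W" "2 < W" "x0 < W" "2 ^ h < W" "2 ^ Suc e < W" "2 * 2 ^ e < W" "?c < W"
  proof -
    have pe2: "(2::nat) * 2 ^ e \<le> 2 ^ h" using pe by simp
    have "?c \<le> x0" by (rule div_le_dividend)
    then show "Suc 0 < W" "2 < W" "x0 < W" "2 ^ h < W" "2 ^ Suc e < W" "2 * 2 ^ e < W" "?c < W"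
      using W p pe pe2 Suc.prems(5) by linarith+
  qed
  have c: "0 < ?c" using nd_pos Suc.prems(1) by blast
  have d: "?d = 2 * ?c \<or> ?d = 2 * ?c + 1" 
  proof -
    have "y = 2 * (y div 2) \<or> y = 2 * (y div 2) + 1" for y :: nat by presburger
    then show ?thesis by (simp only: div_pow_Suc)
  qed
  have nd: "nd h e ?d" using nd_Suc[OF Suc.prems(1)] d by metis
  have two: "(2::nat) * 2 ^ e div 2 = 2 ^ e" by simp
  have cc: "x0 div (2 * 2 ^ e) = ?c" by simp
  let ?Q = "\<lambda>s t. t \<le> k + Suc e * (400 * Suc e + 1100) + 10 \<and> flags_ok (warr s) \<and>
    (\<forall>x \<in> lv (Suc e) ?c. H (varr s) (warr s) (Suc e) x = H (varr st) (warr st) (Suc e) x) \<and>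
    (\<forall>\<mu>. \<not> sub ?c \<mu> \<longrightarrow> same_at (varr st) (warr st) (varr s) (warr s) \<mu>) \<and>
    (\<forall>i. 1 \<le> i \<longrightarrow> i \<le> Suc e \<longrightarrow> warr s hasL (x0 div 2 ^ i) = 0 \<and> warr s hasT (x0 div 2 ^ i) = 0)"
  have rec: "wp touch_down s1 t1 ?Q"
    if s1: "wreg s1 rX0 = x0" "wreg s1 rPW = 2 ^ e" "wreg s1 rNN = 2 ^ h" "flags_ok (warr s1)"
      "core_eq (varr st) (varr s1)" "t1 \<le> k + 400 * e + 1050"
      "\<forall>x \<in> lv (Suc e) ?c. H (varr s1) (warr s1) (Suc e) x = H (varr st) (warr st) (Suc e) x"
      "\<forall>\<mu>. \<not> sub ?c \<mu> \<longrightarrow> same_at (varr st) (warr st) (varr s1) (warr s1) \<mu>"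
      "warr s1 hasL ?c = 0" "warr s1 hasT ?c = 0" for s1 t1
  proof (rule wp_conseq[OF Suc.IH[OF nd s1(1-3) Suc.prems(5) s1(4)]], goal_cases)
    case 1
    show ?case unfolding core_eqD(5)[OF s1(5)] using Suc.prems(7) d by auto
  next
    case 2
    show ?case unfolding core_eqD(4)[OF s1(5)] using Suc.prems(8) d by auto
  next
    case (3 s t)
    note f = 3(2)
    have core: "R (varr s) = R (varr s1)" "varr s keyM = varr s1 keyM"
      using core_eqD[of "varr s1" "varr s"] frame_varr[OF f] by (auto simp: core_eq_def)
    have sm: "same_at (varr s1) (warr s1) (varr s) (warr s) \<mu>" if "\<not> sub ?d \<mu>" for \<mu> using 3(1) that by blast
    have nd: "\<not> sub ?d ?c" using d not_sub_child[OF c] by metis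
    have "H (varr s) (warr s) (Suc e) x = H (varr st) (warr st) (Suc e) x" if x: "x \<in> lv (Suc e) ?c" for x
    proof -
      have "H (varr s) (warr s) e x = H (varr s1) (warr s1) e x"
        using 3(1) H_child_outside[OF c sm d x] by blast
      then have "H (varr s) (warr s) (Suc e) x = H (varr s1) (warr s1) (Suc e) x"
        using core by (intro H_Suc_cong[OF x sm[OF nd]]) auto
      then show ?thesis using s1(7) x by simp
    qed
    moreover have "same_at (varr st) (warr st) (varr s) (warr s) \<mu>" if "\<not> sub ?c \<mu>" for \<mu>
    proof -
      have "\<not> sub ?d \<mu>" using that d sub_child by metis
      then show ?thesis using sm s1(8) that same_at_trans by blast
    qed
    moreover have "warr s hasL (x0 div 2 ^ i) = 0 \<and> warr s hasT (x0 div 2 ^ i) = 0" if "1 \<le> i" "i \<le> Suc e" for i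
      using 3(1) that s1(9,10) sm[OF nd] by (cases "i = Suc e") (auto simp: same_at_def simp del: power_Suc)
    moreover have "t \<le> k + Suc e * (400 * Suc e + 1100) + 10"
      using 3(1) s1(6) by (simp add: algebra_simps)
    ultimately show ?case using 3(1) by simp
  qed
  have main: "wp push_down s1 t1 (\<lambda>s t. wp (SetW rPW (WDiv (WReg rPW) (WConst 2))) s t (\<lambda>s t. wp touch_down s t ?Q))"
    if s1: "varr s1 = varr st" "warr s1 = warr st" "wreg s1 rV = ?c" "wreg s1 rX0 = x0" "wreg s1 rPW = 2 ^ Suc e"
      "wreg s1 rNN = 2 ^ h" "t1 \<le> k + 20" for s1 t1
  proof (rule wp_conseq[OF wp_push_down[OF Suc.prems(1) s1(3) s1(6) W]], goal_cases)
    case (4 s t)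
    note f = 4(2)
    have core: "core_eq (varr st) (varr s)" using frame_varr[OF f] s1 by (auto simp: core_eq_def)
    show ?case
      unfolding wp_SetW
    proof (intro conjI rec, goal_cases)
      case 1
      show ?case using frame_wreg[OF f] s1 Ws by simp
    qed (use 4(1) s1 frame_wreg[OF f] core in \<open>simp_all add: tick_def\<close>)
  qed (use Suc.prems s1 in simp_all)
  have one: "(1::nat) < 2 ^ Suc e" by (rule one_less_power) auto
  show ?case
    apply (subst touch_down_def, subst wp_Loop, fold touch_down_def)
    apply (rule conjI)
    subgoal using Ws Suc.prems(3) by (simp del: power_Suc)
    apply (subst if_P)
    subgoal using Suc.prems(3) one by (simp del: power_Suc)
    apply (subst wp_Seq, subst wp_SetW, rule conjI)
    subgoal using Ws Suc.prems(2,3) by (simp del: power_Suc)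
    apply (subst wp_Seq, rule main)
    using Suc.prems(2-4) by (simp_all del: power_Suc add: tick_def)
qed

lemma wp_activate:
  assumes "8 \<le> W" "wreg st rX0 = x0" "x0 < W" "flags_ok (warr st)"
  shows "wp activate st k (\<lambda>s t. t \<le> k + 50 \<and> warr s = warr st \<and>
    varr s = (varr st)(leafR := (varr st leafR)(x0 := with_line (varr st) (warr st) x0 x0 (varr st leafR x0))))"
proof -
  have B: "warr st hasL x0 \<le> 1" using assms(4) by (simp add: flags_ok_def)
  have W: "Suc 0 < W" "warr st hasL x0 < W" using B assms(1) by linarith+
  have B': "warr st hasL x0 \<noteq> 0 \<Longrightarrow> warr st hasL x0 = Suc 0" using B by linarith
  show ?thesis
    unfolding activate_def using W B' assms(2,3)
    by (cases "warr st hasL x0 = 0") (simp_all add: tick_def with_line_def min_def not_less)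
qed

end

lemma R_root_change:
  assumes c: "0 < c" and x: "x \<in> lv e c"
    and oth: "\<And>\<nu>. \<nu> \<noteq> c \<Longrightarrow> same_at A B A' B' \<nu>"
    and keep: "\<And>a. a \<noteq> addC \<Longrightarrow> a \<noteq> addS \<Longrightarrow> A' a = A a" "B' = B"
  shows "R A' e x = R A e x + (A' addC c - A addC c) + (A' addS c - A addS c) * A keyM x"
    "H A' B' e x = H A B e x + (A' addC c - A addC c) + (A' addS c - A addS c) * A keyM x"
proof -
  show "R A' e x = R A e x + (A' addC c - A addC c) + (A' addS c - A addS c) * A keyM x"
  proof (cases e)
    case 0
    then show ?thesis using x keep by (simp add: algebra_simps)
  next
    case (Suc e')
    from x[unfolded Suc] have "R A' e' x = R A e' x"
    proof (rule lv_Suc_cases)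
      fix d assume d: "d = 2 * c \<or> d = 2 * c + 1" "x \<in> lv e' d"
      have "\<nu> \<noteq> c" if "sub d \<nu>" for \<nu> using d(1) not_sub_child[OF c] that by metis
      then show ?thesis using d(2) oth by (intro R_cong[of d]) auto
    qed
    then show ?thesis using x[unfolded Suc] keep unfolding Suc by (simp add: R_Suc algebra_simps)
  qed
  show "H A' B' e x = H A B e x + (A' addC c - A addC c) + (A' addS c - A addS c) * A keyM x"
  proof (cases e)
    case 0
    then show ?thesis using x keep by (simp add: with_line_def algebra_simps)
  next
    case (Suc e')
    note x' = x[unfolded Suc]
    have H: "H A' B' e' x = H A B e' x" by (rule H_only_root_changed[OF c oth x'])
    have "R A' e' l = R A e' l" if "l \<in> lv (Suc e') c" for l
      using that
    proof (rule lv_Suc_cases)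
      fix d assume d: "d = 2 * c \<or> d = 2 * c + 1" "l \<in> lv e' d"
      have "\<nu> \<noteq> c" if "sub d \<nu>" for \<nu> using d(1) not_sub_child[OF c] that by metis
      then show ?thesis using d(2) oth by (intro R_cong[of d]) auto
    qed
    then have "tag_min' A' e' c a b x = tag_min' A e' c a b x" for a b
      unfolding tag_min'_def by (intro arg_cong[where f = Min] image_cong) (simp_all add: keep)
    then show ?thesis unfolding Suc
      by (simp add: H_Suc[OF x'] H[unfolded keep(2)] keep with_line_def with_tag_def algebra_simps)
  qed
qed

lemma hull_root_change:
  assumes c: "0 < c"
    and oth: "\<And>\<nu>. \<nu> \<noteq> c \<Longrightarrow> same_at A B A' B' \<nu>"
    and keep: "\<And>a. a \<noteq> addC \<Longrightarrow> a \<noteq> addS \<Longrightarrow> A' a = A a"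
  shows "hull_ok A' e c = hull_ok A e c"
proof (cases e)
  case (Suc e')
  have "hull_ok A' e' d = hull_ok A e' d" "Qm A' e' d = Qm A e' d" if "d = 2 * c \<or> d = 2 * c + 1" for d
  proof -
    have s: "same_at A B A' B' \<nu>" if "sub d \<nu>" for \<nu>
      using \<open>d = 2 * c \<or> d = 2 * c + 1\<close> not_sub_child[OF c] that oth by metis
    show "hull_ok A' e' d = hull_ok A e' d" by (rule hull_cong[OF s])
    show "Qm A' e' d = Qm A e' d" by (intro ext Qm_cong[OF s])
  qed
  then show ?thesis unfolding Suc by (simp add: keep)
qed simp

lemma H_eqI:
  assumes "\<And>a. a \<noteq> thr \<Longrightarrow> A' a = A a"
  shows "H A' B e x = H A B e x"
proof (induction e)
  case 0
  then show ?case by (simp add: assms with_line_def)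
next
  case (Suc e)
  have "R A' e l = R A e l" for l by (rule R_eqI) (simp_all add: assms)
  then show ?case
    by (simp add: H.simps Suc with_line_def with_tag_def tag_min'_def assms)
qed

lemma half_cases: "c = 2 * (c div 2) \<or> c = 2 * (c div 2) + 1" for c :: nat
  by presburger

lemma nd_descend:
  assumes "P h 1" and step: "\<And>e c. P (Suc e) c \<Longrightarrow> P e (2 * c) \<and> P e (2 * c + 1)"
    and "nd h e c"
  shows "P e c"
  using assms(3)
proof (induction "h - e" arbitrary: e c)
  case 0
  then have "e = h" by (auto simp: nd_def)
  with 0 show ?case using assms(1) nd_top by metis
next
  case (Suc n)
  then have "e < h" by simp
  then have "P (Suc e) (c div 2)" using Suc by (intro Suc.hyps(1) nd_parent) auto
  then show ?case using step half_cases by metis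
qed

lemma key_ok_node: "key_ok A h 1 \<Longrightarrow> nd h e c \<Longrightarrow> key_ok A e c"
  by (rule nd_descend[where P = "key_ok A"]) auto

lemma hull_ok_node: "hull_ok A h 1 \<Longrightarrow> nd h e c \<Longrightarrow> hull_ok A e c"
  by (rule nd_descend[where P = "hull_ok A"]) auto

lemma nd_path: "nd h 0 x \<Longrightarrow> e \<le> h \<Longrightarrow> nd h e (x div 2 ^ e)"
proof (induction e)
  case (Suc e)
  then show ?case using nd_parent[of h e "x div 2 ^ e"] by (simp add: div_pow_Suc del: power_Suc)
qed simp

definition updated :: "varrays \<Rightarrow> warrays \<Rightarrow> nat \<Rightarrow> real \<Rightarrow> nat \<Rightarrow> varrays \<Rightarrow> nat \<Rightarrow> bool" where
  "updated A B x0 be e A1 x \<longleftrightarrow>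
     R A1 e x = R A e x + be * max 0 (A keyM x - A keyM x0) \<and>
     H A1 B e x = H A B e x + be * max 0 (A keyM x - A keyM x0)"

text \<open>The state on the way up at height \<open>e\<close>: below the current node of the path
  the increment is complete and the hulls are repaired, outside its subtree nothing has happened
  yet.\<close>

definition UP :: "varrays \<Rightarrow> warrays \<Rightarrow> nat \<Rightarrow> real \<Rightarrow> nat \<Rightarrow> varrays \<Rightarrow> bool" where
  "UP A B x0 be e A1 \<longleftrightarrow>
     (\<forall>a. a \<noteq> addC \<longrightarrow> a \<noteq> addS \<longrightarrow> a \<noteq> thr \<longrightarrow> A1 a = A a) \<and>
     (\<forall>x \<in> lv e (x0 div 2 ^ e). updated A B x0 be e A1 x) \<and>
     hull_ok A1 e (x0 div 2 ^ e) \<and>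
     (\<forall>\<mu>. \<not> sub (x0 div 2 ^ e) \<mu> \<longrightarrow> same_at A B A1 B \<mu>)"

text \<open>The sibling of the path node either has only larger keys, and the linear function is the
  increment there, or only smaller ones, where the maximum is 0. Its hull survives because
  \<open>hull_ok\<close> ignores the linear function of the root of the subtree.\<close>

lemma UP_add:
  assumes up: "UP A B x0 be e A1" and c: "c = x0 div 2 ^ e" "p = c div 2" "0 < p"
    and ko: "key_ok A (Suc e) p"
    and hull: "\<And>q. q div 2 = p \<Longrightarrow> q \<noteq> c \<Longrightarrow> hull_ok A e q"
    and A2: "A2 = (if 2 * p = c
      then A1(addC := (A1 addC)(c + 1 := A1 addC (c + 1) - be * A keyM x0),
              addS := (A1 addS)(c + 1 := A1 addS (c + 1) + be))
      else A1)"
  shows "\<forall>x \<in> lv (Suc e) p. updated A B x0 be e A2 x" "hull_ok A2 e (2 * p)" "hull_ok A2 e (2 * p + 1)"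
    "\<And>\<mu>. \<not> sub p \<mu> \<or> \<mu> = p \<Longrightarrow> same_at A B A2 B \<mu>"
    "\<And>a. a \<noteq> addC \<Longrightarrow> a \<noteq> addS \<Longrightarrow> a \<noteq> thr \<Longrightarrow> A2 a = A a"
proof -
  \<comment> \<open>\<open>q\<close> is the sibling of the path node \<open>c\<close>.\<close>
  define q where "q = (if 2 * p = c then c + 1 else c - 1)"
  have cp: "(c = 2 * p \<and> q = 2 * p + 1) \<or> (c = 2 * p + 1 \<and> q = 2 * p)"
    using c half_cases[of c] by (auto simp: q_def)
  have q0: "0 < q" using cp c by auto
  have disj: "\<not> sub c \<mu>" if "sub q \<mu>" for \<mu> using cp sub_child_disj[OF c(3), of \<mu>] that by auto
  have pn: "\<not> sub c p" "\<not> sub q p" using cp not_sub_child[OF c(3)] by auto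
  have subp: "sub p \<mu>" if "sub c \<mu> \<or> sub q \<mu>" for \<mu> using cp sub_child[of p \<mu>] that by auto
  have x0: "x0 \<in> lv e c" by (simp add: lv_def c)
  have upd: "updated A B x0 be e A1 x" if "x \<in> lv e c" for x using up that c by (simp add: UP_def)
  have same1: "same_at A B A1 B \<mu>" if "\<not> sub c \<mu>" for \<mu> using up that c by (simp add: UP_def)
  have other: "a \<noteq> addC \<Longrightarrow> a \<noteq> addS \<Longrightarrow> A2 a = A1 a" for a using A2 by simp
  have same2: "same_at A1 B A2 B \<mu>" if "\<mu> \<noteq> q" for \<mu> using that unfolding A2 q_def by (auto simp: same_at_def split: if_splits)
  show oth: "a \<noteq> addC \<Longrightarrow> a \<noteq> addS \<Longrightarrow> a \<noteq> thr \<Longrightarrow> A2 a = A a" for a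
    using other up by (simp add: UP_def)
  show "\<not> sub p \<mu> \<or> \<mu> = p \<Longrightarrow> same_at A B A2 B \<mu>" for \<mu>
  proof -
    assume "\<not> sub p \<mu> \<or> \<mu> = p"
    then have "\<not> sub c \<mu>" "\<not> sub q \<mu>" using subp pn by auto
    then have "\<not> sub c \<mu>" "\<mu> \<noteq> q" by auto
    then show ?thesis using same1 same2 same_at_trans by blast
  qed
  have "hull_ok A e q" using hull[of q] cp by auto
  moreover have "hull_ok A1 e q = hull_ok A e q"
    by (rule hull_cong[where B = B and B' = B]) (use same1 disj in blast)
  ultimately have hq: "hull_ok A1 e q" by simp
  have "hull_ok A2 e q = hull_ok A1 e q" by (rule hull_root_change[OF q0 same2 other])
  with hq have hq2: "hull_ok A2 e q" by simp
  have "sub c \<mu> \<Longrightarrow> \<mu> \<noteq> q" for \<mu> using disj[of q] by auto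
  then have sc: "sub c \<mu> \<Longrightarrow> same_at A1 B A2 B \<mu>" for \<mu> using same2 by blast
  have "hull_ok A2 e c" using up c hull_cong[of c A1 B A2 B e, OF sc] by (simp add: UP_def)
  with hq2 cp show "hull_ok A2 e (2 * p)" "hull_ok A2 e (2 * p + 1)" by auto
  show "\<forall>x \<in> lv (Suc e) p. updated A B x0 be e A2 x"
  proof
    fix x assume "x \<in> lv (Suc e) p"
    then consider "x \<in> lv e c" | "x \<in> lv e q" using cp by (auto simp: lv_Suc)
    then show "updated A B x0 be e A2 x"
    proof cases
      case 1
      then show ?thesis
        using upd R_cong[of c A1 B A2 B, OF sc] H_cong[of c A1 B A2 B, OF sc] by (simp add: updated_def)
    next
      case 2
      have R1: "R A1 e x = R A e x" "H A1 B e x = H A B e x"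
        using R_cong[of q A B A1 B x e] H_cong[of q A B A1 B x e] same1 disj 2 by blast+
      have k: "A1 keyM = A keyM" using up by (simp add: UP_def)
      have "x0 \<in> lv e (2 * p) \<and> x \<in> lv e (2 * p + 1) \<and> q = c + 1 \<and> 2 * p = c \<or>
        x \<in> lv e (2 * p) \<and> x0 \<in> lv e (2 * p + 1) \<and> 2 * p \<noteq> c" using cp x0 2 by auto
      then show ?thesis
      proof
        assume a: "x0 \<in> lv e (2 * p) \<and> x \<in> lv e (2 * p + 1) \<and> q = c + 1 \<and> 2 * p = c"
        then have "A keyM x0 < A keyM x" using key_ok_across[OF ko] by blast
        moreover have d: "A2 addC q - A1 addC q = - be * A keyM x0" "A2 addS q - A1 addS q = be"
          using a unfolding A2 by simp_all
        have "R A2 e x = R A e x + be * (A keyM x - A keyM x0)" "H A2 B e x = H A B e x + be * (A keyM x - A keyM x0)"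
          using R_root_change[OF q0 2 same2 other refl] unfolding d R1 k by (simp_all add: algebra_simps)
        ultimately show ?thesis by (simp add: updated_def)
      next
        assume a: "x \<in> lv e (2 * p) \<and> x0 \<in> lv e (2 * p + 1) \<and> 2 * p \<noteq> c"
        then have "A keyM x < A keyM x0" using key_ok_across[OF ko] by blast
        moreover have "A2 = A1" using a unfolding A2 by simp
        ultimately show ?thesis using R1 by (simp add: updated_def)
      qed
    qed
  qed
qed

lemma UP_pull:
  assumes p: "p = x0 div 2 ^ Suc e" "B hasL p = 0" "B hasT p = 0"
    and A2: "\<forall>x \<in> lv (Suc e) p. updated A B x0 be e A2 x"
    "\<And>\<mu>. \<not> sub p \<mu> \<or> \<mu> = p \<Longrightarrow> same_at A B A2 B \<mu>"
    "\<And>a. a \<noteq> addC \<Longrightarrow> a \<noteq> addS \<Longrightarrow> a \<noteq> thr \<Longrightarrow> A2 a = A a"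
    and A3: "\<And>a. a \<noteq> thr \<Longrightarrow> A3 a = A2 a" "\<And>\<mu>. \<mu> \<noteq> p \<Longrightarrow> A3 thr \<mu> = A2 thr \<mu>" "hull_ok A3 (Suc e) p"
  shows "UP A B x0 be (Suc e) A3"
  unfolding UP_def p(1)[symmetric]
proof (intro conjI ballI allI impI)
  show "a \<noteq> addC \<Longrightarrow> a \<noteq> addS \<Longrightarrow> a \<noteq> thr \<Longrightarrow> A3 a = A a" for a using A2(3) A3(1) by simp
  show "hull_ok A3 (Suc e) p" by (rule A3(3))
  show "same_at A B A3 B \<mu>" if "\<not> sub p \<mu>" for \<mu>
  proof -
    have "\<mu> \<noteq> p" using that by auto
    then have "A3 a \<mu> = A2 a \<mu>" for a using A3(1,2) by (cases "a = thr") auto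
    then have "same_at A2 B A3 B \<mu>" by (simp add: same_at_def)
    moreover have "same_at A B A2 B \<mu>" by (rule A2(2)) (use that in simp)
    ultimately show ?thesis by (rule same_at_trans[rotated])
  qed
  fix x assume x: "x \<in> lv (Suc e) p"
  have R: "R A3 e x = R A2 e x" by (rule R_eqI) (simp_all add: A3)
  have H: "H A3 B e x = H A2 B e x" by (rule H_eqI) (simp add: A3)
  have "same_at A B A2 B p" by (rule A2(2)) simp
  then have "A2 addC p = A addC p" "A2 addS p = A addS p" by (simp_all add: same_at_def)
  moreover have "A3 addC = A2 addC" "A3 addS = A2 addS" "A3 keyM = A keyM" using A2(3) A3(1) by simp_all
  moreover have "updated A B x0 be e A2 x" using A2(1) x by blast
  ultimately show "updated A B x0 be (Suc e) A3 x"
    using p(2,3) by (simp add: updated_def R_Suc[OF x] H_Suc[OF x] R H with_line_def with_tag_def)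
qed

lemma UP_0:
  assumes "\<And>a. A1 a = A a"
  shows "UP A B x0 be 0 A1"
  using assms by (simp add: UP_def updated_def same_at_def with_line_def)

context machine
begin

lemma wp_touch_up:
  assumes W: "8 * 2 ^ h \<le> W" and x0: "nd h 0 x0" and ko: "key_ok A h 1"
    and clear: "\<And>i. 1 \<le> i \<Longrightarrow> i \<le> h \<Longrightarrow> B hasL (x0 div 2 ^ i) = 0 \<and> B hasT (x0 div 2 ^ i) = 0"
    and hull: "\<And>i q. i < h \<Longrightarrow> q div 2 = x0 div 2 ^ Suc i \<Longrightarrow> q \<noteq> x0 div 2 ^ i \<Longrightarrow> hull_ok A i q"
    and "e \<le> h" "wreg st rX0 = x0" "wreg st rNN = 2 ^ h" "vreg st fBE = be" "wreg st rLC = x0 div 2 ^ e"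
      "warr st = B" "UP A B x0 be e (varr st)"
  shows "wp touch_up st k (\<lambda>s t. t \<le> k + (h - e) * (2 * h * (60 * h + 200) + 300) + 10 \<and> UP A B x0 be h (varr s))"
  using assms(6-)
proof (induction "h - e" arbitrary: e st k)
  case 0
  then have "e = h" by simp
  then have c: "x0 div 2 ^ e = 1" using nd_path[OF x0, of h] nd_top by blast
  have "(1::nat) \<le> 2 ^ h" by simp
  then have "Suc 0 < W" using W by linarith
  with c 0 \<open>e = h\<close> show ?case by (simp add: touch_up_def wp_Loop tick_def)
next
  case (Suc n)
  define c where "c = x0 div 2 ^ e"
  define p where "p = c div 2"
  have e: "e < h" using Suc by simp
  have ndc: "nd h e c" unfolding c_def by (rule nd_path[OF x0]) (use e in simp)
  have ndp: "nd h (Suc e) p" unfolding p_def by (rule nd_parent[OF ndc e])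
  have pe: "p = x0 div 2 ^ Suc e" by (simp only: p_def c_def div_pow_Suc)
  have p: "p < 2 ^ h" "0 < p" using nd_Suc[OF ndp] nd_pos[OF ndp] by auto
  have c1: "1 < c" using p half_cases[of c] unfolding p_def by linarith
  have one: "(1::nat) \<le> 2 ^ h" by simp
  have cl: "c < 2 * 2 ^ h" by (rule nd_less[OF ndc])
  have x0l: "x0 < 2 * 2 ^ h" by (rule nd_less[OF x0])
  have Ws: "Suc 0 < W" "2 < W" "c < W" "Suc c < W" "p < W" "2 * p < W" "x0 < W"
    using W one cl p x0l by linarith+
  have kop: "key_ok A (Suc e) p" by (rule key_ok_node[OF ko ndp])
  have kA: "varr st keyM = A keyM" using Suc.prems(7) by (simp add: UP_def)
  define A2 where "A2 = (if 2 * p = c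
      then (varr st)(addC := (varr st addC)(c + 1 := varr st addC (c + 1) - be * A keyM x0),
              addS := (varr st addS)(c + 1 := varr st addS (c + 1) + be))
      else varr st)"
  note UA = UP_add[OF Suc.prems(7) c_def p_def p(2) kop hull[OF e, folded pe c_def] A2_def]
  have rec: "wp pull s1 t1 (\<lambda>s t. wp touch_up s t (\<lambda>s t. t \<le> k + (h - e) * (2 * h * (60 * h + 200) + 300) + 10 \<and> UP A B x0 be h (varr s)))"
    if s1: "varr s1 = A2" "warr s1 = B" "wreg s1 rX0 = x0" "wreg s1 rNN = 2 ^ h" "wreg s1 rLC = p" "vreg s1 fBE = be"
      "t1 \<le> k + 80" for s1 t1
  proof (rule wp_conseq[OF wp_pull[OF ndp W _ _ _ s1(5) s1(4)]], goal_cases)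
    case 1 show ?case unfolding s1 by (rule UA)
  next
    case 2 show ?case unfolding s1 by (rule UA)
  next
    case 3 show ?case unfolding s1 using kop UA(5) by (subst key_ok_eqI[of A2 A]) auto
  next
    case (4 s t)
    note f = 4(2)
    have up: "UP A B x0 be (Suc e) (varr s)"
      by (rule UP_pull[OF pe _ _ UA(1,4,5)]) (use 4(1) clear[of "Suc e"] e s1 in \<open>auto simp: pe simp del: power_Suc hull_ok.simps\<close>)
    have ar: "2 * e * (60 * e + 200) \<le> 2 * h * (60 * h + 200)" using e by (intro mult_mono) auto
    have he: "h - e = Suc (h - Suc e)" using e by simp
    show ?case
    proof (rule wp_conseq[OF Suc.hyps(1)[of "Suc e"]], goal_cases)
      case 1 then show ?case using Suc.hyps(2) by simp
    next
      case 2 then show ?case using e by simp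
    next
      case 3 then show ?case using frame_wreg[OF f] s1 by simp
    next
      case 4 then show ?case using frame_wreg[OF f] s1 by simp
    next
      case 5 then show ?case using frame_vreg[OF f] s1 by simp
    next
      case 6 then show ?case using frame_wreg[OF f] s1 pe by (simp del: power_Suc)
    next
      case 7 then show ?case using frame_warr_all[OF f] s1 by simp
    next
      case 8 then show ?case by (rule up)
    next
      case (9 s' t')
      have "t \<le> k + (2 * h * (60 * h + 200) + 290)" using 4(1) ar s1(7) by linarith
      then show ?case using 9(1) unfolding he mult_Suc by linarith
    qed
  qed
  show ?case
    apply (subst touch_up_def, subst wp_Loop, fold touch_up_def)
    apply (intro conjI)
    subgoal using Ws c1 Suc.prems c_def by simp
    apply (subst if_P)
    subgoal using c1 Suc.prems c_def by simp
    using Ws Suc.prems(2-6) kA p_def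
    apply (simp add: c_def[symmetric])
    apply (intro conjI impI; rule rec)
    apply (simp_all add: A2_def tick_def)
    done
qed

end

section \<open>Touching a leaf and pushing at the root, seen from the whole tree\<close>

definition tree_ok :: "nat \<Rightarrow> store \<Rightarrow> bool" where
  "tree_ok h s \<longleftrightarrow> wreg s rNN = 2 ^ h \<and> flags_ok (warr s) \<and> key_ok (varr s) h 1 \<and> hull_ok (varr s) h 1"

definition touch_time :: "nat \<Rightarrow> nat" where
  "touch_time h = h * (400 * h + 1100) + h * (2 * h * (60 * h + 200) + 300) + 100"

definition root_push :: com where
  "root_push = SetW rTC (WConst 1) ;; apply_tag"

lemma mod_root_push [simp]:
  "mod_wreg root_push = {rTC}" "mod_warr root_push = {hasT}"
  "mod_vreg root_push = {fA1, fA2}" "mod_varr root_push = {tagL, tagR}"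
  by (auto simp: root_push_def)

text \<open>A cone stored above \<open>x0\<close> ranges over the old sources, so it has to be gone
  before \<open>leafR\<close> changes. With the path cleared, \<open>H\<close> does not notice that
  the source has absorbed the line of its leaf, and the new source value is the current
  value.\<close>

lemma activate_effect:
  assumes x0: "0 < x0 div 2 ^ e" and clear: "\<And>i. 1 \<le> i \<Longrightarrow> i \<le> e \<Longrightarrow> B hasL (x0 div 2 ^ i) = 0 \<and> B hasT (x0 div 2 ^ i) = 0"
    and A': "A' = A(leafR := (A leafR)(x0 := with_line A B x0 x0 (A leafR x0)))"
    and x: "x \<in> lv e (x0 div 2 ^ e)"
  shows "H A' B e x = H A B e x \<and> R A' e x = (if x = x0 then H A B e x0 else R A e x)"
  using x0 clear x
proof (induction e arbitrary: x)
  case 0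
  then show ?case by (simp add: A' with_line_def)
next
  case (Suc e)
  let ?p = "x0 div 2 ^ Suc e" and ?c = "x0 div 2 ^ e"
  have p: "?p = ?c div 2" by (simp only: div_pow_Suc)
  have c: "?c = 2 * ?p \<or> ?c = 2 * ?p + 1" unfolding p by (rule half_cases)
  have p0: "0 < ?p" by (rule Suc.prems(1))
  have c0: "0 < ?c" using p p0 by simp
  have cl: "B hasL ?p = 0" "B hasT ?p = 0" using Suc.prems(2)[of "Suc e"] by auto
  have "H A' B e x = H A B e x \<and> R A' e x = (if x = x0 then H A B e x0 else R A e x)"
  proof (cases "x \<in> lv e ?c")
    case True
    show ?thesis by (rule Suc.IH[OF c0 _ True]) (use Suc.prems(2) in auto)
  next
    case False
    from Suc.prems(3) show ?thesis
    proof (rule lv_Suc_cases)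
      fix d assume d: "d = 2 * ?p \<or> d = 2 * ?p + 1" "x \<in> lv e d"
      have "d \<noteq> ?c" using d(2) False by auto
      moreover have "sub ?c x0" unfolding sub_def by blast
      ultimately have "\<not> sub d x0" using sub_child_disj[OF p0, of x0] c d(1) by metis
      then have s: "same_at A B A' B \<mu>" if "sub d \<mu>" for \<mu>
        using that by (auto simp: A' same_at_def)
      have "x \<noteq> x0" using False by (auto simp: lv_def)
      then show ?thesis using R_cong[of d A B A' B, OF s d(2)] H_cong[of d A B A' B, OF s d(2)] by simp
    qed
  qed
  moreover have "x0 \<in> lv (Suc e) ?p" by (simp add: lv_def)
  moreover have "A' addC = A addC" "A' addS = A addS" "A' keyM = A keyM" by (simp_all add: A')
  ultimately show ?case
    using cl by (simp add: R_Suc[OF Suc.prems(3)] H_Suc[OF Suc.prems(3)] H_Suc[of x0 e ?p] with_line_def with_tag_def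
        del: power_Suc)
qed

context machine
begin

lemma wp_touch:
  assumes W: "8 * 2 ^ h \<le> W" and tree: "tree_ok h st" and x0: "nd h 0 x0" "wreg st rX0 = x0"
  shows "wp touch st k (\<lambda>s t. t \<le> k + touch_time h \<and> tree_ok h s \<and>
    (\<forall>x \<in> lv h 1.
      R (varr s) h x = (if x = x0 then H (varr st) (warr st) h x0 else R (varr st) h x)
        + vreg st fBE * max 0 (varr st keyM x - varr st keyM x0) \<and>
      H (varr s) (warr s) h x = H (varr st) (warr st) h x
        + vreg st fBE * max 0 (varr st keyM x - varr st keyM x0)))"
proof -
  define A B be where "A = varr st" and "B = warr st" and "be = vreg st fBE"
  have t: "wreg st rNN = 2 ^ h" "flags_ok B" "key_ok A h 1" "hull_ok A h 1"
    using tree by (simp_all add: tree_ok_def A_def B_def)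
  have root: "x0 div 2 ^ h = 1" using nd_path[OF x0(1), of h] nd_top by blast
  have x0l: "x0 < 2 * 2 ^ h" by (rule nd_less[OF x0(1)])
  have one: "(1::nat) \<le> 2 ^ h" by simp
  have Ws: "2 ^ h < W" "x0 < W" "8 \<le> W" using W one x0l by linarith+
  have down: "wp touch_down s1 t1 (\<lambda>s t. wp activate s t (\<lambda>s t. wp (SetW rLC (WReg rX0)) s t (\<lambda>s t. wp touch_up s t
     (\<lambda>s t. t \<le> k + touch_time h \<and> tree_ok h s \<and>
    (\<forall>x \<in> lv h 1.
      R (varr s) h x = (if x = x0 then H A B h x0 else R A h x) + be * max 0 (A keyM x - A keyM x0) \<and>
      H (varr s) (warr s) h x = H A B h x + be * max 0 (A keyM x - A keyM x0))))))"
    if s1: "varr s1 = A" "warr s1 = B" "vreg s1 fBE = be" "wreg s1 rNN = 2 ^ h" "wreg s1 rX0 = x0"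
      "wreg s1 rPW = 2 ^ h" "t1 \<le> k + 10" for s1 t1
  proof (rule wp_conseq[OF wp_touch_down[where h = h and e = h and ?x0.0 = x0, OF W _ s1(5,6,4) x0l, unfolded root]], goal_cases)
    case 1 show ?case by (rule nd_root)
  next
    case 2 show ?case using t s1 by simp
  next
    case 3 show ?case unfolding s1 by (rule t)
  next
    case 4 show ?case unfolding s1 by (rule t)
  next
    case (5 s2 t2)
    note f2 = 5(2)
    define A1 B1 where "A1 = varr s2" and "B1 = warr s2"
    have core: "core_eq A A1" using frame_varr[OF f2] s1 by (auto simp: core_eq_def A1_def)
    note cD = core_eqD[OF core]
    have ko1: "key_ok A1 h 1" unfolding cD by (rule t)
    have ho1: "hull_ok A1 h 1" unfolding cD by (rule t)
    have fl: "flags_ok B1" using 5 by (simp add: B1_def)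
    have Heq: "H A1 B1 h x = H A B h x" if "x \<in> lv h 1" for x using 5(1) that s1 by (simp add: A1_def B1_def)
    have clear: "B1 hasL (x0 div 2 ^ i) = 0 \<and> B1 hasT (x0 div 2 ^ i) = 0" if "1 \<le> i" "i \<le> h" for i
      using 5(1) that by (simp add: B1_def)
    define A2 where "A2 = A1(leafR := (A1 leafR)(x0 := with_line A1 B1 x0 x0 (A1 leafR x0)))"
    have eff: "H A2 B1 h x = H A1 B1 h x \<and> R A2 h x = (if x = x0 then H A1 B1 h x0 else R A1 h x)" if "x \<in> lv h 1" for x
      by (rule activate_effect[OF _ clear A2_def]) (use that root in auto)
    have x0r: "wreg s2 rX0 = x0" "wreg s2 rNN = 2 ^ h" "vreg s2 fBE = be"
      using frame_wreg[OF f2] frame_vreg[OF f2] s1 by simp_all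
    have ko2: "key_ok A2 h 1" using ko1 key_ok_eqI[of A2 A1] by (simp add: A2_def)
    have hsib: "hull_ok A2 i q" if q: "i < h" "q div 2 = x0 div 2 ^ Suc i" "q \<noteq> x0 div 2 ^ i" for i q
    proof -
      let ?p = "x0 div 2 ^ Suc i" and ?c = "x0 div 2 ^ i"
      have ndp: "nd h (Suc i) ?p" by (rule nd_path[OF x0(1)]) (use q in simp)
      have p0: "0 < ?p" by (rule nd_pos[OF ndp])
      have c: "?c = 2 * ?p \<or> ?c = 2 * ?p + 1"
        using half_cases[of ?c] by (simp only: div_pow_Suc)
      have d: "q = 2 * ?p \<or> q = 2 * ?p + 1" using half_cases[of q] unfolding q(2) .
      have "sub ?c x0" unfolding sub_def by blast
      then have ns: "\<not> sub q x0" using sub_child_disj[OF p0, of x0] c d q(3) by metis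
      have "nd h i q" using nd_Suc[OF ndp] d by metis
      then have "hull_ok A1 i q" by (rule hull_ok_node[OF ho1])
      moreover have "hull_ok A2 i q = hull_ok A1 i q"
      proof (rule hull_cong)
        fix \<mu> assume "sub q \<mu>"
        then have "\<mu> \<noteq> x0" using ns by metis
        then show "same_at A1 B1 A2 B1 \<mu>" by (simp add: A2_def same_at_def)
      qed
      ultimately show ?thesis by simp
    qed
    show ?case
    proof (rule wp_conseq[OF wp_activate[OF Ws(3) x0r(1) Ws(2) fl[unfolded B1_def]]], goal_cases)
      case (1 s3 t3)
      note f3 = 1(2)
      have v3: "varr s3 = A2" "warr s3 = B1" using 1(1) by (simp_all add: A2_def A1_def B1_def)
      have r3: "wreg s3 rX0 = x0" "wreg s3 rNN = 2 ^ h" "vreg s3 fBE = be"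
        using frame_wreg[OF f3] frame_vreg[OF f3] x0r by simp_all
      have up: "wp touch_up s4 t4 (\<lambda>s t. t \<le> t4 + h * (2 * h * (60 * h + 200) + 300) + 10 \<and> UP A2 B1 x0 be h (varr s))"
        if "varr s4 = A2" "warr s4 = B1" "wreg s4 rX0 = x0" "wreg s4 rNN = 2 ^ h" "vreg s4 fBE = be" "wreg s4 rLC = x0" for s4 t4
        by (rule wp_conseq[OF wp_touch_up[where e = 0 and A = A2 and B = B1 and ?x0.0 = x0, OF W x0(1) ko2 clear hsib]])
           (use that UP_0[of A2 A2] in auto)
      show ?case
        unfolding wp_SetW
      proof (intro conjI, goal_cases)
        case 1 show ?case using r3 Ws by simp
      next
        case 2
        show ?case
        proof (rule wp_conseq[OF up], goal_cases)
          case (7 s t)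
          note f = 7(2)
          have B: "warr s = B1" using frame_warr_all[OF f] v3 by simp
          have "wreg s rNN = 2 ^ h" using frame_wreg[OF f] r3 by simp
          moreover have U: "UP A2 B1 x0 be h (varr s)" using 7 by blast
          then have "hull_ok (varr s) h 1" "\<forall>x \<in> lv h 1. updated A2 B1 x0 be h (varr s) x" "varr s keyM = A2 keyM"
            unfolding UP_def root by auto
          moreover from this(3) have "key_ok (varr s) h 1" using ko2 key_ok_eqI[of "varr s" A2] by simp
          moreover have "t \<le> k + touch_time h"
            using 7(1) 1(1) 5(1) s1(7) by (simp add: touch_time_def tick_def)
          moreover have "A2 keyM = A keyM" using cD by (simp add: A2_def)
          ultimately show ?case
            using fl B eff Heq root cD by (auto simp: tree_ok_def updated_def lv_def)
        qed (use v3 r3 in simp_all)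
      qed
    qed
  qed
  show ?thesis
    unfolding touch_def A_def[symmetric] B_def[symmetric] be_def[symmetric]
    apply (subst wp_Seq, subst wp_SetW, rule conjI)
    subgoal using Ws t by simp
    unfolding wp_Seq
    by (rule down) (use t x0 in \<open>simp_all add: A_def B_def be_def tick_def\<close>)
qed

lemma wp_root_push:
  assumes W: "8 * 2 ^ h \<le> W" and tree: "tree_ok h st"
  shows "wp root_push st k (\<lambda>s t. t \<le> k + 70 \<and> tree_ok h s \<and>
    (\<forall>x \<in> lv h 1. R (varr s) h x = R (varr st) h x \<and>
      H (varr s) (warr s) h x = min (H (varr st) (warr st) h x)
        (tag_min (varr st) h 1 (vreg st fTL) (vreg st fTR) x)))"
proof -
  have one: "(1::nat) \<le> 2 ^ h" by simp
  then have Ws: "1 < W" "8 \<le> W" using W by linarith+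
  let ?s1 = "st\<lparr>wreg := (wreg st)(rTC := wval st (WConst 1))\<rparr>"
  have "wp apply_tag ?s1 k' (\<lambda>s t. t \<le> k' + 60 \<and> tree_ok h s \<and>
    (\<forall>x \<in> lv h 1. R (varr s) h x = R (varr st) h x \<and>
      H (varr s) (warr s) h x = min (H (varr st) (warr st) h x)
        (tag_min (varr st) h 1 (vreg st fTL) (vreg st fTR) x)))" for k'
  proof (rule wp_conseq[OF wp_apply_tag[where c = 1]], goal_cases)
    case (5 s t)
    note f = 5(2)
    have oth: "a \<noteq> tagL \<Longrightarrow> a \<noteq> tagR \<Longrightarrow> varr s a = varr st a" "b \<noteq> hasT \<Longrightarrow> warr s b = warr st b" for a b
      using frame_varr[OF f] frame_warr[OF f] by simp_all
    have "H (varr s) (warr s) h x = min (H (varr st) (warr st) h x) (tag_min (varr st) h 1 (vreg st fTL) (vreg st fTR) x)"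
      if x: "x \<in> lv h 1" for x
      by (rule H_tag[OF x _ _ oth]) (use 5(1) in auto)
    moreover have "core_eq (varr st) (varr s)" using oth by (auto simp: core_eq_def)
    note core_eqD[OF this]
    moreover have "wreg s rNN = 2 ^ h" using frame_wreg[OF f] tree by (simp add: tree_ok_def)
    ultimately show ?case using 5(1) tree by (simp add: tree_ok_def)
  qed (use Ws tree in \<open>simp_all add: tree_ok_def\<close>)
  then have "wp apply_tag ?s1 (tick k (wtime (WConst 1) + 1)) (\<lambda>s t. t \<le> k + 70 \<and> tree_ok h s \<and>
    (\<forall>x \<in> lv h 1. R (varr s) h x = R (varr st) h x \<and>
      H (varr s) (warr s) h x = min (H (varr st) (warr st) h x)
        (tag_min (varr st) h 1 (vreg st fTL) (vreg st fTR) x)))"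
    by (rule wp_conseq) (simp add: tick_def)
  then show ?thesis
    unfolding root_push_def wp_Seq wp_SetW using Ws by simp
qed

end

subsection \<open>Paths through the grid of runs\<close>

text \<open>Sources between \<open>u\<close> and \<open>z\<close> may be omitted: on a left edge
  they belong to states with fewer letters still open, and such a state has already been counted at
  \<open>z\<close>. Sources beyond \<open>v\<close>, the diagonal of the corner, count through the
  corner in the same way.\<close>

definition pushl :: "int \<Rightarrow> int \<Rightarrow> real \<Rightarrow> (int \<Rightarrow> real) \<Rightarrow> int \<Rightarrow> real" where
  "pushl u v d g z =
     (if u \<le> z \<and> z \<le> v then Min ((\<lambda>l. g l + d * real_of_int (l - z)) ` {z..v}) else g z)"

definition ipos :: "int \<Rightarrow> real" where "ipos z = max 0 (real_of_int z)"

definition mirror :: "(int \<Rightarrow> real) \<Rightarrow> int \<Rightarrow> real" where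
  "mirror g z = g (- z)"

lemma pushl_le: "u \<le> z \<Longrightarrow> z \<le> l \<Longrightarrow> l \<le> v \<Longrightarrow> pushl u v d g z \<le> g l + d * real_of_int (l - z)"
  unfolding pushl_def by (auto intro!: Min_le)

lemma pushl_attained:
  assumes "u \<le> z" "z \<le> v"
  obtains l where "z \<le> l" "l \<le> v" "pushl u v d g z = g l + d * real_of_int (l - z)"
proof -
  have "Min ((\<lambda>l. g l + d * real_of_int (l - z)) ` {z..v}) \<in> (\<lambda>l. g l + d * real_of_int (l - z)) ` {z..v}"
    using assms by (intro Min_in) auto
  then obtain l where "Min ((\<lambda>l. g l + d * real_of_int (l - z)) ` {z..v}) = g l + d * real_of_int (l - z)" "l \<in> {z..v}"
    by (rule imageE)
  then show thesis using that[of l] assms unfolding pushl_def by simp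
qed

lemma pushl_le_self: "pushl u v d g z \<le> g z"
  by (cases "u \<le> z \<and> z \<le> v") (use pushl_le[of u z z v d g] in \<open>auto simp: pushl_def\<close>)

lemma pushl_outside: "z < u \<or> v \<le> z \<Longrightarrow> pushl u v d g z = g z"
  by (auto simp: pushl_def)

locale grid =
  fixes n m :: nat and a b :: "nat \<Rightarrow> nat" and d :: "nat \<Rightarrow> nat \<Rightarrow> real"
  assumes n: "0 < n" and m: "0 < m"
    and a: "i < n \<Longrightarrow> 0 < a i" and b: "j < m \<Longrightarrow> 0 < b j" and d: "0 \<le> d i j"
begin

text \<open>\<open>reach i j p q c\<close>: at cost \<open>c\<close> one can arrive at the pair of runs \<open>(i, j)\<close> so that \<open>p\<close> letters of run
  \<open>i\<close> and \<open>q\<close> letters of run \<open>j\<close> are still to be matched; \<open>X\<close> is the number of pairs that are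
  then matched within \<open>(i, j)\<close>, possibly zero.\<close>

inductive reach :: "nat \<Rightarrow> nat \<Rightarrow> nat \<Rightarrow> nat \<Rightarrow> real \<Rightarrow> bool" where
  start: "reach 0 0 (a 0) (b 0) 0"
| right: "reach i j p q c \<Longrightarrow> i < n \<Longrightarrow> j < m \<Longrightarrow> q \<le> X \<Longrightarrow>
    reach i (Suc j) (p - X) (b (Suc j)) (c + d i j * real X)"
| down: "reach i j p q c \<Longrightarrow> i < n \<Longrightarrow> j < m \<Longrightarrow> p \<le> X \<Longrightarrow>
    reach (Suc i) j (a (Suc i)) (q - X) (c + d i j * real X)"
| diag: "reach i j p q c \<Longrightarrow> i < n \<Longrightarrow> j < m \<Longrightarrow> p \<le> X \<Longrightarrow> q \<le> X \<Longrightarrow>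
    reach (Suc i) (Suc j) (a (Suc i)) (b (Suc j)) (c + d i j * real X)"

lemma reach_bounds: "reach i j p q c \<Longrightarrow> p \<le> a i \<and> q \<le> b j"
  by (induction rule: reach.induct) auto

definition rowsum :: "nat \<Rightarrow> int" where "rowsum i = (\<Sum>k<i. int (a k))"
definition colsum :: "nat \<Rightarrow> int" where "colsum j = (\<Sum>k<j. int (b k))"

lemma rowsum_Suc [simp]: "rowsum (Suc i) = rowsum i + int (a i)" by (simp add: rowsum_def)
lemma colsum_Suc [simp]: "colsum (Suc i) = colsum i + int (b i)" by (simp add: colsum_def)
lemma rowsum_0 [simp]: "rowsum 0 = 0" by (simp add: rowsum_def)
lemma colsum_0 [simp]: "colsum 0 = 0" by (simp add: colsum_def)

lemma rowsum_mono: "i \<le> i' \<Longrightarrow> rowsum i \<le> rowsum i'"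
  unfolding rowsum_def by (intro sum_mono2) auto

lemma colsum_mono: "i \<le> i' \<Longrightarrow> colsum i \<le> colsum i'"
  unfolding colsum_def by (intro sum_mono2) auto

text \<open>The diagonal through the upper left corner of block \<open>(i, j)\<close>, as column
  minus row.\<close>

definition crn :: "nat \<Rightarrow> nat \<Rightarrow> int" where
  "crn i j = colsum j - rowsum i"

text \<open>An upper bound for the cost of one explicit path. It plays the role of infinity on
  diagonals that have not been reached.\<close>

definition total :: real where
  "total = (\<Sum>i<n. \<Sum>j<m. d i j * (real (a i) + real (b j)))"

lemma total_nonneg: "0 \<le> total"
  unfolding total_def by (intro sum_nonneg mult_nonneg_nonneg d) auto

text \<open>The length of diagonal \<open>z\<close> inside the block: it rises with slope 1, stays
  at the smaller side length and falls again. Its four kinks are the corner diagonals, so four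
  touches can add it.\<close>

definition trap :: "nat \<Rightarrow> nat \<Rightarrow> int \<Rightarrow> real" where
  "trap i j z = ipos (z - crn (Suc i) j) - ipos (z - crn i j) - ipos (z - crn (Suc i) (Suc j)) + ipos (z - crn i (Suc j))"

definition push1 :: "nat \<Rightarrow> nat \<Rightarrow> (int \<Rightarrow> real) \<Rightarrow> int \<Rightarrow> real" where
  "push1 i j h = pushl (crn (Suc i) j) (crn i j) (d i j) h"

definition push2 :: "nat \<Rightarrow> nat \<Rightarrow> (int \<Rightarrow> real) \<Rightarrow> int \<Rightarrow> real" where
  "push2 i j h = mirror (pushl (- crn i (Suc j)) (- crn i j) (d i j) (mirror h))"

definition pushed :: "nat \<Rightarrow> nat \<Rightarrow> (int \<Rightarrow> real) \<Rightarrow> int \<Rightarrow> real" where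
  "pushed i j h = push2 i j (push1 i j h)"

definition step :: "nat \<Rightarrow> nat \<Rightarrow> (int \<Rightarrow> real) \<Rightarrow> int \<Rightarrow> real" where
  "step i j h z = pushed i j h z + d i j * trap i j z"

lemma crn_Suc: "crn (Suc i) j = crn i j - int (a i)" "crn i (Suc j) = crn i j + int (b j)"
  by (simp_all add: crn_def)

lemma push2_outside: "z \<le> crn i j \<or> crn i (Suc j) < z \<Longrightarrow> push2 i j h z = h z"
  unfolding push2_def mirror_def by (subst pushl_outside) auto

lemma push1_outside: "crn i j \<le> z \<or> z < crn (Suc i) j \<Longrightarrow> push1 i j h z = h z"
  unfolding push1_def by (subst pushl_outside) auto

lemma push2_le:
  assumes "crn i j \<le> l" "l \<le> z" "z \<le> crn i (Suc j)"
  shows "push2 i j h z \<le> h l + d i j * real_of_int (z - l)"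
  using pushl_le[of "- crn i (Suc j)" "- z" "- l" "- crn i j" "d i j" "mirror h"] assms
  unfolding push2_def mirror_def by simp

lemma pushed_left: "z \<le> crn i j \<Longrightarrow> pushed i j h z = push1 i j h z"
  unfolding pushed_def by (rule push2_outside) simp

lemma pushed_le_left:
  assumes "crn (Suc i) j \<le> z" "z \<le> l" "l \<le> crn i j"
  shows "pushed i j h z \<le> h l + d i j * real_of_int (l - z)"
  using pushl_le[OF assms] assms pushed_left unfolding push1_def by simp

lemma pushed_le_right:
  assumes "crn i j \<le> l" "l \<le> z" "z \<le> crn i (Suc j)"
  shows "pushed i j h z \<le> h l + d i j * real_of_int (z - l)"
  using push2_le[OF assms, of "push1 i j h"] assms(1) push1_outside[of i j l h]
  unfolding pushed_def by simp

lemma pushed_attained_left: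
  assumes "crn (Suc i) j \<le> z" "z \<le> crn i j"
  obtains l where "z \<le> l" "l \<le> crn i j" "pushed i j h z = h l + d i j * real_of_int (l - z)"
  using pushl_attained[OF assms, of "d i j" h] that pushed_left[OF assms(2)] unfolding push1_def by metis

lemma pushed_attained_right:
  assumes "crn i j \<le> z" "z \<le> crn i (Suc j)"
  obtains l where "crn i j \<le> l" "l \<le> z" "pushed i j h z = h l + d i j * real_of_int (z - l)"
proof -
  obtain l where "- z \<le> l" "l \<le> - crn i j"
    "pushl (- crn i (Suc j)) (- crn i j) (d i j) (mirror (push1 i j h)) (- z) = mirror (push1 i j h) l + d i j * real_of_int (l - - z)"
    using assms by (elim pushl_attained[of "- crn i (Suc j)" "- z" "- crn i j", rotated 2]) auto
  then show thesis
    using that[of "- l"] push1_outside[of i j "- l" h] by (simp add: pushed_def push2_def mirror_def add.commute)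
qed

lemma pushed_outside: "z < crn (Suc i) j \<or> crn i (Suc j) < z \<Longrightarrow> pushed i j h z = h z"
  unfolding pushed_def using push2_outside push1_outside by (auto simp: crn_Suc)

lemma pushed_le_self: "pushed i j h z \<le> h z"
proof -
  have "pushed i j h z \<le> mirror (push1 i j h) (- z)"
    unfolding pushed_def push2_def mirror_def[of "pushl _ _ _ _"] by (rule pushl_le_self)
  also have "\<dots> \<le> h z" unfolding mirror_def push1_def by (simp add: pushl_le_self)
  finally show ?thesis .
qed

lemma trap_outside: "z \<le> crn (Suc i) j \<or> crn i (Suc j) \<le> z \<Longrightarrow> trap i j z = 0"
  by (auto simp: trap_def ipos_def crn_Suc)

lemma trap_nonneg: "0 \<le> trap i j z"
  by (simp add: trap_def ipos_def crn_Suc max_def)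

lemma trap_le: "trap i j z \<le> real (a i) + real (b j)"
  by (simp add: trap_def ipos_def crn_Suc max_def)

lemma step_outside_le: "z \<le> crn (Suc i) j \<or> crn i (Suc j) \<le> z \<Longrightarrow> step i j h z \<le> h z"
  unfolding step_def by (subst trap_outside) (auto simp: pushed_le_self)

lemma step_outside: "z < crn (Suc i) j \<or> crn i (Suc j) < z \<Longrightarrow> step i j h z = h z"
  unfolding step_def by (subst trap_outside) (auto simp: pushed_outside)

subsection \<open>Soundness and completeness of one step\<close>

text \<open>Either \<open>v\<close> says nothing, being at least \<open>total\<close>, or it pays
  for a state of the grid. The state may ask for fewer letters than \<open>p\<close> and
  \<open>q\<close>, as that is never a disadvantage.\<close>

definition sound :: "nat \<Rightarrow> nat \<Rightarrow> nat \<Rightarrow> nat \<Rightarrow> real \<Rightarrow> bool" where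
  "sound i j p q v \<longleftrightarrow> total \<le> v \<or> (\<exists>p' q' c. reach i j p' q' c \<and> p' \<le> p \<and> q' \<le> q \<and> c \<le> v)"

text \<open>The edges are open, because a corner diagonal is shared by several blocks; corners have
  a predicate of their own.\<close>

definition sound_left :: "nat \<Rightarrow> nat \<Rightarrow> (int \<Rightarrow> real) \<Rightarrow> bool" where
  "sound_left i j h \<longleftrightarrow> (\<forall>p. 0 < p \<longrightarrow> p < a i \<longrightarrow> sound i j p (b j) (h (crn (Suc i) j + int p)))"

definition sound_top :: "nat \<Rightarrow> nat \<Rightarrow> (int \<Rightarrow> real) \<Rightarrow> bool" where
  "sound_top i j h \<longleftrightarrow> (\<forall>q. 0 < q \<longrightarrow> q < b j \<longrightarrow> sound i j (a i) q (h (crn i (Suc j) - int q)))"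

definition sound_corner :: "nat \<Rightarrow> nat \<Rightarrow> (int \<Rightarrow> real) \<Rightarrow> bool" where
  "sound_corner i j h \<longleftrightarrow> sound i j (a i) (b j) (h (crn i j))"

lemma sound_leftD:
  assumes "sound_left i j h" "sound_corner i j h" "crn (Suc i) j < l" "l \<le> crn i j"
  shows "sound i j (nat (l - crn (Suc i) j)) (b j) (h l)"
proof (cases "l = crn i j")
  case True
  then show ?thesis using assms(2) by (simp add: sound_corner_def crn_Suc)
next
  case False
  then show ?thesis
    using assms(1)[unfolded sound_left_def, rule_format, of "nat (l - crn (Suc i) j)"] assms(3,4)
    by (simp add: crn_Suc nat_less_iff)
qed

lemma sound_topD:
  assumes "sound_top i j h" "sound_corner i j h" "crn i j \<le> l" "l < crn i (Suc j)"
  shows "sound i j (a i) (nat (crn i (Suc j) - l)) (h l)"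
proof (cases "l = crn i j")
  case True
  then show ?thesis using assms(2) by (simp add: sound_corner_def crn_Suc)
next
  case False
  then show ?thesis
    using assms(1)[unfolded sound_top_def, rule_format, of "nat (crn i (Suc j) - l)"] assms(3,4)
    by (simp add: crn_Suc nat_less_iff)
qed

lemma sound_moves:
  assumes s: "sound i j p q v" and i: "i < n" "j < m" and v: "v + d i j * real X \<le> v'"
  shows "q \<le> X \<Longrightarrow> p - X \<le> p' \<Longrightarrow> sound i (Suc j) p' (b (Suc j)) v'"
    and "p \<le> X \<Longrightarrow> q - X \<le> q' \<Longrightarrow> sound (Suc i) j (a (Suc i)) q' v'"
    and "p \<le> X \<Longrightarrow> q \<le> X \<Longrightarrow> sound (Suc i) (Suc j) (a (Suc i)) (b (Suc j)) v'"
proof -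
  have vv: "v \<le> v'" using v mult_nonneg_nonneg[OF d[of i j], of "real X"] by simp
  have *: "total \<le> v' \<or> (\<exists>p0 q0 c. reach i j p0 q0 c \<and> p0 \<le> p \<and> q0 \<le> q \<and> c + d i j * real X \<le> v')"
    using s v vv unfolding sound_def by fastforce
  consider "total \<le> v'" | p0 q0 c where "reach i j p0 q0 c" "p0 \<le> p" "q0 \<le> q" "c + d i j * real X \<le> v'"
    using * by blast
  note cases = this
  show "sound i (Suc j) p' (b (Suc j)) v'" if "q \<le> X" "p - X \<le> p'"
  proof (rule cases)
    fix p0 q0 c assume r: "reach i j p0 q0 c" "p0 \<le> p" "q0 \<le> q" "c + d i j * real X \<le> v'"
    have "q0 \<le> X" using r that by simp
    from right[OF r(1) i this] show ?thesis
      unfolding sound_def using r that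
      by (intro disjI2 exI[of _ "p0 - X"] exI[of _ "b (Suc j)"] exI[of _ "c + d i j * real X"]) auto
  qed (simp add: sound_def)
  show "sound (Suc i) j (a (Suc i)) q' v'" if "p \<le> X" "q - X \<le> q'"
  proof (rule cases)
    fix p0 q0 c assume r: "reach i j p0 q0 c" "p0 \<le> p" "q0 \<le> q" "c + d i j * real X \<le> v'"
    have "p0 \<le> X" using r that by simp
    from down[OF r(1) i this] show ?thesis
      unfolding sound_def using r that
      by (intro disjI2 exI[of _ "a (Suc i)"] exI[of _ "q0 - X"] exI[of _ "c + d i j * real X"]) auto
  qed (simp add: sound_def)
  show "sound (Suc i) (Suc j) (a (Suc i)) (b (Suc j)) v'" if "p \<le> X" "q \<le> X"
  proof (rule cases)
    fix p0 q0 c assume r: "reach i j p0 q0 c" "p0 \<le> p" "q0 \<le> q" "c + d i j * real X \<le> v'"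
    have "p0 \<le> X" "q0 \<le> X" using r that by simp_all
    from diag[OF r(1) i this] show ?thesis
      unfolding sound_def using r that
      by (intro disjI2 exI[of _ "a (Suc i)"] exI[of _ "b (Suc j)"] exI[of _ "c + d i j * real X"]) auto
  qed (simp add: sound_def)
qed

lemma trap_cases:
  "z \<le> crn i j \<Longrightarrow> crn (Suc i) j \<le> z \<Longrightarrow> z \<le> crn (Suc i) (Suc j) \<Longrightarrow> trap i j z = real_of_int (z - crn (Suc i) j)"
  "z \<le> crn i j \<Longrightarrow> crn (Suc i) (Suc j) \<le> z \<Longrightarrow> trap i j z = real (b j)"
  "crn i j \<le> z \<Longrightarrow> z \<le> crn (Suc i) (Suc j) \<Longrightarrow> trap i j z = real (a i)"
  "crn i j \<le> z \<Longrightarrow> crn (Suc i) (Suc j) \<le> z \<Longrightarrow> z \<le> crn i (Suc j) \<Longrightarrow> trap i j z = real_of_int (crn i (Suc j) - z)"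
  by (auto simp: trap_def ipos_def crn_Suc)

text \<open>Take the source \<open>l\<close> that attains the minimum. Going from it to
  \<open>z\<close> matches \<open>trap + |l - z|\<close> pairs inside the block, and this number is
  \<open>X\<close>; it finishes run \<open>j\<close> if \<open>z\<close> leaves on the right and run
  \<open>i\<close> if it leaves at the bottom. The first alternative concerns the two extreme
  diagonals, which only touch the block in a corner.\<close>

lemma step_source:
  assumes sl: "sound_left i j h" and stp: "sound_top i j h" and sc: "sound_corner i j h"
    and z: "crn (Suc i) j \<le> z" "z \<le> crn i (Suc j)"
  shows "step i j h z = h z \<and> (z = crn (Suc i) j \<or> z = crn i (Suc j)) \<or>
    (\<exists>X p q v. sound i j p q v \<and> v + d i j * real X \<le> step i j h z \<and>
       (crn (Suc i) (Suc j) \<le> z \<longrightarrow> q \<le> X \<and> int (p - X) \<le> z - crn (Suc i) (Suc j)) \<and>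
       (z \<le> crn (Suc i) (Suc j) \<longrightarrow> p \<le> X \<and> int (q - X) \<le> crn (Suc i) (Suc j) - z))"
proof (cases "z \<le> crn i j")
  case True
  with z(1) obtain l where l: "z \<le> l" "l \<le> crn i j" "pushed i j h z = h l + d i j * real_of_int (l - z)"
    by (rule pushed_attained_left)
  show ?thesis
  proof (cases "l = crn (Suc i) j")
    case True
    then have "z = crn (Suc i) j" using l z by simp
    then show ?thesis using True l(3) by (simp add: step_def trap_outside)
  next
    case False
    define p where "p = nat (l - crn (Suc i) j)"
    have lp: "l = crn (Suc i) j + int p" using l z by (simp add: p_def)
    have s: "sound i j p (b j) (h l)" unfolding p_def
      by (rule sound_leftD[OF sl sc]) (use False l z in auto)
    show ?thesis
    proof (cases "crn (Suc i) (Suc j) \<le> z")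
      case T: True
      \<comment> \<open>Enough pairs to cross the whole width \<open>b j\<close>, and
        \<open>l - z\<close> more to sink from diagonal \<open>l\<close> to
        \<open>z\<close>.\<close>
      define X where "X = nat (int (b j) + l - z)"
      have X: "int X = int (b j) + l - z" using l by (simp add: X_def)
      then have rX: "real X = real (b j) + real_of_int (l - z)" by linarith
      have "h l + d i j * real X \<le> step i j h z"
        unfolding rX step_def l(3) trap_cases(2)[OF True T] by (simp add: algebra_simps)
      moreover have "b j \<le> X" using X l by linarith
      moreover have "int (p - X) \<le> z - crn (Suc i) (Suc j)" using X lp T by (simp add: crn_Suc)
      moreover have "p \<le> X" "int (b j - X) \<le> crn (Suc i) (Suc j) - z" if "z \<le> crn (Suc i) (Suc j)"
        using X lp T that l by (simp_all add: crn_Suc)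
      ultimately show ?thesis using s by blast
    next
      case F: False
      have "h l + d i j * real p \<le> step i j h z"
        using True F z lp by (simp add: step_def l(3) trap_cases(1) algebra_simps)
      moreover have "int (b j - p) \<le> crn (Suc i) (Suc j) - z" using lp F l by (simp add: crn_Suc)
      ultimately show ?thesis using s F by (intro disjI2 exI[of _ p] exI[of _ "b j"] exI[of _ "h l"]) auto
    qed
  qed
next
  case False
  then have zc: "crn i j \<le> z" by simp
  then obtain l where l: "crn i j \<le> l" "l \<le> z" "pushed i j h z = h l + d i j * real_of_int (z - l)"
    using z(2) by (rule pushed_attained_right)
  show ?thesis
  proof (cases "l = crn i (Suc j)")
    case True
    then have "z = crn i (Suc j)" using l z by simp
    then show ?thesis using True l(3) by (simp add: step_def trap_outside)
  next
    case nl: False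
    define q where "q = nat (crn i (Suc j) - l)"
    have lq: "l = crn i (Suc j) - int q" using l z by (simp add: q_def)
    have s: "sound i j (a i) q (h l)" unfolding q_def
      by (rule sound_topD[OF stp sc]) (use nl l z in auto)
    show ?thesis
    proof (cases "z \<le> crn (Suc i) (Suc j)")
      case T: True
      define X where "X = nat (int (a i) + z - l)"
      have X: "int X = int (a i) + z - l" using l by (simp add: X_def)
      then have rX: "real X = real (a i) + real_of_int (z - l)" by linarith
      have "h l + d i j * real X \<le> step i j h z"
        unfolding rX step_def l(3) trap_cases(3)[OF zc T] by (simp add: algebra_simps)
      moreover have "a i \<le> X" using X l by linarith
      moreover have "int (q - X) \<le> crn (Suc i) (Suc j) - z" using X lq T by (simp add: crn_Suc)
      moreover have "q \<le> X" "int (a i - X) \<le> z - crn (Suc i) (Suc j)" if "crn (Suc i) (Suc j) \<le> z"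
        using X lq T that l by (simp_all add: crn_Suc)
      ultimately show ?thesis using s by blast
    next
      case F: False
      have rq: "real q = real_of_int (crn i (Suc j) - z) + real_of_int (z - l)" using lq by linarith
      have F': "crn (Suc i) (Suc j) \<le> z" using F by simp
      have "h l + d i j * real q \<le> step i j h z"
        unfolding rq step_def l(3) trap_cases(4)[OF zc F' z(2)] by (simp add: algebra_simps)
      moreover have "int (a i - q) \<le> z - crn (Suc i) (Suc j)" using lq F l by (simp add: crn_Suc)
      ultimately show ?thesis using s F by (intro disjI2 exI[of _ q] exI[of _ "a i"] exI[of _ "h l"]) auto
    qed
  qed
qed

lemma step_sound:
  assumes ij: "i < n" "j < m" and s: "sound_left i j h" "sound_top i j h" "sound_corner i j h"
  shows "sound_left i (Suc j) (step i j h)" "sound_top (Suc i) j (step i j h)"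
    "sound_corner (Suc i) (Suc j) (step i j h)"
    "sound_corner (Suc i) j h \<Longrightarrow> sound_corner (Suc i) j (step i j h)"
    "sound_corner i (Suc j) h \<Longrightarrow> sound_corner i (Suc j) (step i j h)"
proof -
  note src = step_source[OF s]
  have ab: "0 < a i" "0 < b j" using a b ij by auto
  show "sound_left i (Suc j) (step i j h)"
    unfolding sound_left_def
  proof (intro allI impI)
    fix p assume p: "0 < p" "p < a i"
    let ?z = "crn (Suc i) (Suc j) + int p"
    have "crn (Suc i) j \<le> ?z" "?z \<le> crn i (Suc j)" "?z \<noteq> crn (Suc i) j" "?z \<noteq> crn i (Suc j)" "crn (Suc i) (Suc j) \<le> ?z"
      using p by (simp_all add: crn_Suc)
    then obtain X p' q v where "sound i j p' q v" "v + d i j * real X \<le> step i j h ?z" "q \<le> X" "int (p' - X) \<le> int p"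
      using src[of ?z] by fastforce
    then show "sound i (Suc j) p (b (Suc j)) (step i j h ?z)"
      by (intro sound_moves(1)[OF _ ij, of p' q v X]) auto
  qed
  show "sound_top (Suc i) j (step i j h)"
    unfolding sound_top_def
  proof (intro allI impI)
    fix q assume q: "0 < q" "q < b j"
    let ?z = "crn (Suc i) (Suc j) - int q"
    have "crn (Suc i) j \<le> ?z" "?z \<le> crn i (Suc j)" "?z \<noteq> crn (Suc i) j" "?z \<noteq> crn i (Suc j)" "?z \<le> crn (Suc i) (Suc j)"
      using q by (simp_all add: crn_Suc)
    then obtain X p q' v where "sound i j p q' v" "v + d i j * real X \<le> step i j h ?z" "p \<le> X" "int (q' - X) \<le> int q"
      using src[of ?z] by fastforce
    then show "sound (Suc i) j (a (Suc i)) q (step i j h ?z)"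
      by (intro sound_moves(2)[OF _ ij, of p q' v X]) auto
  qed
  show "sound_corner (Suc i) (Suc j) (step i j h)"
  proof -
    let ?z = "crn (Suc i) (Suc j)"
    have "crn (Suc i) j \<le> ?z" "?z \<le> crn i (Suc j)" "?z \<noteq> crn (Suc i) j" "?z \<noteq> crn i (Suc j)"
      using ab by (simp_all add: crn_Suc)
    then obtain X p q v where "sound i j p q v" "v + d i j * real X \<le> step i j h ?z" "p \<le> X" "q \<le> X"
      using src[of ?z] by fastforce
    then show ?thesis unfolding sound_corner_def
      by (intro sound_moves(3)[OF _ ij, of p q v X]) auto
  qed
  show "sound_corner (Suc i) j (step i j h)" if "sound_corner (Suc i) j h"
  proof -
    let ?z = "crn (Suc i) j"
    have "crn (Suc i) j \<le> ?z" "?z \<le> crn i (Suc j)" "?z \<le> crn (Suc i) (Suc j)"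
      using ab by (simp_all add: crn_Suc)
    then consider "step i j h ?z = h ?z" | X p q v where "sound i j p q v" "v + d i j * real X \<le> step i j h ?z" "p \<le> X" "int (q - X) \<le> int (b j)"
      using src[of ?z] unfolding crn_Suc by fastforce
    then show ?thesis
    proof cases
      case 1
      then show ?thesis using that by (simp add: sound_corner_def)
    next
      case 2
      then show ?thesis unfolding sound_corner_def by (intro sound_moves(2)[OF _ ij, of p q v X]) auto
    qed
  qed
  show "sound_corner i (Suc j) (step i j h)" if "sound_corner i (Suc j) h"
  proof -
    let ?z = "crn i (Suc j)"
    have "crn (Suc i) j \<le> ?z" "?z \<le> crn i (Suc j)" "crn (Suc i) (Suc j) \<le> ?z"
      using ab by (simp_all add: crn_Suc)
    then consider "step i j h ?z = h ?z" | X p q v where "sound i j p q v" "v + d i j * real X \<le> step i j h ?z" "q \<le> X" "int (p - X) \<le> int (a i)"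
      using src[of ?z] unfolding crn_Suc by fastforce
    then show ?thesis
    proof cases
      case 1
      then show ?thesis using that by (simp add: sound_corner_def)
    next
      case 2
      then show ?thesis unfolding sound_corner_def by (intro sound_moves(1)[OF _ ij, of p q v X]) auto
    qed
  qed
qed

text \<open>Among the diagonals known to cost at most \<open>c\<close>, use the one nearest to
  \<open>z\<close>. Its distance to \<open>z\<close> plus the trapezoid is then at most
  \<open>X\<close>.\<close>

lemma step_complete:
  assumes cells: "q = b j \<and> (\<forall>l. crn (Suc i) j + int p \<le> l \<longrightarrow> l \<le> crn i j \<longrightarrow> h l \<le> c) \<or>
      p = a i \<and> (\<forall>l. crn i j \<le> l \<longrightarrow> l \<le> crn i (Suc j) - int q \<longrightarrow> h l \<le> c)"
    and pq: "p \<le> a i" "q \<le> b j"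
  shows "q \<le> X \<Longrightarrow> crn (Suc i) (Suc j) + int (p - X) \<le> z \<Longrightarrow> z \<le> crn i (Suc j) \<Longrightarrow> step i j h z \<le> c + d i j * real X"
    and "p \<le> X \<Longrightarrow> crn (Suc i) j \<le> z \<Longrightarrow> z \<le> crn (Suc i) (Suc j) - int (q - X) \<Longrightarrow> step i j h z \<le> c + d i j * real X"
proof -
  have mono: "step i j h z \<le> c + d i j * real X"
    if "h l \<le> c" "pushed i j h z \<le> h l + d i j * y" "trap i j z + y \<le> real X" for l y
  proof -
    have "d i j * (trap i j z + y) \<le> d i j * real X" by (rule mult_left_mono[OF that(3) d])
    then show ?thesis using that(1,2) by (simp add: step_def algebra_simps)
  qed
  \<comment> \<open>Both kinds of cells contain the corner, so a target beyond it can be served from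
    there.\<close>
  have hc: "h (crn i j) \<le> c" using cells pq by (auto simp: crn_Suc)
  note L = pushed_le_left[of i j z _ h] and Rr = pushed_le_right[of i j _ z h]
  show "step i j h z \<le> c + d i j * real X"
    if X: "q \<le> X" and z: "crn (Suc i) (Suc j) + int (p - X) \<le> z" "z \<le> crn i (Suc j)"
    using cells
  proof (elim disjE conjE)
    assume q: "q = b j" and cl: "\<forall>l. crn (Suc i) j + int p \<le> l \<longrightarrow> l \<le> crn i j \<longrightarrow> h l \<le> c"
    show ?thesis
    proof (cases "z \<le> crn i j")
      case True
      let ?l = "max z (crn (Suc i) j + int p)"
      show ?thesis
        by (rule mono[of ?l, OF _ L]) (use True cl z X q pq in \<open>auto simp: trap_cases(2) crn_Suc max_def\<close>)
    next
      case False
      show ?thesis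
        by (rule mono[of "crn i j", OF hc Rr]) (use False z X q in \<open>auto simp: trap_cases(4) crn_Suc\<close>)
    qed
  next
    assume p: "p = a i" and ct: "\<forall>l. crn i j \<le> l \<longrightarrow> l \<le> crn i (Suc j) - int q \<longrightarrow> h l \<le> c"
    show ?thesis
    proof (cases "crn i j \<le> z")
      case True
      let ?l = "min z (crn i (Suc j) - int q)"
      show ?thesis
        by (rule mono[of ?l, OF _ Rr]) (use True ct z X p pq in \<open>auto simp: trap_cases(4) crn_Suc min_def\<close>)
    next
      case False
      show ?thesis
        by (rule mono[of "crn i j", OF hc L]) (use False z X p in \<open>auto simp: trap_cases(2) crn_Suc\<close>)
    qed
  qed
  show "step i j h z \<le> c + d i j * real X"
    if X: "p \<le> X" and z: "crn (Suc i) j \<le> z" "z \<le> crn (Suc i) (Suc j) - int (q - X)"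
    using cells
  proof (elim disjE conjE)
    assume q: "q = b j" and cl: "\<forall>l. crn (Suc i) j + int p \<le> l \<longrightarrow> l \<le> crn i j \<longrightarrow> h l \<le> c"
    show ?thesis
    proof (cases "z \<le> crn i j")
      case True
      let ?l = "max z (crn (Suc i) j + int p)"
      show ?thesis
        by (rule mono[of ?l, OF _ L]) (use True cl z X q pq in \<open>auto simp: trap_cases(1) crn_Suc max_def\<close>)
    next
      case False
      show ?thesis
        by (rule mono[of "crn i j", OF hc Rr]) (use False z X q in \<open>auto simp: trap_cases(3) crn_Suc\<close>)
    qed
  next
    assume p: "p = a i" and ct: "\<forall>l. crn i j \<le> l \<longrightarrow> l \<le> crn i (Suc j) - int q \<longrightarrow> h l \<le> c"
    show ?thesis
    proof (cases "crn i j \<le> z")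
      case True
      let ?l = "min z (crn i (Suc j) - int q)"
      show ?thesis
        by (rule mono[of ?l, OF _ Rr]) (use True ct z X p pq in \<open>auto simp: trap_cases(3) crn_Suc min_def\<close>)
    next
      case False
      show ?thesis
        by (rule mono[of "crn i j", OF hc L]) (use False z X p in \<open>auto simp: trap_cases(1) crn_Suc\<close>)
    qed
  qed
qed

end

section \<open>The invariant of the sweep over the blocks\<close>

context grid
begin

definition cmpl_corner :: "nat \<Rightarrow> nat \<Rightarrow> (int \<Rightarrow> real) \<Rightarrow> bool" where
  "cmpl_corner I J h \<longleftrightarrow> (\<forall>i j p q c X. I = Suc i \<longrightarrow> J = Suc j \<longrightarrow> reach i j p q c \<longrightarrow> p \<le> X \<longrightarrow> q \<le> X \<longrightarrow>
     h (crn I J) \<le> c + d i j * real X)"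

text \<open>A move bounds \<open>h\<close> on its own diagonal and on every diagonal of the edge
  that leaves more letters open. This monotone closure is what lets the pushes look in one direction
  only.\<close>

definition cmpl_top :: "nat \<Rightarrow> nat \<Rightarrow> (int \<Rightarrow> real) \<Rightarrow> bool" where
  "cmpl_top I j h \<longleftrightarrow> (\<forall>i p q c X z. I = Suc i \<longrightarrow> reach i j p q c \<longrightarrow> p \<le> X \<longrightarrow>
     crn I j \<le> z \<longrightarrow> z \<le> crn I (Suc j) - int (q - X) \<longrightarrow> h z \<le> c + d i j * real X)"

definition cmpl_left :: "nat \<Rightarrow> nat \<Rightarrow> (int \<Rightarrow> real) \<Rightarrow> bool" where
  "cmpl_left i J h \<longleftrightarrow> (\<forall>j p q c X z. J = Suc j \<longrightarrow> reach i j p q c \<longrightarrow> q \<le> X \<longrightarrow>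
     crn (Suc i) J + int (p - X) \<le> z \<longrightarrow> z \<le> crn i J \<longrightarrow> h z \<le> c + d i j * real X)"

text \<open>In the columns before \<open>j\<close> row \<open>i\<close> has been processed, so there
  the staircase runs below it.\<close>

definition level :: "nat \<Rightarrow> nat \<Rightarrow> nat \<Rightarrow> nat" where
  "level i j J = (if J < j then Suc i else i)"

text \<open>The blocks are processed row by row; \<open>Inv i j\<close> holds before block \<open>(i, j)\<close>.  The array \<open>h\<close> then
  describes the staircase that separates the processed blocks from the others.\<close>

definition Inv :: "nat \<Rightarrow> nat \<Rightarrow> (int \<Rightarrow> real) \<Rightarrow> bool" where
  "Inv i j h \<longleftrightarrow> sound_left i j h \<and> cmpl_left i j h \<and>
     (\<forall>J<m. sound_top (level i j J) J h \<and> cmpl_top (level i j J) J h) \<and>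
     (\<forall>J. j \<le> J \<longrightarrow> J \<le> m \<longrightarrow> sound_corner i J h \<and> cmpl_corner i J h) \<and>
     (\<forall>J\<le>j. sound_corner (Suc i) J h \<and> cmpl_corner (Suc i) J h) \<and>
     (\<forall>z<crn (Suc i) 0. h z = total) \<and> h (crn (Suc i) 0) \<le> total \<and>
     (i = 0 \<longrightarrow> j = 0 \<longrightarrow> h 0 \<le> 0)"

definition init :: "int \<Rightarrow> real" where
  "init z = (if z = 0 then 0 else total)"

lemma crn_mono: "J \<le> J' \<Longrightarrow> crn i J \<le> crn i J'"
  using colsum_mono by (simp add: crn_def)

lemma crn_strict: "J < J' \<Longrightarrow> J < m \<Longrightarrow> crn i J < crn i J'"
  using crn_mono[of "Suc J" J' i] b[of J] by (simp add: crn_Suc)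

lemma sound_total: "total \<le> v \<Longrightarrow> sound i j p q v"
  by (simp add: sound_def)

lemma Inv_init: "Inv 0 0 init"
proof -
  have c0: "crn 0 0 = 0" by (simp add: crn_def)
  have "sound_left 0 0 init"
    unfolding sound_left_def by (auto simp: init_def crn_Suc c0 intro: sound_total)
  moreover have "sound_top 0 J init" if "J < m" for J
    unfolding sound_top_def
  proof (intro allI impI)
    fix q assume "0 < q" "q < b J"
    then have "crn 0 (Suc J) - int q \<noteq> 0" using crn_mono[of 0 J 0] c0 by (simp add: crn_Suc)
    then show "sound 0 J (a 0) q (init (crn 0 (Suc J) - int q))" by (simp add: init_def sound_total)
  qed
  moreover have "sound_corner 0 J init" if "J \<le> m" for J
  proof (cases "J = 0")
    case True
    then show ?thesis using start by (auto simp: sound_corner_def sound_def init_def c0)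
  next
    case False
    then have "crn 0 J \<noteq> 0" using crn_strict[of 0 J 0] m c0 by simp
    then show ?thesis by (simp add: sound_corner_def init_def sound_total)
  qed
  moreover have "crn (Suc 0) 0 \<noteq> 0" using a[of 0] n by (simp add: crn_Suc c0)
  then have "sound_corner (Suc 0) 0 init" "init (crn (Suc 0) 0) \<le> total"
    by (simp_all add: sound_corner_def init_def sound_total)
  ultimately show ?thesis
    using a[of 0] n
    by (auto simp: Inv_def cmpl_left_def cmpl_top_def cmpl_corner_def level_def init_def crn_Suc c0)
qed

text \<open>No path has come below the lower end of the staircase, so \<open>h\<close> is
  \<open>total\<close> there and the left edge of the new row is sound for lack of
  information.\<close>

lemma Inv_row:
  assumes I: "Inv i m h" and i: "Suc i < n"
  shows "Inv (Suc i) 0 h"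
proof -
  have low: "h z = total" if "z < crn (Suc i) 0" for z using I that by (simp add: Inv_def)
  have lt: "crn (Suc (Suc i)) 0 < crn (Suc i) 0" using a[OF i] by (simp add: crn_Suc)
  have "sound_left (Suc i) 0 h"
    unfolding sound_left_def
  proof (intro allI impI)
    fix p assume "0 < p" "p < a (Suc i)"
    then have "h (crn (Suc (Suc i)) 0 + int p) = total" by (intro low) (simp add: crn_Suc)
    then show "sound (Suc i) 0 p (b 0) (h (crn (Suc (Suc i)) 0 + int p))" by (simp add: sound_total)
  qed
  moreover have "sound_corner (Suc (Suc i)) 0 h"
    unfolding sound_corner_def using low[OF lt] by (simp add: sound_total)
  moreover have "cmpl_corner (Suc (Suc i)) 0 h" "cmpl_left (Suc i) 0 h"
    by (simp_all add: cmpl_corner_def cmpl_left_def)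
  ultimately show ?thesis
    using I low lt by (simp add: Inv_def level_def)
qed

text \<open>The last rule used tells how the block was entered: from the left with run
  \<open>j\<close> untouched, from above with run \<open>i\<close> untouched, or at the corner with
  both. This selects the part of the invariant that applies.\<close>

lemma Inv_cells:
  assumes I: "Inv i j h" and "j < m" and r: "reach i j p q c"
  shows "q = b j \<and> (\<forall>l. crn (Suc i) j + int p \<le> l \<longrightarrow> l \<le> crn i j \<longrightarrow> h l \<le> c) \<or>
      p = a i \<and> (\<forall>l. crn i j \<le> l \<longrightarrow> l \<le> crn i (Suc j) - int q \<longrightarrow> h l \<le> c)"
  using r
proof (cases rule: reach.cases)
  case start
  then have "h 0 \<le> 0" using I by (simp add: Inv_def)
  then show ?thesis using start by (auto simp: crn_def)
next
  case (right j' p' q' c' X)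
  have "cmpl_left i j h" using I by (simp add: Inv_def)
  then show ?thesis using right unfolding cmpl_left_def by blast
next
  case (down i' p' q' c' X)
  have "cmpl_top i j h" using I assms(2) by (auto simp: Inv_def level_def dest: spec[of _ j])
  then show ?thesis using down unfolding cmpl_top_def by blast
next
  case (diag i' j' p' q' c' X)
  have "cmpl_corner i j h" using I assms(2) by (simp add: Inv_def)
  then have "h (crn i j) \<le> c" using diag unfolding cmpl_corner_def by blast
  moreover have "crn (Suc i) j + int p = crn i j" using diag by (simp add: crn_Suc)
  ultimately show ?thesis using diag by (metis order_antisym)
qed

text \<open>Strictly outside the diagonals of the block nothing changes. On its two extreme
  diagonals values can only drop, which keeps completeness, and \<open>step_sound\<close> keeps them
  sound.\<close>

lemma Inv_step:
  assumes I: "Inv i j h" and ij: "i < n" "j < m"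
  shows "Inv i (Suc j) (step i j h)"
proof -
  let ?h = "step i j h"
  have lo: "?h z \<le> h z" if "z \<le> crn (Suc i) j \<or> crn i (Suc j) \<le> z" for z
    by (rule step_outside_le[OF that])
  have eq: "?h z = h z" if "z < crn (Suc i) j \<or> crn i (Suc j) < z" for z
    by (rule step_outside[OF that])
  have It: "sound_top (level i j J) J h \<and> cmpl_top (level i j J) J h" if "J < m" for J
    using I that by (simp add: Inv_def)
  have Ic: "sound_corner i J h \<and> cmpl_corner i J h" if "j \<le> J" "J \<le> m" for J
    using I that by (simp add: Inv_def)
  have Id: "sound_corner (Suc i) J h \<and> cmpl_corner (Suc i) J h" if "J \<le> j" for J
    using I that by (simp add: Inv_def)
  have s: "sound_left i j h" "sound_top i j h" "sound_corner i j h" "sound_corner (Suc i) j h" "sound_corner i (Suc j) h"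
  proof -
    show "sound_left i j h" using I by (simp add: Inv_def)
    show "sound_top i j h" using It[OF ij(2)] by (simp add: level_def)
    show "sound_corner i j h" "sound_corner i (Suc j) h" using Ic[of j] Ic[of "Suc j"] ij by simp_all
    show "sound_corner (Suc i) j h" using Id[of j] by simp
  qed
  note S = step_sound[OF ij s(1-3)]
  have C: "reach i j p q c \<Longrightarrow> q \<le> X \<Longrightarrow> crn (Suc i) (Suc j) + int (p - X) \<le> z \<Longrightarrow> z \<le> crn i (Suc j) \<Longrightarrow>
      ?h z \<le> c + d i j * real X"
    "reach i j p q c \<Longrightarrow> p \<le> X \<Longrightarrow> crn (Suc i) j \<le> z \<Longrightarrow> z \<le> crn (Suc i) (Suc j) - int (q - X) \<Longrightarrow>
      ?h z \<le> c + d i j * real X" for p q c X z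
  proof -
    assume r: "reach i j p q c"
    note bd = reach_bounds[OF r, THEN conjunct1] reach_bounds[OF r, THEN conjunct2]
    note S = step_complete[OF Inv_cells[OF I ij(2) r] bd, of X z]
    show "q \<le> X \<Longrightarrow> crn (Suc i) (Suc j) + int (p - X) \<le> z \<Longrightarrow> z \<le> crn i (Suc j) \<Longrightarrow>
      ?h z \<le> c + d i j * real X" by (rule S(1))
    show "p \<le> X \<Longrightarrow> crn (Suc i) j \<le> z \<Longrightarrow> z \<le> crn (Suc i) (Suc j) - int (q - X) \<Longrightarrow>
      ?h z \<le> c + d i j * real X" by (rule S(2))
  qed
  have right: "crn i (Suc j) \<le> crn i J" if "j < J" for J using crn_mono that by simp
  have left: "crn (Suc i) J \<le> crn (Suc i) j" if "J \<le> j" for J using crn_mono that by simp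
  have tops: "sound_top (level i (Suc j) J) J ?h \<and> cmpl_top (level i (Suc j) J) J ?h" if J: "J < m" for J
  proof -
    consider "J < j" | "J = j" | "j < J" by linarith
    then show ?thesis
    proof cases
      case 2
      have "cmpl_top (Suc i) j ?h" unfolding cmpl_top_def
      proof (intro allI impI)
        fix i' p q c X z
        assume r: "Suc i = Suc i'" "reach i' j p q c" "p \<le> X" "crn (Suc i) j \<le> z" "z \<le> crn (Suc i) (Suc j) - int (q - X)"
        then show "?h z \<le> c + d i' j * real X" using C(2)[of p q c X z] by simp
      qed
      then show ?thesis using S(2) 2 by (simp add: level_def)
    next
      case 1
      have l: "level i (Suc j) J = Suc i" "level i j J = Suc i" using 1 by (simp_all add: level_def)
      have old: "sound_top (Suc i) J h" "cmpl_top (Suc i) J h" using It[OF J] l(2) by simp_all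
      have "sound_top (Suc i) J ?h"
        unfolding sound_top_def
      proof (intro allI impI)
        fix q assume q: "0 < q" "q < b J"
        have "crn (Suc i) (Suc J) - int q < crn (Suc i) j" using left[of "Suc J"] 1 q by simp
        then show "sound (Suc i) J (a (Suc i)) q (?h (crn (Suc i) (Suc J) - int q))"
          using old(1) q eq by (simp add: sound_top_def)
      qed
      moreover have "cmpl_top (Suc i) J ?h"
        unfolding cmpl_top_def
      proof (intro allI impI)
        fix i' p q c X z assume r: "Suc i = Suc i'" "reach i' J p q c" "p \<le> X"
          "crn (Suc i) J \<le> z" "z \<le> crn (Suc i) (Suc J) - int (q - X)"
        have "z \<le> crn (Suc i) j" using r left[of "Suc J"] 1 by simp
        then have "?h z \<le> h z" by (intro lo) simp
        also have "\<dots> \<le> c + d i' J * real X" using old(2) r unfolding cmpl_top_def by blast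
        finally show "?h z \<le> c + d i' J * real X" .
      qed
      ultimately show ?thesis by (simp add: l)
    next
      case 3
      have l: "level i (Suc j) J = i" "level i j J = i" using 3 by (simp_all add: level_def)
      have old: "sound_top i J h" "cmpl_top i J h" using It[OF J] l(2) by simp_all
      have "sound_top i J ?h"
        unfolding sound_top_def
      proof (intro allI impI)
        fix q assume q: "0 < q" "q < b J"
        have "crn i (Suc j) < crn i (Suc J) - int q" using right[OF 3] q by (simp add: crn_Suc)
        then show "sound i J (a i) q (?h (crn i (Suc J) - int q))"
          using old(1) q eq by (simp add: sound_top_def)
      qed
      moreover have "cmpl_top i J ?h"
        unfolding cmpl_top_def
      proof (intro allI impI)
        fix i' p q c X z assume r: "i = Suc i'" "reach i' J p q c" "p \<le> X"
          "crn i J \<le> z" "z \<le> crn i (Suc J) - int (q - X)"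
        have "crn i (Suc j) \<le> z" using r right[OF 3] by simp
        then have "?h z \<le> h z" by (intro lo) simp
        also have "\<dots> \<le> c + d i' J * real X" using old(2) r unfolding cmpl_top_def by blast
        finally show "?h z \<le> c + d i' J * real X" .
      qed
      ultimately show ?thesis by (simp add: l)
    qed
  qed
  have corner_lo: "cmpl_corner I' J ?h" if "cmpl_corner I' J h" "crn I' J \<le> crn (Suc i) j \<or> crn i (Suc j) \<le> crn I' J" for I' J
    unfolding cmpl_corner_def
  proof (intro allI impI)
    fix i' j' p q c X assume "I' = Suc i'" "J = Suc j'" "reach i' j' p q c" "p \<le> X" "q \<le> X"
    then have "h (crn I' J) \<le> c + d i' j' * real X" using that(1) unfolding cmpl_corner_def by blast
    then show "?h (crn I' J) \<le> c + d i' j' * real X" using lo[OF that(2)] by simp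
  qed
  have top_corners: "sound_corner i J ?h \<and> cmpl_corner i J ?h" if J: "Suc j \<le> J" "J \<le> m" for J
  proof -
    have old: "sound_corner i J h" "cmpl_corner i J h" using Ic[of J] J by simp_all
    have "sound_corner i J ?h"
    proof (cases "J = Suc j")
      case True then show ?thesis using S(5) s(5) by simp
    next
      case False
      then have "crn i (Suc j) < crn i J" using J crn_strict[of "Suc j" J i] by simp
      then show ?thesis using old(1) eq by (simp add: sound_corner_def)
    qed
    moreover have "cmpl_corner i J ?h" by (rule corner_lo[OF old(2)]) (use right[of J] J in auto)
    ultimately show ?thesis by simp
  qed
  have bot_corners: "sound_corner (Suc i) J ?h \<and> cmpl_corner (Suc i) J ?h" if J: "J \<le> Suc j" for J
  proof (cases "J = Suc j")
    case True
    have "cmpl_corner (Suc i) (Suc j) ?h"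
      unfolding cmpl_corner_def
    proof (intro allI impI)
      fix i' j' p q c X assume r: "Suc i = Suc i'" "Suc j = Suc j'" "reach i' j' p q c" "p \<le> X" "q \<le> X"
      show "?h (crn (Suc i) (Suc j)) \<le> c + d i' j' * real X"
        using C(1)[of p q c X "crn (Suc i) (Suc j)"] r by (simp add: crn_Suc)
    qed
    then show ?thesis using S(3) True by simp
  next
    case False
    then have Jj: "J \<le> j" using J by simp
    have old: "sound_corner (Suc i) J h" "cmpl_corner (Suc i) J h" using Id[OF Jj] by simp_all
    have "sound_corner (Suc i) J ?h"
    proof (cases "J = j")
      case True then show ?thesis using S(4) s(4) by simp
    next
      case False
      then have "crn (Suc i) J < crn (Suc i) j" using Jj ij crn_strict[of J j "Suc i"] by simp
      then show ?thesis using old(1) eq by (simp add: sound_corner_def)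
    qed
    moreover have "cmpl_corner (Suc i) J ?h" by (rule corner_lo[OF old(2)]) (use left[of J] Jj in auto)
    ultimately show ?thesis by simp
  qed
  have "cmpl_left i (Suc j) ?h" unfolding cmpl_left_def
  proof (intro allI impI)
    fix j' p q c X z
    assume r: "Suc j = Suc j'" "reach i j' p q c" "q \<le> X" "crn (Suc i) (Suc j) + int (p - X) \<le> z" "z \<le> crn i (Suc j)"
    then show "?h z \<le> c + d i j' * real X" using C(1)[of p q c X z] by simp
  qed
  moreover have "?h z = total" if "z < crn (Suc i) 0" for z
  proof -
    have "z < crn (Suc i) j" using left[of 0] that by simp
    then show ?thesis using eq I that by (simp add: Inv_def)
  qed
  moreover have "?h (crn (Suc i) 0) \<le> total"
    using lo[of "crn (Suc i) 0"] left[of 0] I by (simp add: Inv_def)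
  ultimately show ?thesis
    unfolding Inv_def using S(1) tops top_corners bot_corners by simp
qed

text \<open>Walk along the first row of blocks and then down the last column, matching enough pairs
  in every block to exhaust what has to be exhausted.\<close>

lemma reach_total: "\<exists>p q c. reach n m p q c \<and> c \<le> total"
proof -
  define t where "t i j = d i j * (real (a i) + real (b j))" for i j
  have t0: "0 \<le> t i j" for i j unfolding t_def by (intro mult_nonneg_nonneg d) auto
  have t1: "d i j * real (b j) \<le> t i j" "d i j * real (a i) \<le> t i j" for i j
    unfolding t_def by (intro mult_left_mono d; simp)+
  have row: "j < m \<Longrightarrow> \<exists>p c. reach 0 j p (b j) c \<and> c \<le> (\<Sum>J<j. t 0 J)" for j
  proof (induction j)
    case 0
    then show ?case using start by auto
  next
    case (Suc j)
    then obtain p c where r: "reach 0 j p (b j) c" "c \<le> (\<Sum>J<j. t 0 J)" by auto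
    have "reach 0 (Suc j) (p - b j) (b (Suc j)) (c + d 0 j * real (b j))"
      using right[OF r(1) n _ order_refl] Suc.prems by simp
    then show ?case using r(2) t1(1)[of 0 j] by (intro exI conjI) auto
  qed
  obtain n' m' where nm: "n = Suc n'" "m = Suc m'" using n m by (metis gr0_implies_Suc)
  have col: "i < n \<Longrightarrow> \<exists>p q c. reach i m' p q c \<and> c \<le> (\<Sum>I<i. \<Sum>J<m. t I J) + (\<Sum>J<m'. t i J)" for i
  proof (induction i)
    case 0
    then show ?case using row[of m'] nm by fastforce
  next
    case (Suc i)
    then obtain p q c where r: "reach i m' p q c" "c \<le> (\<Sum>I<i. \<Sum>J<m. t I J) + (\<Sum>J<m'. t i J)" by auto
    have "p \<le> a i" using reach_bounds r(1) by blast
    then have "reach (Suc i) m' (a (Suc i)) (q - a i) (c + d i m' * real (a i))"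
      using down[OF r(1)] Suc.prems nm by simp
    moreover have "c + d i m' * real (a i) \<le> (\<Sum>I<Suc i. \<Sum>J<m. t I J) + (\<Sum>J<m'. t (Suc i) J)"
      using r(2) t1(2)[of i m'] sum_nonneg[of "{..<m'}" "t (Suc i)"] t0 by (simp add: nm(2))
    ultimately show ?case by blast
  qed
  obtain p q c where r: "reach n' m' p q c" "c \<le> (\<Sum>I<n'. \<Sum>J<m. t I J) + (\<Sum>J<m'. t n' J)"
    using col[of n'] nm by auto
  have pq: "p \<le> a n'" "q \<le> b m'" using reach_bounds[OF r(1)] by auto
  have "reach (Suc n') (Suc m') (a (Suc n')) (b (Suc m')) (c + d n' m' * real (a n' + b m'))"
    by (rule diag[OF r(1)]) (use nm pq in auto)
  moreover have "total = (\<Sum>I<n'. \<Sum>J<m. t I J) + (\<Sum>J<m'. t n' J) + t n' m'"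
    unfolding total_def t_def[symmetric] by (simp add: nm)
  moreover have "t n' m' = d n' m' * real (a n' + b m')" by (simp add: t_def)
  ultimately show ?thesis using r(2) nm by fastforce
qed

lemma Inv_result:
  assumes "Inv (n - 1) m h"
  shows "\<exists>p q. reach n m p q (h (crn n m))" and "reach n m p q c \<Longrightarrow> h (crn n m) \<le> c"
proof -
  have s: "sound_corner n m h" "cmpl_corner n m h" using assms n by (auto simp: Inv_def)
  have le: "h (crn n m) \<le> c" if "reach n m p q c" for p q c
    using that
  proof (cases rule: reach.cases)
    case (diag i j p q c X)
    then show ?thesis using s(2) unfolding cmpl_corner_def by blast
  qed (use n m in auto)
  show "reach n m p q c \<Longrightarrow> h (crn n m) \<le> c" by (rule le)
  obtain p q c where t: "reach n m p q c" "c \<le> total" using reach_total by blast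
  from s(1) consider "total \<le> h (crn n m)" | p' q' c' where "reach n m p' q' c'" "c' \<le> h (crn n m)"
    unfolding sound_corner_def sound_def by blast
  then show "\<exists>p q. reach n m p q (h (crn n m))"
  proof cases
    case 1
    \<comment> \<open>A path of cost at most \<open>total\<close> exists, so by completeness the
      uninformative case can occur only with equality, and then that path witnesses the
      value.\<close>
    then have "c = h (crn n m)" using t le[OF t(1)] by simp
    then show ?thesis using t(1) by blast
  next
    case (2 p' q' c')
    then have "c' = h (crn n m)" using le[OF 2(1)] by simp
    then show ?thesis using 2(1) by blast
  qed
qed

end

section \<open>A push on an interval of diagonals as a cone over all of them\<close>

lemma push_cost:
  fixes u v p q :: int and D M :: real
  assumes "u \<le> v" "0 \<le> D" "D \<le> M"
  defines "cost \<equiv> M * real_of_int \<bar>p - q\<bar> +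
    ((D - M) * (ipos (p - u) - ipos (p - v)) - (D - M) * (ipos (q - u) - ipos (q - v)))"
  shows "u \<le> q \<Longrightarrow> q \<le> p \<Longrightarrow> p \<le> v \<Longrightarrow> cost = D * real_of_int (p - q)"
    and "p = q \<Longrightarrow> cost = 0"
    and "p \<noteq> q \<Longrightarrow> \<not> (u \<le> q \<and> q \<le> p \<and> p \<le> v) \<Longrightarrow> M \<le> cost"
proof -
  \<comment> \<open>\<open>L\<close> is the signed length of the part of the move from
    \<open>q\<close> to \<open>p\<close> inside \<open>[u, v]\<close>. Each step costs
    \<open>M\<close>, with a discount of \<open>M - D\<close> per unit of \<open>L\<close>.\<close>
  define L where "L = (ipos (p - u) - ipos (p - v)) - (ipos (q - u) - ipos (q - v))"
  have cost: "cost = M * real_of_int \<bar>p - q\<bar> - (M - D) * L"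
    unfolding cost_def L_def by (simp add: algebra_simps)
  show "p = q \<Longrightarrow> cost = 0" unfolding cost_def by simp
  { assume "u \<le> q" "q \<le> p" "p \<le> v"
    then have "L = real_of_int (p - q)" "\<bar>p - q\<bar> = p - q" by (simp_all add: L_def ipos_def)
    then show "cost = D * real_of_int (p - q)" unfolding cost by (simp only: left_diff_distrib) }
  assume ne: "p \<noteq> q" "\<not> (u \<le> q \<and> q \<le> p \<and> p \<le> v)"
  show "M \<le> cost"
  proof (cases "q < p")
    case True
    \<comment> \<open>At least one unit step of the move lies outside \<open>[u, v]\<close> and gets
      no discount; integrality of the diagonals enters here.\<close>
    have "L \<le> real_of_int (p - q - 1)"
      using True ne(2) assms(1) unfolding L_def ipos_def by (auto simp: max_def)
    then have "(M - D) * L \<le> (M - D) * real_of_int (p - q - 1)" using assms(3) by (intro mult_left_mono) auto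
    moreover have "0 \<le> D * real_of_int (p - q - 1)" using True assms(2) by (intro mult_nonneg_nonneg) auto
    moreover have "\<bar>p - q\<bar> = p - q" using True by simp
    ultimately show ?thesis unfolding cost by (simp add: algebra_simps)
  next
    case False
    then have "p < q" using ne by simp
    then have "L \<le> 0" using assms(1) unfolding L_def ipos_def by (auto simp: max_def)
    then have "(M - D) * L \<le> 0" using assms(3) by (intro mult_nonneg_nonpos) auto
    moreover have "M * 1 \<le> M * real_of_int \<bar>p - q\<bar>"
      using \<open>p < q\<close> assms(2,3) by (intro mult_left_mono) auto
    ultimately show ?thesis unfolding cost by simp
  qed
qed

text \<open>Only positions where \<open>g\<close> is not concave can be useful sources of a push, and there \<open>\<rho>\<close> equals \<open>g\<close>.\<close>

lemma pushl_slots: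
  fixes y :: "nat \<Rightarrow> int" and \<rho> :: "nat \<Rightarrow> real" and g :: "int \<Rightarrow> real" and D M :: real
  assumes "finite K" "u \<le> v" "0 \<le> D" "D \<le> M"
    and bd: "\<And>k. k \<in> K \<Longrightarrow> g (y k) \<le> \<rho> k" "\<And>z. 0 \<le> g z" "\<And>z. g z \<le> M"
    and conc: "\<And>z. u < z \<Longrightarrow> z < v \<Longrightarrow> g (z - 1) + g (z + 1) \<le> 2 * g z \<or> (\<exists>l\<in>K. y l = z \<and> \<rho> l = g z)"
    and v: "\<exists>l\<in>K. y l = v \<and> \<rho> l = g v"
    and k: "k \<in> K"
  shows "min (g (y k)) (Min ((\<lambda>l. \<rho> l + M * real_of_int \<bar>y l - y k\<bar> +
      ((D - M) * (ipos (y l - u) - ipos (y l - v)) - (D - M) * (ipos (y k - u) - ipos (y k - v)))) ` K))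
    = pushl u v D g (y k)" (is "min _ (Min (?f ` K)) = ?p")
proof -
  note cost = push_cost[OF assms(2-4)]
  have lower: "?p \<le> ?f l" if l: "l \<in> K" for l
  proof -
    consider "y l = y k" | "u \<le> y k" "y k \<le> y l" "y l \<le> v"
      | "y l \<noteq> y k" "\<not> (u \<le> y k \<and> y k \<le> y l \<and> y l \<le> v)" by blast
    then show ?thesis
    proof cases
      case 1
      then show ?thesis using pushl_le_self[of u v D g "y k"] bd(1)[OF l] by simp
    next
      case 2
      then show ?thesis using cost(1)[OF 2] pushl_le[OF 2, of D g] bd(1)[OF l] by linarith
    next
      case 3
      have "?p \<le> M" using pushl_le_self[of u v D g "y k"] bd(3)[of "y k"] by simp
      then show ?thesis using cost(3)[OF 3] bd(1)[OF l] bd(2)[of "y l"] by linarith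
    qed
  qed
  have "?p = g (y k) \<or> (\<exists>l\<in>K. ?f l = ?p)"
  proof (cases "u \<le> y k \<and> y k \<le> v")
    case False
    then show ?thesis by (auto simp: pushl_def)
  next
    case True
    \<comment> \<open>Choose the least minimiser. One step to its left the cost is strictly larger,
      one step to its right it is no smaller, so \<open>g\<close> fails to be concave there unless
      the minimiser is the end \<open>v\<close> or the target itself.\<close>
    define L where "L = {l. y k \<le> l \<and> l \<le> v \<and> ?p = g l + D * real_of_int (l - y k)}"
    have "finite L" unfolding L_def by (rule finite_subset[of _ "{y k..v}"]) auto
    moreover obtain l where "y k \<le> l" "l \<le> v" "?p = g l + D * real_of_int (l - y k)"
      using pushl_attained True by metis
    then have "L \<noteq> {}" by (auto simp: L_def)
    ultimately have mL: "Min L \<in> L" "\<And>l. l \<in> L \<Longrightarrow> Min L \<le> l" by auto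
    define l where "l = Min L"
    have l: "y k \<le> l" "l \<le> v" "?p = g l + D * real_of_int (l - y k)" using mL(1) by (auto simp: L_def l_def)
    show ?thesis
    proof (cases "l = y k")
      case True
      then show ?thesis using l by simp
    next
      case False
      then have lk: "y k \<le> l - 1" using l by simp
      have "\<exists>s\<in>K. y s = l \<and> \<rho> s = g l"
      proof (cases "l = v")
        case True
        then show ?thesis using v by simp
      next
        case F: False
        have "l - 1 \<notin> L" using mL(2)[of "l - 1"] by (auto simp: l_def)
        then have "?p \<noteq> g (l - 1) + D * real_of_int (l - 1 - y k)" using lk l by (auto simp: L_def)
        moreover have "?p \<le> g (l - 1) + D * real_of_int (l - 1 - y k)"
          by (rule pushl_le) (use True lk l in auto)
        ultimately have "?p < g (l - 1) + D * real_of_int (l - 1 - y k)" by linarith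
        moreover have "?p \<le> g (l + 1) + D * real_of_int (l + 1 - y k)"
          by (rule pushl_le) (use True F l in auto)
        ultimately have "\<not> g (l - 1) + g (l + 1) \<le> 2 * g l" using l(3) by (simp add: algebra_simps)
        then show ?thesis using conc[of l] True lk F l by simp
      qed
      then obtain s where s: "s \<in> K" "y s = l" "\<rho> s = g l" by blast
      have "?f s = ?p" unfolding s(2,3) l(3) using cost(1)[of "y k" l] True l by linarith
      then show ?thesis using s(1) by blast
    qed
  qed
  then show ?thesis
  proof
    assume e: "?p = g (y k)"
    have "?p \<le> Min (?f ` K)" using lower assms(1) k by (intro Min.boundedI) auto
    then show ?thesis using e by simp
  next
    assume "\<exists>l\<in>K. ?f l = ?p"
    then have "Min (?f ` K) = ?p" using lower assms(1) by (intro Min_eqI) force+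
    then show ?thesis using pushl_le_self[of u v D g "y k"] by simp
  qed
qed

subsection \<open>Restriction to the corner diagonals\<close>

locale slots = grid n m a b d
  for n m :: nat and a b :: "nat \<Rightarrow> nat" and d :: "nat \<Rightarrow> nat \<Rightarrow> real" +
  fixes N :: nat and zi :: "nat \<Rightarrow> int" and sl :: "nat \<Rightarrow> nat \<Rightarrow> nat"
  assumes sl: "i \<le> n \<Longrightarrow> j \<le> m \<Longrightarrow> sl i j < N \<and> zi (sl i j) = crn i j"
begin

text \<open>The pair consists of source values and current values, indexed by the leaves; this is
  the abstract effect of touching leaf \<open>s\<close>.\<close>

definition touchf :: "nat \<Rightarrow> real \<Rightarrow> (nat \<Rightarrow> real) \<times> (nat \<Rightarrow> real) \<Rightarrow> (nat \<Rightarrow> real) \<times> (nat \<Rightarrow> real)" where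
  "touchf s \<beta> S = (\<lambda>k. (if k = s then snd S s else fst S k) + \<beta> * max 0 (real_of_int (zi k) - real_of_int (zi s)),
     \<lambda>k. snd S k + \<beta> * max 0 (real_of_int (zi k) - real_of_int (zi s)))"

definition pushf :: "real \<Rightarrow> (nat \<Rightarrow> real) \<times> (nat \<Rightarrow> real) \<Rightarrow> (nat \<Rightarrow> real) \<times> (nat \<Rightarrow> real)" where
  "pushf M S = (fst S, \<lambda>k. min (snd S k)
     (Min ((\<lambda>l. fst S l + pen M M (real_of_int (zi l)) (real_of_int (zi k))) ` {..<N})))"

text \<open>Splits off a function \<open>F\<close> of the diagonal that has been added to both
  families for the moment. The ten operations of a block become bookkeeping on \<open>F\<close>
  around the true sources \<open>r\<close> and values \<open>\<eta>\<close>.\<close>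

definition rep :: "(nat \<Rightarrow> real) \<Rightarrow> (nat \<Rightarrow> real) \<Rightarrow> (int \<Rightarrow> real) \<Rightarrow> (nat \<Rightarrow> real) \<times> (nat \<Rightarrow> real) \<Rightarrow> bool" where
  "rep r \<eta> F S \<longleftrightarrow> (\<forall>k<N. fst S k = r k + F (zi k) \<and> snd S k = \<eta> k + F (zi k))"

lemma rep_touch:
  assumes "rep r \<eta> F S" "s < N"
  shows "rep (r(s := \<eta> s)) \<eta> (\<lambda>z. F z + \<beta> * ipos (z - zi s)) (touchf s \<beta> S)"
  using assms by (auto simp: rep_def touchf_def ipos_def)

text \<open>The added function enters through the source and is discounted at the target, so only
  the difference \<open>F (zi l) - F (zi k)\<close> remains. It deforms the cone as computed in
  \<open>push_cost\<close>.\<close>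

lemma rep_push:
  assumes "rep r \<eta> F S"
  shows "rep r (\<lambda>k. min (\<eta> k) (Min ((\<lambda>l. r l + M * real_of_int \<bar>zi l - zi k\<bar> + (F (zi l) - F (zi k))) ` {..<N}))) F (pushf M S)"
proof -
  have "Min ((\<lambda>l. fst S l + pen M M (real_of_int (zi l)) (real_of_int (zi k))) ` {..<N})
      = Min ((\<lambda>l. r l + M * real_of_int \<bar>zi l - zi k\<bar> + (F (zi l) - F (zi k))) ` {..<N}) + F (zi k)"
    if k: "k < N" for k
  proof -
    have p: "pen M M (real_of_int (zi l)) (real_of_int (zi k)) = M * real_of_int \<bar>zi l - zi k\<bar>" for l
      by (simp add: pen_def abs_if)
    have "Min ((\<lambda>l. fst S l + pen M M (real_of_int (zi l)) (real_of_int (zi k))) ` {..<N})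
      = Min ((\<lambda>l. r l + M * real_of_int \<bar>zi l - zi k\<bar> + (F (zi l) - F (zi k)) + F (zi k)) ` {..<N})"
      using assms by (intro arg_cong[where f = Min] image_cong) (auto simp: rep_def p)
    also have "\<dots> = Min ((\<lambda>l. r l + M * real_of_int \<bar>zi l - zi k\<bar> + (F (zi l) - F (zi k))) ` {..<N}) + F (zi k)"
      by (rule Min_add_commute) (use k in auto)
    finally show ?thesis .
  qed
  then show ?thesis using assms by (simp add: rep_def pushf_def min_add_distrib_left)
qed

lemma rep_cong:
  assumes "rep r \<eta> F S" "\<And>k. k < N \<Longrightarrow> r k = r' k" "\<And>k. k < N \<Longrightarrow> \<eta> k = \<eta>' k" "\<And>z. F z = F' z"
  shows "rep r' \<eta>' F' S"
  using assms by (simp add: rep_def)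

text \<open>Exactly what \<open>pushl_slots\<close> demands of an interior diagonal: concavity, or a
  slot whose source is up to date.\<close>

definition pc :: "(int \<Rightarrow> real) \<Rightarrow> (nat \<Rightarrow> real) \<Rightarrow> int \<Rightarrow> bool" where
  "pc h r z \<longleftrightarrow> h (z - 1) + h (z + 1) \<le> 2 * h z \<or> (\<exists>k<N. zi k = z \<and> r k = h z)"

text \<open>The corners of the staircase are exempt. The corner of the current block from which its
  pushes start is touched before them.\<close>

definition PInv :: "nat \<Rightarrow> nat \<Rightarrow> (int \<Rightarrow> real) \<Rightarrow> (nat \<Rightarrow> real) \<Rightarrow> bool" where
  "PInv i j h r \<longleftrightarrow>
     (\<forall>J<m. \<forall>z. crn (level i j J) J < z \<longrightarrow> z < crn (level i j J) (Suc J) \<longrightarrow> pc h r z) \<and>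
     (\<forall>z. crn (Suc i) j < z \<longrightarrow> z < crn i j \<longrightarrow> pc h r z)"

lemma PInv_frontier:
  "PInv i j h r \<Longrightarrow> J < m \<Longrightarrow> crn (level i j J) J < z \<Longrightarrow> z < crn (level i j J) (Suc J) \<Longrightarrow> pc h r z"
  by (simp add: PInv_def)

lemma PInv_left: "PInv i j h r \<Longrightarrow> crn (Suc i) j < z \<Longrightarrow> z < crn i j \<Longrightarrow> pc h r z"
  by (simp add: PInv_def)

lemma PInv_init: "PInv 0 0 init r"
proof -
  have pc: "pc init r z" if "z \<noteq> 0" for z
    using that total_nonneg by (simp add: pc_def init_def)
  have "0 \<le> crn 0 J" for J using colsum_mono[of 0 J] by (simp add: crn_def)
  then have "z \<noteq> 0" if "crn 0 J < z" for J z using that by (metis not_le)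
  with pc show ?thesis
    unfolding PInv_def by (auto simp: level_def crn_def)
qed

text \<open>On the newly exposed left edge \<open>h\<close> equals its maximum \<open>total\<close>
  and the neighbours do not exceed it, so concavity is immediate.\<close>

lemma PInv_row:
  assumes "Inv i m h" "PInv i m h r"
  shows "PInv (Suc i) 0 h r"
proof -
  have low: "h z = total" if "z < crn (Suc i) 0" for z using assms(1) that by (simp add: Inv_def)
  have le: "h (crn (Suc i) 0) \<le> total" using assms(1) by (simp add: Inv_def)
  have "pc h r z" if "z < crn (Suc i) 0" for z
  proof -
    have "h (z + 1) \<le> total" using low[of "z + 1"] le that by (cases "z + 1 = crn (Suc i) 0") auto
    then show ?thesis using low[OF that] low[of "z - 1"] that by (simp add: pc_def)
  qed
  then show ?thesis using assms(2) by (simp add: PInv_def level_def)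
qed

text \<open>If the push strictly lowers the value at \<open>z\<close>, the source that attains it
  also serves both neighbours, along one straight line. Otherwise the value at \<open>z\<close>
  stays while the neighbours can only drop.\<close>

lemma pushed_concave:
  assumes z: "crn (Suc i) j < z" "z < crn i (Suc j)" "z \<noteq> crn i j"
    and p: "pushed i j h z < h z \<or> h (z - 1) + h (z + 1) \<le> 2 * h z"
  shows "pushed i j h (z - 1) + pushed i j h (z + 1) \<le> 2 * pushed i j h z"
proof (cases "pushed i j h z < h z")
  case False
  then have "pushed i j h z = h z" using pushed_le_self[of i j h z] by simp
  moreover have "h (z - 1) + h (z + 1) \<le> 2 * h z" using p False by simp
  ultimately show ?thesis using pushed_le_self[of i j h "z - 1"] pushed_le_self[of i j h "z + 1"] by linarith
next
  case True
  show ?thesis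
  proof (cases "z < crn i j")
    case L: True
    obtain l where l: "z \<le> l" "l \<le> crn i j" "pushed i j h z = h l + d i j * real_of_int (l - z)"
      by (rule pushed_attained_left[of i j z h]) (use z L in auto)
    have "z \<noteq> l" using l True by auto
    then have "pushed i j h (z + 1) \<le> h l + d i j * real_of_int (l - (z + 1))"
      by (intro pushed_le_left) (use z l in auto)
    moreover have "pushed i j h (z - 1) \<le> h l + d i j * real_of_int (l - (z - 1))"
      by (intro pushed_le_left) (use z l in auto)
    ultimately show ?thesis unfolding l(3) by (simp add: algebra_simps)
  next
    case False
    obtain l where l: "crn i j \<le> l" "l \<le> z" "pushed i j h z = h l + d i j * real_of_int (z - l)"
      by (rule pushed_attained_right[of i j z h]) (use z False in auto)
    have "z \<noteq> l" using l True by auto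
    then have "pushed i j h (z - 1) \<le> h l + d i j * real_of_int (z - 1 - l)"
      by (intro pushed_le_right) (use z l in auto)
    moreover have "pushed i j h (z + 1) \<le> h l + d i j * real_of_int (z + 1 - l)"
      by (intro pushed_le_right) (use z l in auto)
    ultimately show ?thesis unfolding l(3) by (simp add: algebra_simps)
  qed
qed

lemma trap_concave:
  assumes "crn (Suc i) j < z" "z < crn i (Suc j)"
  shows "trap i j (z - 1) + trap i j (z + 1) \<le> 2 * trap i j z"
  using assms by (simp add: trap_def ipos_def crn_Suc max_def)

lemma PInv_step:
  assumes P: "PInv i j h r" and ij: "i < n" "j < m"
    and r': "\<And>k. k < N \<Longrightarrow> r' k = (if k \<in> {sl i j, sl (Suc i) j, sl i (Suc j), sl (Suc i) (Suc j)}
      then step i j h (zi k) else r k + d i j * trap i j (zi k))"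
  shows "PInv i (Suc j) (step i j h) r'"
proof -
  let ?h = "step i j h"
  let ?C = "{sl i j, sl (Suc i) j, sl i (Suc j), sl (Suc i) (Suc j)}"
  have zC: "zi k \<in> {crn i j, crn (Suc i) j, crn i (Suc j), crn (Suc i) (Suc j)}" if "k \<in> ?C" for k
    using that sl ij by auto
  have out: "pc ?h r' z" if "pc h r z" "z < crn (Suc i) j \<or> crn i (Suc j) < z" for z
  proof -
    have eq: "?h z = h z" by (rule step_outside[OF that(2)])
    have "?h (z - 1) \<le> h (z - 1)" "?h (z + 1) \<le> h (z + 1)"
      by (rule step_outside_le; use that(2) in auto)+
    moreover have "r' k = ?h z" if "k < N" "zi k = z" "r k = h z" for k
    proof -
      have "k \<notin> ?C" using zC[of k] that \<open>z < crn (Suc i) j \<or> crn i (Suc j) < z\<close> by (auto simp: crn_Suc)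
      then show ?thesis using r'[OF that(1)] that eq trap_outside[of z i j] \<open>z < crn (Suc i) j \<or> crn i (Suc j) < z\<close> by auto
    qed
    ultimately show ?thesis using that(1) eq unfolding pc_def by fastforce
  qed
  have inn: "pc ?h r' z"
    if z: "crn (Suc i) j < z" "z < crn i (Suc j)" "z \<noteq> crn i j" and p: "pc h r z" for z
  proof (cases "pushed i j h z < h z \<or> h (z - 1) + h (z + 1) \<le> 2 * h z")
    case True
    have "d i j * (trap i j (z - 1) + trap i j (z + 1)) \<le> d i j * (2 * trap i j z)"
      by (rule mult_left_mono[OF trap_concave[OF z(1,2)] d])
    then show ?thesis using pushed_concave[OF z True] by (simp add: pc_def step_def algebra_simps)
  next
    \<comment> \<open>Here the push left the value unchanged, so a source that was exact before is
      still exact after the common addition of the trapezoid.\<close>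
    case False
    then obtain k where k: "k < N" "zi k = z" "r k = h z" using p by (auto simp: pc_def)
    have "pushed i j h z = h z" using False pushed_le_self[of i j h z] by simp
    then have "r' k = ?h z" using r'[OF k(1)] k by (simp add: step_def)
    then show ?thesis using k by (auto simp: pc_def)
  qed
  \<comment> \<open>Where the two pushes meet a kink may remain, but the slot of this diagonal has
    just been touched.\<close>
  have cc: "pc ?h r' (crn i j)"
    using sl[of i j] ij r'[of "sl i j"] by (auto simp: pc_def)
  have ab: "0 < a i" "0 < b j" using a b ij by auto
  have block: "pc ?h r' z" if z: "crn (Suc i) j < z" "z < crn i (Suc j)" "z \<noteq> crn (Suc i) (Suc j)" for z
  proof -
    consider "z = crn i j" | "z \<noteq> crn i j" "z < crn i j" | "crn i j < z" by linarith
    then show ?thesis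
    proof cases
      case 1 then show ?thesis using cc by simp
    next
      case 2
      then have "pc h r z" using PInv_left[OF P] z by simp
      then show ?thesis using inn z 2 by simp
    next
      case 3
      have "level i j j = i" by (simp add: level_def)
      then have "pc h r z" using PInv_frontier[OF P ij(2), of z] z 3 by simp
      then show ?thesis using inn z 3 by auto
    qed
  qed
  show ?thesis
    unfolding PInv_def
  proof (intro conjI allI impI)
    fix z assume z: "crn (Suc i) (Suc j) < z" "z < crn i (Suc j)"
    then show "pc ?h r' z" using block ab by (simp add: crn_Suc)
  next
    fix J z assume J: "J < m" and z: "crn (level i (Suc j) J) J < z" "z < crn (level i (Suc j) J) (Suc J)"
    consider "J < j" | "J = j" | "j < J" by linarith
    then show "pc ?h r' z"
    proof cases
      case 1
      have l: "level i (Suc j) J = Suc i" "level i j J = Suc i" using 1 by (simp_all add: level_def)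
      have "pc h r z" using PInv_frontier[OF P J, of z] z l by simp
      moreover have "crn (Suc i) (Suc J) \<le> crn (Suc i) j" using 1 by (intro crn_mono) simp
      ultimately show ?thesis using z l by (intro out) auto
    next
      case 2
      have l: "level i (Suc j) J = Suc i" using 2 by (simp add: level_def)
      then show ?thesis using block z 2 ab by (simp add: crn_Suc)
    next
      case 3
      have l: "level i (Suc j) J = i" "level i j J = i" using 3 by (simp_all add: level_def)
      have "pc h r z" using PInv_frontier[OF P J, of z] z l by simp
      moreover have "crn i (Suc j) \<le> crn i J" using 3 by (intro crn_mono) simp
      ultimately show ?thesis using z l by (intro out) auto
    qed
  qed
qed

text \<open>The budget of the blocks processed so far. It bounds the growth of \<open>h\<close>,
  which therefore never exceeds \<open>2 * total\<close>.\<close>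

definition partial :: "nat \<Rightarrow> nat \<Rightarrow> real" where
  "partial i j = (\<Sum>I<i. \<Sum>J<m. d I J * (real (a I) + real (b J))) + (\<Sum>J<j. d i J * (real (a i) + real (b J)))"

lemma weight_nonneg: "0 \<le> d i j * (real (a i) + real (b j))"
  by (intro mult_nonneg_nonneg d) auto

lemma partial_le_total:
  assumes "i < n" "j \<le> m"
  shows "partial i j \<le> total"
proof -
  let ?t = "\<lambda>i. \<Sum>J<m. d i J * (real (a i) + real (b J))"
  have "partial i j \<le> (\<Sum>I<i. ?t I) + ?t i"
    unfolding partial_def using assms by (intro add_left_mono sum_mono2) (auto simp: weight_nonneg)
  also have "\<dots> = (\<Sum>I<Suc i. ?t I)" by simp
  also have "\<dots> \<le> total"
    unfolding total_def using assms by (intro sum_mono2) (auto intro!: sum_nonneg weight_nonneg)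
  finally show ?thesis .
qed

lemma d_le_total:
  assumes "i < n" "j < m"
  shows "d i j \<le> total"
proof -
  have "d i j * 1 \<le> d i j * (real (a i) + real (b j))"
    using a[OF assms(1)] by (intro mult_left_mono d) auto
  also have "\<dots> \<le> partial i (Suc j)"
    unfolding partial_def by (simp add: sum_nonneg weight_nonneg)
  also have "\<dots> \<le> total" using assms by (intro partial_le_total) auto
  finally show ?thesis by simp
qed

text \<open>Of a slot that has not been touched recently only \<open>h (zi k) \<le> fst S k\<close>
  is asked: an outdated source is too large and cannot spoil a minimum.\<close>

definition Good :: "nat \<Rightarrow> nat \<Rightarrow> (nat \<Rightarrow> real) \<times> (nat \<Rightarrow> real) \<Rightarrow> bool" where
  "Good i j S \<longleftrightarrow> (\<exists>h. Inv i j h \<and> PInv i j h (fst S) \<and> (\<forall>z. 0 \<le> h z \<and> h z \<le> total + partial i j) \<and>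
     (\<forall>k<N. snd S k = h (zi k) \<and> h (zi k) \<le> fst S k))"

text \<open>To be read from the inside. Two touches give the left part of the block the slope
  \<open>D - M\<close> for the push to the left, two more remove it and give the right part the
  slope \<open>M - D\<close> for the other push, and the last four remove that and add
  \<open>D\<close> times the trapezoid, which also refreshes the sources at all four
  corners.\<close>

definition blockf :: "nat \<Rightarrow> nat \<Rightarrow> (nat \<Rightarrow> real) \<times> (nat \<Rightarrow> real) \<Rightarrow> (nat \<Rightarrow> real) \<times> (nat \<Rightarrow> real)" where
  "blockf i j S = (let M = 2 * total; D = d i j in
     touchf (sl i (Suc j)) M (touchf (sl (Suc i) (Suc j)) (- D) (touchf (sl i j) (- M) (touchf (sl (Suc i) j) D
       (pushf M (touchf (sl i (Suc j)) (D - M) (touchf (sl (Suc i) j) (M - D)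
         (pushf M (touchf (sl i j) (M - D) (touchf (sl (Suc i) j) (D - M) S))))))))))"

lemma push_nonneg:
  assumes "\<And>z. 0 \<le> h z"
  shows "0 \<le> pushed i j h z"
proof -
  consider "crn (Suc i) j \<le> z" "z \<le> crn i j" | "crn i j \<le> z" "z \<le> crn i (Suc j)"
    | "z < crn (Suc i) j \<or> crn i (Suc j) < z" by linarith
  then show ?thesis
  proof cases
    case 1
    then obtain l where "z \<le> l" "pushed i j h z = h l + d i j * real_of_int (l - z)"
      by (rule pushed_attained_left)
    then show ?thesis using assms[of l] d by simp
  next
    case 2
    then obtain l where "l \<le> z" "pushed i j h z = h l + d i j * real_of_int (z - l)"
      by (rule pushed_attained_right)
    then show ?thesis using assms[of l] d by simp
  next
    case 3
    show ?thesis unfolding pushed_outside[OF 3] by (rule assms)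
  qed
qed

lemma Good_row:
  assumes "Good i m S" "Suc i < n"
  shows "Good (Suc i) 0 S"
proof -
  have "partial (Suc i) 0 = partial i m" by (simp add: partial_def)
  then show ?thesis using assms(1) Inv_row[OF _ assms(2)] PInv_row unfolding Good_def by metis
qed

lemma Good_init:
  assumes "\<And>k. k < N \<Longrightarrow> snd S k = init (zi k)" "\<And>k. k < N \<Longrightarrow> fst S k = total"
  shows "Good 0 0 S"
proof -
  have "0 \<le> init z \<and> init z \<le> total" for z using total_nonneg by (simp add: init_def)
  moreover have "partial 0 0 = 0" by (simp add: partial_def)
  ultimately show ?thesis
    unfolding Good_def using Inv_init PInv_init assms by (intro exI[of _ init]) simp
qed

lemma Good_result:
  assumes "Good (n - 1) m S"
  shows "\<exists>p q. reach n m p q (snd S (sl n m))" and "reach n m p q c \<Longrightarrow> snd S (sl n m) \<le> c"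
proof -
  obtain h where h: "Inv (n - 1) m h" "\<forall>k<N. snd S k = h (zi k)" using assms by (auto simp: Good_def)
  have "snd S (sl n m) = h (crn n m)" using h(2) sl[of n m] by auto
  then show "\<exists>p q. reach n m p q (snd S (sl n m))" and "reach n m p q c \<Longrightarrow> snd S (sl n m) \<le> c"
    using Inv_result[OF h(1)] by simp_all
qed

lemma ipos_neg: "ipos (- z) = ipos z - real_of_int z"
  by (simp add: ipos_def max_def)

lemma Good_block:
  assumes S: "Good i j S" and ij: "i < n" "j < m"
  shows "Good i (Suc j) (blockf i j S)"
proof -
  obtain h where Inv: "Inv i j h" and P: "PInv i j h (fst S)" and h0: "\<And>z. 0 \<le> h z"
    and hub: "\<And>z. h z \<le> total + partial i j"
    and S: "\<And>k. k < N \<Longrightarrow> snd S k = h (zi k)" "\<And>k. k < N \<Longrightarrow> h (zi k) \<le> fst S k"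
    using S unfolding Good_def by blast
  define D M r0 where "D = d i j" and "M = 2 * total" and "r0 = fst S"
  define z0 zc zo z3 where z_def: "z0 = crn (Suc i) j" "zc = crn i j" "zo = crn (Suc i) (Suc j)" "z3 = crn i (Suc j)"
  define s0 sc so s3 where s_def: "s0 = sl (Suc i) j" "sc = sl i j" "so = sl (Suc i) (Suc j)" "s3 = sl i (Suc j)"
  have D: "0 \<le> D" "D \<le> M" using d[of i j] d_le_total[OF ij] total_nonneg by (simp_all add: D_def M_def)
  have hM: "h z \<le> M" for z using hub[of z] partial_le_total[of i j] ij by (simp add: M_def)
  have z: "z0 < zc" "zc < z3" using a[OF ij(1)] b[OF ij(2)] by (simp_all add: z_def crn_Suc)
  have s: "s0 < N" "sc < N" "so < N" "s3 < N" "zi s0 = z0" "zi sc = zc" "zi so = zo" "zi s3 = z3"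
    using sl ij by (simp_all add: s_def z_def)
  have ne: "sc \<noteq> s0" "sc \<noteq> s3" "s0 \<noteq> s3" using s z by auto
  define \<eta>0 where "\<eta>0 k = h (zi k)" for k
  define \<eta>1 where "\<eta>1 k = push1 i j h (zi k)" for k
  define \<eta>2 where "\<eta>2 k = pushed i j h (zi k)" for k
  have E0: "rep r0 \<eta>0 (\<lambda>z. 0) S" using S by (simp add: rep_def r0_def \<eta>0_def)
  define r1 where "r1 = r0(s0 := \<eta>0 s0, sc := \<eta>0 sc)"
  \<comment> \<open>Slope \<open>D - M\<close> between the lower left and the upper left corner,
    constant elsewhere: the correction of \<open>push_cost\<close>.\<close>
  define F1 where "F1 z = (D - M) * ipos (z - z0) + (M - D) * ipos (z - zc)" for z
  have "rep r1 \<eta>0 (\<lambda>z. 0 + (D - M) * ipos (z - zi s0) + (M - D) * ipos (z - zi sc)) (touchf sc (M - D) (touchf s0 (D - M) S))"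
    unfolding r1_def by (intro rep_touch E0 s)
  then have "rep r1 \<eta>0 F1 (touchf sc (M - D) (touchf s0 (D - M) S))"
    by (rule rep_cong) (simp_all add: F1_def s)
  note E1 = rep_push[OF this, of M]
  have r1: "r1 k = h (zi k)" if "k < N" "k = s0 \<or> k = sc \<or> r0 k = h (zi k)" for k
    using that by (auto simp: r1_def \<eta>0_def)
  have r1_ge: "h (zi k) \<le> r1 k" if "k < N" for k
    using S(2)[OF that] by (simp add: r1_def \<eta>0_def r0_def)
  have p1: "min (\<eta>0 k) (Min ((\<lambda>l. r1 l + M * real_of_int \<bar>zi l - zi k\<bar> + (F1 (zi l) - F1 (zi k))) ` {..<N})) = \<eta>1 k"
    if k: "k < N" for k
  proof -
    have F1: "F1 z = (D - M) * (ipos (z - z0) - ipos (z - zc))" for z by (simp add: F1_def algebra_simps)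
    show ?thesis
      unfolding \<eta>0_def \<eta>1_def push1_def F1 z_def(1,2)[symmetric] D_def[symmetric]
    proof (rule pushl_slots)
      fix z assume "z0 < z" "z < zc"
      then have "pc h r0 z" using PInv_left[OF P] by (simp add: z_def r0_def)
      then show "h (z - 1) + h (z + 1) \<le> 2 * h z \<or> (\<exists>l\<in>{..<N}. zi l = z \<and> r1 l = h z)"
        unfolding pc_def using r1 by blast
    next
      show "\<exists>l\<in>{..<N}. zi l = zc \<and> r1 l = h zc" using r1[of sc] s by auto
    qed (use z D k h0 hM r1_ge in auto)
  qed
  note E1' = rep_cong[OF E1 refl p1 refl]
  \<comment> \<open>The source at \<open>sc\<close> is still exact, because the push to the left
    keeps the value on the corner diagonal.\<close>
  define r2 where "r2 = r1(s0 := \<eta>1 s0, s3 := \<eta>1 s3)"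
  define F2 where "F2 z = (M - D) * ipos (z - zc) + (D - M) * ipos (z - z3)" for z
  let ?S2 = "touchf s3 (D - M) (touchf s0 (M - D) (pushf M (touchf sc (M - D) (touchf s0 (D - M) S))))"
  have "rep r2 \<eta>1 (\<lambda>z. F1 z + (M - D) * ipos (z - zi s0) + (D - M) * ipos (z - zi s3)) ?S2"
    unfolding r2_def by (intro rep_touch E1' s)
  then have "rep r2 \<eta>1 F2 ?S2"
    by (rule rep_cong) (simp_all add: F1_def F2_def s algebra_simps)
  note E2 = rep_push[OF this, of M]
  let ?g = "push1 i j h"
  have g_le: "?g z \<le> h z" for z unfolding push1_def by (rule pushl_le_self)
  have g_eq: "?g z = h z" if "zc \<le> z" for z by (rule push1_outside) (use that in \<open>simp add: z_def\<close>)
  have g0: "0 \<le> ?g z" for z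
  proof (cases "z \<le> zc")
    case True
    then show ?thesis using push_nonneg[of h i j z] h0 pushed_left[of z i j h] by (simp add: z_def)
  next
    case False
    then show ?thesis using g_eq[of z] h0 by simp
  qed
  have r2: "r2 k = ?g (zi k)" if "k < N" "k = sc \<or> k = s3 \<or> r0 k = h (zi k)" "zc \<le> zi k" for k
    using that s z g_eq[of "zi k"] by (auto simp: r2_def r1_def \<eta>0_def \<eta>1_def)
  have r2_ge: "?g (zi k) \<le> r2 k" if "k < N" for k
    using r1_ge[OF that] g_le[of "zi k"] by (simp add: r2_def \<eta>1_def)
  have p2: "min (\<eta>1 k) (Min ((\<lambda>l. r2 l + M * real_of_int \<bar>zi l - zi k\<bar> + (F2 (zi l) - F2 (zi k))) ` {..<N})) = \<eta>2 k"
    if k: "k < N" for k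
  proof -
    \<comment> \<open>Reflecting the diagonals reduces the push to the right to the one to the left.
      The linear terms of \<open>ipos_neg\<close> cancel in the difference.\<close>
    define y where "y l = - zi l" for l
    have F2: "F2 (zi l) - F2 (zi k) = (D - M) * (ipos (y l - - z3) - ipos (y l - - zc)) - (D - M) * (ipos (y k - - z3) - ipos (y k - - zc))" for l
    proof -
      have i: "ipos (y l - - z) = ipos (zi l - z) - real_of_int (zi l - z)" for l z
        using ipos_neg[of "zi l - z"] by (simp add: y_def)
      show ?thesis unfolding F2_def i by (simp add: algebra_simps)
    qed
    have abs: "\<bar>zi l - zi k\<bar> = \<bar>y l - y k\<bar>" for l by (simp add: y_def)
    have e1: "\<eta>1 k = mirror ?g (y k)" by (simp add: \<eta>1_def mirror_def y_def)
    have e2: "\<eta>2 k = pushl (- z3) (- zc) D (mirror ?g) (y k)"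
      by (simp add: \<eta>2_def pushed_def push2_def z_def D_def y_def mirror_def[of "pushl _ _ _ _"])
    show ?thesis
      unfolding F2 abs e1 e2
    proof (rule pushl_slots)
      fix z assume zz: "- z3 < z" "z < - zc"
      have "level i j j = i" by (simp add: level_def)
      then have "pc h r0 (- z)" using PInv_frontier[OF P ij(2), of "- z"] zz by (simp add: z_def r0_def)
      then consider "h (- z - 1) + h (- z + 1) \<le> 2 * h (- z)" | l where "l < N" "zi l = - z" "r0 l = h (- z)"
        unfolding pc_def by blast
      then show "mirror ?g (z - 1) + mirror ?g (z + 1) \<le> 2 * mirror ?g z \<or> (\<exists>l\<in>{..<N}. y l = z \<and> r2 l = mirror ?g z)"
      proof cases
        case 1
        have "?g (- (z - 1)) = h (- z + 1)" "?g (- (z + 1)) = h (- z - 1)" "?g (- z) = h (- z)"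
          using zz g_eq by simp_all
        then show ?thesis using 1 by (simp add: mirror_def)
      next
        case 2
        then have "r2 l = ?g (- z)" using r2[of l] zz by simp
        then show ?thesis using 2 by (intro disjI2 bexI[of _ l]) (simp_all add: y_def mirror_def)
      qed
    next
      show "\<exists>l\<in>{..<N}. y l = - zc \<and> r2 l = mirror ?g (- zc)"
        using r2[of sc] s by (intro bexI[of _ sc]) (simp_all add: y_def mirror_def)
    next
      fix z show "mirror ?g z \<le> M" using g_le[of "- z"] hM[of "- z"] by (simp add: mirror_def)
    qed (use z D k g0 r2_ge in \<open>auto simp: mirror_def y_def\<close>)
  qed
  note E2' = rep_cong[OF E2 refl p2 refl]
  define r3 where "r3 = r2(s0 := \<eta>2 s0, sc := \<eta>2 sc, so := \<eta>2 so, s3 := \<eta>2 s3)"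
  have block: "blockf i j S = touchf s3 M (touchf so (- D) (touchf sc (- M) (touchf s0 D (pushf M ?S2))))"
    by (simp add: blockf_def Let_def s_def D_def M_def)
  have "rep r3 \<eta>2 (\<lambda>z. F2 z + D * ipos (z - zi s0) + (- M) * ipos (z - zi sc) + (- D) * ipos (z - zi so) + M * ipos (z - zi s3)) (blockf i j S)"
    unfolding r3_def block by (intro rep_touch E2' s)
  then have rep: "rep r3 \<eta>2 (\<lambda>z. D * trap i j z) (blockf i j S)"
  proof (rule rep_cong)
    show "F2 z + D * ipos (z - zi s0) + (- M) * ipos (z - zi sc) + (- D) * ipos (z - zi so) + M * ipos (z - zi s3)
      = D * trap i j z" for z
      by (simp add: F2_def s trap_def z_def algebra_simps)
  qed simp_all
  let ?C = "{sl i j, sl (Suc i) j, sl i (Suc j), sl (Suc i) (Suc j)}"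
  have C: "?C = {sc, s0, s3, so}" by (simp add: s_def)
  have H': "snd (blockf i j S) k = step i j h (zi k)" if "k < N" for k
    using rep that by (simp add: rep_def \<eta>2_def step_def D_def)
  have r': "fst (blockf i j S) k = (if k \<in> ?C then step i j h (zi k) else fst S k + d i j * trap i j (zi k))"
    if "k < N" for k
  proof (cases "k \<in> ?C")
    case True
    then have "r3 k = \<eta>2 k" unfolding C r3_def by auto
    then show ?thesis using rep that True by (simp add: rep_def \<eta>2_def step_def D_def)
  next
    case False
    then have "r3 k = r0 k" unfolding C r3_def r2_def r1_def by auto
    then show ?thesis using rep that False by (simp add: rep_def r0_def D_def)
  qed
  have "0 \<le> step i j h z \<and> step i j h z \<le> total + partial i (Suc j)" for z
  proof -
    have "d i j * trap i j z \<le> d i j * (real (a i) + real (b j))" by (rule mult_left_mono[OF trap_le d])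
    moreover have "partial i (Suc j) = partial i j + d i j * (real (a i) + real (b j))" by (simp add: partial_def)
    moreover have "0 \<le> d i j * trap i j z" using d trap_nonneg by simp
    ultimately show ?thesis
      using pushed_le_self[of i j h z] hub[of z] push_nonneg[of h i j z, OF h0] by (simp add: step_def)
  qed
  moreover have "step i j h (zi k) \<le> fst (blockf i j S) k" if "k < N" for k
    using r'[OF that] pushed_le_self[of i j h "zi k"] S(2)[OF that] by (simp add: step_def)
  ultimately show ?thesis
    unfolding Good_def using Inv_step[OF Inv ij] PInv_step[OF P ij r'] H' by blast
qed

end

subsection \<open>Time warps as paths through the grid\<close>

text \<open>Zero beyond the end, like the input arrays: the final states of \<open>reach\<close>
  refer to the run after the last one.\<close>

definition run :: "'a rle \<Rightarrow> nat \<Rightarrow> nat" where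
  "run S i = (if i < length S then snd (S ! i) else 0)"

definition dlt :: "('a \<Rightarrow> 'a \<Rightarrow> real) \<Rightarrow> 'a rle \<Rightarrow> 'a rle \<Rightarrow> nat \<Rightarrow> nat \<Rightarrow> real" where
  "dlt \<delta> S T i j = \<delta> (fst (S ! i)) (fst (T ! j))"

lemma run_pos: "is_rle S \<Longrightarrow> i < length S \<Longrightarrow> 0 < run S i"
  unfolding is_rle_def run_def by (fastforce simp: case_prod_beta dest: nth_mem)

lemma grid_rle:
  assumes "is_rle S" "is_rle T" "\<And>x y. 0 \<le> \<delta> x y"
  shows "grid (length S) (length T) (run S) (run T) (dlt \<delta> S T)"
  by unfold_locales (use assms run_pos in \<open>auto simp: is_rle_def dlt_def\<close>)

lemma warp_cost_sum_list:
  "length u = length v \<Longrightarrow> warp_cost \<delta> u v = sum_list (map2 \<delta> u v)"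
  unfolding warp_cost_def by (subst sum_list_sum_nth) (auto simp: atLeast0LessThan)

lemma warp_cost_append:
  assumes "length u = length v" "length u' = length v'"
  shows "warp_cost \<delta> (u @ u') (v @ v') = warp_cost \<delta> u v + warp_cost \<delta> u' v'"
  using assms by (simp add: warp_cost_sum_list)

lemma warp_cost_replicate: "warp_cost \<delta> (replicate k s) (replicate k t) = \<delta> s t * real k"
  unfolding warp_cost_def by simp

lemma expand_Nil [simp]: "expand [] = []"
  by (simp add: expand_def)

lemma expand_Cons [simp]: "expand ((s, k) # Z) = replicate k s @ expand Z"
  by (simp add: expand_def)

lemma expand_append [simp]: "expand (Z @ Z') = expand Z @ expand Z'"
  by (simp add: expand_def)

text \<open>A word that uses up the runs before run \<open>i\<close> and \<open>k\<close> letters of run \<open>i\<close>.\<close>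

inductive warp_prefix :: "'a rle \<Rightarrow> nat \<Rightarrow> nat \<Rightarrow> 'a list \<Rightarrow> bool" for S where
  empty: "warp_prefix S 0 0 []"
| letters: "warp_prefix S i k u \<Longrightarrow> i < length S \<Longrightarrow> warp_prefix S i (k + X) (u @ replicate X (fst (S ! i)))"
| advance: "warp_prefix S i k u \<Longrightarrow> i < length S \<Longrightarrow> run S i \<le> k \<Longrightarrow> warp_prefix S (Suc i) 0 u"

lemma warp_prefix_expand:
  assumes "warp_prefix S i k u"
  shows "i \<le> length S \<and> (\<exists>Z. map fst Z = map fst (take i S) \<and>
    list_all2 (\<le>) (map snd (take i S)) (map snd Z) \<and>
    (if i < length S then u = expand Z @ replicate k (fst (S ! i)) else u = expand Z))"
  using assms
proof induction
  case empty
  then show ?case by auto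
next
  case (letters i k u X)
  then show ?case by (auto simp: replicate_add)
next
  case (advance i k u)
  then obtain Z where Z: "map fst Z = map fst (take i S)" "list_all2 (\<le>) (map snd (take i S)) (map snd Z)"
    "u = expand Z @ replicate k (fst (S ! i))" by auto
  let ?Z = "Z @ [(fst (S ! i), k)]"
  have "map fst ?Z = map fst (take (Suc i) S)" using Z advance.hyps by (simp add: take_Suc_conv_app_nth)
  moreover have "list_all2 (\<le>) (map snd (take (Suc i) S)) (map snd ?Z)"
    using Z advance.hyps by (simp add: take_Suc_conv_app_nth run_def list_all2_appendI)
  moreover have "u = expand ?Z" using Z by simp
  ultimately show ?case using advance.hyps(2) by (intro conjI exI[of _ ?Z]) auto
qed

lemma warp_prefix_full: "warp_prefix S (length S) k u \<Longrightarrow> u \<in> time_warps S"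
  using warp_prefix_expand[of S "length S" k u] by (auto simp: time_warps_def)

text \<open>\<open>warp_suffix S i p U\<close>: the runs of \<open>S\<close> from run \<open>i\<close> on are warped to \<open>U\<close>, where only \<open>p\<close> letters
  are required of run \<open>i\<close>.\<close>

inductive warp_suffix :: "'a rle \<Rightarrow> nat \<Rightarrow> nat \<Rightarrow> 'a rle \<Rightarrow> bool" for S where
  Nil: "warp_suffix S (length S) p []"
| Cons: "i < length S \<Longrightarrow> p \<le> r \<Longrightarrow> 0 < r \<Longrightarrow> warp_suffix S (Suc i) (run S (Suc i)) U \<Longrightarrow>
    warp_suffix S i p ((fst (S ! i), r) # U)"

inductive_cases warp_suffix_ConsE: "warp_suffix S i p ((s, r) # U)"

lemma warp_suffix_all:
  assumes "is_rle S" "i \<le> length S" "map fst U = map fst (drop i S)"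
    "list_all2 (\<le>) (map snd (drop i S)) (map snd U)"
  shows "warp_suffix S i (run S i) U"
  using assms(2-)
proof (induction U arbitrary: i)
  case Nil
  then have "i = length S" by simp
  then show ?case by (simp add: warp_suffix.Nil)
next
  case (Cons x U)
  have i: "i < length S" using Cons.prems(1,2) by (cases "i = length S") auto
  then have drop: "drop i S = S ! i # drop (Suc i) S" by (simp add: Cons_nth_drop_Suc)
  obtain r where x: "x = (fst (S ! i), r)" using Cons.prems(2) drop by (cases x) auto
  have r: "run S i \<le> r" using Cons.prems(3) drop x i by (simp add: run_def)
  have "warp_suffix S (Suc i) (run S (Suc i)) U"
    using Cons.prems drop i by (intro Cons.IH) auto
  then show ?case unfolding x using i r run_pos[OF assms(1) i] by (intro warp_suffix.Cons) auto
qed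

lemma warp_suffix_empty: "warp_suffix S i p U \<Longrightarrow> expand U = [] \<Longrightarrow> U = [] \<and> i = length S"
  by (induction rule: warp_suffix.cases) auto

lemma expand_split: "X \<le> r \<Longrightarrow> expand ((s, r) # U) = replicate X s @ expand ((s, r - X) # U)"
  by (simp flip: replicate_add append_assoc)

context
  fixes \<delta> :: "'a \<Rightarrow> 'a \<Rightarrow> real" and S T :: "'a rle"
  assumes S: "is_rle S" and T: "is_rle T" and \<delta>: "0 \<le> \<delta> x y"
begin

interpretation grid "length S" "length T" "run S" "run T" "dlt \<delta> S T"
  by (rule grid_rle[OF S T \<delta>])

text \<open>The inequalities \<open>run S i \<le> k + p\<close> and
  \<open>run T j \<le> l + q\<close> link the two ways of counting, letters already used and letters
  still required.\<close>

lemma reach_warp_prefix: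
  assumes "reach i j p q c"
  shows "\<exists>u v k l. warp_prefix S i k u \<and> warp_prefix T j l v \<and> length u = length v \<and> warp_cost \<delta> u v = c \<and>
    run S i \<le> k + p \<and> run T j \<le> l + q"
  using assms
proof induction
  case start
  have "warp_cost \<delta> [] [] = 0" by (simp add: warp_cost_def)
  then show ?case
    by (intro exI[of _ "[]"] exI[of _ 0] conjI warp_prefix.empty) auto
next
  case (right i j p q c X)
  then obtain u v k l where *: "warp_prefix S i k u" "warp_prefix T j l v" "length u = length v" "warp_cost \<delta> u v = c"
    "run S i \<le> k + p" "run T j \<le> l + q" by blast
  let ?u = "u @ replicate X (fst (S ! i))" and ?v = "v @ replicate X (fst (T ! j))"
  have "warp_prefix S i (k + X) ?u" "warp_prefix T j (l + X) ?v"
    using * right.hyps by (auto intro: warp_prefix.letters)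
  moreover from this(2) have "warp_prefix T (Suc j) 0 ?v"
    by (rule warp_prefix.advance) (use * right.hyps in auto)
  moreover have "warp_cost \<delta> ?u ?v = c + dlt \<delta> S T i j * real X"
    using * by (simp add: warp_cost_append warp_cost_replicate dlt_def)
  ultimately show ?case using * by (intro exI[of _ ?u] exI[of _ ?v] exI[of _ "k + X"] exI[of _ 0]) auto
next
  case (down i j p q c X)
  then obtain u v k l where *: "warp_prefix S i k u" "warp_prefix T j l v" "length u = length v" "warp_cost \<delta> u v = c"
    "run S i \<le> k + p" "run T j \<le> l + q" by blast
  let ?u = "u @ replicate X (fst (S ! i))" and ?v = "v @ replicate X (fst (T ! j))"
  have "warp_prefix S i (k + X) ?u" "warp_prefix T j (l + X) ?v"
    using * down.hyps by (auto intro: warp_prefix.letters)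
  moreover from this(1) have "warp_prefix S (Suc i) 0 ?u"
    by (rule warp_prefix.advance) (use * down.hyps in auto)
  moreover have "warp_cost \<delta> ?u ?v = c + dlt \<delta> S T i j * real X"
    using * by (simp add: warp_cost_append warp_cost_replicate dlt_def)
  ultimately show ?case using * by (intro exI[of _ ?u] exI[of _ ?v] exI[of _ 0] exI[of _ "l + X"]) auto
next
  case (diag i j p q c X)
  then obtain u v k l where *: "warp_prefix S i k u" "warp_prefix T j l v" "length u = length v" "warp_cost \<delta> u v = c"
    "run S i \<le> k + p" "run T j \<le> l + q" by blast
  let ?u = "u @ replicate X (fst (S ! i))" and ?v = "v @ replicate X (fst (T ! j))"
  have "warp_prefix S i (k + X) ?u" "warp_prefix T j (l + X) ?v"
    using * diag.hyps by (auto intro: warp_prefix.letters)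
  then have "warp_prefix S (Suc i) 0 ?u" "warp_prefix T (Suc j) 0 ?v"
    using * diag.hyps by (auto intro: warp_prefix.advance)
  moreover have "warp_cost \<delta> ?u ?v = c + dlt \<delta> S T i j * real X"
    using * by (simp add: warp_cost_append warp_cost_replicate dlt_def)
  ultimately show ?case using * by (intro exI[of _ ?u] exI[of _ ?v] exI[of _ 0]) auto
qed

text \<open>Match the common length of the two leading runs. At least one of them is used up, which
  is one move of \<open>reach\<close>, and the number of remaining runs drops. Leading runs stay
  nonempty, so an empty expansion means that no run is left.\<close>

lemma warp_suffix_reach:
  assumes "reach i j p q c" "warp_suffix S i p U" "warp_suffix T j q V" "length (expand U) = length (expand V)"
  shows "\<exists>p q. reach (length S) (length T) p q (c + warp_cost \<delta> (expand U) (expand V))"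
  using assms
proof (induction "length U + length V" arbitrary: i j p q c U V rule: less_induct)
  case less
  note r = less.prems(1) and U = less.prems(2) and V = less.prems(3) and len = less.prems(4)
  consider "expand U = []" "expand V = []" | s ru U' t rv V' where "U = (s, ru) # U'" "V = (t, rv) # V'"
    using len by (cases U; cases V) auto
  then show ?case
  proof cases
    case 1
    then have "i = length S" "j = length T" using warp_suffix_empty U V by blast+
    then show ?thesis using r 1 by (auto simp: warp_cost_def)
  next
    case 2
    from U[unfolded 2] have u: "i < length S" "s = fst (S ! i)" "p \<le> ru" "0 < ru" "warp_suffix S (Suc i) (run S (Suc i)) U'"
      by (auto elim: warp_suffix_ConsE)
    from V[unfolded 2] have v: "j < length T" "t = fst (T ! j)" "q \<le> rv" "0 < rv" "warp_suffix T (Suc j) (run T (Suc j)) V'"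
      by (auto elim: warp_suffix_ConsE)
    define X where "X = min ru rv"
    have X: "X \<le> ru" "X \<le> rv" by (simp_all add: X_def)
    let ?U = "(s, ru - X) # U'" and ?V = "(t, rv - X) # V'"
    have eU: "expand U = replicate X s @ expand ?U" unfolding 2 by (rule expand_split[OF X(1)])
    have eV: "expand V = replicate X t @ expand ?V" unfolding 2 by (rule expand_split[OF X(2)])
    have len': "length (expand ?U) = length (expand ?V)" using len eU eV by simp
    have cost: "c + warp_cost \<delta> (expand U) (expand V) = c + dlt \<delta> S T i j * real X + warp_cost \<delta> (expand ?U) (expand ?V)"
      unfolding eU eV using len' u v by (subst warp_cost_append) (simp_all add: warp_cost_replicate dlt_def)
    consider "ru < rv" | "rv < ru" | "ru = rv" by linarith
    then show ?thesis
    proof cases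
      case A: 1
      have V'': "warp_suffix T j (q - X) ?V"
        unfolding v(2) by (rule warp_suffix.Cons) (use v A in \<open>auto simp: X_def\<close>)
      show ?thesis unfolding cost
        using less.hyps[OF _ down[OF r u(1) v(1), of X] u(5) V''] u A len' 2 by (simp add: X_def)
    next
      case A: 2
      have U'': "warp_suffix S i (p - X) ?U"
        unfolding u(2) by (rule warp_suffix.Cons) (use u A in \<open>auto simp: X_def\<close>)
      show ?thesis unfolding cost
        using less.hyps[OF _ right[OF r u(1) v(1), of X] U'' v(5)] v A len' 2 by (simp add: X_def)
    next
      case A: 3
      show ?thesis unfolding cost
        using less.hyps[OF _ diag[OF r u(1) v(1), of X] u(5) v(5)] u v A len' 2 by (simp add: X_def)
    qed
  qed
qed

lemma DTW_eqI:
  assumes c: "\<exists>p q. reach (length S) (length T) p q c"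
    and le: "\<And>p q c'. reach (length S) (length T) p q c' \<Longrightarrow> c \<le> c'"
  shows "DTW \<delta> S T = c"
  unfolding DTW_def
proof (rule Least_equality)
  show "\<exists>u\<in>time_warps S. \<exists>v\<in>time_warps T. length u = length v \<and> c = warp_cost \<delta> u v"
    using c reach_warp_prefix warp_prefix_full by metis
next
  fix c' assume "\<exists>u\<in>time_warps S. \<exists>v\<in>time_warps T. length u = length v \<and> c' = warp_cost \<delta> u v"
  then obtain U V where *: "map fst U = map fst S" "list_all2 (\<le>) (map snd S) (map snd U)"
    "map fst V = map fst T" "list_all2 (\<le>) (map snd T) (map snd V)"
    "length (expand U) = length (expand V)" "c' = warp_cost \<delta> (expand U) (expand V)"
    by (auto simp: time_warps_def)
  have "warp_suffix S 0 (run S 0) U" "warp_suffix T 0 (run T 0) V"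
    using warp_suffix_all[OF S, of 0 U] warp_suffix_all[OF T, of 0 V] * by simp_all
  then show "c \<le> c'" using warp_suffix_reach[OF start] le * by fastforce
qed

end

subsection \<open>Counting loops\<close>

definition for_w :: "nat \<Rightarrow> wexp \<Rightarrow> com \<Rightarrow> com" where
  "for_w x E P = SetW x (WConst 0) ;; Loop (WLess (WReg x) E) (P ;; SetW x (WAdd (WReg x) (WConst 1)))"

lemma mod_for_w [simp]:
  "mod_wreg (for_w x E P) = insert x (mod_wreg P)" "mod_warr (for_w x E P) = mod_warr P"
  "mod_vreg (for_w x E P) = mod_vreg P" "mod_varr (for_w x E P) = mod_varr P"
  by (auto simp: for_w_def)

lemma frame_trans: "frame P s s' \<Longrightarrow> frame P s' s'' \<Longrightarrow> frame P s s''"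
  by (simp add: frame_def)

lemma frame_refl: "frame P s s"
  by (simp add: frame_def)

lemma frame_mono:
  assumes "frame P s s'" "mod_wreg P \<subseteq> mod_wreg Q" "mod_warr P \<subseteq> mod_warr Q"
    "mod_vreg P \<subseteq> mod_vreg Q" "mod_varr P \<subseteq> mod_varr Q"
  shows "frame Q s s'"
  using assms unfolding frame_def by blast

context machine
begin

lemma wp_Loop_frame:
  fixes I :: "nat \<Rightarrow> store \<Rightarrow> bool" and c :: nat
  assumes "I N st"
    and defd: "\<And>i s. I i s \<Longrightarrow> frame P st s \<Longrightarrow> i \<le> N \<Longrightarrow> cdef \<delta> us W s b \<and> (holds \<delta> us s b \<longleftrightarrow> 0 < i)"
    and body: "\<And>i s k. I (Suc i) s \<Longrightarrow> frame P st s \<Longrightarrow> i < N \<Longrightarrow> wp P s k (\<lambda>s' k'. k' \<le> k + c \<and> I i s')"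
  shows "wp (Loop b P) st k (\<lambda>s' k'. I 0 s' \<and> frame P st s' \<and> k' \<le> k + N * (c + ctime b + 1) + (ctime b + 1))"
proof (rule wp_Loop_count[where I = "\<lambda>i s. I i s \<and> frame P st s" and N = N and c = c])
  fix i s k assume "I (Suc i) s \<and> frame P st s" "i < N"
  then show "wp P s k (\<lambda>s' k'. k' \<le> k + c \<and> I i s' \<and> frame P st s')"
    by (intro wp_conseq[OF body]) (auto intro: frame_trans)
qed (use assms(1) defd frame_refl in auto)

text \<open>By \<open>upd\<close> the invariant ignores the counter, so its value is supplied to the
  body separately; the bound \<open>E\<close> is evaluated anew in every round and must keep its
  value.\<close>

lemma wp_for:
  fixes I :: "nat \<Rightarrow> store \<Rightarrow> bool"
  assumes start: "I 0 st"
    and upd: "\<And>i s v. I i s \<Longrightarrow> I i (s\<lparr>wreg := (wreg s)(x := v)\<rparr>)"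
    and E: "\<And>i s. I i s \<Longrightarrow> frame (for_w x E P) st s \<Longrightarrow> wdef W s E \<and> wval s E = N"
    and W: "N < W" "1 < W" and x: "x \<notin> mod_wreg P" and E_time: "wtime E \<le> 3"
    and body: "\<And>i s k. I i s \<Longrightarrow> frame (for_w x E P) st s \<Longrightarrow> wreg s x = i \<Longrightarrow> i < N \<Longrightarrow>
      wp P s k (\<lambda>s' k'. k' \<le> k + c \<and> I (Suc i) s')"
  shows "wp (for_w x E P) st k (\<lambda>s' k'. I N s' \<and> k' \<le> k + N * (c + 10) + 10)"
proof -
  let ?st = "st\<lparr>wreg := (wreg st)(x := 0)\<rparr>"
  let ?b = "WLess (WReg x) E" and ?P = "P ;; SetW x (WAdd (WReg x) (WConst 1))"
  define F where "F s \<longleftrightarrow> frame (for_w x E P) st s" for s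
  have loop: "wp (Loop ?b ?P) ?st k' (\<lambda>s' k''. I N s' \<and> k'' \<le> k' + N * (c + 10) + 8)" for k'
  proof (rule wp_Loop_count[where I = "\<lambda>i s. I (N - i) s \<and> wreg s x = N - i \<and> F s" and N = N and c = "c + 4"])
    show "I (N - N) ?st \<and> wreg ?st x = N - N \<and> F ?st" using upd[OF start] by (simp add: F_def frame_def)
  next
    fix i s assume "I (N - i) s \<and> wreg s x = N - i \<and> F s" "i \<le> N"
    then show "cdef \<delta> us W s ?b \<and> (holds \<delta> us s ?b \<longleftrightarrow> 0 < i)" using E W by (auto simp: F_def)
  next
    fix i s k assume *: "I (N - Suc i) s \<and> wreg s x = N - Suc i \<and> F s" "i < N"
    have "wp P s k (\<lambda>s' k'. k' \<le> k + c \<and> I (N - i) s' \<and> wreg s' x = N - Suc i \<and> F s')"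
    proof (rule wp_conseq[OF body])
      fix s' t assume a: "t \<le> k + c \<and> I (Suc (N - Suc i)) s'" and f: "frame P s s'"
      have "frame (for_w x E P) s s'" using f by (rule frame_mono) auto
      then have "F s'" using * frame_trans unfolding F_def by blast
      then show "t \<le> k + c \<and> I (N - i) s' \<and> wreg s' x = N - Suc i \<and> F s'"
        using a * f x by (simp add: frame_wreg Suc_diff_Suc)
    qed (use * in \<open>auto simp: F_def\<close>)
    then show "wp ?P s k (\<lambda>s' k'. k' \<le> k + (c + 4) \<and> I (N - i) s' \<and> wreg s' x = N - i \<and> F s')"
      unfolding wp_Seq
    proof (rule wp_conseq)
      fix s' t assume a: "t \<le> k + c \<and> I (N - i) s' \<and> wreg s' x = N - Suc i \<and> F s'"
      have "F (s'\<lparr>wreg := (wreg s')(x := v)\<rparr>)" for v using a by (simp add: F_def frame_def)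
      then show "wp (SetW x (WAdd (WReg x) (WConst 1))) s' t
         (\<lambda>s' k'. k' \<le> k + (c + 4) \<and> I (N - i) s' \<and> wreg s' x = N - i \<and> F s')"
        using a upd W *(2) by (auto simp: tick_def Suc_diff_Suc)
    qed
  next
    fix s' k'' assume a: "I (N - 0) s' \<and> wreg s' x = N - 0 \<and> F s'"
      "k'' \<le> k' + N * (c + 4 + ctime ?b + 1) + (ctime ?b + 1)"
    have "N * (c + 4 + ctime ?b + 1) \<le> N * (c + 10)" using E_time by (intro mult_le_mono2) simp
    then have "k'' \<le> k' + N * (c + 10) + (ctime ?b + 1)" using a(2) by linarith
    then show "I N s' \<and> k'' \<le> k' + N * (c + 10) + 8" using a(1) E_time by simp
  qed
  have "wp (SetW x (WConst 0)) st k (\<lambda>s' k'. wp (Loop ?b ?P) s' k' (\<lambda>s' k'. I N s' \<and> k' \<le> k + N * (c + 10) + 10))"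
    unfolding wp_SetW wval.simps
    by (intro conjI wp_conseq[OF loop]) (use W in \<open>auto simp: tick_def\<close>)
  then show ?thesis unfolding for_w_def wp_Seq .
qed

end

subsection \<open>Setting up the keys\<close>

text \<open>
  Corner \<open>(i, j)\<close> has the number \<open>i * (m + 1) + j\<close>; word array 4 will hold the leaf of its diagonal.
  Value arrays 2 and 3 are the prefix sums of the run lengths and value array 4 is a tournament tree for sorting,
  whose used-up leaves get the value of register 21, larger than all keys.
  Word registers: 13 and 14 are \<open>i\<close> and \<open>j\<close>, 15 is a tree node, 16 the number of distinct keys,
  17 is \<open>m + 1\<close>, and 18 to 21 are the leaves of the four corners of a block.  Value registers:
  19 is \<open>total\<close>, 22 the extracted key, 23 is \<open>M\<close> and 24 is \<open>D\<close>.
\<close>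

definition prefix_sums :: "nat \<Rightarrow> nat \<Rightarrow> nat \<Rightarrow> com" where
  "prefix_sums src dst r = for_w 13 (WReg r)
     (PutV dst (WAdd (WReg 13) (WConst 1)) (VAdd (varr_at dst 13) (varr_at src 13)))"

lemma mod_prefix_sums [simp]:
  "mod_wreg (prefix_sums src dst r) = {13}" "mod_warr (prefix_sums src dst r) = {}"
  "mod_vreg (prefix_sums src dst r) = {}" "mod_varr (prefix_sums src dst r) = {dst}"
  by (auto simp: prefix_sums_def)

definition cost_total :: com where
  "cost_total = for_w 13 (WReg 0) (for_w 14 (WReg 1)
     (SetV 19 (VAdd (VReg 19) (VMul (VDelta (WReg 13) (WAdd (WReg 0) (WReg 14))) (VAdd (varr_at 0 13) (varr_at 1 14))))))"

lemma mod_cost_total [simp]: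
  "mod_wreg cost_total = {13, 14}" "mod_warr cost_total = {}" "mod_vreg cost_total = {19}" "mod_varr cost_total = {}"
  by (auto simp: cost_total_def)

definition set_sizes :: com where
  "set_sizes = SetW 17 (WAdd (WReg 1) (WConst 1)) ;; SetW rNN (WConst 1) ;;
     Loop (WLess (WReg rNN) (WMul (WAdd (WReg 0) (WConst 1)) (WReg 17))) (SetW rNN (WMul (WConst 2) (WReg rNN)))"

lemma mod_set_sizes [simp]:
  "mod_wreg set_sizes = {17, rNN}" "mod_warr set_sizes = {}" "mod_vreg set_sizes = {}" "mod_varr set_sizes = {}"
  by (auto simp: set_sizes_def)

definition fill_leaves :: com where
  "fill_leaves = SetV 21 (VAdd (VAdd (VArr 2 (WReg 0)) (VArr 3 (WReg 1))) (VWord (WConst 1))) ;;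
     for_w 15 (WReg rNN) (PutV 4 (WAdd (WReg rNN) (WReg 15)) (VReg 21) ;; PutV leafR (WAdd (WReg rNN) (WReg 15)) (VReg 19))"

lemma mod_fill_leaves [simp]:
  "mod_wreg fill_leaves = {15}" "mod_warr fill_leaves = {}" "mod_vreg fill_leaves = {21}" "mod_varr fill_leaves = {4, leafR}"
  by (auto simp: fill_leaves_def)

definition fill_keys :: com where
  "fill_keys = for_w 13 (WAdd (WReg 0) (WConst 1)) (for_w 14 (WReg 17)
     (PutV 4 (WAdd (WReg rNN) (WAdd (WMul (WReg 13) (WReg 17)) (WReg 14))) (VSub (varr_at 3 14) (varr_at 2 13))))"

lemma mod_fill_keys [simp]:
  "mod_wreg fill_keys = {13, 14}" "mod_warr fill_keys = {}" "mod_vreg fill_keys = {}" "mod_varr fill_keys = {4}"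
  by (auto simp: fill_keys_def)

definition put_min :: com where
  "put_min = Branch (VLess (VArr 4 (child0 15)) (VArr 4 (child1 15)))
     (PutV 4 (WReg 15) (VArr 4 (child0 15))) (PutV 4 (WReg 15) (VArr 4 (child1 15)))"

lemma mod_put_min [simp]:
  "mod_wreg put_min = {}" "mod_warr put_min = {}" "mod_vreg put_min = {}" "mod_varr put_min = {4}"
  by (auto simp: put_min_def)

definition build_heap :: com where
  "build_heap = SetW 15 (WReg rNN) ;;
     Loop (WLess (WConst 1) (WReg 15)) (SetW 15 (WSub (WReg 15) (WConst 1)) ;; put_min)"

lemma mod_build_heap [simp]:
  "mod_wreg build_heap = {15}" "mod_warr build_heap = {}" "mod_vreg build_heap = {}" "mod_varr build_heap = {4}"
  by (auto simp: build_heap_def)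

text \<open>A tournament: an inner node repeats the least value below it, so a least leaf is found
  by following equal values downwards.\<close>

definition heap_at :: "(nat \<Rightarrow> real) \<Rightarrow> nat \<Rightarrow> bool" where
  "heap_at A \<nu> \<longleftrightarrow> A \<nu> = min (A (2 * \<nu>)) (A (2 * \<nu> + 1))"

definition heap :: "(nat \<Rightarrow> real) \<Rightarrow> nat \<Rightarrow> bool" where
  "heap A N \<longleftrightarrow> (\<forall>\<nu>. 1 \<le> \<nu> \<longrightarrow> \<nu> < N \<longrightarrow> heap_at A \<nu>)"

lemma heap_root_le:
  assumes "heap A (2 ^ h)" "g \<le> h" "2 ^ g \<le> x" "x < 2 * 2 ^ g"
  shows "A 1 \<le> A x"
  using assms(2-)
proof (induction g arbitrary: x)
  case 0
  then have "x = 1" by simp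
  then show ?case by simp
next
  case (Suc g)
  have "A 1 \<le> A (x div 2)" using Suc.prems by (intro Suc.IH) auto
  also have "heap_at A (x div 2)"
  proof -
    have "(2::nat) ^ Suc g \<le> 2 ^ h" using Suc.prems(1) by (intro power_increasing) auto
    moreover have "(1::nat) \<le> 2 ^ g" by simp
    ultimately have "1 \<le> x div 2" "x div 2 < 2 ^ h" using Suc.prems(2,3) unfolding power_Suc by linarith+
    then show ?thesis using assms(1) by (simp add: heap_def)
  qed
  then have "A (x div 2) \<le> A x"
    unfolding heap_at_def using half_cases[of x] by auto
  finally show ?case .
qed

context machine
begin

lemma wp_prefix_sums:
  assumes "src \<noteq> dst" "r \<noteq> 13" "wreg st r = N" "N < W" "1 < W" "varr st dst 0 = 0"
  shows "wp (prefix_sums src dst r) st k (\<lambda>s k'. (\<forall>i\<le>N. varr s dst i = (\<Sum>k<i. varr st src k)) \<and> k' \<le> k + N * 20 + 10)"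
proof -
  let ?I = "\<lambda>i s. \<forall>i'\<le>i. varr s dst i' = (\<Sum>k<i'. varr st src k)"
  have "wp (prefix_sums src dst r) st k (\<lambda>s k'. ?I N s \<and> k' \<le> k + N * (10 + 10) + 10)"
    unfolding prefix_sums_def
  proof (rule wp_for[where I = ?I], goal_cases)
    case (3 i s)
    then show ?case using assms by (simp add: frame_wreg)
  next
    case (8 i s k)
    have f: "varr s src = varr st src" using 8(2) assms(1) by (simp add: frame_varr)
    show ?case using 8 assms by (auto simp: tick_def f le_Suc_eq)
  qed (use assms in auto)
  then show ?thesis by (rule wp_conseq) simp
qed

lemma wp_cost_total:
  assumes "wreg st 0 = n" "wreg st 1 = m" "length us = n + m" "n + m < W" "1 < W" "vreg st 19 = 0"
  shows "wp cost_total st k (\<lambda>s k'.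
    vreg s 19 = (\<Sum>i<n. \<Sum>j<m. \<delta> (us ! i) (us ! (n + j)) * (varr st 0 i + varr st 1 j)) \<and>
    k' \<le> k + n * (20 + m * 30) + 10)"
proof -
  define t where "t i j = \<delta> (us ! i) (us ! (n + j)) * (varr st 0 i + varr st 1 j)" for i j
  let ?I = "\<lambda>i s. vreg s 19 = (\<Sum>I<i. \<Sum>j<m. t I j)"
  have "wp cost_total st k (\<lambda>s k'. ?I n s \<and> k' \<le> k + n * (m * 30 + 10 + 10) + 10)"
    unfolding cost_total_def
  proof (rule wp_for[where I = ?I], goal_cases)
    case (8 i s k)
    note I = this
    have f: "wreg s 0 = n" "wreg s 1 = m" "varr s = varr st"
      using I(2) assms by (simp_all add: frame_wreg frame_varr_all)
    let ?J = "\<lambda>j s. vreg s 19 = (\<Sum>I<i. \<Sum>j<m. t I j) + (\<Sum>J<j. t i J)"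
    have "wp (for_w 14 (WReg 1)
       (SetV 19 (VAdd (VReg 19) (VMul (VDelta (WReg 13) (WAdd (WReg 0) (WReg 14))) (VAdd (varr_at 0 13) (varr_at 1 14))))))
       s k (\<lambda>s k'. ?J m s \<and> k' \<le> k + m * (20 + 10) + 10)"
    proof (rule wp_for[where I = ?J], goal_cases)
      case (3 j s')
      then show ?case using f assms by (simp add: frame_wreg)
    next
      case (8 j s' k)
      have f': "wreg s' 0 = n" "wreg s' 1 = m" "varr s' = varr st" "wreg s' 13 = i"
        using 8(2) f I(3) by (simp_all add: frame_wreg frame_varr_all)
      show ?case using 8 f' assms I(4) by (simp add: tick_def t_def)
    qed (use I assms in auto)
    then show ?case by (rule wp_conseq) simp
  next
    case (3 j s')
    then show ?case using assms by (simp add: frame_wreg)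
  qed (use assms in auto)
  then show ?thesis by (rule wp_conseq) (simp add: t_def)
qed

lemma wp_set_sizes:
  assumes st: "wreg st 0 = n" "wreg st 1 = m" and h: "(n + 1) * (m + 1) \<le> 2 ^ h" "2 ^ h < 2 * ((n + 1) * (m + 1))"
    and W: "4 * ((n + 1) * (m + 1)) \<le> W"
  shows "wp set_sizes st k (\<lambda>s k'. wreg s rNN = 2 ^ h \<and> wreg s 17 = m + 1 \<and> k' \<le> k + h * 20 + 20)"
proof -
  define N where "N = (n + 1) * (m + 1)"
  have "N = n * m + n + m + 1" by (simp add: N_def)
  then have N: "0 < N" "n + 1 \<le> N" "m + 1 \<le> N" by simp_all
  have W': "4 * N \<le> W" using W by (simp add: N_def)
  let ?b = "WLess (WReg rNN) (WMul (WAdd (WReg 0) (WConst 1)) (WReg 17))"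
  let ?st = "st\<lparr>wreg := (wreg st)(17 := m + 1, rNN := 1)\<rparr>"
  let ?I = "\<lambda>i s. wreg s rNN = 2 ^ (h - i)"
  have loop: "wp (Loop ?b (SetW rNN (WMul (WConst 2) (WReg rNN)))) ?st k (\<lambda>s k'. ?I 0 s \<and> frame (SetW rNN (WMul (WConst 2) (WReg rNN))) ?st s \<and>
     k' \<le> k + h * (5 + ctime ?b + 1) + (ctime ?b + 1))" for k
  proof (rule wp_Loop_frame, goal_cases)
    case (2 i s)
    have f: "wreg s 0 = n" "wreg s 17 = m + 1" using 2(2) st by (simp_all add: frame_wreg)
    have le: "wreg s rNN < 2 * N"
    proof -
      have "(2::nat) ^ (h - i) \<le> 2 ^ h" by (intro power_increasing) auto
      then show ?thesis using 2(1) h(2) by (simp only: N_def)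
    qed
    have "wreg s rNN < N \<longleftrightarrow> 0 < i"
    proof (cases i)
      case 0
      then show ?thesis using 2(1) h(1) by (simp add: N_def)
    next
      case (Suc i')
      then have "2 * 2 ^ (h - i) = (2::nat) ^ (h - i')"
        using 2(3) by (simp flip: power_Suc add: Suc_diff_Suc)
      also have "\<dots> \<le> 2 ^ h" by (intro power_increasing) auto
      finally have "wreg s rNN < N" using 2(1) h(2) unfolding N_def by linarith
      then show ?thesis using Suc by simp
    qed
    moreover have "wdef W s (WMul (WAdd (WReg 0) (WConst 1)) (WReg 17)) \<and> wval s (WMul (WAdd (WReg 0) (WConst 1)) (WReg 17)) = N"
      using N W' unfolding N_def by (simp add: f)
    ultimately show ?case using le W' N by simp
  next
    case (3 i s k)
    have "2 * 2 ^ (h - Suc i) = (2::nat) ^ (h - i)"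
      using 3(3) by (simp flip: power_Suc add: Suc_diff_Suc)
    moreover have "(2::nat) ^ (h - i) \<le> 2 ^ h" by (intro power_increasing) auto
    moreover have "2 ^ h < 2 * N" using h(2) by (simp add: N_def)
    ultimately have *: "2 * 2 ^ (h - Suc i) = (2::nat) ^ (h - i)" "(2::nat) ^ (h - i) < W" using W' by linarith+
    then show ?case using 3(1) W' N by (simp add: tick_def)
  qed simp
  have f17: "wreg s 17 = m + 1" if "frame (SetW rNN (WMul (WConst 2) (WReg rNN))) ?st s" for s
    using that by (simp add: frame_wreg)
  have e: "wval st (WAdd (WReg 1) (WConst 1)) = m + 1" "wdef W st (WAdd (WReg 1) (WConst 1))"
    using N W' st[simplified] by simp_all
  let ?L = "Loop ?b (SetW rNN (WMul (WConst 2) (WReg rNN)))"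
  have "wp ?L ?st k' (\<lambda>s k'. wreg s rNN = 2 ^ h \<and> wreg s 17 = m + 1 \<and> k' \<le> k + h * 20 + 20)" if "k' \<le> k + 6" for k'
    by (rule wp_conseq[OF loop]) (use f17 that in auto)
  then have "wp (SetW 17 (WAdd (WReg 1) (WConst 1))) st k (\<lambda>s k'. wp (SetW rNN (WConst 1)) s k'
    (\<lambda>s k'. wp ?L s k' (\<lambda>s k'. wreg s rNN = 2 ^ h \<and> wreg s 17 = m + 1 \<and> k' \<le> k + h * 20 + 20)))"
    unfolding wp_SetW e using e(2) N W' by (simp add: tick_def)
  then show ?thesis unfolding set_sizes_def wp_Seq .
qed

lemma wp_fill_leaves:
  assumes st: "wreg st 0 = n" "wreg st 1 = m" "wreg st rNN = N" and W: "2 * N < W" "n < W" "m < W" "1 < W"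
  shows "wp fill_leaves st k (\<lambda>s k'. vreg s 21 = varr st 2 n + varr st 3 m + 1 \<and>
    (\<forall>x<N. varr s 4 (N + x) = varr st 2 n + varr st 3 m + 1 \<and> varr s leafR (N + x) = vreg st 19) \<and>
    (\<forall>x<N. varr s 4 x = varr st 4 x) \<and>
    k' \<le> k + N * 30 + 30)"
proof -
  let ?B = "varr st 2 n + varr st 3 m + 1"
  let ?st = "st\<lparr>vreg := (vreg st)(21 := ?B)\<rparr>"
  let ?I = "\<lambda>i s. (\<forall>x<i. varr s 4 (N + x) = ?B \<and> varr s leafR (N + x) = vreg st 19) \<and> (\<forall>x<N. varr s 4 x = varr st 4 x)"
  have loop: "wp (for_w 15 (WReg rNN) (PutV 4 (WAdd (WReg rNN) (WReg 15)) (VReg 21) ;; PutV leafR (WAdd (WReg rNN) (WReg 15)) (VReg 19)))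
    ?st k (\<lambda>s k'. (?I N s \<and> vreg s 21 = ?B) \<and> k' \<le> k + N * (20 + 10) + 10)" for k
  proof (rule wp_for[where I = "\<lambda>i s. ?I i s \<and> vreg s 21 = ?B"], goal_cases)
    case (3 i s)
    then show ?case using st W by (simp add: frame_wreg)
  next
    case (8 i s k)
    have f: "wreg s rNN = N" "vreg s 19 = vreg st 19" using 8(2) st by (simp_all add: frame_wreg frame_vreg)
    show ?case using 8 f W by (auto simp: tick_def less_Suc_eq)
  qed (use W in auto)
  show ?thesis
    unfolding fill_leaves_def using st W
    by (simp add: st) (rule wp_conseq[OF loop], auto simp: tick_def)
qed

lemma wp_fill_keys:
  assumes st: "wreg st 0 = n" "wreg st 17 = m + 1" "wreg st rNN = N" and N: "(n + 1) * (m + 1) \<le> N" and W: "2 * N < W"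
    and B: "\<And>x. x < N \<Longrightarrow> varr st 4 (N + x) = B"
  shows "wp fill_keys st k (\<lambda>s k'.
    (\<forall>x<N. varr s 4 (N + x) = (if x < (n + 1) * (m + 1) then varr st 3 (x mod (m + 1)) - varr st 2 (x div (m + 1)) else B)) \<and>
    k' \<le> k + (n + 1) * ((m + 1) * 30 + 20) + 10)"
proof -
  have "(n + 1) * (m + 1) = n * m + n + m + 1" by simp
  then have N': "n + 1 \<le> N" "m + 1 \<le> N" using N by simp_all
  define key where "key x = varr st 3 (x mod (m + 1)) - varr st 2 (x div (m + 1))" for x
  let ?I = "\<lambda>i s. \<forall>x<N. varr s 4 (N + x) = (if x < i then key x else B)"
  have "wp fill_keys st k (\<lambda>s k'. ?I ((n + 1) * (m + 1)) s \<and> k' \<le> k + (n + 1) * ((m + 1) * (20 + 10) + 10 + 10) + 10)"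
    unfolding fill_keys_def
  proof (rule wp_for[where I = "\<lambda>i. ?I (i * (m + 1))"], goal_cases)
    case (3 i s)
    then show ?case using st N' W by (simp add: frame_wreg)
  next
    case (8 i s k)
    note I = this
    have "i * (m + 1) + (m + 1) \<le> (n + 1) * (m + 1)"
      using mult_le_mono1[of "Suc i" "n + 1" "m + 1"] I(4) by simp
    then have iN: "i * (m + 1) + (m + 1) \<le> N" using N by linarith
    have f: "wreg s 0 = n" "wreg s 17 = m + 1" "wreg s rNN = N" "varr s 2 = varr st 2" "varr s 3 = varr st 3"
      using I(2) st by (simp_all add: frame_wreg frame_varr)
    have "wp (for_w 14 (WReg 17)
     (PutV 4 (WAdd (WReg rNN) (WAdd (WMul (WReg 13) (WReg 17)) (WReg 14))) (VSub (varr_at 3 14) (varr_at 2 13))))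
       s k (\<lambda>s k'. ?I (i * (m + 1) + (m + 1)) s \<and> k' \<le> k + (m + 1) * (20 + 10) + 10)"
    proof (rule wp_for[where I = "\<lambda>j. ?I (i * (m + 1) + j)"], goal_cases)
      case (3 j s')
      then show ?case using f N' W by (simp add: frame_wreg)
    next
      case (8 j s' k)
      have f': "wreg s' 17 = m + 1" "wreg s' rNN = N" "varr s' 2 = varr st 2" "varr s' 3 = varr st 3" "wreg s' 13 = i"
        using 8(2) f I(3) by (simp_all add: frame_wreg frame_varr)
      have k: "key (i * (m + 1) + j) = varr st 3 j - varr st 2 i"
        using 8(4) unfolding key_def by (metis Suc_eq_plus1 add.commute add.right_neutral div_less div_mult_self3 mod_less mod_mult_self3 nat.simps(3))
      define q where "q = i * (m + 1)"
      have q: "q + j < N" using iN 8(4) by (simp add: q_def)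
      have eval: "wval s' (WAdd (WReg rNN) (WAdd (WMul (WReg 13) (WReg 17)) (WReg 14))) = N + (q + j)"
        "wdef W s' (WAdd (WReg rNN) (WAdd (WMul (WReg 13) (WReg 17)) (WReg 14)))"
        using f' 8(3,4) q N' W I(4) by (simp_all add: q_def)
      have inv: "\<forall>x<N. varr s' 4 (N + x) = (if x < q + j then key x else B)" using 8(1) by (simp only: q_def)
      have val: "vval \<delta> us s' (VSub (varr_at 3 14) (varr_at 2 13)) = key (q + j)"
        "vdef \<delta> us W s' (VSub (varr_at 3 14) (varr_at 2 13))"
        using f' 8(3,4) k I(4) W N' by (simp_all add: q_def)
      have "\<forall>x<N. ((varr s' 4)(N + (q + j) := key (q + j))) (N + x) = (if x < q + Suc j then key x else B)"
        using inv q by (auto simp: less_Suc_eq)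
      then show ?case
        unfolding wp_PutV eval val using eval(2) val(2) by (simp add: q_def tick_def del: wdef.simps vdef.simps)
    qed (use I N' W in auto)
    then show ?case by (rule wp_conseq) (simp add: add.commute)
  qed (use N' W B in auto)
  then show ?thesis by (rule wp_conseq) (simp add: key_def)
qed

lemma wp_put_min:
  assumes "wreg st 15 = c" "2 * c + 1 < W" "2 < W"
    and "\<And>s k'. k' \<le> k + 30 \<Longrightarrow> s = st\<lparr>varr := (varr st)(4 := (varr st 4)(c := min (varr st 4 (2 * c)) (varr st 4 (2 * c + 1))))\<rparr> \<Longrightarrow> Q s k'"
  shows "wp put_min st k Q"
  unfolding put_min_def using assms(1-3)
  by simp (intro conjI impI assms(4); simp add: tick_def min_absorb1 min_absorb2)

lemma wp_build_heap:
  assumes st: "wreg st rNN = N" and W: "2 * N < W" "2 < W" and N: "1 \<le> N"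
  shows "wp build_heap st k (\<lambda>s k'. heap (varr s 4) N \<and> (\<forall>x\<ge>N. varr s 4 x = varr st 4 x) \<and> k' \<le> k + N * 40 + 10)"
proof -
  let ?st = "st\<lparr>wreg := (wreg st)(15 := N)\<rparr>"
  let ?P = "SetW 15 (WSub (WReg 15) (WConst 1)) ;; put_min"
  let ?b = "WLess (WConst 1) (WReg 15)"
  let ?I = "\<lambda>i s. wreg s 15 = i + 1 \<and> (\<forall>\<nu>. i + 1 \<le> \<nu> \<longrightarrow> \<nu> < N \<longrightarrow> heap_at (varr s 4) \<nu>) \<and> (\<forall>x\<ge>N. varr s 4 x = varr st 4 x)"
  have loop: "wp (Loop ?b ?P) ?st k (\<lambda>s k'. ?I 0 s \<and> frame ?P ?st s \<and> k' \<le> k + (N - 1) * (35 + ctime ?b + 1) + (ctime ?b + 1))" for k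
  proof (rule wp_Loop_frame, goal_cases)
    case 1
    then show ?case using N by auto
  next
    case (2 i s)
    then show ?case using W N by auto
  next
    case (3 i s k)
    have i: "i + 1 < N" using 3(3) by simp
    let ?s1 = "s\<lparr>wreg := (wreg s)(15 := i + 1)\<rparr>"
    have e: "wval s (WSub (WReg 15) (WConst 1)) = i + 1" "wdef W s (WSub (WReg 15) (WConst 1))"
      using 3(1) W i by simp_all
    have "wp put_min ?s1 k' (\<lambda>s' k'. k' \<le> k + 35 \<and> ?I i s')" if k': "k' \<le> k + 5" for k'
    proof (rule wp_put_min[where c = "i + 1"], goal_cases)
      case (4 s' t)
      have v: "varr s' 4 = (varr s 4)(i + 1 := min (varr s 4 (2 * (i + 1))) (varr s 4 (2 * (i + 1) + 1)))"
        by (simp add: 4(2))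
      have "heap_at (varr s' 4) \<nu>" if "i + 1 \<le> \<nu>" "\<nu> < N" for \<nu>
      proof (cases "\<nu> = i + 1")
        case True
        then show ?thesis by (simp add: heap_at_def v)
      next
        case False
        then have "heap_at (varr s 4) \<nu>" using 3(1) that by simp
        then show ?thesis using False that by (simp add: heap_at_def v)
      qed
      moreover have "varr s' 4 x = varr st 4 x" if "x \<ge> N" for x using 3(1) that i by (simp add: v)
      moreover have "wreg s' 15 = i + 1" by (simp add: 4(2))
      ultimately show ?case using k' 4(1) by auto
    qed (use W i in auto)
    then show ?case unfolding wp_Seq wp_SetW e using e(2) by (simp add: tick_def del: wdef.simps)
  qed
  have t: "(N - 1) * (35 + 3 + 1) + (3 + 1) + 2 \<le> N * 40 + 10" using N by (simp add: diff_mult_distrib)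
  have "wp (Loop ?b ?P) ?st k' (\<lambda>s k'. heap (varr s 4) N \<and> (\<forall>x\<ge>N. varr s 4 x = varr st 4 x) \<and> k' \<le> k + N * 40 + 10)"
    if "k' \<le> k + 2" for k'
    by (rule wp_conseq[OF loop]) (use t that in \<open>auto simp: heap_def\<close>)
  then have "wp (SetW 15 (WReg rNN)) st k (\<lambda>s k'. wp (Loop ?b ?P) s k'
     (\<lambda>s k'. heap (varr s 4) N \<and> (\<forall>x\<ge>N. varr s 4 x = varr st 4 x) \<and> k' \<le> k + N * 40 + 10))"
    unfolding wp_SetW using W by (simp add: tick_def st)
  then show ?thesis unfolding build_heap_def wp_Seq .
qed

end

subsection \<open>Sorting the keys\<close>

definition descend :: com where
  "descend = Loop (WLess (WReg 15) (WReg rNN))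
     (Branch (VEq (VArr 4 (child0 15)) (VReg 22)) (SetW 15 (child0 15)) (SetW 15 (child1 15)))"

definition ascend :: com where
  "ascend = Loop (WLess (WConst 1) (WReg 15)) (SetW 15 (WDiv (WReg 15) (WConst 2)) ;; put_min)"

text \<open>Comparing with the previous key makes all corners on one diagonal share a leaf. Before
  the first key stands the value of \<open>sentinel\<close>, in a place that
  \<open>inner_keys\<close> overwrites later.\<close>

definition new_key :: com where
  "new_key = Branch (VLess (VArr keyM (WSub (WAdd (WReg rNN) (WReg 16)) (WConst 1))) (VReg 22))
     (PutV keyM (WAdd (WReg rNN) (WReg 16)) (VReg 22) ;; SetW 16 (WAdd (WReg 16) (WConst 1))) Skip"

definition extract_min :: com where
  "extract_min = SetV 22 (VArr 4 (WConst 1)) ;; SetW 15 (WConst 1) ;; descend ;; new_key ;;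
     PutW 4 (WSub (WReg 15) (WReg rNN)) (WSub (WAdd (WReg rNN) (WReg 16)) (WConst 1)) ;;
     PutV 4 (WReg 15) (VReg 21) ;; ascend"

definition extract_all :: com where
  "extract_all = Loop (VLess (VArr 4 (WConst 1)) (VReg 21)) extract_min"

text \<open>The leaves left over by coinciding diagonals get further integers, because the tree
  needs strictly increasing keys at all of its leaves.\<close>

definition pad_keys :: com where
  "pad_keys = Loop (WLess (WReg 16) (WReg rNN))
     (PutV keyM (WAdd (WReg rNN) (WReg 16)) (VAdd (VArr keyM (WSub (WAdd (WReg rNN) (WReg 16)) (WConst 1))) (VWord (WConst 1))) ;;
      SetW 16 (WAdd (WReg 16) (WConst 1)))"

definition inner_keys :: com where
  "inner_keys = for_w 15 (WReg rNN) (PutV keyL (WAdd (WReg rNN) (WReg 15)) (VArr keyM (WAdd (WReg rNN) (WReg 15)))) ;;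
     SetW 15 (WReg rNN) ;;
     Loop (WLess (WConst 1) (WReg 15)) (SetW 15 (WSub (WReg 15) (WConst 1)) ;;
       PutV keyM (WReg 15) (VArr keyL (child1 15)) ;; PutV keyL (WReg 15) (VArr keyL (child0 15)))"

lemma mod_extract [simp]:
  "mod_wreg descend = {15}" "mod_warr descend = {}" "mod_vreg descend = {}" "mod_varr descend = {}"
  "mod_wreg ascend = {15}" "mod_warr ascend = {}" "mod_vreg ascend = {}" "mod_varr ascend = {4}"
  "mod_wreg new_key = {16}" "mod_warr new_key = {}" "mod_vreg new_key = {}" "mod_varr new_key = {keyM}"
  "mod_wreg extract_min = {15, 16}" "mod_warr extract_min = {4}" "mod_vreg extract_min = {22}" "mod_varr extract_min = {keyM, 4}"
  "mod_wreg extract_all = {15, 16}" "mod_warr extract_all = {4}" "mod_vreg extract_all = {22}" "mod_varr extract_all = {keyM, 4}"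
  "mod_wreg pad_keys = {16}" "mod_warr pad_keys = {}" "mod_vreg pad_keys = {}" "mod_varr pad_keys = {keyM}"
  "mod_wreg inner_keys = {15}" "mod_warr inner_keys = {}" "mod_vreg inner_keys = {}" "mod_varr inner_keys = {keyM, keyL}"
  by (auto simp: descend_def ascend_def new_key_def extract_min_def extract_all_def pad_keys_def inner_keys_def)

text \<open>\<open>Al\<close> is the set of corners still in the tournament. The last clause bounds
  the number of distinct keys, so that there is always room for the next one.\<close>

definition extract_inv :: "nat \<Rightarrow> nat \<Rightarrow> (nat \<Rightarrow> real) \<Rightarrow> real \<Rightarrow> real \<Rightarrow> nat set \<Rightarrow> store \<Rightarrow> bool" where
  "extract_inv h N' key B L Al s \<longleftrightarrow> Al \<subseteq> {..<N'} \<and> heap (varr s 4) (2 ^ h) \<and>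
     (\<forall>x<2 ^ h. varr s 4 (2 ^ h + x) = (if x \<in> Al then key x else B)) \<and>
     (\<forall>x<N'. x \<notin> Al \<longrightarrow> 2 ^ h \<le> warr s 4 x \<and> warr s 4 x < 2 ^ h + wreg s 16 \<and> varr s keyM (warr s 4 x) = key x) \<and>
     (\<forall>y<wreg s 16. varr s keyM (2 ^ h + y - 1) < varr s keyM (2 ^ h + y) \<and> varr s keyM (2 ^ h + y) \<in> \<int>) \<and>
     (\<forall>x\<in>Al. varr s keyM (2 ^ h + wreg s 16 - 1) \<le> key x) \<and> varr s keyM (2 ^ h - 1) = L \<and>
     wreg s 16 + card Al \<le> N'"

definition keys_sorted :: "nat \<Rightarrow> (nat \<Rightarrow> real) \<Rightarrow> bool" where
  "keys_sorted N A \<longleftrightarrow> (\<forall>x y. N \<le> x \<longrightarrow> x < y \<longrightarrow> y < 2 * N \<longrightarrow> A x < A y) \<and> (\<forall>x. N \<le> x \<longrightarrow> x < 2 * N \<longrightarrow> A x \<in> \<int>)"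

text \<open>\<open>keyL\<close> is the least key below a node, so the separating key of a node is
  the first key of its right child.\<close>

lemma key_ok_sorted:
  assumes sorted: "keys_sorted (2 ^ h) (A keyM)"
    and leaf: "\<And>x. 2 ^ h \<le> x \<Longrightarrow> x < 2 * 2 ^ h \<Longrightarrow> A keyL x = A keyM x"
    and inner: "\<And>\<nu>. 1 \<le> \<nu> \<Longrightarrow> \<nu> < 2 ^ h \<Longrightarrow> A keyM \<nu> = A keyL (2 * \<nu> + 1) \<and> A keyL \<nu> = A keyL (2 * \<nu>)"
    and nd: "nd h e c"
  shows "key_ok A e c \<and> A keyL c = A keyM (c * 2 ^ e)"
  using nd
proof (induction e arbitrary: c)
  case 0
  then show ?case using leaf by (simp add: nd_0)
next
  case (Suc e)
  have c: "nd h e (2 * c)" "nd h e (2 * c + 1)" "c < 2 ^ h" using nd_Suc[OF Suc.prems] by auto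
  have c1: "1 \<le> c" using nd_pos[OF Suc.prems] by simp
  note IH = Suc.IH[OF c(1)] Suc.IH[OF c(2)]
  have m: "A keyM c = A keyM ((2 * c + 1) * 2 ^ e)" using inner[OF c1 c(3)] IH(2) by simp
  have first: "(2 * c + 1) * 2 ^ e \<in> lv e (2 * c + 1)" by (simp add: lv_interval)
  then have lf: "2 ^ h \<le> (2 * c + 1) * 2 ^ e" "(2 * c + 1) * 2 ^ e < 2 * 2 ^ h"
    using nd_leaf[OF c(2)] nd_0 by blast+
  have "A keyM x < A keyM c" if "x \<in> lv e (2 * c)" for x
  proof -
    have "2 ^ h \<le> x" using nd_leaf[OF c(1) that] nd_0 by blast
    moreover have "x < (2 * c + 1) * 2 ^ e" using that by (simp add: lv_interval)
    ultimately show ?thesis using sorted lf unfolding m keys_sorted_def by (metis mult.commute)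
  qed
  moreover have "A keyM c \<le> A keyM x" if "x \<in> lv e (2 * c + 1)" for x
  proof (cases "x = (2 * c + 1) * 2 ^ e")
    case True
    then show ?thesis by (simp add: m)
  next
    case False
    have "x < 2 * 2 ^ h" using nd_leaf[OF c(2) that] nd_0 by blast
    moreover have "(2 * c + 1) * 2 ^ e \<le> x" using that by (simp add: lv_interval)
    then have "(2 * c + 1) * 2 ^ e < x" using False by linarith
    ultimately have "A keyM ((2 * c + 1) * 2 ^ e) < A keyM x" using sorted lf unfolding keys_sorted_def by blast
    then show ?thesis unfolding m by simp
  qed
  moreover have "A keyL c = A keyM (c * 2 ^ Suc e)" using inner[OF c1 c(3)] IH(1) by (simp add: ac_simps)
  ultimately show ?case using IH by simp
qed

context machine
begin

lemma wp_descend: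
  assumes st: "wreg st rNN = 2 ^ h" "wreg st 15 = 1" "vreg st 22 = varr st 4 1" and hp: "heap (varr st 4) (2 ^ h)"
    and W: "2 * 2 ^ h < W" "2 < W"
  shows "wp descend st k (\<lambda>s k'. 2 ^ h \<le> wreg s 15 \<and> wreg s 15 < 2 * 2 ^ h \<and> varr st 4 (wreg s 15) = varr st 4 1 \<and>
    frame descend st s \<and> k' \<le> k + h * 30 + 10)"
proof -
  let ?b = "WLess (WReg 15) (WReg rNN)"
  let ?P = "Branch (VEq (VArr 4 (child0 15)) (VReg 22)) (SetW 15 (child0 15)) (SetW 15 (child1 15))"
  let ?I = "\<lambda>i s. 2 ^ (h - i) \<le> wreg s 15 \<and> wreg s 15 < 2 * 2 ^ (h - i) \<and> varr st 4 (wreg s 15) = varr st 4 1"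
  have "wp (Loop ?b ?P) st k (\<lambda>s k'. ?I 0 s \<and> frame ?P st s \<and> k' \<le> k + h * (20 + ctime ?b + 1) + (ctime ?b + 1))"
  proof (rule wp_Loop_frame, goal_cases)
    case 1
    then show ?case using st by simp
  next
    case (2 i s)
    have f: "wreg s rNN = 2 ^ h" using 2(2) st by (simp add: frame_wreg)
    have "wreg s 15 < 2 ^ h \<longleftrightarrow> 0 < i"
    proof (cases i)
      case 0
      then show ?thesis using 2(1) by simp
    next
      case (Suc i')
      then have "2 * 2 ^ (h - i) = (2::nat) ^ (h - i')" using 2(3) by (simp flip: power_Suc add: Suc_diff_Suc)
      also have "\<dots> \<le> 2 ^ h" by (intro power_increasing) auto
      finally show ?thesis using 2(1) Suc by simp
    qed
    moreover have "wreg s 15 < W"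
    proof -
      have "(2::nat) ^ (h - i) \<le> 2 ^ h" by (intro power_increasing) auto
      then show ?thesis using 2(1) W by linarith
    qed
    ultimately show ?case using f W by simp
  next
    case (3 i s k)
    have f: "vreg s 22 = varr st 4 1" "varr s 4 = varr st 4" using 3(2) st by (simp_all add: frame_vreg frame_varr)
    define c where "c = wreg s 15"
    have p: "2 * 2 ^ (h - Suc i) = (2::nat) ^ (h - i)" using 3(3) by (simp flip: power_Suc add: Suc_diff_Suc)
    have c: "2 ^ (h - Suc i) \<le> c" "c < 2 ^ (h - i)" "varr st 4 c = varr st 4 1"
      using 3(1) unfolding c_def p by simp_all
    have "(2::nat) ^ (h - i) \<le> 2 ^ h" by (intro power_increasing) auto
    then have ch: "c < 2 ^ h" using c by linarith
    have "(1::nat) \<le> 2 ^ (h - Suc i)" by simp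
    then have "1 \<le> c" using c(1) by linarith
    then have "heap_at (varr st 4) c" using hp ch by (simp add: heap_def)
    then have "varr st 4 (2 * c) = varr st 4 1 \<or> varr st 4 (2 * c + 1) = varr st 4 1"
      using c(3) by (simp add: heap_at_def min_def split: if_splits)
    moreover have "2 ^ (h - i) \<le> 2 * c" "2 * c + 1 < 2 * 2 ^ (h - i)" using c p by linarith+
    ultimately show ?case using W ch f by (auto simp: tick_def c_def[symmetric])
  qed
  then show ?thesis unfolding descend_def by (rule wp_conseq) (simp add: frame_def)
qed

text \<open>The tournament can be violated only at the parent of the current node; repairing it
  there moves the defect one level up, until it leaves the tree at the root.\<close>

lemma wp_ascend:
  assumes c: "2 ^ h \<le> wreg st 15" "wreg st 15 < 2 * 2 ^ h"
    and hp: "\<And>\<nu>. 1 \<le> \<nu> \<Longrightarrow> \<nu> < 2 ^ h \<Longrightarrow> \<nu> \<noteq> wreg st 15 div 2 \<Longrightarrow> heap_at (varr st 4) \<nu>"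
    and W: "2 * 2 ^ h < W" "2 < W"
  shows "wp ascend st k (\<lambda>s k'. heap (varr s 4) (2 ^ h) \<and> (\<forall>x\<ge>2 ^ h. varr s 4 x = varr st 4 x) \<and>
    frame ascend st s \<and> k' \<le> k + h * 40 + 10)"
proof -
  let ?b = "WLess (WConst 1) (WReg 15)"
  let ?P = "SetW 15 (WDiv (WReg 15) (WConst 2)) ;; put_min"
  let ?I = "\<lambda>i s. 2 ^ i \<le> wreg s 15 \<and> wreg s 15 < 2 * 2 ^ i \<and>
    (\<forall>\<nu>. 1 \<le> \<nu> \<longrightarrow> \<nu> < 2 ^ h \<longrightarrow> \<nu> \<noteq> wreg s 15 div 2 \<longrightarrow> heap_at (varr s 4) \<nu>) \<and> (\<forall>x\<ge>2 ^ h. varr s 4 x = varr st 4 x)"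
  have "wp (Loop ?b ?P) st k (\<lambda>s k'. ?I 0 s \<and> frame ?P st s \<and> k' \<le> k + h * (35 + ctime ?b + 1) + (ctime ?b + 1))"
  proof (rule wp_Loop_frame, goal_cases)
    case 1
    then show ?case using c hp by simp
  next
    case (2 i s)
    have "(2::nat) ^ i \<le> 2 ^ h" using 2(3) by (intro power_increasing) auto
    then have "wreg s 15 < W" using 2(1) W by linarith
    moreover have "1 < wreg s 15 \<longleftrightarrow> 0 < i"
    proof (cases i)
      case 0
      then show ?thesis using 2(1) by simp
    next
      case (Suc i')
      have "(1::nat) \<le> 2 ^ i'" by simp
      then have "(2::nat) \<le> 2 ^ i" unfolding Suc power_Suc by linarith
      then have "2 \<le> wreg s 15" using 2(1) by linarith
      then show ?thesis using Suc by simp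
    qed
    ultimately show ?case using W by simp
  next
    case (3 i s k)
    define c where "c = wreg s 15 div 2"
    have I: "2 * 2 ^ i \<le> wreg s 15" "wreg s 15 < 2 * (2 * 2 ^ i)"
      "\<And>\<nu>. 1 \<le> \<nu> \<Longrightarrow> \<nu> < 2 ^ h \<Longrightarrow> \<nu> \<noteq> c \<Longrightarrow> heap_at (varr s 4) \<nu>" "\<And>x. 2 ^ h \<le> x \<Longrightarrow> varr s 4 x = varr st 4 x"
      using 3(1) by (simp_all add: c_def)
    have ci: "2 ^ i \<le> c" "c < 2 * 2 ^ i" using I(1,2) unfolding c_def by linarith+
    have "(2::nat) ^ Suc i \<le> 2 ^ h" using 3(3) by (intro power_increasing) auto
    then have le: "2 * (2::nat) ^ i \<le> 2 ^ h" by simp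
    then have ch: "c < 2 ^ h" using ci by linarith
    have "(1::nat) \<le> 2 ^ i" by simp
    then have c1: "1 \<le> c" using ci(1) by linarith
    let ?s1 = "s\<lparr>wreg := (wreg s)(15 := c)\<rparr>"
    have e: "wval s (WDiv (WReg 15) (WConst 2)) = c" "wdef W s (WDiv (WReg 15) (WConst 2))"
      using I(2) le W by (simp_all add: c_def)
    have "wp put_min ?s1 k' (\<lambda>s' k'. k' \<le> k + 35 \<and> ?I i s')" if k': "k' \<le> k + 5" for k'
    proof (rule wp_put_min[where c = c], goal_cases)
      case (4 s' t)
      have v: "varr s' 4 = (varr s 4)(c := min (varr s 4 (2 * c)) (varr s 4 (2 * c + 1)))" and w: "wreg s' 15 = c"
        by (simp_all add: 4(2))
      have "heap_at (varr s' 4) \<nu>" if \<nu>: "1 \<le> \<nu>" "\<nu> < 2 ^ h" "\<nu> \<noteq> c div 2" for \<nu>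
      proof (cases "\<nu> = c")
        case True
        then show ?thesis using c1 by (simp add: heap_at_def v)
      next
        case False
        then have "heap_at (varr s 4) \<nu>" using I(3) \<nu> by simp
        moreover have "2 * \<nu> \<noteq> c" "2 * \<nu> + 1 \<noteq> c" using \<nu>(3) by auto
        ultimately show ?thesis using False by (simp add: heap_at_def v)
      qed
      moreover have "varr s' 4 x = varr st 4 x" if "x \<ge> 2 ^ h" for x using I(4) that ch by (simp add: v)
      ultimately show ?case using k' 4(1) ci w by auto
    qed (use W ch in auto)
    then show ?case unfolding wp_Seq wp_SetW e using e(2) by (simp add: tick_def del: wdef.simps)
  qed
  then show ?thesis unfolding ascend_def by (rule wp_conseq) (auto simp: frame_def heap_def)
qed

context
  fixes h N' :: nat and key :: "nat \<Rightarrow> real" and B L :: real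
  assumes N': "N' \<le> 2 ^ h" "0 < N'" and W: "2 * 2 ^ h < W" "2 < W"
    and keyB: "\<And>x. x < N' \<Longrightarrow> L < key x \<and> key x < B \<and> key x \<in> \<int>"
begin

abbreviation "ext \<equiv> extract_inv h N' key B L"

lemma wp_extract_min:
  assumes inv: "ext Al st" and st: "wreg st rNN = 2 ^ h" "vreg st 21 = B" "Al \<noteq> {}"
  shows "wp extract_min st k (\<lambda>s k'. k' \<le> k + (h * 70 + 100) \<and> (\<exists>x\<in>Al. ext (Al - {x}) s))"
proof -
  let ?N = "2 ^ h :: nat"
  define v where "v = varr st 4 1"
  define K where "K = wreg st 16"
  note I = inv[unfolded extract_inv_def, folded K_def]
  have fin: "finite Al" using I finite_subset by blast
  have N1: "1 \<le> ?N" by simp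
  have vle: "v \<le> varr st 4 (?N + x)" if "x < ?N" for x
    unfolding v_def by (rule heap_root_le[of _ h h]) (use I that in auto)
  have K: "K < N'" using I st(3) fin by (cases "card Al") auto
  let ?s1 = "st\<lparr>vreg := (vreg st)(22 := v)\<rparr>\<lparr>wreg := (wreg st)(15 := 1)\<rparr>"
  have fin_step: "wp ascend s4 k4 (\<lambda>s k'. k' \<le> k + (h * 70 + 100) \<and> (\<exists>x\<in>Al. ext (Al - {x}) s))"
    if k4: "k4 \<le> k + h * 30 + 80" and x: "x \<in> Al" "key x = v" "wreg s4 15 = ?N + x"
      and v4: "varr s4 4 = (varr st 4)(?N + x := B)" and w4: "warr s4 4 = (warr st 4)(x := ?N + K' - 1)"
      and K': "wreg s4 16 = K'" "K \<le> K'" "K' \<le> K + 1" "0 < K'"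
      and keys: "\<And>y. y < ?N + K \<Longrightarrow> varr s4 keyM y = varr st keyM y" "varr s4 keyM (?N + K' - 1) = v"
        "K' = K + 1 \<Longrightarrow> varr s4 keyM (?N + K - 1) < v"
    for s4 k4 x K'
  proof (rule wp_conseq[OF wp_ascend[where h = h]], goal_cases)
    case (3 \<nu>)
    then have "heap_at (varr st 4) \<nu>" using I by (simp add: heap_def)
    then show ?case using 3 x(3) by (auto simp: heap_at_def v4)
  next
    case (6 s t)
    have xN: "x < N'" using I x by auto
    have f: "wreg s 16 = K'" "warr s = warr s4" "varr s keyM = varr s4 keyM"
      using 6(2) K' by (simp_all add: frame_wreg frame_warr_all frame_varr)
    have K1: "K' \<le> N'" using K K' by linarith
    have kM: "varr s4 keyM y = varr st keyM y" if "y < ?N + K" for y using keys that by simp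
    have mono: "varr s keyM (?N + y - 1) < varr s keyM (?N + y) \<and> varr s keyM (?N + y) \<in> \<int>" if y: "y < K'" for y
    proof (cases "y < K")
      case True
      then show ?thesis unfolding f using I kM[of "?N + y"] kM[of "?N + y - 1"] by auto
    next
      case False
      then have y: "y = K" "K' = K + 1" using y K' by auto
      then show ?thesis unfolding f using keys(2,3) x(2) keyB[OF xN] by simp
    qed
    have old: "?N \<le> warr s 4 x' \<and> warr s 4 x' < ?N + K' \<and> varr s keyM (warr s 4 x') = key x'"
      if "x' < N'" "x' \<notin> Al - {x}" for x'
    proof (cases "x' = x")
      case True
      then show ?thesis unfolding f w4 using keys(2) x(2) K' by simp
    next
      case False
      then have "?N \<le> warr st 4 x' \<and> warr st 4 x' < ?N + K \<and> varr st keyM (warr st 4 x') = key x'" using I that by auto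
      then show ?thesis unfolding f w4 using False K' kM by auto
    qed
    have le: "v \<le> key x'" if "x' \<in> Al" for x'
      using vle[of x'] I that N' by auto
    have T: "varr s 4 (?N + x') = (if x' \<in> Al - {x} then key x' else B)" if "x' < ?N" for x'
      using 6(1) I that v4 by auto
    have "card (Al - {x}) + 1 = card Al" using x(1) fin by (metis Suc_eq_plus1 card_Suc_Diff1)
    then have cd: "K' + card (Al - {x}) \<le> N'" using I K' by linarith
    have "?N - 1 < ?N + K" using N1 by linarith
    then have L: "varr s keyM (?N - 1) = L" unfolding f using I kM[of "?N - 1"] by simp
    have "ext (Al - {x}) s"
      unfolding extract_inv_def f(1) using 6(1) I T old mono le keys(2) cd L unfolding f by auto
    then show ?case using 6(1) k4 x(1) by auto
  qed (use x W I N' in auto)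
  have put: "wp (PutW 4 (WSub (WReg 15) (WReg rNN)) (WSub (WAdd (WReg rNN) (WReg 16)) (WConst 1)) ;;
       PutV 4 (WReg 15) (VReg 21) ;; ascend) s3 k3 (\<lambda>s k'. k' \<le> k + (h * 70 + 100) \<and> (\<exists>x\<in>Al. ext (Al - {x}) s))"
    if k3: "k3 \<le> k + h * 30 + 50" and x: "x \<in> Al" "key x = v" "wreg s3 15 = ?N + x"
      and s3: "varr s3 4 = varr st 4" "warr s3 = warr st" "vreg s3 21 = B" "wreg s3 rNN = ?N"
      and K': "wreg s3 16 = K'" "K \<le> K'" "K' \<le> K + 1" "0 < K'"
      and keys: "\<And>y. y < ?N + K \<Longrightarrow> varr s3 keyM y = varr st keyM y" "varr s3 keyM (?N + K' - 1) = v"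
        "K' = K + 1 \<Longrightarrow> varr s3 keyM (?N + K - 1) < v"
    for s3 k3 x K'
  proof -
    have "x < ?N" using x(1) I N' by auto
    moreover have "K' \<le> ?N" using K K' N' by linarith
    ultimately have W': "?N + x < W" "?N + K' < W" "1 < W" using W by linarith+
    let ?s4 = "s3\<lparr>warr := (warr s3)(4 := (warr s3 4)(x := ?N + K' - 1))\<rparr>
      \<lparr>varr := (varr s3)(4 := (varr s3 4)(?N + x := B))\<rparr>"
    have "wp ascend ?s4 k4 (\<lambda>s k'. k' \<le> k + (h * 70 + 100) \<and> (\<exists>x\<in>Al. ext (Al - {x}) s))" if "k4 \<le> k3 + 20" for k4
      by (rule fin_step[where x = x and K' = K']) (use k3 x s3 K' keys that in auto)
    then show ?thesis using W' x s3 K' by (simp add: tick_def less_imp_le_nat)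
  qed
  have new: "wp new_key s2 k2 Q"
    if k2: "k2 \<le> k + h * 30 + 20" and c: "?N \<le> wreg s2 15" "wreg s2 15 < 2 * ?N" "varr st 4 (wreg s2 15) = v"
      and s2: "varr s2 = varr st" "warr s2 = warr st" "vreg s2 21 = B" "vreg s2 22 = v" "wreg s2 rNN = ?N" "wreg s2 16 = K"
      and Q: "Q = (\<lambda>s k'. wp (PutW 4 (WSub (WReg 15) (WReg rNN)) (WSub (WAdd (WReg rNN) (WReg 16)) (WConst 1)) ;;
       PutV 4 (WReg 15) (VReg 21) ;; ascend) s k' (\<lambda>s k'. k' \<le> k + (h * 70 + 100) \<and> (\<exists>x\<in>Al. ext (Al - {x}) s)))"
    for s2 k2 Q
  proof -
    obtain x where x: "wreg s2 15 = ?N + x" "x < ?N" using c by (metis le_Suc_ex add_less_cancel_left mult_2)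
    obtain x1 where x1: "x1 \<in> Al" using st(3) by blast
    then have "v \<le> key x1" "key x1 < B" using vle[of x1] I N' keyB by auto
    \<comment> \<open>The extracted value is below the filler \<open>B\<close>, so the leaf found is
      one that is still in use.\<close>
    then have xA: "x \<in> Al" "key x = v" using c(3) I x by (auto split: if_splits)
    have KW: "?N + K < W" "1 < W" "?N + K - 1 < W" "K + 1 < W" using K N' W by linarith+
    have ge: "varr st keyM (?N + K - 1) \<le> v" using I xA by auto
    show ?thesis
    proof (cases "varr st keyM (?N + K - 1) < v")
      case True
      let ?s3 = "s2\<lparr>varr := (varr s2)(keyM := (varr s2 keyM)(?N + K := v))\<rparr>\<lparr>wreg := (wreg s2)(16 := K + 1)\<rparr>"
      have "Q ?s3 k3" if "k3 \<le> k2 + 25" for k3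
        unfolding Q by (rule put[where x = x and K' = "K + 1"])
          (use True k2 x xA s2 N1 that in auto)
      then show ?thesis unfolding new_key_def using True s2 KW by (simp add: tick_def)
    next
      case False
      then have eq: "varr st keyM (?N + K - 1) = v" using ge by simp
      \<comment> \<open>The sentinel \<open>L\<close> lies below every key, so the first extraction
        always opens a new key.\<close>
      have "K \<noteq> 0"
      proof
        assume "K = 0"
        then have "v = L" using eq I by simp
        then show False using keyB[of x] xA I by auto
      qed
      then have "Q s2 k3" if "k3 \<le> k2 + 25" for k3
        unfolding Q by (intro put[where x = x and K' = K])
          (use eq k2 x xA s2 that in auto)
      then show ?thesis unfolding new_key_def using False s2 KW by (simp add: tick_def)
    qed
  qed
  have "wp descend ?s1 k1 (\<lambda>s k. wp new_key s k (\<lambda>s k. wp (PutW 4 (WSub (WReg 15) (WReg rNN)) (WSub (WAdd (WReg rNN) (WReg 16)) (WConst 1)) ;;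
       PutV 4 (WReg 15) (VReg 21) ;; ascend) s k (\<lambda>s k'. k' \<le> k0 + (h * 70 + 100) \<and> (\<exists>x\<in>Al. ext (Al - {x}) s))))"
    if "k1 \<le> k + 6" "k0 = k" for k1 k0
  proof (rule wp_conseq[OF wp_descend[where h = h]], goal_cases)
    case (7 s t)
    show ?case
      unfolding that(2)
      by (rule new[OF _ _ _ _ _ _ _ _ _ _ refl])
        (use 7 that st in \<open>auto simp: frame_wreg frame_warr_all frame_varr_all frame_vreg v_def K_def\<close>)
  qed (use st I W in \<open>auto simp: v_def\<close>)
  then show ?thesis unfolding extract_min_def using W by (simp add: tick_def v_def del: wp_PutW wp_PutV)
qed

lemma wp_extract_all:
  assumes inv: "ext {..<N'} st" and st: "wreg st rNN = 2 ^ h" "vreg st 21 = B"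
  shows "wp extract_all st k (\<lambda>s k'. ext {} s \<and> k' \<le> k + N' * (h * 70 + 110) + 10)"
proof -
  let ?b = "VLess (VArr 4 (WConst 1)) (VReg 21)"
  have "wp (Loop ?b extract_min) st k (\<lambda>s k'. (\<exists>Al. 0 = card Al \<and> ext Al s) \<and> frame extract_min st s \<and>
    k' \<le> k + N' * ((h * 70 + 100) + ctime ?b + 1) + (ctime ?b + 1))"
  proof (rule wp_Loop_frame[where I = "\<lambda>i s. \<exists>Al. i = card Al \<and> ext Al s"], goal_cases)
    case 1
    then show ?case using inv by (intro exI[of _ "{..<N'}"]) simp
  next
    case (2 i s)
    then obtain Al where Al: "i = card Al" "ext Al s" by blast
    then have I: "Al \<subseteq> {..<N'}" "heap (varr s 4) (2 ^ h)" "\<And>x. x < 2 ^ h \<Longrightarrow> varr s 4 (2 ^ h + x) = (if x \<in> Al then key x else B)"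
      by (auto simp: extract_inv_def)
    have f: "vreg s 21 = B" using 2(2) st by (simp add: frame_vreg)
    have fin: "finite Al" using I(1) finite_subset by blast
    have "varr s 4 1 < B \<longleftrightarrow> Al \<noteq> {}"
    proof
      assume "Al \<noteq> {}"
      then obtain x where x: "x \<in> Al" by blast
      have "varr s 4 1 \<le> varr s 4 (2 ^ h + x)" by (rule heap_root_le[of _ h h]) (use I x N' in auto)
      then show "varr s 4 1 < B" using I x N' keyB[of x] by auto
    next
      assume lt: "varr s 4 1 < B"
      \<comment> \<open>The root value can be followed down to a leaf, so a root value below the
        filler comes from a leaf that is still in use.\<close>
      have "\<exists>x\<ge>2 ^ g. x < 2 * 2 ^ g \<and> varr s 4 x = varr s 4 1" if "g \<le> h" for g
        using that
      proof (induction g)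
        case 0
        then show ?case by (intro exI[of _ 1]) simp
      next
        case (Suc g)
        then obtain x where x: "2 ^ g \<le> x" "x < 2 * 2 ^ g" "varr s 4 x = varr s 4 1" by auto
        have "(2::nat) ^ Suc g \<le> 2 ^ h" using Suc.prems by (intro power_increasing) auto
        moreover have "(1::nat) \<le> 2 ^ g" by simp
        ultimately have "1 \<le> x" "x < 2 ^ h" using x unfolding power_Suc by linarith+
        then have "heap_at (varr s 4) x" using I(2) by (simp add: heap_def)
        then have "varr s 4 (2 * x) = varr s 4 1 \<or> varr s 4 (2 * x + 1) = varr s 4 1"
          using x(3) by (simp add: heap_at_def min_def split: if_splits)
        then show ?case
        proof
          assume "varr s 4 (2 * x) = varr s 4 1"
          then show ?thesis using x by (intro exI[of _ "2 * x"]) simp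
        next
          assume "varr s 4 (2 * x + 1) = varr s 4 1"
          then show ?thesis using x by (intro exI[of _ "2 * x + 1"]) simp
        qed
      qed
      from this[OF order_refl] obtain x where "2 ^ h \<le> x" "x < 2 * 2 ^ h" "varr s 4 x = varr s 4 1" by blast
      then show "Al \<noteq> {}" using I(3)[of "x - 2 ^ h"] lt by auto
    qed
    then show ?case using W f Al(1) fin by (auto simp: card_gt_0_iff)
  next
    case (3 i s k)
    then obtain Al where Al: "Suc i = card Al" "ext Al s" by blast
    have ne: "Al \<noteq> {}" using Al(1) by auto
    have f: "wreg s rNN = 2 ^ h" "vreg s 21 = B" using 3(2) st by (simp_all add: frame_wreg frame_vreg)
    show ?case
    proof (rule wp_conseq[OF wp_extract_min[OF Al(2) f ne]])
      fix s' t assume a: "t \<le> k + (h * 70 + 100) \<and> (\<exists>x\<in>Al. ext (Al - {x}) s')"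
      then obtain x where x: "x \<in> Al" "ext (Al - {x}) s'" by blast
      have "card (Al - {x}) = i" using Al(1) x(1) by simp
      then show "t \<le> k + (h * 70 + 100) \<and> (\<exists>Al. i = card Al \<and> ext Al s')" using a x by blast
    qed
  qed
  then show ?thesis
    unfolding extract_all_def
  proof (rule wp_conseq)
    fix s t assume a: "(\<exists>Al. 0 = card Al \<and> ext Al s) \<and> frame extract_min st s \<and>
      t \<le> k + N' * ((h * 70 + 100) + ctime ?b + 1) + (ctime ?b + 1)"
    then obtain Al where "card Al = 0" "ext Al s" by auto
    moreover from this have "Al = {}" using finite_subset[of Al "{..<N'}"] by (auto simp: extract_inv_def)
    ultimately show "ext {} s \<and> t \<le> k + N' * (h * 70 + 110) + 10"
      using a by (simp add: algebra_simps)
  qed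
qed

end

lemma wp_pad_keys:
  assumes st: "wreg st rNN = N" "wreg st 16 = K" and K: "0 < K" "K \<le> N" and W: "2 * N < W" "1 < W"
    and keys: "\<And>y. y < K \<Longrightarrow> varr st keyM (N + y - 1) < varr st keyM (N + y) \<and> varr st keyM (N + y) \<in> \<int>"
  shows "wp pad_keys st k (\<lambda>s k'. keys_sorted N (varr s keyM) \<and> (\<forall>x<N + K. varr s keyM x = varr st keyM x) \<and>
    k' \<le> k + N * 40 + 10)"
proof -
  let ?b = "WLess (WReg 16) (WReg rNN)"
  let ?P = "PutV keyM (WAdd (WReg rNN) (WReg 16)) (VAdd (VArr keyM (WSub (WAdd (WReg rNN) (WReg 16)) (WConst 1))) (VWord (WConst 1))) ;;
      SetW 16 (WAdd (WReg 16) (WConst 1))"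
  let ?I = "\<lambda>i s. wreg s 16 = N - i \<and> (\<forall>y. 0 < y \<longrightarrow> y < N - i \<longrightarrow> varr s keyM (N + y - 1) < varr s keyM (N + y)) \<and>
    (\<forall>y<N - i. varr s keyM (N + y) \<in> \<int>) \<and> (\<forall>x<N + K. varr s keyM x = varr st keyM x)"
  have "wp (Loop ?b ?P) st k (\<lambda>s k'. ?I 0 s \<and> frame ?P st s \<and> k' \<le> k + (N - K) * (30 + ctime ?b + 1) + (ctime ?b + 1))"
  proof (rule wp_Loop_frame[where I = ?I], goal_cases)
    case 1
    then show ?case using st K keys by simp
  next
    case (2 i s)
    then have "wreg s rNN = N" using st by (simp add: frame_wreg)
    then show ?case using 2 W K by auto
  next
    case (3 i s k)
    define q where "q = N - Suc i"
    have q: "N - i = Suc q" "K \<le> q" "0 < q" "q < N" using 3(3) K by (auto simp: q_def)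
    have f: "wreg s rNN = N" using 3(2) st by (simp add: frame_wreg)
    have I: "wreg s 16 = q" "\<And>y. 0 < y \<Longrightarrow> y < q \<Longrightarrow> varr s keyM (N + y - 1) < varr s keyM (N + y)"
      "\<And>y. y < q \<Longrightarrow> varr s keyM (N + y) \<in> \<int>" "\<And>x. x < N + K \<Longrightarrow> varr s keyM x = varr st keyM x"
      using 3(1) unfolding q_def by blast+
    define A where "A = (varr s keyM)(N + q := varr s keyM (N + q - 1) + 1)"
    have "varr s keyM (N + (q - 1)) \<in> \<int>" using q by (intro I) simp
    then have int: "varr s keyM (N + q - 1) \<in> \<int>" using q by simp
    have "A (N + y - 1) < A (N + y)" if "0 < y" "y < Suc q" for y
      using I(2)[of y] that by (cases "y = q") (auto simp: A_def)
    moreover have "A (N + y) \<in> \<int>" if "y < Suc q" for y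
      using I(3)[of y] int that by (cases "y = q") (auto simp: A_def)
    moreover have "A x = varr st keyM x" if "x < N + K" for x using I(4) that q by (simp add: A_def)
    ultimately have A: "(\<forall>y. 0 < y \<longrightarrow> y < N - i \<longrightarrow> A (N + y - 1) < A (N + y)) \<and> (\<forall>y<N - i. A (N + y) \<in> \<int>) \<and>
      (\<forall>x<N + K. A x = varr st keyM x)" unfolding q(1) by blast
    have e: "wval s (WAdd (WReg rNN) (WReg 16)) = N + q" "wdef W s (WAdd (WReg rNN) (WReg 16))"
      "vval \<delta> us s (VAdd (VArr keyM (WSub (WAdd (WReg rNN) (WReg 16)) (WConst 1))) (VWord (WConst 1))) = varr s keyM (N + q - 1) + 1"
      "vdef \<delta> us W s (VAdd (VArr keyM (WSub (WAdd (WReg rNN) (WReg 16)) (WConst 1))) (VWord (WConst 1)))"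
      using f I(1) q W by simp_all
    show ?case
      unfolding wp_Seq wp_PutV e(1,3) A_def[symmetric] using e(2,4) A I(1) q W
      by (simp add: tick_def del: wdef.simps vdef.simps One_nat_def) simp
  qed
  then show ?thesis
    unfolding pad_keys_def
  proof (rule wp_conseq)
    fix s t assume a: "?I 0 s \<and> frame ?P st s \<and> t \<le> k + (N - K) * (30 + ctime ?b + 1) + (ctime ?b + 1)"
    have "varr s keyM x < varr s keyM y" if "N \<le> x" "x < y" "y < 2 * N" for x y
      using that(2,3)
    proof (induction y)
      case 0
      then show ?case by simp
    next
      case (Suc y)
      have "varr s keyM (N + (Suc y - N) - 1) < varr s keyM (N + (Suc y - N))"
        using a Suc.prems that(1) by (intro a[THEN conjunct1, THEN conjunct2, THEN conjunct1, rule_format]) auto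
      then have "varr s keyM y < varr s keyM (Suc y)" using Suc.prems that(1) by simp
      then show ?case using Suc by (cases "x = y") auto
    qed
    moreover have "varr s keyM x \<in> \<int>" if "N \<le> x" "x < 2 * N" for x
    proof -
      have int: "varr s keyM (N + y) \<in> \<int>" if "y < N" for y using a that by simp
      from le_Suc_ex[OF that(1)] obtain y where y: "x = N + y" by blast
      show ?thesis unfolding y by (rule int) (use that(2) y in linarith)
    qed
    moreover have "(N - K) * (30 + ctime ?b + 1) \<le> N * 40" by (intro mult_le_mono) auto
    then have "t \<le> k + N * 40 + (ctime ?b + 1)" using a by linarith
    ultimately show "keys_sorted N (varr s keyM) \<and> (\<forall>x<N + K. varr s keyM x = varr st keyM x) \<and> t \<le> k + N * 40 + 10"
      using a unfolding keys_sorted_def by auto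
  qed
qed

lemma wp_inner_keys:
  assumes st: "wreg st rNN = 2 ^ h" and W: "2 * 2 ^ h < W" "2 < W" and keys: "keys_sorted (2 ^ h) (varr st keyM)"
  shows "wp inner_keys st k (\<lambda>s k'. key_ok (varr s) h 1 \<and> (\<forall>x\<ge>2 ^ h. varr s keyM x = varr st keyM x) \<and>
    k' \<le> k + 2 ^ h * 100 + 30)"
proof -
  define N :: nat where "N = 2 ^ h"
  have N: "1 \<le> N" "2 * N < W" "wreg st rNN = N" using W st by (simp_all add: N_def)
  let ?b = "WLess (WConst 1) (WReg 15)"
  let ?P = "SetW 15 (WSub (WReg 15) (WConst 1)) ;;
       PutV keyM (WReg 15) (VArr keyL (child1 15)) ;; PutV keyL (WReg 15) (VArr keyL (child0 15))"
  let ?F = "PutV keyL (WAdd (WReg rNN) (WReg 15)) (VArr keyM (WAdd (WReg rNN) (WReg 15)))"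
  let ?I = "\<lambda>i s. wreg s 15 = i + 1 \<and>
    (\<forall>\<nu>. i + 1 \<le> \<nu> \<longrightarrow> \<nu> < N \<longrightarrow> varr s keyM \<nu> = varr s keyL (2 * \<nu> + 1) \<and> varr s keyL \<nu> = varr s keyL (2 * \<nu>)) \<and>
    (\<forall>x\<ge>N. varr s keyM x = varr st keyM x) \<and> (\<forall>x. N \<le> x \<longrightarrow> x < 2 * N \<longrightarrow> varr s keyL x = varr st keyM x)"
  have loop: "wp (Loop ?b ?P) s1 k1 (\<lambda>s k'. ?I 0 s \<and> frame ?P s1 s \<and> k' \<le> k1 + (N - 1) * (30 + ctime ?b + 1) + (ctime ?b + 1))"
    if s1: "wreg s1 15 = N" "varr s1 keyM = varr st keyM" "\<And>x. x < N \<Longrightarrow> varr s1 keyL (N + x) = varr st keyM (N + x)" for s1 k1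
  proof (rule wp_Loop_frame[where I = ?I], goal_cases)
    case 1
    have "varr s1 keyL x = varr st keyM x" if "N \<le> x" "x < 2 * N" for x using s1(3)[of "x - N"] that by simp
    then show ?case using s1 N by auto
  next
    case (2 i s)
    then show ?case using N by auto
  next
    case (3 i s k)
    have i: "i + 1 < N" using 3(3) by simp
    have I: "wreg s 15 = i + 2"
      "\<And>\<nu>. i + 2 \<le> \<nu> \<Longrightarrow> \<nu> < N \<Longrightarrow> varr s keyM \<nu> = varr s keyL (2 * \<nu> + 1) \<and> varr s keyL \<nu> = varr s keyL (2 * \<nu>)"
      "\<And>x. N \<le> x \<Longrightarrow> varr s keyM x = varr st keyM x" "\<And>x. N \<le> x \<Longrightarrow> x < 2 * N \<Longrightarrow> varr s keyL x = varr st keyM x"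
      using 3(1) by simp_all
    define M L where "M = (varr s keyM)(i + 1 := varr s keyL (2 * (i + 1) + 1))" and "L = (varr s keyL)(i + 1 := varr s keyL (2 * (i + 1)))"
    have "M \<nu> = L (2 * \<nu> + 1) \<and> L \<nu> = L (2 * \<nu>)" if "i + 1 \<le> \<nu>" "\<nu> < N" for \<nu>
      using I(2)[of \<nu>] that by (cases "\<nu> = i + 1") (auto simp: M_def L_def)
    moreover have "M x = varr st keyM x" if "N \<le> x" for x using I(3) that i by (simp add: M_def)
    moreover have "L x = varr st keyM x" if "N \<le> x" "x < 2 * N" for x using I(4) that i by (simp add: L_def)
    ultimately have new: "(\<forall>\<nu>. Suc i \<le> \<nu> \<longrightarrow> \<nu> < N \<longrightarrow> M \<nu> = L (Suc (2 * \<nu>)) \<and> L \<nu> = L (2 * \<nu>)) \<and>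
      (\<forall>x\<ge>N. M x = varr st keyM x) \<and> (\<forall>x. N \<le> x \<longrightarrow> x < 2 * N \<longrightarrow> L x = varr st keyM x)" by simp
    then show ?case using I(1) i N by (simp add: tick_def M_def L_def) (use I(2) in force)
  qed
  have fill: "wp (for_w 15 (WReg rNN) ?F) st k (\<lambda>s k'. (\<forall>x<N. varr s keyL (N + x) = varr st keyM (N + x)) \<and> k' \<le> k + N * (20 + 10) + 10)"
  proof (rule wp_for[where I = "\<lambda>i s. \<forall>x<i. varr s keyL (N + x) = varr st keyM (N + x)"], goal_cases)
    case (3 i s)
    then show ?case using N by (simp add: frame_wreg)
  next
    case (8 i s k)
    have f: "wreg s rNN = N" "varr s keyM = varr st keyM" using 8(2) N by (simp_all add: frame_wreg frame_varr)
    show ?case using 8 f N W by (auto simp: tick_def less_Suc_eq)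
  qed (use N W in auto)
  have t: "(N - 1) * (30 + ctime ?b + 1) \<le> N * 40" by (intro mult_le_mono) auto
  have fin: "wp (SetW 15 (WReg rNN)) s1 k1 (\<lambda>s k'. wp (Loop ?b ?P) s k'
     (\<lambda>s k'. key_ok (varr s) h 1 \<and> (\<forall>x\<ge>2 ^ h. varr s keyM x = varr st keyM x) \<and> k' \<le> k + 2 ^ h * 100 + 30))"
    if s1: "wreg s1 rNN = N" "varr s1 keyM = varr st keyM" "\<forall>x<N. varr s1 keyL (N + x) = varr st keyM (N + x)"
      and k1: "k1 \<le> k + N * 30 + 10" for s1 k1
  proof -
    have "wp (Loop ?b ?P) (s1\<lparr>wreg := (wreg s1)(15 := N)\<rparr>) k2
     (\<lambda>s k'. key_ok (varr s) h 1 \<and> (\<forall>x\<ge>2 ^ h. varr s keyM x = varr st keyM x) \<and> k' \<le> k + 2 ^ h * 100 + 30)" if k2: "k2 \<le> k + N * 30 + 12" for k2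
    proof (rule wp_conseq[OF loop], goal_cases)
      case (4 s t')
      have I: "\<And>\<nu>. 1 \<le> \<nu> \<Longrightarrow> \<nu> < N \<Longrightarrow> varr s keyM \<nu> = varr s keyL (2 * \<nu> + 1) \<and> varr s keyL \<nu> = varr s keyL (2 * \<nu>)"
        "\<And>x. N \<le> x \<Longrightarrow> varr s keyM x = varr st keyM x" "\<And>x. N \<le> x \<Longrightarrow> x < 2 * N \<Longrightarrow> varr s keyL x = varr st keyM x"
        using 4(1) by simp_all
      have "key_ok (varr s) h 1 \<and> varr s keyL 1 = varr s keyM (1 * 2 ^ h)"
      proof (rule key_ok_sorted)
        show "keys_sorted (2 ^ h) (varr s keyM)" using keys I(2) by (simp add: keys_sorted_def N_def)
      qed (use I nd_root in \<open>auto simp: N_def\<close>)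
      moreover have "t' \<le> k + N * 100 + 30"
      proof -
        have "t' \<le> k2 + N * 40 + (ctime ?b + 1)" using 4(1) t by linarith
        then show ?thesis using k2 by simp
      qed
      ultimately show ?case using I(2) by (simp add: N_def)
    qed (use s1 in auto)
    then show ?thesis using s1 N k1 by (simp add: tick_def)
  qed
  show ?thesis
    unfolding inner_keys_def wp_Seq[of "for_w _ _ _"] wp_Seq[of "SetW 15 (WReg rNN)"]
  proof (rule wp_conseq[OF fill], goal_cases)
    case (1 s t)
    then show ?case by (intro fin) (use N in \<open>auto simp: frame_wreg frame_varr\<close>)
  qed
qed

end

section \<open>Assembling the preparation\<close>

definition sentinel :: com where
  "sentinel = PutV keyM (WSub (WReg rNN) (WConst 1)) (VSub vzero (VAdd (VArr 2 (WReg 0)) (VWord (WConst 1))))"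

text \<open>The line arrays are still zero, so the flag alone puts the zero line at the leaf of
  corner \<open>(0, 0)\<close>. This makes the values those of \<open>init\<close>, while all
  sources remain at \<open>total\<close>.\<close>

definition mark_start :: com where
  "mark_start = PutW hasL (WArr 4 (WConst 0)) (WConst 1) ;; SetV 23 (VAdd (VReg 19) (VReg 19))"

definition prepare :: com where
  "prepare = prefix_sums 0 2 0 ;; prefix_sums 1 3 1 ;; cost_total ;; set_sizes ;; fill_leaves ;; fill_keys ;; build_heap ;;
     sentinel ;; extract_all ;; pad_keys ;; inner_keys ;; mark_start"

lemma mod_mark [simp]:
  "mod_wreg sentinel = {}" "mod_warr sentinel = {}" "mod_vreg sentinel = {}" "mod_varr sentinel = {keyM}"
  "mod_wreg mark_start = {}" "mod_warr mark_start = {hasL}" "mod_vreg mark_start = {23}" "mod_varr mark_start = {}"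
  by (auto simp: sentinel_def mark_start_def)

lemma (in machine) wp_seqI:
  assumes "wp P st k (\<lambda>s t. t \<le> k + c \<and> A s)"
    and "\<And>s k'. A s \<Longrightarrow> frame P st s \<Longrightarrow> wp Q s k' (\<lambda>s t. t \<le> k' + c' \<and> A' s)"
  shows "wp (P ;; Q) st k (\<lambda>s t. t \<le> k + (c + c') \<and> A' s)"
  unfolding wp_Seq
proof (rule wp_conseq[OF assms(1)], goal_cases)
  case (1 s t)
  show ?case by (rule wp_conseq[OF assms(2)]) (use 1 in auto)
qed

text \<open>There are fewer than twice as many leaves as corners, so \<open>W\<close> exceeds
  \<open>8 * 2 ^ h\<close>. This leaves room for every node number and for the child numbers of
  leaves, which occur when a loop ends.\<close>

locale solver = machine \<delta> us W + grid n m a b d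
  for \<delta> :: "'a \<Rightarrow> 'a \<Rightarrow> real" and us W n m a b d +
  fixes h :: nat
  assumes us: "length us = n + m" "\<And>i j. i < n \<Longrightarrow> j < m \<Longrightarrow> \<delta> (us ! i) (us ! (n + j)) = d i j"
    and h: "(n + 1) * (m + 1) \<le> 2 ^ h" "2 ^ h < 2 * ((n + 1) * (m + 1))"
    and W: "16 * ((n + 1) * (m + 1)) \<le> W"
begin

lemma bounds: "8 * 2 ^ h < W" "n + m + 1 \<le> (n + 1) * (m + 1)" "n + m + 1 \<le> 2 ^ h" "4 \<le> (n + 1) * (m + 1)"
  "(4::nat) \<le> 2 ^ h"
proof -
  show "8 * 2 ^ h < W" using h(2) W by linarith
  show 1: "n + m + 1 \<le> (n + 1) * (m + 1)" by simp
  then show "n + m + 1 \<le> 2 ^ h" using h(1) by linarith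
  have "(1 + 1) * (1 + 1) \<le> (n + 1) * (m + 1)" using n m by (intro mult_le_mono) auto
  then show 4: "4 \<le> (n + 1) * (m + 1)" by simp
  then show "(4::nat) \<le> 2 ^ h" using h(1) by linarith
qed

definition key :: "nat \<Rightarrow> real" where
  "key x = real_of_int (crn (x div (m + 1)) (x mod (m + 1)))"

definition quiet :: "store \<Rightarrow> bool" where
  "quiet s \<longleftrightarrow> wreg s 0 = n \<and> wreg s 1 = m \<and> varr s addC = (\<lambda>_. 0) \<and> varr s addS = (\<lambda>_. 0) \<and>
     varr s linC = (\<lambda>_. 0) \<and> varr s linS = (\<lambda>_. 0) \<and> varr s thr = (\<lambda>_. 0) \<and> warr s hasT = (\<lambda>_. 0)"

definition stage1 :: "store \<Rightarrow> bool" where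
  "stage1 s \<longleftrightarrow> quiet s \<and> (\<forall>i\<le>n. varr s 2 i = real_of_int (rowsum i)) \<and> (\<forall>j\<le>m. varr s 3 j = real_of_int (colsum j)) \<and>
     vreg s 19 = total \<and> warr s hasL = (\<lambda>_. 0)"

definition stage2 :: "store \<Rightarrow> bool" where
  "stage2 s \<longleftrightarrow> stage1 s \<and> wreg s rNN = 2 ^ h \<and> wreg s 17 = m + 1"

definition stage3 :: "store \<Rightarrow> bool" where
  "stage3 s \<longleftrightarrow> stage2 s \<and> (\<forall>x<2 ^ h. varr s leafR (2 ^ h + x) = total) \<and>
     vreg s 21 = real_of_int (rowsum n + colsum m + 1)"

lemma quiet_frame:
  assumes "quiet st" "frame P st s" "mod_wreg P \<inter> {0, 1} = {}" "mod_warr P \<inter> {hasT} = {}"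
    "mod_varr P \<inter> {addC, addS, linC, linS, thr} = {}"
  shows "quiet s"
  using assms unfolding quiet_def by (simp add: frame_wreg frame_warr frame_varr)

lemma stage1_frame:
  assumes "stage1 st" "frame P st s" "mod_wreg P \<inter> {0, 1} = {}" "mod_warr P \<inter> {hasT, hasL} = {}" "mod_vreg P \<inter> {19} = {}"
    "mod_varr P \<inter> {addC, addS, linC, linS, thr, 2, 3} = {}"
  shows "stage1 s"
  using assms quiet_frame[of st P s] unfolding stage1_def by (simp add: frame_vreg frame_warr frame_varr)

lemma stage2_frame:
  assumes "stage2 st" "frame P st s" "mod_wreg P \<inter> {0, 1, rNN, 17} = {}" "mod_warr P \<inter> {hasT, hasL} = {}" "mod_vreg P \<inter> {19} = {}"
    "mod_varr P \<inter> {addC, addS, linC, linS, thr, 2, 3} = {}"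
  shows "stage2 s"
  using assms stage1_frame[of st P s] unfolding stage2_def by (simp add: frame_wreg)

lemma stage3_frame:
  assumes "stage3 st" "frame P st s" "mod_wreg P \<inter> {0, 1, rNN, 17} = {}" "mod_warr P \<inter> {hasT, hasL} = {}" "mod_vreg P \<inter> {19, 21} = {}"
    "mod_varr P \<inter> {addC, addS, linC, linS, thr, 2, 3, leafR} = {}"
  shows "stage3 s"
  using assms stage2_frame[of st P s] unfolding stage3_def by (simp add: frame_vreg frame_varr)

lemma key_bounds:
  assumes "x < (n + 1) * (m + 1)"
  shows "- real_of_int (rowsum n) - 1 < key x \<and> key x < real_of_int (rowsum n + colsum m + 1) \<and> key x \<in> \<int>"
proof -
  have "x div (m + 1) \<le> n" using assms by (simp add: less_mult_imp_div_less less_Suc_eq_le[symmetric])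
  moreover have "x mod (m + 1) \<le> m" by (simp add: less_Suc_eq_le[symmetric])
  ultimately have "rowsum (x div (m + 1)) \<le> rowsum n" "colsum (x mod (m + 1)) \<le> colsum m"
    "0 \<le> rowsum (x div (m + 1))" "0 \<le> colsum (x mod (m + 1))"
    using rowsum_mono colsum_mono rowsum_mono[of 0] colsum_mono[of 0] by simp_all
  then show ?thesis unfolding key_def crn_def by auto
qed

lemma key_at: "i \<le> n \<Longrightarrow> j \<le> m \<Longrightarrow> key (i * (m + 1) + j) = real_of_int (crn i j)"
proof -
  assume "j \<le> m"
  then have "(i * (m + 1) + j) div (m + 1) = i" "(i * (m + 1) + j) mod (m + 1) = j"
    using div_mult_self3[of "m + 1" i j] mod_mult_self3[of i "m + 1" j] by simp_all
  then show ?thesis by (simp only: key_def)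
qed

lemma slot_id_less:
  assumes "i \<le> n" "j \<le> m"
  shows "i * (m + 1) + j < (n + 1) * (m + 1)"
proof -
  have "i * (m + 1) \<le> n * (m + 1)" using assms by (intro mult_le_mono) auto
  then have "i * (m + 1) + j < n * (m + 1) + (m + 1)" using assms by linarith
  also have "\<dots> = (n + 1) * (m + 1)" by simp
  finally show ?thesis .
qed

abbreviation extracted :: "nat set \<Rightarrow> store \<Rightarrow> bool" where
  "extracted \<equiv> extract_inv h ((n + 1) * (m + 1)) key (real_of_int (rowsum n + colsum m + 1)) (- real_of_int (rowsum n) - 1)"

definition ready :: "store \<Rightarrow> bool" where
  "ready s \<longleftrightarrow> quiet s \<and> wreg s rNN = 2 ^ h \<and> wreg s 17 = m + 1 \<and> vreg s 23 = 2 * total \<and>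
     key_ok (varr s) h 1 \<and> keys_sorted (2 ^ h) (varr s keyM) \<and>
     (\<forall>x<(n + 1) * (m + 1). 2 ^ h \<le> warr s 4 x \<and> warr s 4 x < 2 * 2 ^ h \<and> varr s keyM (warr s 4 x) = key x) \<and>
     (\<forall>x<2 ^ h. varr s leafR (2 ^ h + x) = total) \<and> warr s hasL = (\<lambda>_. 0)(warr s 4 0 := 1)"

definition prepare_time :: nat where
  "prepare_time = (n * 20 + 10) + ((m * 20 + 10) + ((n * (20 + m * 30) + 10) + ((h * 20 + 20) +
     ((2 ^ h * 30 + 30) + (((n + 1) * ((m + 1) * 30 + 20) + 10) + ((2 ^ h * 40 + 10) + (20 +
     (((n + 1) * (m + 1) * (h * 70 + 110) + 10) + ((2 ^ h * 40 + 10) + ((2 ^ h * 100 + 30) + 20))))))))))"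

lemma wp_prepare:
  assumes st: "wreg st = (\<lambda>_. 0)(0 := n, 1 := m)" "warr st = (\<lambda>_ _. 0)" "vreg st = (\<lambda>_. 0)"
    "varr st = (\<lambda>_ _. 0)(0 := \<lambda>i. real (a i), 1 := \<lambda>j. real (b j))"
  shows "wp prepare st k (\<lambda>s t. t \<le> k + prepare_time \<and> ready s)"
proof -
  define N' where "N' = (n + 1) * (m + 1)"
  define B where "B = real_of_int (rowsum n + colsum m + 1)"
  define L where "L = - real_of_int (rowsum n) - 1"
  note bd = bounds[folded N'_def]
  have Ws: "1 < W" "2 < W" "n < W" "m < W" "n + m < W" "2 * 2 ^ h < W" using bd by linarith+
  have total': "total = (\<Sum>i<n. \<Sum>j<m. \<delta> (us ! i) (us ! (n + j)) * (real (a i) + real (b j)))"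
    unfolding total_def using us(2) by (intro sum.cong) auto
  define A0 where "A0 s \<longleftrightarrow> quiet s \<and> wreg s 16 = 0 \<and> vreg s 19 = 0 \<and> warr s hasL = (\<lambda>_. 0) \<and>
    varr s 0 = (\<lambda>i. real (a i)) \<and> varr s 1 = (\<lambda>j. real (b j))" for s
  have A0: "A0 s" if "A0 s0" "frame P s0 s" "mod_wreg P \<inter> {0, 1, 16} = {}" "mod_warr P \<inter> {hasT, hasL} = {}" "mod_vreg P \<inter> {19} = {}"
    "mod_varr P \<inter> {addC, addS, linC, linS, thr, 0, 1} = {}" for s0 s P
    using that quiet_frame[of s0 P s] unfolding A0_def by (simp add: frame_vreg frame_warr frame_varr frame_wreg)
  have start: "A0 st" "varr st 2 0 = 0" "varr st 3 0 = 0" by (simp_all add: A0_def quiet_def st)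
  have s1: "wp (prefix_sums 0 2 0) st k (\<lambda>s t. t \<le> k + (n * 20 + 10) \<and> A0 s \<and> varr s 3 0 = 0 \<and>
     (\<forall>i\<le>n. varr s 2 i = real_of_int (rowsum i)))" for k
  proof (rule wp_conseq[OF wp_prefix_sums[where N = n]], goal_cases)
    case (7 s t)
    have "A0 s" by (rule A0[OF start(1) 7(2)]) auto
    then show ?case using 7(1) frame_varr[OF 7(2), of 3] start by (simp add: A0_def rowsum_def)
  qed (use Ws start in \<open>auto simp: A0_def quiet_def\<close>)
  have s2: "wp (prefix_sums 1 3 1) s k (\<lambda>s t. t \<le> k + (m * 20 + 10) \<and> A0 s \<and>
     (\<forall>i\<le>n. varr s 2 i = real_of_int (rowsum i)) \<and> (\<forall>i\<le>m. varr s 3 i = real_of_int (colsum i)))"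
    if s: "A0 s" "varr s 3 0 = 0" "\<forall>i\<le>n. varr s 2 i = real_of_int (rowsum i)" for s k
  proof (rule wp_conseq[OF wp_prefix_sums[where N = m]], goal_cases)
    case (7 s' t)
    have "A0 s'" by (rule A0[OF s(1) 7(2)]) auto
    moreover have "varr s 1 = (\<lambda>j. real (b j))" using s(1) unfolding A0_def by blast
    ultimately show ?case using 7(1) frame_varr[OF 7(2), of 2] s(3) by (simp add: colsum_def)
  qed (use Ws s in \<open>auto simp: A0_def quiet_def\<close>)
  have s3: "wp cost_total s k (\<lambda>s t. t \<le> k + (n * (20 + m * 30) + 10) \<and> stage1 s \<and> wreg s 16 = 0)"
    if s: "A0 s" "\<forall>i\<le>n. varr s 2 i = real_of_int (rowsum i)" "\<forall>i\<le>m. varr s 3 i = real_of_int (colsum i)" for s k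
  proof (rule wp_conseq[OF wp_cost_total[where n = n and m = m]], goal_cases)
    case (7 s' t)
    have "quiet s'" using s(1) quiet_frame[OF _ 7(2)] by (simp add: A0_def)
    moreover have "varr s 0 = (\<lambda>i. real (a i))" "varr s 1 = (\<lambda>j. real (b j))" "wreg s 16 = 0" "warr s hasL = (\<lambda>_. 0)"
      using s(1) unfolding A0_def by blast+
    moreover have "varr s' = varr s" "warr s' = warr s" "wreg s' 16 = wreg s 16"
      using 7(2) by (simp_all add: frame_varr_all frame_warr_all frame_wreg)
    ultimately show ?case using 7(1) s(2,3) unfolding stage1_def total' by simp
  qed (use Ws s us in \<open>auto simp: A0_def quiet_def\<close>)
  have s4: "wp set_sizes s k (\<lambda>s t. t \<le> k + (h * 20 + 20) \<and> stage2 s \<and> wreg s 16 = 0)" if "stage1 s" "wreg s 16 = 0" for s k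
  proof (rule wp_conseq[OF wp_set_sizes[where n = n and m = m and h = h]], goal_cases)
    case (6 s' t)
    have "stage1 s'" by (rule stage1_frame[OF that(1) 6(2)]) auto
    moreover have "wreg s' 16 = 0" using frame_wreg[OF 6(2)] that(2) by simp
    ultimately show ?case using 6(1) by (simp add: stage2_def)
  qed (use that h W in \<open>auto simp: stage1_def quiet_def\<close>)
  have s5: "wp fill_leaves s k (\<lambda>s t. t \<le> k + (2 ^ h * 30 + 30) \<and> stage3 s \<and> wreg s 16 = 0 \<and> (\<forall>x<2 ^ h. varr s 4 (2 ^ h + x) = B))"
    if "stage2 s" "wreg s 16 = 0" for s k
  proof (rule wp_conseq[OF wp_fill_leaves[where n = n and m = m and N = "2 ^ h"]], goal_cases)
    case (8 s' t)
    have "stage2 s'" by (rule stage2_frame[OF that(1) 8(2)]) auto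
    moreover have "wreg s' 16 = 0" using frame_wreg[OF 8(2)] that(2) by simp
    moreover have "varr s 2 n + varr s 3 m + 1 = B" "vreg s 19 = total" using that(1) by (simp_all add: stage2_def stage1_def B_def)
    ultimately show ?case using 8(1) by (simp add: stage3_def B_def)
  qed (use that Ws in \<open>auto simp: stage1_def quiet_def stage2_def\<close>)
  have s6: "wp fill_keys s k (\<lambda>s t. t \<le> k + ((n + 1) * ((m + 1) * 30 + 20) + 10) \<and> stage3 s \<and> wreg s 16 = 0 \<and>
      (\<forall>x<2 ^ h. varr s 4 (2 ^ h + x) = (if x < N' then key x else B)))"
    if "stage3 s" "wreg s 16 = 0" "\<forall>x<2 ^ h. varr s 4 (2 ^ h + x) = B" for s k
  proof (rule wp_conseq[OF wp_fill_keys[where n = n and m = m and N = "2 ^ h" and B = B]], goal_cases)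
    case (7 s' t)
    have "stage3 s'" by (rule stage3_frame[OF that(1) 7(2)]) auto
    moreover have "wreg s' 16 = 0" using frame_wreg[OF 7(2)] that(2) by simp
    moreover have "varr s 3 (x mod (m + 1)) - varr s 2 (x div (m + 1)) = key x" if "x < N'" for x
    proof -
      have "x div (m + 1) \<le> n" using that by (simp add: N'_def less_mult_imp_div_less less_Suc_eq_le[symmetric])
      moreover have "x mod (m + 1) \<le> m" by (simp add: less_Suc_eq_le[symmetric])
      ultimately show ?thesis using \<open>stage3 s\<close> by (simp add: stage3_def stage2_def stage1_def key_def crn_def)
    qed
    ultimately show ?case using 7(1) by (simp add: N'_def)
  qed (use that Ws h in \<open>auto simp: stage1_def quiet_def stage2_def stage3_def\<close>)
  have s7: "wp build_heap s k (\<lambda>s t. t \<le> k + (2 ^ h * 40 + 10) \<and> stage3 s \<and> wreg s 16 = 0 \<and> heap (varr s 4) (2 ^ h) \<and>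
      (\<forall>x<2 ^ h. varr s 4 (2 ^ h + x) = (if x < N' then key x else B)))"
    if "stage3 s" "wreg s 16 = 0" "\<forall>x<2 ^ h. varr s 4 (2 ^ h + x) = (if x < N' then key x else B)" for s k
  proof (rule wp_conseq[OF wp_build_heap[where N = "2 ^ h"]], goal_cases)
    case (5 s' t)
    have "stage3 s'" by (rule stage3_frame[OF that(1) 5(2)]) auto
    moreover have "wreg s' 16 = 0" using frame_wreg[OF 5(2)] that(2) by simp
    ultimately show ?case using 5(1) that(3) by simp
  qed (use that Ws in \<open>auto simp: stage2_def stage3_def\<close>)
  have s8: "wp sentinel s k (\<lambda>s t. t \<le> k + 20 \<and> stage3 s \<and> extracted {..<N'} s)"
    if s: "stage3 s" "wreg s 16 = 0" "heap (varr s 4) (2 ^ h)" "\<forall>x<2 ^ h. varr s 4 (2 ^ h + x) = (if x < N' then key x else B)" for s k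
  proof -
    have step: "wp sentinel s k (\<lambda>s' t. t \<le> k + 20 \<and> s' = s\<lparr>varr := (varr s)(keyM := (varr s keyM)(2 ^ h - 1 := L))\<rparr>)"
      unfolding sentinel_def using s Ws by (simp add: stage3_def stage2_def stage1_def quiet_def tick_def L_def)
    have kb: "L \<le> key x" if "x < N'" for x
      using key_bounds[of x] that by (simp add: L_def N'_def)
    show ?thesis
    proof (rule wp_conseq[OF step], goal_cases)
      case (1 s' t)
      have "stage3 s'" by (rule stage3_frame[OF s(1) 1(2)]) auto
      moreover have "extracted {..<N'} s'"
        unfolding extract_inv_def N'_def[symmetric] B_def[symmetric] L_def[symmetric]
        using 1(1) s kb h by (auto simp: N'_def)
      ultimately show ?case using 1(1) by simp
    qed
  qed
  have s9: "wp extract_all s k (\<lambda>s t. t \<le> k + ((n + 1) * (m + 1) * (h * 70 + 110) + 10) \<and> stage3 s \<and> extracted {} s)"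
    if "stage3 s" "extracted {..<N'} s" for s k
  proof (rule wp_conseq[OF wp_extract_all[OF _ _ _ _ _ that(2)[unfolded N'_def]]], goal_cases)
    case (8 s' t)
    have "stage3 s'" by (rule stage3_frame[OF that(1) 8(2)]) auto
    then show ?case using 8(1) by simp
  qed (use that Ws h key_bounds in \<open>auto simp: stage2_def stage3_def\<close>)
  have s10: "wp pad_keys s k (\<lambda>s t. t \<le> k + (2 ^ h * 40 + 10) \<and> stage3 s \<and> keys_sorted (2 ^ h) (varr s keyM) \<and>
     (\<forall>x<N'. 2 ^ h \<le> warr s 4 x \<and> warr s 4 x < 2 * 2 ^ h \<and> varr s keyM (warr s 4 x) = key x))"
    if "stage3 s" "extracted {} s" for s k
  proof -
    define K where "K = wreg s 16"
    have K: "\<And>x. x < N' \<Longrightarrow> 2 ^ h \<le> warr s 4 x \<and> warr s 4 x < 2 ^ h + K \<and> varr s keyM (warr s 4 x) = key x"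
      "\<And>y. y < K \<Longrightarrow> varr s keyM (2 ^ h + y - 1) < varr s keyM (2 ^ h + y) \<and> varr s keyM (2 ^ h + y) \<in> \<int>" "K \<le> N'"
      using that(2) unfolding extract_inv_def K_def N'_def by auto
    have "0 < K" using K(1)[of 0] bd by auto
    moreover have "K \<le> 2 ^ h" using K(3) h by (simp add: N'_def)
    ultimately show ?thesis
    proof (intro wp_conseq[OF wp_pad_keys[where N = "2 ^ h" and K = K]], goal_cases)
      case (8 s' t)
      have "stage3 s'" by (rule stage3_frame[OF that(1) 8(4)]) auto
      moreover have "warr s' = warr s" using frame_warr_all[OF 8(4)] by simp
      ultimately show ?case using 8 K(1) by (fastforce simp: mult_2)
    qed (use that Ws K in \<open>auto simp: stage2_def stage3_def K_def\<close>)
  qed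
  have s11: "wp inner_keys s k (\<lambda>s t. t \<le> k + (2 ^ h * 100 + 30) \<and> stage3 s \<and> key_ok (varr s) h 1 \<and> keys_sorted (2 ^ h) (varr s keyM) \<and>
     (\<forall>x<N'. 2 ^ h \<le> warr s 4 x \<and> warr s 4 x < 2 * 2 ^ h \<and> varr s keyM (warr s 4 x) = key x))"
    if "stage3 s" "keys_sorted (2 ^ h) (varr s keyM)"
     "\<forall>x<N'. 2 ^ h \<le> warr s 4 x \<and> warr s 4 x < 2 * 2 ^ h \<and> varr s keyM (warr s 4 x) = key x" for s k
  proof (rule wp_conseq[OF wp_inner_keys[where h = h]], goal_cases)
    case (5 s' t)
    have "stage3 s'" by (rule stage3_frame[OF that(1) 5(2)]) auto
    moreover have "warr s' = warr s" using frame_warr_all[OF 5(2)] by simp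
    moreover have "keys_sorted (2 ^ h) (varr s' keyM)" using that(2) 5(1) by (simp add: keys_sorted_def)
    ultimately show ?case using 5(1) that(3) by simp
  qed (use that Ws in \<open>auto simp: stage2_def stage3_def\<close>)
  have s12: "wp mark_start s k (\<lambda>s t. t \<le> k + 20 \<and> ready s)"
    if s: "stage3 s" "key_ok (varr s) h 1" "keys_sorted (2 ^ h) (varr s keyM)"
     "\<forall>x<N'. 2 ^ h \<le> warr s 4 x \<and> warr s 4 x < 2 * 2 ^ h \<and> varr s keyM (warr s 4 x) = key x" for s k
  proof -
    have "warr s 4 0 < 2 * 2 ^ h" using s(4) bd by auto
    then have "warr s 4 0 < W" using Ws by linarith
    then have "wp mark_start s k (\<lambda>s' t. t \<le> k + 20 \<and> s' = s\<lparr>warr := (warr s)(hasL := (warr s hasL)(warr s 4 0 := 1)),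
        vreg := (vreg s)(23 := vreg s 19 + vreg s 19)\<rparr>)"
      unfolding mark_start_def using Ws by (simp add: tick_def)
    then show ?thesis
      by (rule wp_conseq) (use s in \<open>auto simp: ready_def stage3_def stage2_def stage1_def quiet_def N'_def\<close>)
  qed
  show ?thesis
    unfolding prepare_def prepare_time_def
    apply (rule wp_seqI, rule s1)
    apply (rule wp_seqI, rule s2, blast, blast, blast)
    apply (rule wp_seqI, rule s3, blast, blast, blast)
    apply (rule wp_seqI, rule s4, blast, blast)
    apply (rule wp_seqI, rule s5, blast, blast)
    apply (rule wp_seqI, rule s6, blast, blast, blast)
    apply (rule wp_seqI, rule s7, blast, blast, blast)
    apply (rule wp_seqI, rule s8, blast, blast, blast, blast)
    apply (rule wp_seqI, rule s9, blast, blast)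
    apply (rule wp_seqI, rule s10, blast, blast)
    apply (rule wp_seqI, rule s11, blast, blast, blast)
    apply (rule s12, blast, blast, blast, blast)
    done
qed

end

subsection \<open>The main loop\<close>

definition touch_with :: "nat \<Rightarrow> vexp \<Rightarrow> com" where
  "touch_with r e = SetW rX0 (WReg r) ;; SetV fBE e ;; touch"

definition push_all :: com where
  "push_all = SetV fTL (VReg 23) ;; SetV fTR (VReg 23) ;; root_push"

definition slot_at :: "nat \<Rightarrow> nat \<Rightarrow> wexp" where
  "slot_at i j = WArr 4 (WAdd (WMul (WAdd (WReg 13) (WConst i)) (WReg 17)) (WAdd (WReg 14) (WConst j)))"

definition load_corners :: com where
  "load_corners = SetV 24 (VDelta (WReg 13) (WAdd (WReg 0) (WReg 14))) ;;
     SetW 18 (slot_at 0 0) ;; SetW 19 (slot_at 1 0) ;; SetW 20 (slot_at 0 1) ;; SetW 21 (slot_at 1 1)"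

definition block :: com where
  "block = load_corners ;;
     touch_with 19 (VSub (VReg 24) (VReg 23)) ;; touch_with 18 (VSub (VReg 23) (VReg 24)) ;; push_all ;;
     touch_with 19 (VSub (VReg 23) (VReg 24)) ;; touch_with 20 (VSub (VReg 24) (VReg 23)) ;; push_all ;;
     touch_with 19 (VReg 24) ;; touch_with 18 (VSub vzero (VReg 23)) ;;
     touch_with 21 (VSub vzero (VReg 24)) ;; touch_with 20 (VReg 23)"

definition sweep :: com where
  "sweep = for_w 13 (WReg 0) (for_w 14 (WReg 1) block)"

text \<open>A touch with increment 0 makes the source of the last corner equal to its value. Unlike
  \<open>H\<close>, a source is just \<open>leafR\<close> plus the linear functions on the root
  path, and these can be summed.\<close>

definition read_off :: com where
  "read_off = SetW 22 (WArr 4 (WAdd (WMul (WReg 0) (WReg 17)) (WReg 1))) ;; touch_with 22 vzero ;;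
     SetW 15 (WReg 22) ;; SetV 0 (varr_at leafR 22) ;;
     Loop (WLess (WConst 0) (WReg 15))
       (SetV 0 (VAdd (VReg 0) (VAdd (varr_at addC 15) (VMul (varr_at addS 15) (varr_at keyM 22)))) ;;
        SetW 15 (WDiv (WReg 15) (WConst 2)))"

lemma mod_block [simp]:
  "mod_wreg (touch_with r e) = {rX0, rV, rC, rC2, rTC, rPW, rLC, rPC}"
  "mod_warr (touch_with r e) = {hasL, hasT}"
  "mod_vreg (touch_with r e) = {fBE, fACC, fS, fQ, fU, fV, fT1, fT2, fTL, fTR, fA1, fA2, fAL, fBB, fTT, fXX, fR1, fZ1}"
  "mod_varr (touch_with r e) = {linC, linS, tagL, tagR, leafR, addC, addS, thr}"
  "mod_wreg push_all = {rTC}" "mod_warr push_all = {hasT}" "mod_vreg push_all = {fTL, fTR, fA1, fA2}" "mod_varr push_all = {tagL, tagR}"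
  "mod_wreg load_corners = {18, 19, 20, 21}" "mod_warr load_corners = {}" "mod_vreg load_corners = {24}" "mod_varr load_corners = {}"
  "mod_wreg block = {18, 19, 20, 21, rX0, rV, rC, rC2, rTC, rPW, rLC, rPC}" "mod_warr block = {hasL, hasT}"
  "mod_vreg block = {24, fBE, fACC, fS, fQ, fU, fV, fT1, fT2, fTL, fTR, fA1, fA2, fAL, fBB, fTT, fXX, fR1, fZ1}"
  "mod_varr block = {linC, linS, tagL, tagR, leafR, addC, addS, thr}"
  by (auto simp: touch_with_def push_all_def load_corners_def block_def)

definition block_time :: "nat \<Rightarrow> nat" where
  "block_time h = 100 + (8 * (touch_time h + 10) + 2 * 80)"

locale sweeper = solver \<delta> us W n m a b d h + slots n m a b d "2 ^ h" zi sl
  for \<delta> :: "'a \<Rightarrow> 'a \<Rightarrow> real" and us W n m a b d h zi sl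
begin

definition repr :: "(nat \<Rightarrow> real) \<times> (nat \<Rightarrow> real) \<Rightarrow> store \<Rightarrow> bool" where
  "repr S s \<longleftrightarrow> tree_ok h s \<and> (\<forall>k<2 ^ h. varr s keyM (2 ^ h + k) = real_of_int (zi k) \<and>
     R (varr s) h (2 ^ h + k) = fst S k \<and> H (varr s) (warr s) h (2 ^ h + k) = snd S k)"

definition fixed :: "store \<Rightarrow> bool" where
  "fixed s \<longleftrightarrow> wreg s 0 = n \<and> wreg s 1 = m \<and> wreg s 17 = m + 1 \<and> vreg s 23 = 2 * total \<and>
     (\<forall>i\<le>n. \<forall>j\<le>m. warr s 4 (i * (m + 1) + j) = 2 ^ h + sl i j)"

definition loaded :: "nat \<Rightarrow> nat \<Rightarrow> store \<Rightarrow> bool" where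
  "loaded i j s \<longleftrightarrow> wreg s 18 = 2 ^ h + sl i j \<and> wreg s 19 = 2 ^ h + sl (Suc i) j \<and> wreg s 20 = 2 ^ h + sl i (Suc j) \<and>
     wreg s 21 = 2 ^ h + sl (Suc i) (Suc j) \<and> vreg s 24 = d i j \<and> vreg s 23 = 2 * total"

lemma leaves: "x \<in> lv h 1 \<longleftrightarrow> (\<exists>k<2 ^ h. x = 2 ^ h + k)"
  unfolding lv_interval by (auto simp: mult_2 le_iff_add)

lemma wp_touch_with:
  assumes S: "repr S st" and r: "wreg st r = 2 ^ h + k0" "k0 < 2 ^ h" and e: "vval \<delta> us st e = \<beta>" "vdef \<delta> us W st e" "vtime e \<le> 5"
    and e_reg: "vval \<delta> us (st\<lparr>wreg := (wreg st)(rX0 := 2 ^ h + k0)\<rparr>) e = \<beta>" "vdef \<delta> us W (st\<lparr>wreg := (wreg st)(rX0 := 2 ^ h + k0)\<rparr>) e"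
  shows "wp (touch_with r e) st k (\<lambda>s t. t \<le> k + (touch_time h + 10) \<and> repr (touchf k0 \<beta> S) s)"
proof -
  let ?st = "st\<lparr>wreg := (wreg st)(rX0 := 2 ^ h + k0)\<rparr>\<lparr>vreg := (vreg st)(fBE := \<beta>)\<rparr>"
  have tree: "tree_ok h ?st" using S by (simp add: repr_def tree_ok_def)
  have W': "8 * 2 ^ h \<le> W" using bounds by simp
  have rW: "2 ^ h + k0 < W" using r(2) bounds by linarith
  have key: "varr st keyM (2 ^ h + k) = real_of_int (zi k)" if "k < 2 ^ h" for k using S that by (simp add: repr_def)
  have "wp touch ?st k' (\<lambda>s t. t \<le> k + (touch_time h + 10) \<and> repr (touchf k0 \<beta> S) s)" if "k' \<le> k + 8" for k'
  proof (rule wp_conseq[OF wp_touch[OF W' tree, where ?x0.0 = "2 ^ h + k0"]], goal_cases)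
    case (3 s t)
    have m: "varr s keyM = varr st keyM" using frame_varr[OF 3(2), of keyM] by simp
    have "R (varr s) h (2 ^ h + k) = fst (touchf k0 \<beta> S) k \<and> H (varr s) (warr s) h (2 ^ h + k) = snd (touchf k0 \<beta> S) k"
      if k: "k < 2 ^ h" for k
    proof -
      have "2 ^ h + k \<in> lv h 1" using k leaves by blast
      then have "R (varr s) h (2 ^ h + k) = (if 2 ^ h + k = 2 ^ h + k0 then H (varr st) (warr st) h (2 ^ h + k0) else R (varr st) h (2 ^ h + k))
        + \<beta> * max 0 (varr st keyM (2 ^ h + k) - varr st keyM (2 ^ h + k0)) \<and>
        H (varr s) (warr s) h (2 ^ h + k) = H (varr st) (warr st) h (2 ^ h + k)
        + \<beta> * max 0 (varr st keyM (2 ^ h + k) - varr st keyM (2 ^ h + k0))"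
        using 3(1) by simp
      then show ?thesis using S k r(2) key[OF k] key[OF r(2)] by (simp add: repr_def touchf_def)
    qed
    then show ?case using 3(1) that key m by (simp add: repr_def)
  qed (use r in \<open>auto simp: nd_0\<close>)
  then show ?thesis unfolding touch_with_def using rW r e(3) e_reg by (simp add: tick_def)
qed

lemma wp_push_all:
  assumes S: "repr S st" and M: "vreg st 23 = M"
  shows "wp push_all st k (\<lambda>s t. t \<le> k + 80 \<and> repr (pushf M S) s)"
proof -
  let ?st = "st\<lparr>vreg := (vreg st)(fTL := M, fTR := M)\<rparr>"
  have tree: "tree_ok h ?st" using S by (simp add: repr_def tree_ok_def)
  have W': "8 * 2 ^ h \<le> W" using bounds by simp
  have key: "varr st keyM (2 ^ h + k) = real_of_int (zi k)" if "k < 2 ^ h" for k using S that by (simp add: repr_def)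
  have img: "lv h 1 = (\<lambda>k. 2 ^ h + k) ` {..<2 ^ h}" using leaves by auto
  have "wp root_push ?st k' (\<lambda>s t. t \<le> k + 80 \<and> repr (pushf M S) s)" if "k' \<le> k + 8" for k'
  proof (rule wp_conseq[OF wp_root_push[OF W' tree]], goal_cases)
    case (1 s t)
    have m: "varr s keyM = varr st keyM" using frame_varr[OF 1(2), of keyM] by simp
    have "R (varr s) h (2 ^ h + k) = fst (pushf M S) k \<and> H (varr s) (warr s) h (2 ^ h + k) = snd (pushf M S) k"
      if k: "k < 2 ^ h" for k
    proof -
      have "2 ^ h + k \<in> lv h 1" using k leaves by blast
      then have "R (varr s) h (2 ^ h + k) = R (varr st) h (2 ^ h + k) \<and>
        H (varr s) (warr s) h (2 ^ h + k) = min (H (varr st) (warr st) h (2 ^ h + k)) (tag_min (varr st) h 1 M M (2 ^ h + k))"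
        using 1(1) by simp
      moreover have "tag_min (varr st) h 1 M M (2 ^ h + k) =
        Min ((\<lambda>l. fst S l + pen M M (real_of_int (zi l)) (real_of_int (zi k))) ` {..<2 ^ h})"
        unfolding tag_min_def img image_image
        using S k key by (intro arg_cong[where f = Min] image_cong) (auto simp: repr_def)
      ultimately show ?thesis using S k by (simp add: repr_def pushf_def)
    qed
    then show ?case using 1(1) that key m by (simp add: repr_def)
  qed
  then show ?thesis unfolding push_all_def by (simp add: tick_def M)
qed

lemma wp_block:
  assumes S: "repr S st" and f: "fixed st" and ij: "wreg st 13 = i" "wreg st 14 = j" "i < n" "j < m"
  shows "wp block st k (\<lambda>s t. t \<le> k + block_time h \<and> repr (blockf i j S) s)"
proof -
  define P where "P S s \<longleftrightarrow> repr S s \<and> loaded i j s" for S s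
  let ?M = "2 * total" and ?D = "d i j"
  have slots: "sl i j < 2 ^ h" "sl (Suc i) j < 2 ^ h" "sl i (Suc j) < 2 ^ h" "sl (Suc i) (Suc j) < 2 ^ h"
    using sl ij(3,4) by simp_all
  have load: "wp load_corners st k (\<lambda>s t. t \<le> k + 100 \<and> P S s)" for k
  proof -
    have st: "wreg st 0 = n" "wreg st (Suc 0) = m" "wreg st 17 = Suc m" "vreg st 23 = 2 * total"
      using f by (simp_all add: fixed_def)
    have arr: "warr st 4 ((i + i') * (m + 1) + (j + j')) = 2 ^ h + sl (i + i') (j + j')"
      "(i + i') * (m + 1) + (j + j') < W" "(i + i') * (m + 1) < W" "2 ^ h + sl (i + i') (j + j') < W"
      if "i' \<le> 1" "j' \<le> 1" for i' j'
    proof -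
      have le: "i + i' \<le> n" "j + j' \<le> m" using that ij by simp_all
      then show "warr st 4 ((i + i') * (m + 1) + (j + j')) = 2 ^ h + sl (i + i') (j + j')" using f by (simp add: fixed_def)
      have "(i + i') * (m + 1) + (j + j') < (n + 1) * (m + 1)" by (rule slot_id_less[OF le])
      then show "(i + i') * (m + 1) + (j + j') < W" "(i + i') * (m + 1) < W" using W by linarith+
      have "sl (i + i') (j + j') < 2 ^ h" using sl[OF le] by simp
      then show "2 ^ h + sl (i + i') (j + j') < W" using bounds by linarith
    qed
    have small: "n + m < W" "1 < W" using bounds by linarith+
    have ev: "wval s (slot_at i' j') = 2 ^ h + sl (i + i') (j + j') \<and> wdef W s (slot_at i' j')"
      if "i' \<le> 1" "j' \<le> 1" "wreg s 13 = i" "wreg s 14 = j" "wreg s 17 = Suc m" "warr s = warr st" for s i' j'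
      using arr[OF that(1,2)] that ij small by (simp add: slot_at_def)
    have tm: "wtime (slot_at i' j') = 10" for i' j' by (simp add: slot_at_def)
    show ?thesis
      unfolding load_corners_def P_def loaded_def
      using S st ij ev[of 0 0] ev[of 1 0] ev[of 0 1] ev[of 1 1] us small tm
      by (simp add: tick_def repr_def tree_ok_def)
  qed
  have tw: "wp (touch_with r e) s k (\<lambda>s t. t \<le> k + (touch_time h + 10) \<and> P (touchf k0 \<beta> S) s)"
    if P: "P S s" and r: "wreg s r = 2 ^ h + k0" "k0 < 2 ^ h"
      and e: "e = VSub (VReg 24) (VReg 23) \<and> \<beta> = ?D - ?M \<or> e = VSub (VReg 23) (VReg 24) \<and> \<beta> = ?M - ?D \<or> e = VReg 24 \<and> \<beta> = ?D \<or>
        e = VReg 23 \<and> \<beta> = ?M \<or> e = VSub vzero (VReg 23) \<and> \<beta> = - ?M \<or> e = VSub vzero (VReg 24) \<and> \<beta> = - ?D"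
    for S s r k0 e \<beta> k
  proof (rule wp_conseq[OF wp_touch_with[where ?k0.0 = k0 and \<beta> = \<beta> and S = S]], goal_cases)
    case (9 s' t)
    have "loaded i j s'" using P 9(2) by (simp add: P_def loaded_def frame_wreg frame_vreg)
    then show ?case using 9(1) by (simp add: P_def)
  qed (use P r e bounds in \<open>auto simp: P_def loaded_def\<close>)
  have t18: "wp (touch_with 18 e) s k (\<lambda>s t. t \<le> k + (touch_time h + 10) \<and> P (touchf (sl i j) \<beta> S) s)"
    and t19: "wp (touch_with 19 e) s k (\<lambda>s t. t \<le> k + (touch_time h + 10) \<and> P (touchf (sl (Suc i) j) \<beta> S) s)"
    and t20: "wp (touch_with 20 e) s k (\<lambda>s t. t \<le> k + (touch_time h + 10) \<and> P (touchf (sl i (Suc j)) \<beta> S) s)"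
    and t21: "wp (touch_with 21 e) s k (\<lambda>s t. t \<le> k + (touch_time h + 10) \<and> P (touchf (sl (Suc i) (Suc j)) \<beta> S) s)"
    if P: "P S s" and e: "e = VSub (VReg 24) (VReg 23) \<and> \<beta> = ?D - ?M \<or> e = VSub (VReg 23) (VReg 24) \<and> \<beta> = ?M - ?D \<or> e = VReg 24 \<and> \<beta> = ?D \<or>
        e = VReg 23 \<and> \<beta> = ?M \<or> e = VSub vzero (VReg 23) \<and> \<beta> = - ?M \<or> e = VSub vzero (VReg 24) \<and> \<beta> = - ?D"
    for S s e \<beta> k
    by (rule tw[OF P _ _ e]; use P slots in \<open>simp add: P_def loaded_def\<close>)+
  have pu: "wp push_all s k (\<lambda>s t. t \<le> k + 80 \<and> P (pushf ?M S) s)" if P: "P S s" for S s k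
  proof (rule wp_conseq[OF wp_push_all[where S = S and M = ?M]], goal_cases)
    case (3 s' t)
    have "loaded i j s'" using P 3(2) by (simp add: P_def loaded_def frame_wreg frame_vreg)
    then show ?case using 3(1) by (simp add: P_def)
  qed (use P in \<open>auto simp: P_def loaded_def\<close>)
  let ?t = "touch_time h + 10"
  have "wp block st k (\<lambda>s t. t \<le> k + (100 + (?t + (?t + (80 + (?t + (?t + (80 + (?t + (?t + (?t + ?t)))))))))) \<and> P (blockf i j S) s)"
    unfolding block_def blockf_def Let_def
    apply (rule wp_seqI, rule load)
    apply (rule wp_seqI, erule t19, blast)
    apply (rule wp_seqI, erule t18, blast)
    apply (rule wp_seqI, erule pu)
    apply (rule wp_seqI, erule t19, blast)
    apply (rule wp_seqI, erule t20, blast)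
    apply (rule wp_seqI, erule pu)
    apply (rule wp_seqI, erule t19, blast)
    apply (rule wp_seqI, erule t18, blast)
    apply (rule wp_seqI, erule t21, blast)
    apply (erule t20, blast)
    done
  then show ?thesis by (rule wp_conseq) (simp add: P_def block_time_def)
qed

lemma fixed_frame:
  assumes "fixed st" "frame P st s" "mod_wreg P \<inter> {0, 1, 17} = {}" "mod_warr P \<inter> {4} = {}" "mod_vreg P \<inter> {23} = {}"
  shows "fixed s"
  using assms unfolding fixed_def by (simp add: frame_wreg frame_vreg frame_warr)

lemma wp_sweep:
  assumes S: "repr S st" "Good 0 0 S" and f: "fixed st"
  shows "wp sweep st k (\<lambda>s t. t \<le> k + (n * (20 + m * (block_time h + 10)) + 10) \<and> fixed s \<and> (\<exists>S. repr S s \<and> Good (n - 1) m S))"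
proof -
  \<comment> \<open>After the last row there is no block to enter, so the final state of row
    \<open>n - 1\<close> is kept instead.\<close>
  let ?I = "\<lambda>i s. \<exists>S. repr S s \<and> (if i < n then Good i 0 S else Good (n - 1) m S)"
  have upd: "repr S (s\<lparr>wreg := (wreg s)(x := v)\<rparr>)" if "repr S s" "x = 13 \<or> x = 14" for S s x v
    using that by (auto simp: repr_def tree_ok_def)
  have small: "n < W" "m < W" "1 < W" using bounds by linarith+
  have "wp sweep st k (\<lambda>s t. ?I n s \<and> t \<le> k + n * ((m * (block_time h + 10) + 10) + 10) + 10)"
    unfolding sweep_def
  proof (rule wp_for[where I = ?I], goal_cases)
    case 1
    then show ?case using S n by (intro exI[of _ S]) simp
  next
    case (2 i s v)
    then show ?case using upd by blast
  next
    case (3 i s)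
    have "fixed s" by (rule fixed_frame[OF f 3(2)]) auto
    then show ?case using small by (simp add: fixed_def)
  next
    case (8 i s k)
    then obtain S where S: "repr S s" "Good i 0 S" by auto
    have f1: "fixed s" by (rule fixed_frame[OF f 8(2)]) auto
    let ?J = "\<lambda>j s. \<exists>S. repr S s \<and> Good i j S"
    have "wp (for_w 14 (WReg 1) block) s k (\<lambda>s t. ?J m s \<and> t \<le> k + m * (block_time h + 10) + 10)"
    proof (rule wp_for[where I = ?J], goal_cases)
      case 1
      then show ?case using S by blast
    next
      case (2 i s v)
      then show ?case using upd by blast
    next
      case (3 j s')
      have "fixed s'" by (rule fixed_frame[OF f1 3(2)]) auto
      then show ?case using small by (simp add: fixed_def)
    next
      case (8 j s' k)
      then obtain S' where S': "repr S' s'" "Good i j S'" by auto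
      have f2: "fixed s'" by (rule fixed_frame[OF f1 8(2)]) auto
      have i: "wreg s' 13 = i" using frame_wreg[OF 8(2), of 13] \<open>wreg s 13 = i\<close> by simp
      show ?case
        by (rule wp_conseq[OF wp_block[OF S'(1) f2 i 8(3) \<open>i < n\<close> 8(4)]])
          (use Good_block[OF S'(2) \<open>i < n\<close> 8(4)] in blast)
    qed (use small in auto)
    then show ?case
    proof (rule wp_conseq, goal_cases)
      case (1 s' t)
      then obtain S' where S': "repr S' s'" "Good i m S'" by blast
      have "if Suc i < n then Good (Suc i) 0 S' else Good (n - 1) m S'"
      proof (cases "Suc i < n")
        case True
        then show ?thesis using Good_row[OF S'(2)] by simp
      next
        case False
        then have "n - 1 = i" using \<open>i < n\<close> by simp
        then show ?thesis using S'(2) False by simp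
      qed
      then have "?I (Suc i) s'" using S'(1) by blast
      then show ?case using 1(1) by simp
    qed
  qed (use small in auto)
  then show ?thesis
  proof (rule wp_conseq, goal_cases)
    case (1 s t)
    have "fixed s" by (rule fixed_frame[OF f 1(2)]) (auto simp: sweep_def)
    then show ?case using 1(1) by auto
  qed
qed

lemma wp_read_off:
  assumes S: "repr S st" and f: "fixed st"
  shows "wp read_off st k (\<lambda>s t. t \<le> k + (touch_time h + h * 40 + 100) \<and> vreg s 0 = snd S (sl n m))"
proof -
  define k0 where "k0 = sl n m"
  define x where "x = 2 ^ h + k0"
  have k0: "k0 < 2 ^ h" using sl[of n m] by (simp add: k0_def)
  have xW: "x < W" "2 < W" "n + 1 < W" "m + 1 < W" using k0 bounds unfolding x_def by linarith+
  let ?L = "Loop (WLess (WConst 0) (WReg 15))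
       (SetV 0 (VAdd (VReg 0) (VAdd (varr_at addC 15) (VMul (varr_at addS 15) (varr_at keyM 22)))) ;;
        SetW 15 (WDiv (WReg 15) (WConst 2)))"
  define part where "part A e = (case e of 0 \<Rightarrow> A leafR x | Suc g \<Rightarrow> R A g x)" for A e
  have part_Suc: "part A (Suc e) = part A e + (A addC (x div 2 ^ e) + A addS (x div 2 ^ e) * A keyM x)" for A e
    by (cases e) (simp_all add: part_def R.simps(2) del: power_Suc)
  have loop: "wp ?L s k (\<lambda>s' t. t \<le> k + (Suc h * 40 + 10) \<and> vreg s' 0 = R (varr s) h x)"
    if s: "wreg s 15 = x" "wreg s 22 = x" "vreg s 0 = varr s leafR x" for s k
  proof -
    let ?I = "\<lambda>i s'. wreg s' 15 = x div 2 ^ (Suc h - i) \<and> vreg s' 0 = part (varr s) (Suc h - i)"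
    let ?P = "SetV 0 (VAdd (VReg 0) (VAdd (varr_at addC 15) (VMul (varr_at addS 15) (varr_at keyM 22)))) ;;
        SetW 15 (WDiv (WReg 15) (WConst 2))"
    let ?b = "WLess (WConst 0) (WReg 15)"
    have "wp ?L s k (\<lambda>s' t. ?I 0 s' \<and> frame ?P s s' \<and> t \<le> k + Suc h * (25 + ctime ?b + 1) + (ctime ?b + 1))"
    proof (rule wp_Loop_frame[where I = ?I], goal_cases)
      case 1
      then show ?case using s by (simp add: part_def)
    next
      case (2 i s')
      have le: "x div 2 ^ (Suc h - i) < W" using xW by (meson div_le_dividend le_less_trans)
      have "0 < x div 2 ^ (Suc h - i) \<longleftrightarrow> 0 < i"
      proof (cases i)
        case 0
        then show ?thesis using k0 by (simp add: x_def)
      next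
        case (Suc i')
        have "(2::nat) ^ (Suc h - i) \<le> 2 ^ h" using Suc by (intro power_increasing) auto
        then have "2 ^ (Suc h - i) \<le> x" unfolding x_def by (rule trans_le_add1)
        then show ?thesis using Suc by (simp add: div_greater_zero_iff)
      qed
      then show ?case using 2(1) le xW by simp
    next
      case (3 i s' k)
      define e where "e = h - i"
      have e: "Suc h - Suc i = e" "Suc h - i = Suc e" using 3(3) by (auto simp: e_def)
      have f': "wreg s' 22 = x" "varr s' = varr s" using 3(2) s by (simp_all add: frame_wreg frame_varr_all)
      have le: "x div 2 ^ e < W" using xW by (meson div_le_dividend le_less_trans)
      have dv: "x div 2 ^ Suc e = x div 2 ^ e div 2" by (rule div_pow_Suc)
      show ?case using 3(1) f' le xW unfolding e dv part_Suc by (simp add: tick_def)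
    qed
    then show ?thesis
    proof (rule wp_conseq, goal_cases)
      case (1 s' t)
      have "part (varr s) (Suc h) = R (varr s) h x" by (simp add: part_def)
      then show ?case using 1(1) by simp
    qed
  qed
  have id: "warr st 4 (n * (m + 1) + m) = x" using f by (simp add: fixed_def x_def k0_def)
  have idW: "n * (m + 1) + m < W" "n * (m + 1) < W" using slot_id_less[of n m] W by linarith+
  let ?s1 = "st\<lparr>wreg := (wreg st)(22 := x)\<rparr>"
  have S1: "repr S ?s1" using S by (simp add: repr_def tree_ok_def)
  have tail: "wp (SetW 15 (WReg 22)) s k' (\<lambda>s k. wp (SetV 0 (varr_at leafR 22)) s k (\<lambda>s k. wp ?L s k
     (\<lambda>s' t. t \<le> k1 + (touch_time h + h * 40 + 100) \<and> vreg s' 0 = snd S (sl n m))))"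
    if s: "repr (touchf k0 0 S) s" "wreg s 22 = x" and k': "k' \<le> k1 + touch_time h + 30" for s k' k1
  proof -
    have R: "R (varr s) h x = snd S (sl n m)" using s(1) k0 by (simp add: repr_def x_def touchf_def k0_def)
    let ?s = "s\<lparr>wreg := (wreg s)(15 := x)\<rparr>\<lparr>vreg := (vreg s)(0 := varr s leafR x)\<rparr>"
    have "wp ?L ?s k'' (\<lambda>s' t. t \<le> k1 + (touch_time h + h * 40 + 100) \<and> vreg s' 0 = snd S (sl n m))"
      if "k'' \<le> k' + 10" for k''
      by (rule wp_conseq[OF loop]) (use s(2) R k' that in auto)
    then show ?thesis using xW s(2) by (simp add: tick_def)
  qed
  have "wp (touch_with 22 vzero) ?s1 k2 (\<lambda>s k. wp (SetW 15 (WReg 22)) s k (\<lambda>s k. wp (SetV 0 (varr_at leafR 22)) s k (\<lambda>s k. wp ?L s k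
     (\<lambda>s' t. t \<le> k1 + (touch_time h + h * 40 + 100) \<and> vreg s' 0 = snd S (sl n m)))))"
    if "k2 \<le> k1 + 15" for k1 k2
  proof (rule wp_conseq[OF wp_touch_with[where ?k0.0 = k0 and \<beta> = 0 and S = S]], goal_cases)
    case (9 s t)
    then show ?case by (intro tail) (use that in \<open>auto simp: frame_wreg\<close>)
  qed (use S1 k0 xW x_def in auto)
  then show ?thesis
    unfolding read_off_def using f id idW xW
    by (simp add: tick_def fixed_def)
qed

end

subsection \<open>Correctness and running time of the program\<close>

definition dtw_program :: com where
  "dtw_program = prepare ;; sweep ;; read_off"

lemma R_quiet: "A addC = (\<lambda>_. 0) \<Longrightarrow> A addS = (\<lambda>_. 0) \<Longrightarrow> R A e x = A leafR x"
  by (induction e) (simp_all add: R.simps(2) del: power_Suc)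

text \<open>With equal sources \<open>R + s * z\<close> is least at the right end for negative and
  at the left end for positive \<open>s\<close>, so the zero thresholds of fresh memory are
  correct.\<close>

lemma hull_ok_const:
  assumes "A addC = (\<lambda>_. 0)" "A addS = (\<lambda>_. 0)" "A thr = (\<lambda>_. 0)" "keys_sorted (2 ^ h) (A keyM)"
    and leaf: "\<And>x. 2 ^ h \<le> x \<Longrightarrow> x < 2 * 2 ^ h \<Longrightarrow> A leafR x = v"
    and "nd h e c"
  shows "hull_ok A e c"
  using assms(6)
proof (induction e arbitrary: c)
  case 0
  then show ?case by simp
next
  case (Suc e)
  have c: "nd h e (2 * c)" "nd h e (2 * c + 1)" using nd_Suc[OF Suc.prems] by auto
  have val: "R A e x = v" if "x \<in> lv e d" "nd h e d" for x d
    using R_quiet[OF assms(1,2)] leaf nd_leaf[OF that(2,1)] nd_0 by simp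
  have lt: "A keyM x < A keyM y" if "x \<in> lv e (2 * c)" "y \<in> lv e (2 * c + 1)" for x y
  proof -
    have "2 ^ h \<le> x" "y < 2 * 2 ^ h" using nd_leaf[OF c(1) that(1)] nd_leaf[OF c(2) that(2)] nd_0 by blast+
    moreover have "x < (2 * c + 1) * 2 ^ e" "(2 * c + 1) * 2 ^ e \<le> y" using that by (simp_all add: lv_interval)
    ultimately show ?thesis using assms(4) unfolding keys_sorted_def by (meson less_le_trans)
  qed
  have "Qm A e (2 * c + 1) s \<le> Qm A e (2 * c) s" if "s \<le> 0" for s
  proof -
    obtain x where x: "x \<in> lv e (2 * c)" "Qm A e (2 * c) s = R A e x + s * A keyM x" by (rule Qm_attained)
    obtain y where y: "y \<in> lv e (2 * c + 1)" using lv_nonempty by blast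
    have "Qm A e (2 * c + 1) s \<le> R A e y + s * A keyM y" by (rule Qm_le[OF y])
    also have "\<dots> \<le> R A e x + s * A keyM x"
      using val[OF x(1) c(1)] val[OF y c(2)] mult_left_mono_neg[OF less_imp_le[OF lt[OF x(1) y]] that] by simp
    finally show ?thesis using x(2) by simp
  qed
  moreover have "Qm A e (2 * c) s \<le> Qm A e (2 * c + 1) s" if "0 \<le> s" for s
  proof -
    obtain y where y: "y \<in> lv e (2 * c + 1)" "Qm A e (2 * c + 1) s = R A e y + s * A keyM y" by (rule Qm_attained)
    obtain x where x: "x \<in> lv e (2 * c)" using lv_nonempty by blast
    have "Qm A e (2 * c) s \<le> R A e x + s * A keyM x" by (rule Qm_le[OF x])
    also have "\<dots> \<le> R A e y + s * A keyM y"
      using val[OF x c(1)] val[OF y(1) c(2)] mult_left_mono[OF less_imp_le[OF lt[OF x y(1)]] that] by simp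
    finally show ?thesis using y(2) by simp
  qed
  ultimately show ?case using Suc.IH[OF c(1)] Suc.IH[OF c(2)] assms(3) by simp
qed

text \<open>The bound \<open>x < 2 * x0\<close> keeps \<open>x0\<close> from being a proper ancestor
  of \<open>x\<close>, so its line is felt at \<open>x0\<close> alone.\<close>

lemma H_quiet:
  assumes "A addC = (\<lambda>_. 0)" "A addS = (\<lambda>_. 0)" "A linC = (\<lambda>_. 0)" "A linS = (\<lambda>_. 0)" "B hasT = (\<lambda>_. 0)"
    "B hasL = (\<lambda>_. 0)(x0 := 1)" and x: "x < 2 * x0"
  shows "H A B e x = (if x = x0 then min (A leafR x) 0 else A leafR x)"
proof (induction e)
  case 0
  then show ?case using assms by (simp add: with_line_def)
next
  case (Suc e)
  have "x div 2 ^ Suc e \<le> x div 2" by (simp add: div_mult2_eq div_le_dividend)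
  also have "\<dots> < x0" using x by simp
  finally have "x div 2 ^ Suc e \<noteq> x0" by simp
  then show ?case using Suc assms by (simp add: H.simps(2) with_line_def with_tag_def del: power_Suc)
qed

context solver
begin

lemma wp_dtw_program:
  assumes st: "wreg st = (\<lambda>_. 0)(0 := n, 1 := m)" "warr st = (\<lambda>_ _. 0)" "vreg st = (\<lambda>_. 0)"
    "varr st = (\<lambda>_ _. 0)(0 := \<lambda>i. real (a i), 1 := \<lambda>j. real (b j))"
  shows "wp dtw_program st k (\<lambda>s t. t \<le> k + (prepare_time + ((n * (20 + m * (block_time h + 10)) + 10) + (touch_time h + h * 40 + 100))) \<and>
    (\<exists>p q. reach n m p q (vreg s 0)) \<and> (\<forall>p q c. reach n m p q c \<longrightarrow> vreg s 0 \<le> c))"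
  unfolding dtw_program_def
proof (rule wp_seqI, rule wp_prepare[OF st])
  fix s k assume r: "ready s"
  define A x0 where "A = varr s" and "x0 = warr s 4 0"
  have q: "wreg s 0 = n" "wreg s 1 = m" "A addC = (\<lambda>_. 0)" "A addS = (\<lambda>_. 0)" "A linC = (\<lambda>_. 0)" "A linS = (\<lambda>_. 0)"
    "A thr = (\<lambda>_. 0)" "warr s hasT = (\<lambda>_. 0)"
    using r by (simp_all add: ready_def quiet_def A_def)
  have rd: "wreg s rNN = 2 ^ h" "wreg s 17 = m + 1" "vreg s 23 = 2 * total" "key_ok A h 1" "keys_sorted (2 ^ h) (A keyM)"
    "\<And>x. x < (n + 1) * (m + 1) \<Longrightarrow> 2 ^ h \<le> warr s 4 x \<and> warr s 4 x < 2 * 2 ^ h \<and> A keyM (warr s 4 x) = key x"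
    "\<And>x. x < 2 ^ h \<Longrightarrow> A leafR (2 ^ h + x) = total" "warr s hasL = (\<lambda>_. 0)(x0 := 1)"
    using r by (simp_all add: ready_def A_def x0_def)
  \<comment> \<open>The machine has the keys only as reals; rounding happens in the proof alone and
    is exact because they are integers.\<close>
  define zi where "zi k = \<lfloor>A keyM (2 ^ h + k)\<rfloor>" for k
  define sl where "sl i j = warr s 4 (i * (m + 1) + j) - 2 ^ h" for i j
  have zi: "A keyM (2 ^ h + k) = real_of_int (zi k)" if "k < 2 ^ h" for k
  proof -
    have "A keyM (2 ^ h + k) \<in> \<int>" using rd(5) that by (simp add: keys_sorted_def)
    then show ?thesis by (simp add: zi_def)
  qed
  have slot: "2 ^ h \<le> warr s 4 (i * (m + 1) + j) \<and> warr s 4 (i * (m + 1) + j) < 2 * 2 ^ h \<and>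
      A keyM (warr s 4 (i * (m + 1) + j)) = real_of_int (crn i j)" if "i \<le> n" "j \<le> m" for i j
    using rd(6)[OF slot_id_less[OF that]] key_at[OF that] by simp
  interpret slots n m a b d "2 ^ h" zi sl
  proof
    fix i j assume ij: "i \<le> n" "j \<le> m"
    note s = slot[OF ij]
    have "zi (sl i j) = \<lfloor>A keyM (warr s 4 (i * (m + 1) + j))\<rfloor>" unfolding zi_def sl_def using s by simp
    also have "\<dots> = crn i j" using s by simp
    finally show "sl i j < 2 ^ h \<and> zi (sl i j) = crn i j" using s by (simp add: sl_def less_diff_conv2)
  qed
  interpret sweeper \<delta> us W n m a b d h zi sl ..
  have x0: "2 ^ h \<le> x0" "x0 < 2 * 2 ^ h" "A keyM x0 = 0"
    using slot[of 0 0] by (simp_all add: x0_def crn_def)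
  have leaf: "A leafR x = total" if "2 ^ h \<le> x" "x < 2 * 2 ^ h" for x
    using rd(7)[of "x - 2 ^ h"] that by simp
  let ?S = "(\<lambda>_. total, \<lambda>k. init (zi k)) :: (nat \<Rightarrow> real) \<times> (nat \<Rightarrow> real)"
  have fx: "fixed s" using q rd slot by (simp add: fixed_def sl_def)
  have "hull_ok A h 1" by (rule hull_ok_const[where v = total]) (use q(3,4,7) rd(5) leaf nd_root in auto)
  then have tree: "tree_ok h s" using rd q(8) by (simp add: tree_ok_def flags_ok_def A_def)
  have Hk: "H A (warr s) h (2 ^ h + k) = init (zi k)" if k: "k < 2 ^ h" for k
  proof -
    have "H A (warr s) h (2 ^ h + k) = (if 2 ^ h + k = x0 then min (A leafR (2 ^ h + k)) 0 else A leafR (2 ^ h + k))"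
      by (rule H_quiet[OF q(3-6,8) rd(8)]) (use k x0 in linarith)
    moreover have "2 ^ h + k = x0 \<longleftrightarrow> zi k = 0"
    proof
      assume "2 ^ h + k = x0"
      then show "zi k = 0" using zi[OF k] x0(3) by simp
    next
      assume z: "zi k = 0"
      have le: "2 ^ h \<le> 2 ^ h + k" "2 ^ h + k < 2 * 2 ^ h" using k by simp_all
      have "A keyM (2 ^ h + k) = A keyM x0" using zi[OF k] z x0(3) by simp
      then show "2 ^ h + k = x0" using rd(5) le x0 unfolding keys_sorted_def by (metis less_irrefl linorder_neqE_nat)
    qed
    ultimately show ?thesis using leaf[of "2 ^ h + k"] k total_nonneg by (simp add: init_def)
  qed
  have Rk: "R A h (2 ^ h + k) = total" if "k < 2 ^ h" for k
    using R_quiet[OF q(3,4)] rd(7)[OF that] by simp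
  have S: "repr ?S s" using tree zi Rk Hk by (simp add: repr_def A_def)
  have "Good 0 0 ?S" by (rule Good_init) simp_all
  from wp_sweep[OF S this fx]
  show "wp (sweep ;; read_off) s k (\<lambda>s t. t \<le> k + ((n * (20 + m * (block_time h + 10)) + 10) + (touch_time h + h * 40 + 100)) \<and>
    (\<exists>p q. reach n m p q (vreg s 0)) \<and> (\<forall>p q c. reach n m p q c \<longrightarrow> vreg s 0 \<le> c))"
  proof (rule wp_seqI)
    fix s k assume "fixed s \<and> (\<exists>S. repr S s \<and> Good (n - 1) m S)"
    then obtain S where S: "fixed s" "repr S s" "Good (n - 1) m S" by blast
    show "wp read_off s k (\<lambda>s t. t \<le> k + (touch_time h + h * 40 + 100) \<and>
      (\<exists>p q. reach n m p q (vreg s 0)) \<and> (\<forall>p q c. reach n m p q c \<longrightarrow> vreg s 0 \<le> c))"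
      by (rule wp_conseq[OF wp_read_off[OF S(2,1)]]) (use Good_result[OF S(3)] in auto)
  qed
qed

lemma touch_time_le: "touch_time h \<le> 2500 * (h + 1) ^ 3"
  by (simp add: touch_time_def power3_eq_cube algebra_simps)

lemma program_time:
  "prepare_time + ((n * (20 + m * (block_time h + 10)) + 10) + (touch_time h + h * 40 + 100)) \<le> 30000 * ((n * m) * (h + 1) ^ 3)"
proof -
  \<comment> \<open>\<open>Q\<close> dominates every contribution: the sweep performs
    \<open>p\<close> blocks at a cost of order \<open>g\<close>, and sorting costs of order
    \<open>p * h\<close>.\<close>
  define p g Q where "p = n * m" and "g = (h + 1) ^ 3" and "Q = p * g"
  have p: "n \<le> p" "m \<le> p" "1 \<le> p" using n m by (simp_all add: p_def)
  have g: "h + 1 \<le> g" "1 \<le> g" unfolding g_def using self_le_power[of "h + 1" 3] by simp_all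
  have Q: "p \<le> Q" "g \<le> Q" "p * h \<le> Q" using p g unfolding Q_def
    by (auto intro: mult_le_mono2 order_trans[OF _ mult_le_mono2])
  have "(n + 1) * (m + 1) = p + n + m + 1" by (simp add: p_def)
  then have N: "(n + 1) * (m + 1) \<le> 4 * p" using p by linarith
  have e: "2 ^ h \<le> 8 * p" using h(2) N by linarith
  have t: "touch_time h \<le> 2500 * g" using touch_time_le by (simp add: g_def)
  have "8 * (touch_time h + 10) \<le> 20000 * g + 80" using t by simp
  then have bt: "block_time h \<le> 20500 * g" unfolding block_time_def using g(2) by linarith
  have s: "n * (20 + m * (block_time h + 10)) \<le> 20500 * Q + 10 * p + 20 * n"
  proof -
    have "n * (20 + m * (block_time h + 10)) = p * block_time h + 10 * p + 20 * n" by (simp add: p_def algebra_simps)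
    moreover have "p * block_time h \<le> p * (20500 * g)" using bt by (intro mult_le_mono) auto
    ultimately show ?thesis by (simp add: Q_def)
  qed
  have x: "(n + 1) * (m + 1) * (h * 70 + 110) \<le> 280 * (p * h) + 440 * p"
    using mult_le_mono1[OF N, of "h * 70 + 110"] by (simp add: algebra_simps)
  have y: "n * (20 + m * 30) = 20 * n + 30 * p" "(n + 1) * ((m + 1) * 30 + 20) = 30 * ((n + 1) * (m + 1)) + 20 * n + 20"
    by (simp_all add: p_def algebra_simps)
  have "prepare_time \<le> 5000 * Q"
    unfolding prepare_time_def y using x e N p g Q by linarith
  moreover have "touch_time h + h * 40 + 100 \<le> 2700 * Q" using t g Q by linarith
  moreover have "n * (20 + m * (block_time h + 10)) + 10 \<le> 20600 * Q" using s p Q by linarith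
  ultimately show ?thesis by (simp add: Q_def p_def g_def)
qed

end

text \<open>Since \<open>ln 2\<close> is at least \<open>1 / 2\<close>, the height is at most
  \<open>3 + 2 * ln x\<close>. The summand 1 beside the logarithm is kept for
  \<open>x = 1\<close>.\<close>

lemma height_le_ln:
  fixes x :: real
  assumes "2 ^ h \<le> 8 * x" "1 \<le> x"
  shows "real (h + 1) \<le> 4 * (1 + ln x)"
proof -
  have l2: "1 / 2 \<le> ln (2::real)" using ln_2_less_1 ln_le_minus_one[of "1 / 2 :: real"] by (simp add: ln_div)
  have "real h * ln 2 = ln (2 ^ h)" by (simp add: ln_realpow)
  also have "\<dots> \<le> ln (8 * x)" using assms by (intro ln_mono) auto
  also have "\<dots> = ln (2 ^ 3) + ln x" using assms(2) by (simp add: ln_mult)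
  also have "\<dots> = 3 * ln 2 + ln x" by (subst ln_realpow) auto
  finally have "(real h - 3) * ln 2 \<le> ln x" by (simp add: algebra_simps)
  moreover have "(real h - 3) * (1 / 2) \<le> (real h - 3) * ln 2" if "3 \<le> real h" using that l2 by (intro mult_left_mono) auto
  moreover have "0 \<le> ln x" using assms(2) by simp
  ultimately show ?thesis by (cases "3 \<le> real h") auto
qed

lemma power_of_two_above:
  assumes "2 \<le> (N::nat)"
  obtains h where "N \<le> 2 ^ h" "2 ^ h < 2 * N"
proof -
  obtain e where "2 ^ e < N" "N \<le> 2 ^ (e + 1)" using ex_power_ivl2[of 2 N] assms by auto
  then show thesis by (intro that[of "e + 1"]) auto
qed

text \<open>The number of corners is at most \<open>(n + m) ^ 2\<close>, and \<open>n + m\<close> is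
  at least 2, so four more powers pay for the factor 16.\<close>

lemma word_bound:
  assumes "0 < n" "0 < (m::nat)"
  shows "16 * ((n + 1) * (m + 1)) \<le> (n + m) ^ 6"
proof -
  have "n \<le> n * n" "m \<le> m * m" "1 \<le> n * m" using assms by simp_all
  moreover have "(n + 1) * (m + 1) = n * m + n + m + 1" "(n + m) ^ 2 = n * n + 2 * (n * m) + m * m"
    by (simp_all add: power2_eq_square algebra_simps)
  ultimately have 1: "(n + 1) * (m + 1) \<le> (n + m) ^ 2" by linarith
  have "(2::nat) ^ 4 \<le> (n + m) ^ 4" using assms by (intro power_mono) auto
  then have "16 * ((n + 1) * (m + 1)) \<le> (n + m) ^ 4 * (n + m) ^ 2" using 1 by (intro mult_le_mono) auto
  also have "\<dots> = (n + m) ^ 6" by (simp flip: power_add)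
  finally show ?thesis .
qed

lemma computes_dtw:
  assumes \<delta>: "\<And>x y. 0 \<le> \<delta> x y" and S: "is_rle S" and T: "is_rle T"
  shows "computes_within \<delta> 6 dtw_program S T (DTW \<delta> S T)
    (1920000 * real (length S * length T) * (1 + ln (real (length S * length T))) ^ 3)"
proof -
  define n m where "n = length S" and "m = length T"
  have g: "grid n m (run S) (run T) (dlt \<delta> S T)" unfolding n_def m_def by (rule grid_rle[OF S T \<delta>])
  have nm: "0 < n" "0 < m" using S T by (auto simp: is_rle_def n_def m_def)
  have "2 \<le> (n + 1) * (m + 1)" using nm by simp
  then obtain h where h: "(n + 1) * (m + 1) \<le> 2 ^ h" "2 ^ h < 2 * ((n + 1) * (m + 1))" by (rule power_of_two_above)
  interpret grid n m "run S" "run T" "dlt \<delta> S T" by (rule g)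
  interpret solver \<delta> "input_letters S T" "(n + m) ^ 6" n m "run S" "run T" "dlt \<delta> S T" h
    by unfold_locales
      (use h word_bound[OF nm] in \<open>auto simp: input_letters_def n_def m_def dlt_def nth_append\<close>)
  have "wp dtw_program (input_store S T) 0 (\<lambda>s t. t \<le> 0 + (prepare_time + ((n * (20 + m * (block_time h + 10)) + 10) + (touch_time h + h * 40 + 100))) \<and>
    (\<exists>p q. reach n m p q (vreg s 0)) \<and> (\<forall>p q c. reach n m p q c \<longrightarrow> vreg s 0 \<le> c))"
    by (rule wp_dtw_program) (auto simp: input_store_def n_def m_def run_def fun_eq_iff)
  then obtain t st where e: "exec \<delta> (input_letters S T) ((n + m) ^ 6) dtw_program (input_store S T) t st"
    and t: "t \<le> prepare_time + ((n * (20 + m * (block_time h + 10)) + 10) + (touch_time h + h * 40 + 100))"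
    and v: "\<exists>p q. reach n m p q (vreg st 0)" "\<And>p q c. reach n m p q c \<Longrightarrow> vreg st 0 \<le> c"
    unfolding wp_def by auto
  have dtw: "DTW \<delta> S T = vreg st 0"
    by (rule DTW_eqI[OF S T \<delta>]) (use v in \<open>auto simp: n_def m_def\<close>)
  define x where "x = real (n * m)"
  have "1 \<le> n * m" using nm by simp
  then have x1: "1 \<le> x" unfolding x_def by linarith
  have "n \<le> n * m" "m \<le> n * m" using nm by simp_all
  moreover have "(n + 1) * (m + 1) = n * m + n + m + 1" by simp
  ultimately have "2 ^ h \<le> 8 * (n * m)" using h(2) \<open>1 \<le> n * m\<close> by linarith
  then have "real (2 ^ h) \<le> real (8 * (n * m))" by (rule of_nat_mono)
  then have "2 ^ h \<le> 8 * x" by (simp add: x_def)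
  then have "real (h + 1) ^ 3 \<le> (4 * (1 + ln x)) ^ 3" using x1 by (intro power_mono height_le_ln) auto
  \<comment> \<open>The cube of the factor 4 from \<open>height_le_ln\<close>; together with the
    30000 of \<open>program_time\<close> it gives the constant 1920000.\<close>
  also have "(4 * (1 + ln x)) ^ 3 = 64 * (1 + ln x) ^ 3" by (simp only: power_mult_distrib) simp
  finally have hb: "real (h + 1) ^ 3 \<le> 64 * (1 + ln x) ^ 3" .
  have "t \<le> 30000 * ((n * m) * (h + 1) ^ 3)" using t program_time by linarith
  then have "real t \<le> real (30000 * ((n * m) * (h + 1) ^ 3))" by (rule of_nat_mono)
  also have "\<dots> = 30000 * (x * real (h + 1) ^ 3)" by (simp add: x_def)
  also have "\<dots> \<le> 30000 * (x * (64 * (1 + ln x) ^ 3))" using hb x1 by (intro mult_left_mono) auto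
  also have "\<dots> = 1920000 * x * (1 + ln x) ^ 3" by simp
  finally have "real t \<le> 1920000 * x * (1 + ln x) ^ 3" .
  then show ?thesis
    unfolding computes_within_def using e dtw by (auto simp: result_def x_def n_def m_def)
qed

theorem mainTheorem2:
  shows "\<exists>(P :: com) (w :: nat) (C :: real) (k :: nat).
    \<forall>(\<delta> :: 'a \<Rightarrow> 'a \<Rightarrow> real) (S :: 'a rle) (T :: 'a rle).
      (\<forall>a b. 0 \<le> \<delta> a b) \<longrightarrow> is_rle S \<longrightarrow> is_rle T \<longrightarrow>
      computes_within \<delta> w P S T (DTW \<delta> S T)
        (C * real (length S * length T) * (1 + ln (real (length S * length T))) ^ k)"
  using computes_dtw by blast

end
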